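(* Suppose that $\alpha\in\mathbb{R}$ is such that $$\lim_{t\uparrow T} I_{X^{(\alpha)}}(t)=\infty$$ and $$\lim_{t\uparrow T}\frac{b(t)}{\sigma(t)^2}\exp\left\{2\alpha\int_0^t b(w)\,\mathrm{d}w\right\}=C\in\mathbb{R}\setminus\{0\},$$ and that $\operatorname{sign}(\alpha)=\operatorname{sign}(C)$ or $\alpha=0$. Then $$\sqrt{I_{Y^{(\alpha)}}(t)}\,\big(\widehat{\alpha}_t^{(Y^{(\alpha)})}-\alpha\big)\ \longrightarrow\ \frac{\operatorname{sign}(C)}{\sqrt{2}}\,\frac{\int_0^1 W_s\,\mathrm{d}W_s}{\int_0^1 (W_s)^2\,\mathrm{d}s}\qquad\text{in distribution as } t\uparrow T,$$ where $(W_s)_{s\in[0,1]}$ is a standard Wiener process.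
   Context: Let $T\in(0,\infty]$ be fixed. Let $b:[0,T)\to\mathbb{R}$ and $\sigma:[0,T)\to\mathbb{R}$ be continuous functions such that $\sigma(t)>0$ for all $t\in[0,T)$, and there exists $t_0\in(0,T)$ with $b(t)\neq0$ for all $t\in[t_0,T)$. Let $a:\mathbb{R}\to\mathbb{R}$ be a function with $a(x)=x+r(x)$, $x\in\mathbb{R}$, where $|r(x)|\leq L(1+|x|^\gamma)$, $x\in\mathbb{R}$, for some $L\geq0$ and $\gamma\in[0,1)$, and $|r(x)-r(y)|\leq M|x-y|$, $x,y\in\mathbb{R}$, for some $M\geq0$. Let $(B_t)_{t\in[0,T)}$ be a standard Wiener process. For $\alpha\in\mathbb{R}$, let $(X_t^{(\alpha)})_{t\in[0,T)}$ and $(Y_t^{(\alpha)})_{t\in[0,T)}$ be the unique strong solutions of $$\mathrm{d}X_t^{(\alpha)}=\alpha b(t)X_t^{(\alpha)}\,\mathrm{d}t+\sigma(t)\,\mathrm{d}B_t,\quad X_0^{(\alpha)}=0,\qquad \mathrm{d}Y_t^{(\alpha)}=\alpha b(t)a(Y_t^{(\alpha)})\,\mathrm{d}t+\sigma(t)\,\mathrm{d}B_t,\quad Y_0^{(\alpha)}=0,\qquad t\in[0,T).$$ Fisher informations: $$I_{X^{(\alpha)}}(t)=\int_0^t\frac{b(s)^2}{\sigma(s)^2}\,\mathsf{E}(X_s^{(\alpha)})^2\,\mathrm{d}s,\qquad I_{Y^{(\alpha)}}(t)=\int_0^t\frac{b(s)^2}{\sigma(s)^2}\,\mathsf{E}\,a(Y_s^{(\alpha)})^2\,\mathrm{d}s,\qquad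 t\in(0,T),$$ where $\mathsf{E}(X_s^{(\alpha)})^2=\int_0^s\sigma(u)^2\exp\{2\alpha\int_u^s b(v)\,\mathrm{d}v\}\,\mathrm{d}u$. The maximum likelihood estimator $\widehat{\alpha}_t^{(Y^{(\alpha)})}$ of $\alpha$ based on $(Y_s^{(\alpha)})_{s\in[0,t]}$ is the maximizer over $\theta\in\mathbb{R}$ of the log-likelihood $\theta\int_0^t\frac{b(s)}{\sigma(s)^2}a(Y_s^{(\alpha)})\,\mathrm{d}Y_s^{(\alpha)}-\frac{\theta^2}{2}\int_0^t\frac{b(s)^2}{\sigma(s)^2}a(Y_s^{(\alpha)})^2\,\mathrm{d}s$. On the event where $\int_0^t\frac{b(s)^2}{\sigma(s)^2}a(Y_s^{(\alpha)})^2\,\mathrm{d}s>0$ it is $$\widehat{\alpha}_t^{(Y^{(\alpha)})}=\frac{\int_0^t\frac{b(s)a(Y_s^{(\alpha)})}{\sigma(s)^2}\,\mathrm{d}Y_s^{(\alpha)}}{\int_0^t\frac{b(s)^2a(Y_s^{(\alpha)})^2}{\sigma(s)^2}\,\mathrm{d}s},\qquad \widehat{\alpha}_t^{(Y^{(\alpha)})}-\alpha=\frac{\int_0^t\frac{b(s)a(Y_s^{(\alpha)})}{\sigma(s)}\,\mathrm{d}B_s}{\int_0^t\frac{b(s)^2a(Y_s^{(\alpha)})^2}{\sigma(s)^2}\,\mathrm{d}s}.$$ The MLE is understood to exist asymptotically as $t\uparrow T$ with probability one: there is an event of probability one such that for each $\omega$ in it there is $t(\omega)\in[0,T)$ for which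 $$\int_0^t\frac{b(s)^2a(Y_s^{(\alpha)}(\omega))^2}{\sigma(s)^2}\,\mathrm{d}s>0\qquad\text{and}\qquad \widehat{\alpha}_t^{(Y^{(\alpha)})}(\omega)=\frac{\left(\int_0^t\frac{b(s)a(Y_s^{(\alpha)})}{\sigma(s)^2}\,\mathrm{d}Y_s^{(\alpha)}\right)(\omega)}{\int_0^t\frac{b(s)^2a(Y_s^{(\alpha)}(\omega))^2}{\sigma(s)^2}\,\mathrm{d}s}$$ hold for all $t\in[t(\omega),T)$. On the event where the denominator $\int_0^t\frac{b(s)^2a(Y_s^{(\alpha)})^2}{\sigma(s)^2}\,\mathrm{d}s$ vanishes, $\widehat{\alpha}_t^{(Y^{(\alpha)})}$ may be given any (measurable) value. $\operatorname{sign}$ denotes the signum function. *)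

theory Defs
  imports "HOL-Probability.Probability"
begin

section \<open>Time horizon and convergence in distribution\<close>

definition horizon :: "ereal \<Rightarrow> real set" where
  "horizon T = {t. 0 \<le> t \<and> ereal t < T}"

definition at_horizon :: "ereal \<Rightarrow> real filter" where
  "at_horizon T = (if T = \<infinity> then at_top else at_left (real_of_ereal T))"

text \<open>\<^const>\<open>weak_conv_m\<close> along an arbitrary filter instead of a sequence.\<close>

definition weak_conv_filter :: "('i \<Rightarrow> real measure) \<Rightarrow> real measure \<Rightarrow> 'i filter \<Rightarrow> bool" where
  "weak_conv_filter \<mu> \<nu> G \<longleftrightarrow>
     (\<forall>x. isCont (cdf \<nu>) x \<longrightarrow> ((\<lambda>i. cdf (\<mu> i) x) \<longlongrightarrow> cdf \<nu> x) G)"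

section \<open>Wiener processes\<close>

definition wiener_process :: "'a measure \<Rightarrow> real set \<Rightarrow> (real \<Rightarrow> 'a \<Rightarrow> real) \<Rightarrow> bool" where
  "wiener_process M J B \<longleftrightarrow>
     prob_space M \<and>
     (\<forall>t\<in>J. B t \<in> borel_measurable M) \<and>
     (AE \<omega> in M. B 0 \<omega> = 0) \<and>
     (\<forall>\<omega>\<in>space M. continuous_on J (\<lambda>t. B t \<omega>)) \<and>
     (\<forall>s\<in>J. \<forall>t\<in>J. s < t \<longrightarrow>
        distributed M lborel (\<lambda>\<omega>. B t \<omega> - B s \<omega>) (normal_density 0 (sqrt (t - s)))) \<and>
     (\<forall>(n::nat) \<tau>. (\<forall>i\<le>n. \<tau> i \<in> J) \<and> (\<forall>i<n. \<tau> i < \<tau> (Suc i)) \<longrightarrow>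
        prob_space.indep_vars M (\<lambda>_. borel) (\<lambda>i \<omega>. B (\<tau> (Suc i)) \<omega> - B (\<tau> i) \<omega>) {..<n})"

text \<open>The filtration generated by a process, augmented by the null sets.\<close>

definition aug_filtration :: "'a measure \<Rightarrow> (real \<Rightarrow> 'a \<Rightarrow> real) \<Rightarrow> real \<Rightarrow> 'a measure" where
  "aug_filtration M B t =
     sigma (space M) ({B s -` A \<inter> space M | s A. s \<in> {0..t} \<and> A \<in> sets borel} \<union> null_sets M)"

section \<open>Stochastic integrals of continuous adapted integrands\<close>

text \<open>A simple predictable process \<open>\<Sum>i<n. \<xi>\<^sub>i \<cdot> 1\<^bsub>(\<tau>\<^sub>i, \<tau>\<^sub>i\<^sub>+\<^sub>1]\<^esub>\<close> is represented by its number
  of steps \<open>n\<close>, its deterministic grid \<open>\<tau>\<close> and its levels \<open>\<xi>\<close>.\<close>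

record 'a step_process =
  steps :: nat
  grid :: "nat \<Rightarrow> real"
  level :: "nat \<Rightarrow> 'a \<Rightarrow> real"

definition simple_predictable ::
    "'a measure \<Rightarrow> (real \<Rightarrow> 'a measure) \<Rightarrow> real \<Rightarrow> 'a step_process \<Rightarrow> bool" where
  "simple_predictable M F t K \<longleftrightarrow>
     grid K 0 = 0 \<and> grid K (steps K) = t \<and>
     (\<forall>i<steps K. grid K i < grid K (Suc i)) \<and>
     (\<forall>i<steps K. level K i \<in> borel_measurable (F (grid K i))) \<and>
     (\<exists>c. \<forall>i<steps K. \<forall>\<omega>\<in>space M. \<bar>level K i \<omega>\<bar> \<le> c)"

definition step_value :: "'a step_process \<Rightarrow> real \<Rightarrow> 'a \<Rightarrow> real" where
  "step_value K s \<omega> = (\<Sum>i<steps K. level K i \<omega> * indicator {grid K i<..grid K (Suc i)} s)"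

definition step_integral :: "'a step_process \<Rightarrow> (real \<Rightarrow> 'a \<Rightarrow> real) \<Rightarrow> 'a \<Rightarrow> real" where
  "step_integral K Z \<omega> = (\<Sum>i<steps K. level K i \<omega> * (Z (grid K (Suc i)) \<omega> - Z (grid K i) \<omega>))"

text \<open>\<open>has_stochastic_integral M F Z H t I\<close> says that the random variable \<open>I\<close> is (a version of)
  \<open>\<integral>\<^sub>0\<^sup>t H dZ\<close>: the integral is extended from simple predictable processes to continuous adapted
  ones by continuity, with respect to uniform convergence in probability of the integrands and
  convergence in probability of the integrals. If \<open>Z\<close> is a continuous semimartingale for \<open>F\<close>,
  the limit \<open>I\<close> exists, and up to null sets it does not depend on the approximating sequence.
  The integrands are compared on \<open>(0, t]\<close> only, since simple predictable processes carry no
  information at time \<open>0\<close>.\<close>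

definition has_stochastic_integral ::
    "'a measure \<Rightarrow> (real \<Rightarrow> 'a measure) \<Rightarrow> (real \<Rightarrow> 'a \<Rightarrow> real) \<Rightarrow> (real \<Rightarrow> 'a \<Rightarrow> real) \<Rightarrow> real
      \<Rightarrow> ('a \<Rightarrow> real) \<Rightarrow> bool" where
  "has_stochastic_integral M F Z H t I \<longleftrightarrow>
     (\<forall>s\<in>{0..t}. H s \<in> borel_measurable (F s)) \<and>
     (\<forall>\<omega>\<in>space M. continuous_on {0..t} (\<lambda>s. H s \<omega>)) \<and>
     I \<in> borel_measurable M \<and>
     (\<exists>K :: nat \<Rightarrow> 'a step_process.
        (\<forall>n. simple_predictable M F t (K n)) \<and>
        (\<forall>\<epsilon>>0. (\<lambda>n. measure M
            {\<omega>\<in>space M. \<exists>s\<in>{0<..t}. \<epsilon> < \<bar>step_value (K n) s \<omega> - H s \<omega>\<bar>}) \<longlonglongrightarrow> 0) \<and>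
        (\<forall>\<epsilon>>0. (\<lambda>n. measure M
            {\<omega>\<in>space M. \<epsilon> < \<bar>step_integral (K n) Z \<omega> - I \<omega>\<bar>}) \<longlonglongrightarrow> 0))"

text \<open>The integral as a process on \<open>[0, T)\<close>, in its version with continuous paths.\<close>

definition stochastic_integral_process ::
    "'a measure \<Rightarrow> (real \<Rightarrow> 'a measure) \<Rightarrow> ereal \<Rightarrow> (real \<Rightarrow> 'a \<Rightarrow> real) \<Rightarrow> (real \<Rightarrow> 'a \<Rightarrow> real)
      \<Rightarrow> (real \<Rightarrow> 'a \<Rightarrow> real) \<Rightarrow> bool" where
  "stochastic_integral_process M F T Z H I \<longleftrightarrow>
     (\<forall>t\<in>horizon T. has_stochastic_integral M F Z H t (I t)) \<and>
     (\<forall>\<omega>\<in>space M. continuous_on (horizon T) (\<lambda>t. I t \<omega>))"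

section \<open>The diffusion, its Fisher information and the maximum likelihood estimator\<close>

text \<open>\<open>Z\<close> is the strong solution of \<open>dZ\<^sub>t = \<alpha> b(t) f(Z\<^sub>t) dt + \<sigma>(t) dB\<^sub>t\<close>, \<open>Z\<^sub>0 = 0\<close>, on \<open>[0, T)\<close>;
  being strong means being adapted to the augmented filtration of \<open>B\<close>.\<close>

definition strong_solution ::
    "'a measure \<Rightarrow> (real \<Rightarrow> 'a \<Rightarrow> real) \<Rightarrow> ereal \<Rightarrow> real \<Rightarrow> (real \<Rightarrow> real) \<Rightarrow> (real \<Rightarrow> real)
      \<Rightarrow> (real \<Rightarrow> real) \<Rightarrow> (real \<Rightarrow> 'a \<Rightarrow> real) \<Rightarrow> bool" where
  "strong_solution M B T \<alpha> b \<sigma> f Z \<longleftrightarrow>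
     (\<forall>t\<in>horizon T. Z t \<in> borel_measurable (aug_filtration M B t)) \<and>
     (\<forall>\<omega>\<in>space M. continuous_on (horizon T) (\<lambda>t. Z t \<omega>)) \<and>
     (AE \<omega> in M. Z 0 \<omega> = 0) \<and>
     (\<forall>t\<in>horizon T. has_stochastic_integral M (aug_filtration M B) B (\<lambda>s _. \<sigma> s) t
        (\<lambda>\<omega>. Z t \<omega> - Z 0 \<omega> - (LBINT s:{0..t}. \<alpha> * b s * f (Z s \<omega>))))"

definition fisher_info ::
    "'a measure \<Rightarrow> (real \<Rightarrow> real) \<Rightarrow> (real \<Rightarrow> real) \<Rightarrow> (real \<Rightarrow> real) \<Rightarrow> (real \<Rightarrow> 'a \<Rightarrow> real)
      \<Rightarrow> real \<Rightarrow> real" where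
  "fisher_info M b \<sigma> f Z t =
     (LBINT s:{0..t}. (b s)\<^sup>2 / (\<sigma> s)\<^sup>2 * prob_space.expectation M (\<lambda>\<omega>. (f (Z s \<omega>))\<^sup>2))"

definition observed_info ::
    "(real \<Rightarrow> real) \<Rightarrow> (real \<Rightarrow> real) \<Rightarrow> (real \<Rightarrow> real) \<Rightarrow> (real \<Rightarrow> 'a \<Rightarrow> real) \<Rightarrow> real \<Rightarrow> 'a \<Rightarrow> real"
  where
  "observed_info b \<sigma> f Z t \<omega> = (LBINT s:{0..t}. (b s)\<^sup>2 * (f (Z s \<omega>))\<^sup>2 / (\<sigma> s)\<^sup>2)"

text \<open>\<open>S\<close> stands for the process \<open>\<integral>\<^sub>0\<^sup>t b(s) f(Z\<^sub>s) / \<sigma>(s)\<^sup>2 dZ\<^sub>s\<close>.\<close>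

definition log_likelihood ::
    "(real \<Rightarrow> real) \<Rightarrow> (real \<Rightarrow> real) \<Rightarrow> (real \<Rightarrow> real) \<Rightarrow> (real \<Rightarrow> 'a \<Rightarrow> real) \<Rightarrow> (real \<Rightarrow> 'a \<Rightarrow> real)
      \<Rightarrow> real \<Rightarrow> 'a \<Rightarrow> real \<Rightarrow> real" where
  "log_likelihood b \<sigma> f Z S t \<omega> \<theta> = \<theta> * S t \<omega> - \<theta>\<^sup>2 / 2 * observed_info b \<sigma> f Z t \<omega>"

text \<open>Where the observed information vanishes, the estimator is left unconstrained.\<close>

definition max_likelihood_estimator ::
    "'a measure \<Rightarrow> ereal \<Rightarrow> (real \<Rightarrow> real) \<Rightarrow> (real \<Rightarrow> real) \<Rightarrow> (real \<Rightarrow> real)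
      \<Rightarrow> (real \<Rightarrow> 'a \<Rightarrow> real) \<Rightarrow> (real \<Rightarrow> 'a \<Rightarrow> real) \<Rightarrow> (real \<Rightarrow> 'a \<Rightarrow> real) \<Rightarrow> bool" where
  "max_likelihood_estimator M T b \<sigma> f Z S est \<longleftrightarrow>
     (\<forall>t\<in>horizon T. est t \<in> borel_measurable M) \<and>
     (AE \<omega> in M. \<forall>t\<in>horizon T. 0 < observed_info b \<sigma> f Z t \<omega> \<longrightarrow>
        is_arg_max (log_likelihood b \<sigma> f Z S t \<omega>) (\<lambda>_. True) (est t \<omega>))"

text \<open>\<open>\<bar>x\<bar>\<^sup>\<gamma>\<close> with \<open>\<bar>0\<bar>\<^sup>0 = 1\<close>, whereas \<open>0 powr 0 = 0\<close>.\<close>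

definition abs_pow :: "real \<Rightarrow> real \<Rightarrow> real" where
  "abs_pow x \<gamma> = (if \<gamma> = 0 then 1 else \<bar>x\<bar> powr \<gamma>)"

end

theory Submission
  imports Defs
begin

text \<open>Write \<open>e(t) = exp(- \<alpha> \<integral>\<^sub>0\<^sup>t b)\<close>. Discounting turns the linear solution into the Gaussian
  martingale \<open>N = e X = \<integral> h dB\<close> with \<open>h = e \<sigma>\<close>, whose clock is \<open>v(t) = \<integral>\<^sub>0\<^sup>t h\<^sup>2\<close>. The hypothesis on
  \<open>C\<close> says that \<open>\<psi> = b / h\<^sup>2\<close> tends to \<open>C\<close>, and since \<open>\<psi>\<close> is bounded, divergence of the Fisher
  information of \<open>X\<close> forces \<open>v\<close> to infinity.

  The difference \<open>D = e (Y - X)\<close> contains no noise: \<open>D = \<integral> \<alpha> b e r(Y)\<close>. The condition on the signs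
  makes the drift rate \<open>\<alpha> b\<close> eventually positive (or zero throughout), so that \<open>e\<close> is bounded, and
  then the sublinearity of \<open>r\<close> and Gronwall's inequality bound \<open>D\<close> in mean square
  (\<open>D_second_moment_bounded\<close>), whereas \<open>N\<close> has variance \<open>v\<close>. Hence the integrand
  \<open>b a(Y) / \<sigma>\<^sup>2 = e (C N + \<rho>)\<close> of the score has an error term \<open>\<rho>\<close> that is negligible against
  \<open>N\<close> (\<open>\<rho>_negligible\<close>). It follows that, as \<open>t\<close> approaches the horizon,
  \<^item> the score \<open>Q\<close>, which is the numerator of the estimation error, is \<open>C \<integral> N dN\<close> up to \<open>o(v)\<close>, and
    \<open>\<integral> N dN = (N\<^sup>2 - v) / 2\<close> by Ito's formula (\<open>ito_square_sum\<close>);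
  \<^item> the observed information is \<open>C\<^sup>2 \<integral> N\<^sup>2 dv\<close> up to \<open>o(v\<^sup>2)\<close>, and its expectation, the Fisher
    information, is \<open>C\<^sup>2 v\<^sup>2 / 2\<close> up to \<open>o(v\<^sup>2)\<close>.

  The pair \<open>((N\<^sub>t\<^sup>2 / v(t) - 1) / 2, v(t)\<^sup>-\<^sup>2 \<integral>\<^sub>0\<^sup>t N\<^sup>2 dv)\<close> has a law that does not depend on \<open>t\<close>, by
  the scaling property of the Wiener process; at unit time it is \<open>(\<integral> W dW, \<integral> W\<^sup>2)\<close>. This is proved without time
  change (\<open>endpoint_energy_law\<close>): along partitions that cut the clock into equal parts, both
  functionals are limits in probability of the same functional of independent and identically
  distributed normal variables.

  The quotient itself is never treated as a random variable in the limit. The event that the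
  normalized error is at most \<open>x\<close> is a linear inequality between numerator and denominator, so it
  suffices that linear combinations converge (\<open>discrepancy_limit\<close>); a continuity point \<open>x\<close> of the
  limit distribution is one where the corresponding equality has probability zero.

  The stochastic integrals are given by approximating sequences of step processes. Isometry
  estimates for elementary sums, together with Fatou's lemma, show that every integral that
  occurs is the limit in probability of the Riemann sums used here
  (\<open>stochastic_integral_step_limit\<close>, \<open>wiener_integral_discounted\<close>, \<open>Q_integral\<close>).\<close>

section \<open>Convergence in probability\<close>

abbreviation nn_mean :: "'a measure \<Rightarrow> ('a \<Rightarrow> real) \<Rightarrow> ennreal" where
  "nn_mean M f \<equiv> \<integral>\<^sup>+z. ennreal (f z) \<partial>M"

abbreviation mean_square :: "'a measure \<Rightarrow> ('a \<Rightarrow> real) \<Rightarrow> ennreal" where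
  "mean_square M f \<equiv> nn_mean M (\<lambda>z. (f z)\<^sup>2)"

definition converges_in_prob :: "'a measure \<Rightarrow> (nat \<Rightarrow> 'a \<Rightarrow> real) \<Rightarrow> ('a \<Rightarrow> real) \<Rightarrow> bool" where
  "converges_in_prob M V A \<longleftrightarrow>
     (\<forall>\<epsilon>>0. (\<lambda>n. measure M {z \<in> space M. \<epsilon> < \<bar>V n z - A z\<bar>}) \<longlonglongrightarrow> 0)"

lemma converges_in_probD:
  "converges_in_prob M V A \<Longrightarrow> 0 < \<epsilon> \<Longrightarrow>
    (\<lambda>n. measure M {z \<in> space M. \<epsilon> < \<bar>V n z - A z\<bar>}) \<longlonglongrightarrow> 0"
  by (auto simp: converges_in_prob_def)

context prob_space
begin

lemma prob_mono_ev:
  assumes "B \<in> events" "A \<subseteq> B" shows "prob A \<le> prob B"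
  using finite_measure_mono[OF assms(2,1)] .

lemma prob_le_add:
  assumes "B \<in> events" "C \<in> events" "A \<subseteq> B \<union> C" shows "prob A \<le> prob B + prob C"
  using finite_measure_mono[OF assms(3)] assms measure_Un_le[of B M C] by auto

lemma prob_tail_L2:
  assumes [measurable]: "V \<in> borel_measurable M" and "0 < \<epsilon>" "0 \<le> c"
    and "mean_square M V \<le> ennreal c"
  shows "prob {z\<in>space M. \<epsilon> < \<bar>V z\<bar>} \<le> c / \<epsilon>\<^sup>2"
proof -
  have e: "mean_square M V < \<infinity>"
    using assms(4) by (simp add: order_le_less_trans)
  have i: "integrable M (\<lambda>z. (V z)\<^sup>2)"
    by (rule integrableI_bounded) (use e in auto)
  have *: "expectation (\<lambda>z. (V z)\<^sup>2) \<le> c"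
    using assms(3,4) nn_integral_eq_integral[OF i] by (simp add: ennreal_le_iff)
  have "prob {z\<in>space M. \<epsilon> < \<bar>V z\<bar>} \<le> prob {z\<in>space M. \<epsilon>\<^sup>2 \<le> (V z)\<^sup>2}"
  proof (rule prob_mono_ev)
    show "{z \<in> space M. \<epsilon> < \<bar>V z\<bar>} \<subseteq> {z \<in> space M. \<epsilon>\<^sup>2 \<le> (V z)\<^sup>2}"
      using assms(2) by (auto simp: abs_le_square_iff[symmetric])
  qed measurable
  also have "... \<le> expectation (\<lambda>z. (V z)\<^sup>2) / \<epsilon>\<^sup>2"
    by (rule integral_Markov_inequality_measure[OF i, of "space M"]) (use assms in auto)
  also have "... \<le> c / \<epsilon>\<^sup>2" using * assms(2) by (simp add: divide_right_mono)
  finally show ?thesis .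
qed

lemma prob_tail_L1:
  assumes [measurable]: "V \<in> borel_measurable M" and "0 < \<epsilon>" "0 \<le> c"
    and "nn_mean M (\<lambda>z. \<bar>V z\<bar>) \<le> ennreal c"
  shows "prob {z\<in>space M. \<epsilon> < \<bar>V z\<bar>} \<le> c / \<epsilon>"
proof -
  have "mean_square M (\<lambda>z. sqrt \<bar>V z\<bar>) \<le> ennreal c" using assms(4) by simp
  from prob_tail_L2[OF _ _ assms(3) this, of "sqrt \<epsilon>"] assms(2)
  have "prob {z\<in>space M. sqrt \<epsilon> < \<bar>sqrt \<bar>V z\<bar>\<bar>} \<le> c / (sqrt \<epsilon>)\<^sup>2" by simp
  then show ?thesis using assms(2) by simp
qed

lemma converges_in_prob_L2:
  assumes [measurable]: "\<And>n. V n \<in> borel_measurable M" "A \<in> borel_measurable M"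
    and c0: "\<And>n. 0 \<le> c n" and c: "c \<longlonglongrightarrow> 0"
    and b: "eventually (\<lambda>n. mean_square M (\<lambda>z. V n z - A z) \<le> ennreal (c n)) sequentially"
  shows "converges_in_prob M V A"
  unfolding converges_in_prob_def
proof (intro allI impI)
  fix \<epsilon> :: real assume "0 < \<epsilon>"
  show "(\<lambda>n. measure M {z \<in> space M. \<epsilon> < \<bar>V n z - A z\<bar>}) \<longlonglongrightarrow> 0"
  proof (rule tendsto_sandwich[where f="\<lambda>_. 0" and h="\<lambda>n. c n / \<epsilon>\<^sup>2"])
    show "(\<lambda>n. c n / \<epsilon>\<^sup>2) \<longlonglongrightarrow> 0" using tendsto_divide[OF c tendsto_const, of "\<epsilon>\<^sup>2"] \<open>0 < \<epsilon>\<close> by simp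
    show "eventually (\<lambda>n. measure M {z \<in> space M. \<epsilon> < \<bar>V n z - A z\<bar>} \<le> c n / \<epsilon>\<^sup>2) sequentially"
      using b by eventually_elim (rule prob_tail_L2, use c0 \<open>0 < \<epsilon>\<close> in auto)
  qed auto
qed

lemma converges_in_prob_AE:
  assumes [measurable]: "\<And>n. V n \<in> borel_measurable M" "A \<in> borel_measurable M"
    and lim: "AE z in M. (\<lambda>n. V n z) \<longlonglongrightarrow> A z"
  shows "converges_in_prob M V A"
  unfolding converges_in_prob_def
proof (intro allI impI)
  fix \<epsilon> :: real assume e: "0 < \<epsilon>"
  let ?S = "\<lambda>n. {z \<in> space M. \<epsilon> < \<bar>V n z - A z\<bar>}"
  have "(\<lambda>n. expectation (indicator (?S n))) \<longlonglongrightarrow> expectation (\<lambda>_. 0 :: real)"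
  proof (rule integral_dominated_convergence[where w="\<lambda>_. 1"])
    show "AE x in M. (\<lambda>i. indicator (?S i) x :: real) \<longlonglongrightarrow> 0"
      using lim
    proof eventually_elim
      case (elim x)
      from tendstoD[OF elim e] have "eventually (\<lambda>n. indicator (?S n) x = (0::real)) sequentially"
        by eventually_elim (auto simp: dist_real_def indicator_def)
      then show ?case by (rule tendsto_eventually)
    qed
  qed (auto simp: indicator_def)
  then show "(\<lambda>n. prob (?S n)) \<longlonglongrightarrow> 0" by simp
qed

text \<open>If the error of \<open>V''\<close> exceeds \<open>\<epsilon>\<close>, then one of the other two errors exceeds \<open>\<epsilon> / 2\<close>. Sums and
  differences are special cases.\<close>

lemma converges_in_prob_dominated:
  assumes [measurable]: "\<And>n. V n \<in> borel_measurable M" "A \<in> borel_measurable M"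
       "\<And>n. V' n \<in> borel_measurable M" "A' \<in> borel_measurable M"
       "\<And>n. V'' n \<in> borel_measurable M" "A'' \<in> borel_measurable M"
    and V: "converges_in_prob M V A" and V': "converges_in_prob M V' A'"
    and le: "\<And>n z. z \<in> space M \<Longrightarrow> \<bar>V'' n z - A'' z\<bar> \<le> \<bar>V n z - A z\<bar> + \<bar>V' n z - A' z\<bar>"
  shows "converges_in_prob M V'' A''"
  unfolding converges_in_prob_def
proof (intro allI impI)
  fix \<epsilon> :: real assume e: "0 < \<epsilon>"
  let ?h = "\<lambda>n. prob {z \<in> space M. \<epsilon>/2 < \<bar>V n z - A z\<bar>} + prob {z \<in> space M. \<epsilon>/2 < \<bar>V' n z - A' z\<bar>}"
  show "(\<lambda>n. prob {z \<in> space M. \<epsilon> < \<bar>V'' n z - A'' z\<bar>}) \<longlonglongrightarrow> 0"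
  proof (rule tendsto_sandwich[where f="\<lambda>_. 0" and h="?h"])
    show "?h \<longlonglongrightarrow> 0"
      using tendsto_add[OF converges_in_probD[OF V, of "\<epsilon>/2"] converges_in_probD[OF V', of "\<epsilon>/2"]] e by simp
    have "prob {z \<in> space M. \<epsilon> < \<bar>V'' n z - A'' z\<bar>} \<le> ?h n" for n
    proof (rule prob_le_add)
      show "{z \<in> space M. \<epsilon> < \<bar>V'' n z - A'' z\<bar>} \<subseteq> {z \<in> space M. \<epsilon>/2 < \<bar>V n z - A z\<bar>} \<union> {z \<in> space M. \<epsilon>/2 < \<bar>V' n z - A' z\<bar>}"
        using le[of _ n] by fastforce
    qed measurable
    then show "eventually (\<lambda>n. prob {z \<in> space M. \<epsilon> < \<bar>V'' n z - A'' z\<bar>} \<le> ?h n) sequentially" by simp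
  qed auto
qed

lemma converges_in_prob_add:
  assumes "\<And>n. V n \<in> borel_measurable M" "A \<in> borel_measurable M"
       "\<And>n. V' n \<in> borel_measurable M" "A' \<in> borel_measurable M"
    and "converges_in_prob M V A" "converges_in_prob M V' A'"
  shows "converges_in_prob M (\<lambda>n z. V n z + V' n z) (\<lambda>z. A z + A' z)"
  by (rule converges_in_prob_dominated[OF assms(1-4) _ _ assms(5,6)]) (use assms(1-4) in auto)

lemma converges_in_prob_diff:
  assumes "\<And>n. V n \<in> borel_measurable M" "A \<in> borel_measurable M"
       "\<And>n. V' n \<in> borel_measurable M" "A' \<in> borel_measurable M"
    and "converges_in_prob M V A" "converges_in_prob M V' A'"
  shows "converges_in_prob M (\<lambda>n z. V n z - V' n z) (\<lambda>z. A z - A' z)"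
  by (rule converges_in_prob_dominated[OF assms(1-4) _ _ assms(5,6)]) (use assms(1-4) in auto)

lemma converges_in_prob_mult_bounded:
  assumes [measurable]: "\<And>n. V n \<in> borel_measurable M" "A \<in> borel_measurable M" "\<xi> \<in> borel_measurable M"
    and V: "converges_in_prob M V A" and c: "\<And>z. z \<in> space M \<Longrightarrow> \<bar>\<xi> z\<bar> \<le> c"
  shows "converges_in_prob M (\<lambda>n z. \<xi> z * V n z) (\<lambda>z. \<xi> z * A z)"
  unfolding converges_in_prob_def
proof (intro allI impI)
  fix \<epsilon> :: real assume e: "0 < \<epsilon>"
  define d where "d = \<bar>c\<bar> + 1"
  have d: "d > 0" "\<And>z. z \<in> space M \<Longrightarrow> \<bar>\<xi> z\<bar> \<le> d" using c unfolding d_def by fastforce+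
  let ?h = "\<lambda>n. prob {z \<in> space M. \<epsilon>/d < \<bar>V n z - A z\<bar>}"
  show "(\<lambda>n. prob {z \<in> space M. \<epsilon> < \<bar>\<xi> z * V n z - \<xi> z * A z\<bar>}) \<longlonglongrightarrow> 0"
  proof (rule tendsto_sandwich[where f="\<lambda>_. 0" and h="?h"])
    show "?h \<longlonglongrightarrow> 0" using converges_in_probD[OF V, of "\<epsilon>/d"] e d by simp
    have "prob {z \<in> space M. \<epsilon> < \<bar>\<xi> z * V n z - \<xi> z * A z\<bar>} \<le> ?h n" for n
    proof (rule prob_mono_ev)
      show "{z \<in> space M. \<epsilon> < \<bar>\<xi> z * V n z - \<xi> z * A z\<bar>} \<subseteq> {z \<in> space M. \<epsilon>/d < \<bar>V n z - A z\<bar>}"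
      proof safe
        fix z assume w: "z \<in> space M" "\<epsilon> < \<bar>\<xi> z * V n z - \<xi> z * A z\<bar>"
        have "\<bar>\<xi> z * V n z - \<xi> z * A z\<bar> = \<bar>\<xi> z\<bar> * \<bar>V n z - A z\<bar>"
          by (simp add: abs_mult[symmetric] algebra_simps)
        also have "... \<le> d * \<bar>V n z - A z\<bar>" by (rule mult_right_mono) (use d w in auto)
        finally show "\<epsilon>/d < \<bar>V n z - A z\<bar>" using w d by (simp add: field_simps)
      qed
    qed measurable
    then show "eventually (\<lambda>n. prob {z \<in> space M. \<epsilon> < \<bar>\<xi> z * V n z - \<xi> z * A z\<bar>} \<le> ?h n) sequentially" by simp
  qed auto
qed

lemma converges_in_prob_cmult:
  assumes "\<And>n. V n \<in> borel_measurable M" "A \<in> borel_measurable M"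
    and "converges_in_prob M V A"
  shows "converges_in_prob M (\<lambda>n z. c * V n z) (\<lambda>z. c * A z)"
  by (rule converges_in_prob_mult_bounded[where c="\<bar>c\<bar>"]) (use assms in auto)

lemma converges_in_prob_const: "converges_in_prob M (\<lambda>_. A) A"
  by (auto simp: converges_in_prob_def)

lemma converges_in_prob_sum:
  assumes "finite I" "\<And>i n. i \<in> I \<Longrightarrow> V i n \<in> borel_measurable M" "\<And>i. i \<in> I \<Longrightarrow> A i \<in> borel_measurable M"
    and "\<And>i. i \<in> I \<Longrightarrow> converges_in_prob M (V i) (A i)"
  shows "converges_in_prob M (\<lambda>n z. \<Sum>i\<in>I. V i n z) (\<lambda>z. \<Sum>i\<in>I. A i z)"
  using assms
proof (induction I)
  case empty
  then show ?case by (simp add: converges_in_prob_const)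
next
  case (insert i I)
  have "converges_in_prob M (\<lambda>n z. V i n z + (\<Sum>i\<in>I. V i n z)) (\<lambda>z. A i z + (\<Sum>i\<in>I. A i z))"
    by (rule converges_in_prob_add) (use insert in auto)
  then show ?case using insert(1,2) by simp
qed

text \<open>Convergence in probability yields almost sure convergence along a subsequence, so that
  Fatou's lemma carries a uniform second moment bound over to the limit. This is how isometry
  estimates for elementary sums reach the integrals.\<close>

lemma converges_in_prob_Fatou:
  assumes [measurable]: "\<And>n. V n \<in> borel_measurable M" "A \<in> borel_measurable M"
    and V: "converges_in_prob M V A"
    and b: "eventually (\<lambda>n. mean_square M (V n) \<le> c) sequentially"
  shows "mean_square M A \<le> c"
proof -
  from b obtain n0 where n0: "\<And>n. n0 \<le> n \<Longrightarrow> mean_square M (V n) \<le> c"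
    by (auto simp: eventually_sequentially)
  let ?u = "\<lambda>n z. min 1 \<bar>V (n + n0) z - A z\<bar>"
  have int: "integrable M (?u n)" for n
    by (rule integrable_const_bound[where B=1]) auto
  have lim: "(\<lambda>n. \<integral>z. norm (?u n z) \<partial>M) \<longlonglongrightarrow> 0"
  proof (rule LIMSEQ_I)
    fix r :: real assume r: "0 < r"
    from LIMSEQ_D[OF LIMSEQ_ignore_initial_segment[OF converges_in_probD[OF V, of "r/2"], of n0], of "r/2"] r
    obtain N where N: "\<And>n. N \<le> n \<Longrightarrow> prob {z \<in> space M. r/2 < \<bar>V (n + n0) z - A z\<bar>} < r/2" by auto
    have "norm ((\<integral>z. norm (?u n z) \<partial>M) - 0) < r" if n: "N \<le> n" for n
    proof -
      let ?S = "{z \<in> space M. r/2 < \<bar>V (n + n0) z - A z\<bar>}"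
      have "(\<integral>z. norm (?u n z) \<partial>M) \<le> (\<integral>z. r/2 + indicator ?S z \<partial>M)"
      proof (rule integral_mono)
        show "integrable M (\<lambda>z. norm (?u n z))" using int by (rule integrable_norm)
        show "integrable M (\<lambda>z. r/2 + indicator ?S z :: real)"
          by (rule integrable_const_bound[where B="r/2 + 1"]) (use r in \<open>auto simp: indicator_def\<close>)
      qed (use r in \<open>auto simp: indicator_def min_def not_less\<close>)
      also have "... = r/2 + prob ?S" 
      proof -
        have "integrable M (indicator ?S :: _ \<Rightarrow> real)"
          by (rule integrable_const_bound[where B=1]) (auto simp: indicator_def)
        then show ?thesis by (subst Bochner_Integration.integral_add) (simp_all add: prob_space)
      qed
      also have "... < r" using N[OF n] by simp
      finally show ?thesis by simp
    qed
    then show "\<exists>N. \<forall>n\<ge>N. norm ((\<integral>z. norm (?u n z) \<partial>M) - 0) < r" by blast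
  qed
  obtain \<phi> where \<phi>: "strict_mono \<phi>" "AE z in M. (\<lambda>n. ?u (\<phi> n) z) \<longlonglongrightarrow> 0"
    using tendsto_L1_AE_subseq[OF int lim] by blast
  have AE: "AE z in M. ennreal ((A z)\<^sup>2) \<le> liminf (\<lambda>n. ennreal ((V (\<phi> n + n0) z)\<^sup>2))"
    using \<phi>(2)
  proof eventually_elim
    case (elim z)
    have "(\<lambda>n. \<bar>V (\<phi> n + n0) z - A z\<bar>) \<longlonglongrightarrow> 0"
    proof (rule Lim_transform_eventually[OF elim])
      from tendstoD[OF elim, of 1]
      show "eventually (\<lambda>n. ?u (\<phi> n) z = \<bar>V (\<phi> n + n0) z - A z\<bar>) sequentially"
        by (auto elim!: eventually_mono simp: min_def split: if_splits)
    qed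
    then have "(\<lambda>n. V (\<phi> n + n0) z) \<longlonglongrightarrow> A z"
      using LIM_zero_iff tendsto_rabs_zero_iff by blast
    then have "(\<lambda>n. ennreal ((V (\<phi> n + n0) z)\<^sup>2)) \<longlonglongrightarrow> ennreal ((A z)\<^sup>2)"
      by (intro tendsto_intros)
    from lim_imp_Liminf[OF _ this] show ?case by simp
  qed
  have "mean_square M A \<le> (\<integral>\<^sup>+z. liminf (\<lambda>n. ennreal ((V (\<phi> n + n0) z)\<^sup>2)) \<partial>M)"
    by (rule nn_integral_mono_AE[OF AE])
  also have "... \<le> liminf (\<lambda>n. \<integral>\<^sup>+z. ennreal ((V (\<phi> n + n0) z)\<^sup>2) \<partial>M)"
    by (rule nn_integral_liminf) auto
  also have "... \<le> liminf (\<lambda>n. c)"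
    by (rule Liminf_mono, rule always_eventually) (simp add: n0)
  also have "... = c" by (simp add: Liminf_const)
  finally show ?thesis .
qed

lemma converges_in_prob_unique:
  assumes [measurable]: "\<And>n. V n \<in> borel_measurable M" "A \<in> borel_measurable M" "A' \<in> borel_measurable M"
    and V: "converges_in_prob M V A" "converges_in_prob M V A'"
  shows "AE z in M. A z = A' z"
proof -
  have "converges_in_prob M (\<lambda>n z. V n z - V n z) (\<lambda>z. A z - A' z)"
    by (rule converges_in_prob_diff) (use V in auto)
  then have "mean_square M (\<lambda>z. A z - A' z) \<le> 0"
    by (rule converges_in_prob_Fatou[rotated 2]) auto
  then have "mean_square M (\<lambda>z. A z - A' z) = 0" by simp
  then show ?thesis by (subst (asm) nn_integral_0_iff_AE) auto
qed

text \<open>Both statements are continuity of measure along a monotone sequence of half-lines.\<close>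

lemma prob_le_shift_right:
  assumes [measurable]: "A \<in> borel_measurable M"
  shows "(\<lambda>n. prob {z\<in>space M. A z \<le> x + 1 / real (Suc n)}) \<longlonglongrightarrow> prob {z\<in>space M. A z \<le> x}"
proof -
  have "(\<lambda>n. prob {z\<in>space M. A z \<le> x + 1 / real (Suc n)}) \<longlonglongrightarrow> prob (\<Inter>n. {z\<in>space M. A z \<le> x + 1 / real (Suc n)})"
  proof (rule finite_Lim_measure_decseq)
    have "x + 1 / real (Suc n) \<le> x + 1 / real (Suc m)" if "m \<le> n" for m n
      using that by (intro add_left_mono frac_le) auto
    then show "decseq (\<lambda>n. {z\<in>space M. A z \<le> x + 1 / real (Suc n)})"
      unfolding decseq_def by (fastforce intro: order_trans)
  qed auto
  also have "(\<Inter>n. {z\<in>space M. A z \<le> x + 1 / real (Suc n)}) = {z\<in>space M. A z \<le> x}"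
  proof safe
    fix z assume a: "z \<in> (\<Inter>n. {z\<in>space M. A z \<le> x + 1 / real (Suc n)})"
    show "A z \<le> x"
    proof (rule field_le_epsilon)
      fix e :: real assume "0 < e"
      then obtain n where "1 / real (Suc n) < e" using nat_approx_posE by blast
      moreover have "A z \<le> x + 1 / real (Suc n)" using a by blast
      ultimately show "A z \<le> x + e" by linarith
    qed
  qed (auto intro: order_trans)
  finally show ?thesis .
qed

lemma prob_le_shift_left:
  assumes [measurable]: "A \<in> borel_measurable M"
  shows "(\<lambda>n. prob {z\<in>space M. A z \<le> x - 1 / real (Suc n)}) \<longlonglongrightarrow> prob {z\<in>space M. A z < x}"
proof -
  have "(\<lambda>n. prob {z\<in>space M. A z \<le> x - 1 / real (Suc n)}) \<longlonglongrightarrow> prob (\<Union>n. {z\<in>space M. A z \<le> x - 1 / real (Suc n)})"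
  proof (rule finite_Lim_measure_incseq)
    have "x - 1 / real (Suc m) \<le> x - 1 / real (Suc n)" if "m \<le> n" for m n
      using that by (intro diff_left_mono frac_le) auto
    then show "incseq (\<lambda>n. {z\<in>space M. A z \<le> x - 1 / real (Suc n)})"
      unfolding incseq_def by (fastforce intro: order_trans)
  qed auto
  also have "(\<Union>n. {z\<in>space M. A z \<le> x - 1 / real (Suc n)}) = {z\<in>space M. A z < x}"
  proof safe
    fix z and n :: nat assume "A z \<le> x - 1 / real (Suc n)"
    moreover have "1 / real (Suc n) > 0" by simp
    ultimately show "A z < x" by linarith
  next
    fix z assume a: "z \<in> space M" "A z < x"
    then obtain n where "1 / real (Suc n) < x - A z" using nat_approx_posE[of "x - A z"] by auto
    then show "z \<in> (\<Union>n. {z\<in>space M. A z \<le> x - 1 / real (Suc n)})" using a by (auto intro!: exI[of _ n])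
  qed
  finally show ?thesis .
qed

end

text \<open>Closeness in probability compares the two distribution functions up to a shift of the argument
  by \<open>\<epsilon>\<close>, which right continuity removes.\<close>

lemma limit_in_prob_same_law_le:
  fixes V :: "nat \<Rightarrow> 'a \<Rightarrow> real" and V' :: "nat \<Rightarrow> 'b \<Rightarrow> real"
  assumes "prob_space M" "prob_space M'"
    and [measurable]: "\<And>n. V n \<in> borel_measurable M" "A \<in> borel_measurable M"
      "\<And>n. V' n \<in> borel_measurable M'" "A' \<in> borel_measurable M'"
    and V: "converges_in_prob M V A" and V': "converges_in_prob M' V' A'"
    and law: "eventually (\<lambda>n. \<forall>x. measure M {z\<in>space M. V n z \<le> x} = measure M' {z\<in>space M'. V' n z \<le> x}) sequentially"
  shows "measure M {z\<in>space M. A z \<le> x} \<le> measure M' {z\<in>space M'. A' z \<le> x}"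
proof -
  interpret M: prob_space M by fact
  interpret M': prob_space M' by fact
  have *: "measure M {z\<in>space M. A z \<le> x} \<le> measure M' {z\<in>space M'. A' z \<le> x + \<epsilon>}" if e: "\<epsilon> > 0" for \<epsilon>
  proof (rule tendsto_le[OF _ _ tendsto_const])
    let ?p = "\<lambda>n. measure M {z\<in>space M. \<epsilon>/2 < \<bar>V n z - A z\<bar>}"
    let ?q = "\<lambda>n. measure M' {z\<in>space M'. \<epsilon>/2 < \<bar>V' n z - A' z\<bar>}"
    let ?c = "measure M' {z\<in>space M'. A' z \<le> x + \<epsilon>}"
    show "(\<lambda>n. ?p n + (?q n + ?c)) \<longlonglongrightarrow> ?c"
      using tendsto_add[OF converges_in_probD[OF V, of "\<epsilon>/2"] tendsto_add[OF converges_in_probD[OF V', of "\<epsilon>/2"] tendsto_const]] e by simp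
    show "eventually (\<lambda>n. measure M {z\<in>space M. A z \<le> x} \<le> ?p n + (?q n + ?c)) sequentially"
      using law
    proof eventually_elim
      case (elim n)
      have "measure M {z\<in>space M. A z \<le> x} \<le> ?p n + measure M {z\<in>space M. V n z \<le> x + \<epsilon>/2}"
        by (rule M.prob_le_add) (auto simp: not_less abs_real_def)
      also have "measure M {z\<in>space M. V n z \<le> x + \<epsilon>/2} = measure M' {z\<in>space M'. V' n z \<le> x + \<epsilon>/2}"
        using elim by blast
      also have "... \<le> ?q n + ?c"
        by (rule M'.prob_le_add) (auto simp: not_less abs_real_def)
      finally show ?case by simp
    qed
  qed simp
  show ?thesis
    by (rule LIMSEQ_le_const[OF M'.prob_le_shift_right]) (auto intro!: exI[of _ 0] *)
qed

lemma limit_in_prob_same_law: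
  fixes V :: "nat \<Rightarrow> 'a \<Rightarrow> real" and V' :: "nat \<Rightarrow> 'b \<Rightarrow> real"
  assumes "prob_space M" "prob_space M'"
    and "\<And>n. V n \<in> borel_measurable M" "A \<in> borel_measurable M"
      "\<And>n. V' n \<in> borel_measurable M'" "A' \<in> borel_measurable M'"
    and "converges_in_prob M V A" "converges_in_prob M' V' A'"
    and "eventually (\<lambda>n. \<forall>x. measure M {z\<in>space M. V n z \<le> x} = measure M' {z\<in>space M'. V' n z \<le> x}) sequentially"
  shows "measure M {z\<in>space M. A z \<le> x} = measure M' {z\<in>space M'. A' z \<le> x}"
proof (rule antisym)
  show "measure M {z\<in>space M. A z \<le> x} \<le> measure M' {z\<in>space M'. A' z \<le> x}"
    by (rule limit_in_prob_same_law_le[OF assms])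
  show "measure M' {z\<in>space M'. A' z \<le> x} \<le> measure M {z\<in>space M. A z \<le> x}"
    by (rule limit_in_prob_same_law_le[OF assms(2,1,5,6,3,4,8,7)]) (use assms(9) in \<open>auto elim: eventually_mono\<close>)
qed

section \<open>Increments of a Wiener process and its augmented filtration\<close>

locale wiener_on =
  fixes M :: "'a measure" and B :: "real \<Rightarrow> 'a \<Rightarrow> real" and t :: real
  assumes wiener: "wiener_process M {0..t} B" and t_pos: "0 < t"
begin

sublocale prob_space M
  using wiener by (simp add: wiener_process_def)

abbreviation "F \<equiv> aug_filtration M B"

lemma B_measurable[measurable]: "s \<in> {0..t} \<Longrightarrow> B s \<in> borel_measurable M"
  using wiener by (simp add: wiener_process_def)

lemma B_measurable': "0 \<le> s \<Longrightarrow> s \<le> t \<Longrightarrow> B s \<in> borel_measurable M"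
  by simp

lemma B_zero: "AE z in M. B 0 z = 0"
  using wiener by (simp add: wiener_process_def)

lemma increment_normal:
  "0 \<le> s \<Longrightarrow> s < u \<Longrightarrow> u \<le> t \<Longrightarrow>
    distributed M lborel (\<lambda>z. B u z - B s z) (normal_density 0 (sqrt (u - s)))"
  using wiener by (simp add: wiener_process_def)

lemma increments_indep:
  assumes "\<And>i. i \<le> n \<Longrightarrow> \<tau> i \<in> {0..t}" "\<And>i. i < n \<Longrightarrow> \<tau> i < \<tau> (Suc i)"
  shows "indep_vars (\<lambda>_. borel) (\<lambda>i z. B (\<tau> (Suc i)) z - B (\<tau> i) z) {..<n}"
  using wiener assms by (simp add: wiener_process_def)

lemma generator_subset:
  "{B s -` A \<inter> space M | s A. s \<in> {0..u} \<and> A \<in> sets borel} \<union> null_sets M \<subseteq> events" if "u \<le> t"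
  using that by (auto intro!: measurable_sets[OF B_measurable])

lemma generator_Pow:
  "{B s -` A \<inter> space M | s A. s \<in> {0..u} \<and> A \<in> sets borel} \<union> null_sets M \<subseteq> Pow (space M)"
  using sets.sets_into_space by auto

lemma space_F[simp]: "space (F s) = space M"
  unfolding aug_filtration_def by (rule space_measure_of[OF generator_Pow])

lemma sets_F: "sets (F s) = sigma_sets (space M) ({B r -` A \<inter> space M | r A. r \<in> {0..s} \<and> A \<in> sets borel} \<union> null_sets M)"
  unfolding aug_filtration_def by (rule sets_measure_of[OF generator_Pow])

lemma sets_F_events: "s \<le> t \<Longrightarrow> sets (F s) \<subseteq> events"
  unfolding sets_F by (rule sets.sigma_sets_subset[OF generator_subset])

lemma sets_F_mono: "r \<le> s \<Longrightarrow> sets (F r) \<subseteq> sets (F s)"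
  unfolding sets_F 
proof (rule sigma_sets_subseteq)
  assume "r \<le> s"
  then have "{0..r} \<subseteq> {0..s}" by simp
  then show "{B q -` A \<inter> space M | q A. q \<in> {0..r} \<and> A \<in> sets borel} \<union> null_sets M
     \<subseteq> {B q -` A \<inter> space M | q A. q \<in> {0..s} \<and> A \<in> sets borel} \<union> null_sets M" by blast
qed

lemma measurable_F_mono: "X \<in> borel_measurable (F r) \<Longrightarrow> r \<le> s \<Longrightarrow> X \<in> borel_measurable (F s)"
  using sets_F_mono[of r s] by (auto simp: measurable_def)

lemma measurable_F_M: "X \<in> borel_measurable (F r) \<Longrightarrow> r \<le> t \<Longrightarrow> X \<in> borel_measurable M"
  using sets_F_events[of r] by (auto simp: measurable_def)

lemma B_measurable_F: "0 \<le> r \<Longrightarrow> r \<le> s \<Longrightarrow> B r \<in> borel_measurable (F s)"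
  by (rule measurableI) (auto simp: sets_F intro!: sigma_sets.Basic)

text \<open>Increments from time \<open>0\<close> rather than values generate the past, because independence is
  assumed of increments only.\<close>

definition past :: "real set \<Rightarrow> 'a set set" where
  "past P = sigma_sets (space M) {(\<lambda>z. B r z - B 0 z) -` A \<inter> space M | r A. r \<in> P \<and> A \<in> sets borel}"

lemma past_mono: "P \<subseteq> Q \<Longrightarrow> past P \<subseteq> past Q"
  unfolding past_def by (rule sigma_sets_subseteq) auto

text \<open>On a finite grid the past is a function of increments that are jointly independent of the
  next one.\<close>

lemma past_indep_increment:
  assumes P: "finite P" "P \<subseteq> {0..s}" and s: "0 \<le> s" "s < u" "u \<le> t"
    and A: "A \<in> past P" and A2: "A2 \<in> sets borel"
  shows "prob (A \<inter> ((\<lambda>z. B u z - B s z) -` A2 \<inter> space M)) =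
    prob A * prob ((\<lambda>z. B u z - B s z) -` A2 \<inter> space M)"
proof -
  define xs where "xs = sorted_list_of_set (P \<union> {0, s})"
  have xs: "sorted_wrt (<) xs" "set xs = P \<union> {0, s}"
    using P unfolding xs_def by (simp_all only: strict_sorted_list_of_set set_sorted_list_of_set finite_Un finite.intros)
  define n where "n = length xs - 1"
  have len: "length xs = Suc n" using xs(2) by (cases xs) (auto simp: n_def)
  define \<tau> where "\<tau> i = (if i \<le> n then xs ! i else u)" for i
  have mono: "\<tau> i < \<tau> j" if "i < j" "j \<le> n" for i j
    using that xs(1) len by (auto simp: \<tau>_def sorted_wrt_iff_nth_less)
  have range: "\<tau> i \<in> {0..s}" if "i \<le> n" for i
    using that nth_mem[of i xs] len xs(2) P s by (auto simp: \<tau>_def)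
  obtain k where k: "k \<le> n" "\<tau> k = 0"
    using xs(2) len in_set_conv_nth[of 0 xs] by (auto simp: \<tau>_def less_Suc_eq_le)
  have \<tau>0: "\<tau> 0 = 0" using mono[of 0 k] k range[of 0] by (cases "k = 0") auto
  obtain k where k: "k \<le> n" "\<tau> k = s"
    using xs(2) len in_set_conv_nth[of s xs] by (auto simp: \<tau>_def less_Suc_eq_le)
  have \<tau>n: "\<tau> n = s" using mono[of k n] k range[of n] by (cases "k = n") auto
  have \<tau>Sn: "\<tau> (Suc n) = u" by (simp add: \<tau>_def)
  have inc: "\<tau> i < \<tau> (Suc i)" if "i < Suc n" for i
    using that mono[of i "Suc i"] \<tau>n \<tau>Sn s by (cases "i = n") auto
  have rng: "\<tau> i \<in> {0..t}" if "i \<le> Suc n" for i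
    using that range[of i] \<tau>Sn s by (cases "i = Suc n") auto
  let ?X = "\<lambda>i z. B (\<tau> (Suc i)) z - B (\<tau> i) z"
  have "indep_vars (\<lambda>_. borel) ?X {..<Suc n}"
    by (rule increments_indep) (use inc rng in auto)
  then have iv: "indep_var (PiM {..<n} (\<lambda>_. borel)) (\<lambda>z. restrict (\<lambda>i. ?X i z) {..<n})
      (PiM {n} (\<lambda>_. borel)) (\<lambda>z. restrict (\<lambda>i. ?X i z) {n})"
    by (rule indep_var_restrict) auto
  let ?V = "\<lambda>z. restrict (\<lambda>i. ?X i z) {..<n}"
  let ?N = "vimage_algebra (space M) ?V (PiM {..<n} (\<lambda>_. borel :: real measure))"
  have V: "?V \<in> space M \<rightarrow> space (PiM {..<n} (\<lambda>_. borel))"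
    by (rule Pi_I) (simp only: space_PiM restrict_PiE_iff, simp)
  have Xm: "?X i \<in> borel_measurable ?N" if "i < n" for i
  proof -
    have "(\<lambda>z. (\<lambda>x. x i) (?V z)) \<in> borel_measurable ?N"
      by (rule measurable_compose[OF measurable_vimage_algebra1[OF V] measurable_component_singleton])
        (use that in simp)
    then show ?thesis using that by (simp cong: measurable_cong)
  qed
  have past: "past P \<subseteq> sets ?N"
    unfolding past_def
  proof (rule sigma_algebra.sigma_sets_subset)
    show "sigma_algebra (space M) (sets ?N)"
      using sets.sigma_algebra_axioms[of ?N] by simp
    show "{(\<lambda>z. B r z - B 0 z) -` A \<inter> space M | r A. r \<in> P \<and> A \<in> sets borel} \<subseteq> sets ?N"
    proof safe
      fix r A assume r: "r \<in> P" and A: "A \<in> sets (borel :: real measure)"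
      obtain k where k: "k \<le> n" "\<tau> k = r"
        using xs(2) r len in_set_conv_nth[of r xs] by (auto simp: \<tau>_def less_Suc_eq_le)
      have eq: "B r z - B 0 z = (\<Sum>i<k. ?X i z)" for z
        using sum_lessThan_telescope[of "\<lambda>i. B (\<tau> i) z" k] k \<tau>0 by simp
      have "(\<lambda>z. \<Sum>i<k. ?X i z) \<in> borel_measurable ?N"
        by (rule borel_measurable_sum) (use Xm k in auto)
      then have "(\<lambda>z. \<Sum>i<k. ?X i z) -` A \<inter> space ?N \<in> sets ?N" using A by (rule measurable_sets)
      then show "(\<lambda>z. B r z - B 0 z) -` A \<inter> space M \<in> sets ?N" by (simp only: eq space_vimage_algebra)
    qed
  qed
  have "sets ?N = {?V -` C \<inter> space M | C. C \<in> sets (PiM {..<n} (\<lambda>_. borel))}"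
    by (rule sets_vimage_algebra2[OF V])
  with subsetD[OF past A] have "A \<in> {?V -` C \<inter> space M | C. C \<in> sets (PiM {..<n} (\<lambda>_. borel))}" by (simp only:)
  then obtain C where C: "C \<in> sets (PiM {..<n} (\<lambda>_. borel))" "A = ?V -` C \<inter> space M" by (elim CollectE exE conjE)
  let ?D = "{f \<in> space (PiM {n} (\<lambda>_. borel)). f n \<in> A2}"
  have D: "?D \<in> sets (PiM {n} (\<lambda>_. borel))"
    using measurable_sets[OF measurable_component_singleton[of n "{n}" "\<lambda>_. borel"] A2]
    by (simp add: vimage_def Int_def conj_commute)
  have D2: "(\<lambda>z. restrict (\<lambda>i. ?X i z) {n}) -` ?D \<inter> space M = (\<lambda>z. B u z - B s z) -` A2 \<inter> space M"
    unfolding space_PiM by (intro set_eqI) (simp add: \<tau>n \<tau>Sn restrict_PiE_iff conj_commute)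
  have "prob ((?V -` C \<inter> space M) \<inter> ((\<lambda>z. restrict (\<lambda>i. ?X i z) {n}) -` ?D \<inter> space M)) =
     prob (?V -` C \<inter> space M) * prob ((\<lambda>z. restrict (\<lambda>i. ?X i z) {n}) -` ?D \<inter> space M)"
    by (subst indep_varD[OF iv C(1) D, symmetric], rule arg_cong[where f=prob]) blast
  then show ?thesis unfolding D2 C(2)[symmetric] .
qed

text \<open>The events agreeing almost surely with an event of a finite past form an intersection
  stable generator: both the null sets and the initial value, which vanishes only almost surely, are
  absorbed in this way.\<close>

lemma F_indep_increment:
  assumes X: "X \<in> borel_measurable (F s)" and s: "0 \<le> s" "s < u" "u \<le> t"
  shows "indep_var borel X borel (\<lambda>z. B u z - B s z)"
proof -
  let ?D = "\<lambda>z. B u z - B s z"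
  have [measurable]: "B u \<in> borel_measurable M" "B s \<in> borel_measurable M" using s by auto
  define \<C> where "\<C> = {A \<in> events. \<exists>P A'. finite P \<and> P \<subseteq> {0..s} \<and> A' \<in> past P \<and> (AE z in M. z \<in> A \<longleftrightarrow> z \<in> A')}"
  let ?E = "{?D -` A2 \<inter> space M | A2. A2 \<in> sets borel}"
  have past_events: "past P \<subseteq> events" if "P \<subseteq> {0..s}" for P
    unfolding past_def
  proof (rule sets.sigma_sets_subset, safe)
    fix r A assume "r \<in> P" "A \<in> sets (borel :: real measure)"
    then show "(\<lambda>z. B r z - B 0 z) -` A \<inter> space M \<in> events"
      using that s by (intro measurable_sets[OF borel_measurable_diff] B_measurable) auto
  qed
  have Int: "Int_stable \<C>"
  proof (rule Int_stableI)
    fix A C assume "A \<in> \<C>" "C \<in> \<C>"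
    then obtain P Q A' C' where 1: "finite P" "P \<subseteq> {0..s}" "A' \<in> past P" "AE z in M. z \<in> A \<longleftrightarrow> z \<in> A'"
       "finite Q" "Q \<subseteq> {0..s}" "C' \<in> past Q" "AE z in M. z \<in> C \<longleftrightarrow> z \<in> C'" "A \<in> events" "C \<in> events"
      unfolding \<C>_def by blast
    have sa: "sigma_algebra (space M) (past (P \<union> Q))"
      unfolding past_def by (rule sigma_algebra_sigma_sets) auto
    have "A' \<inter> C' \<in> past (P \<union> Q)"
      using 1 past_mono[of P "P \<union> Q"] past_mono[of Q "P \<union> Q"] sigma_algebra.axioms(1)[OF sa]
      by (meson Un_upper1 Un_upper2 algebra.axioms(1) ring_of_sets.axioms(1) semiring_of_sets.Int subsetD)
    moreover have "AE z in M. z \<in> A \<inter> C \<longleftrightarrow> z \<in> A' \<inter> C'"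
      using 1(4,8) by eventually_elim auto
    ultimately show "A \<inter> C \<in> \<C>"
      unfolding \<C>_def using 1 by (auto intro!: exI[of _ "P \<union> Q"])
  qed
  have IntE: "Int_stable ?E"
  proof (rule Int_stableI, safe)
    fix A2 A3 assume "A2 \<in> sets (borel :: real measure)" "A3 \<in> sets (borel :: real measure)"
    then show "\<exists>A. ?D -` A2 \<inter> space M \<inter> (?D -` A3 \<inter> space M) = ?D -` A \<inter> space M \<and> A \<in> sets borel"
      by (intro exI[of _ "A2 \<inter> A3"]) auto
  qed
  have "indep_set \<C> ?E"
  proof (rule indep_setI)
    show "\<C> \<subseteq> events" by (auto simp: \<C>_def)
    show "?E \<subseteq> events" by auto
    fix A E assume "A \<in> \<C>" "E \<in> ?E"
    then obtain P A' A2 where 1: "finite P" "P \<subseteq> {0..s}" "A' \<in> past P" "AE z in M. z \<in> A \<longleftrightarrow> z \<in> A'" "A \<in> events"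
      "E = ?D -` A2 \<inter> space M" "A2 \<in> sets borel"
      unfolding \<C>_def by blast
    have 2: "A' \<in> events" "E \<in> events" using past_events[OF 1(2)] 1 by auto
    have "prob (A \<inter> E) = prob (A' \<inter> E)" "prob A = prob A'"
      using 1 2 by (auto intro!: measure_eq_AE)
    then show "prob (A \<inter> E) = prob A * prob E"
      using past_indep_increment[OF 1(1,2) s 1(3,7)] 1(6) by simp
  qed
  from indep_set_sigma_sets[OF this Int IntE]
  have ind: "indep_set (sigma_sets (space M) \<C>) (sigma_sets (space M) ?E)" .
  have CPow: "\<C> \<subseteq> Pow (space M)" by (auto simp: \<C>_def dest: sets.sets_into_space)
  have Fsub: "sets (F s) \<subseteq> sigma_sets (space M) \<C>"
    unfolding sets_F
  proof (rule sigma_sets_subseteq, safe)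
    fix r A assume r: "r \<in> {0..s}" and A: "A \<in> sets (borel :: real measure)"
    show "B r -` A \<inter> space M \<in> \<C>"
      unfolding \<C>_def
    proof (safe intro!: exI[of _ "{r}"] exI[of _ "(\<lambda>z. B r z - B 0 z) -` A \<inter> space M"])
      show "B r -` A \<inter> space M \<in> events" by (rule measurable_sets[OF B_measurable A]) (use r s in auto)
      show "(\<lambda>z. B r z - B 0 z) -` A \<inter> space M \<in> past {r}"
        unfolding past_def using A by (intro sigma_sets.Basic) auto
      show "AE z in M. (z \<in> B r -` A \<inter> space M) = (z \<in> (\<lambda>z. B r z - B 0 z) -` A \<inter> space M)"
        using B_zero by eventually_elim auto
    qed (use r in auto)
  next
    fix A assume A: "A \<in> null_sets M"
    have "AE z in M. z \<notin> A" using A by (rule AE_not_in)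
    then show "A \<in> \<C>"
      unfolding \<C>_def using A
      by (auto intro!: exI[of _ "{}"] simp: past_def sigma_sets.Empty)
  qed
  have XF: "{X -` A \<inter> space M | A. A \<in> sets borel} \<subseteq> sigma_sets (space M) \<C>"
    using Fsub measurable_sets[OF X] by auto
  have "indep_set (sigma_sets (space M) {X -` A \<inter> space M | A. A \<in> sets borel}) (sigma_sets (space M) ?E)"
  proof (rule indep_setI)
    have sub: "sigma_sets (space M) {X -` A \<inter> space M | A. A \<in> sets borel} \<subseteq> sigma_sets (space M) \<C>"
      by (rule sigma_sets_subseteq[THEN order_trans, OF XF]) (simp add: sigma_sets_sigma_sets_eq[OF CPow])
    show "sigma_sets (space M) {X -` A \<inter> space M | A. A \<in> sets borel} \<subseteq> events"
      using sub indep_setD_ev1[OF ind] by blast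
    show "sigma_sets (space M) ?E \<subseteq> events" using indep_setD_ev2[OF ind] .
    fix a b assume "a \<in> sigma_sets (space M) {X -` A \<inter> space M | A. A \<in> sets borel}" "b \<in> sigma_sets (space M) ?E"
    then show "prob (a \<inter> b) = prob a * prob b" using indep_setD[OF ind] sub by blast
  qed
  moreover have "X \<in> borel_measurable M" using measurable_F_M[OF X] s by simp
  ultimately show ?thesis by (simp add: indep_var_eq)
qed

lemma increment_moments:
  assumes "0 \<le> s" "s < u" "u \<le> t"
  shows "expectation (\<lambda>z. B u z - B s z) = 0" "expectation (\<lambda>z. (B u z - B s z)\<^sup>2) = u - s"
    "integrable M (\<lambda>z. (B u z - B s z)\<^sup>2)" "integrable M (\<lambda>z. B u z - B s z)"
proof -
  let ?s = "sqrt (u - s)"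
  have pos: "0 < ?s" using assms by simp
  note D = increment_normal[OF assms]
  show e: "expectation (\<lambda>z. B u z - B s z) = 0" by (rule normal_distributed_expectation[OF pos D])
  show "expectation (\<lambda>z. (B u z - B s z)\<^sup>2) = u - s"
    using normal_distributed_variance[OF pos D] e assms by simp
  show i: "integrable M (\<lambda>z. (B u z - B s z)\<^sup>2)"
    using distributed_integrable[OF D, of "\<lambda>x. x\<^sup>2"] integrable_normal_moment[OF pos, of 0 2] by simp
  show "integrable M (\<lambda>z. B u z - B s z)"
    by (rule square_integrable_imp_integrable[OF _ i]) (use assms in auto)
qed

text \<open>The next increment is independent of the past, so the expectation factorizes.\<close>

lemma increment_second_moment_conditional:
  assumes X: "X \<in> borel_measurable (F s)" and s: "0 \<le> s" "s \<le> u" "u \<le> t"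
    and c: "\<And>z. z \<in> space M \<Longrightarrow> \<bar>X z\<bar> \<le> c"
  shows "integrable M (\<lambda>z. (X z * (B u z - B s z))\<^sup>2)"
    "expectation (\<lambda>z. (X z * (B u z - B s z))\<^sup>2) = expectation (\<lambda>z. (X z)\<^sup>2) * (u - s)"
proof -
  have Xm[measurable]: "X \<in> borel_measurable M" using measurable_F_M[OF X] s by simp
  have "(X z)\<^sup>2 \<le> c\<^sup>2" if "z \<in> space M" for z using c[OF that] abs_le_square_iff[of "X z" c] by simp
  then have iX: "integrable M (\<lambda>z. (X z)\<^sup>2)" by (intro integrable_const_bound[where B="c\<^sup>2"]) auto
  show "integrable M (\<lambda>z. (X z * (B u z - B s z))\<^sup>2)"
    "expectation (\<lambda>z. (X z * (B u z - B s z))\<^sup>2) = expectation (\<lambda>z. (X z)\<^sup>2) * (u - s)"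
  proof (atomize(full), cases "s = u")
    case False
    then have su: "s < u" using s by simp
    have "indep_var borel ((\<lambda>x. x\<^sup>2) \<circ> X) borel ((\<lambda>x. x\<^sup>2) \<circ> (\<lambda>z. B u z - B s z))"
      by (rule indep_var_compose[OF F_indep_increment[OF X s(1) su s(3)]]) auto
    then have "indep_var borel (\<lambda>z. (X z)\<^sup>2) borel (\<lambda>z. (B u z - B s z)\<^sup>2)" by (simp add: comp_def)
    from indep_var_integrable[OF this iX increment_moments(3)[OF s(1) su s(3)]]
      indep_var_lebesgue_integral[OF this iX increment_moments(3)[OF s(1) su s(3)]]
    show "integrable M (\<lambda>z. (X z * (B u z - B s z))\<^sup>2) \<and>
      expectation (\<lambda>z. (X z * (B u z - B s z))\<^sup>2) = expectation (\<lambda>z. (X z)\<^sup>2) * (u - s)"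
      using increment_moments(2)[OF s(1) su s(3)] by (simp add: power_mult_distrib)
  qed simp
qed

lemma increment_mean_conditional:
  assumes X: "X \<in> borel_measurable (F s)" and s: "0 \<le> s" "s \<le> u" "u \<le> t"
    and i: "integrable M X"
  shows "integrable M (\<lambda>z. X z * (B u z - B s z))"
    "expectation (\<lambda>z. X z * (B u z - B s z)) = 0"
proof (atomize(full), cases "s = u")
  case False
  then have su: "s < u" using s by simp
  note * = F_indep_increment[OF X s(1) su s(3)]
  show "integrable M (\<lambda>z. X z * (B u z - B s z)) \<and> expectation (\<lambda>z. X z * (B u z - B s z)) = 0"
    using indep_var_integrable[OF * i increment_moments(4)[OF s(1) su s(3)]]
     indep_var_lebesgue_integral[OF * i increment_moments(4)[OF s(1) su s(3)]]
     increment_moments(1)[OF s(1) su s(3)] by simp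
qed simp

text \<open>Distinct terms are orthogonal, because the earlier increment is known when the later one
  starts. Indexing the intervals by an arbitrary finite set, instead of by their
  position in a partition, spares the enumeration of common refinements.\<close>

lemma wiener_isometry:
  assumes I: "finite I" and lu: "\<And>i. i \<in> I \<Longrightarrow> 0 \<le> l i \<and> l i \<le> u i \<and> u i \<le> t"
    and disj: "\<And>i j. i \<in> I \<Longrightarrow> j \<in> I \<Longrightarrow> i \<noteq> j \<Longrightarrow> u i \<le> l j \<or> u j \<le> l i"
    and X: "\<And>i. i \<in> I \<Longrightarrow> \<xi> i \<in> borel_measurable (F (l i))"
    and c: "\<And>i z. i \<in> I \<Longrightarrow> z \<in> space M \<Longrightarrow> \<bar>\<xi> i z\<bar> \<le> c i"
  shows "mean_square M (\<lambda>z. \<Sum>i\<in>I. \<xi> i z * (B (u i) z - B (l i) z)) =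
    ennreal (\<Sum>i\<in>I. expectation (\<lambda>z. (\<xi> i z)\<^sup>2) * (u i - l i))"
proof -
  let ?x = "\<lambda>i z. \<xi> i z * (B (u i) z - B (l i) z)"
  have xm: "?x i \<in> borel_measurable M" if "i \<in> I" for i
    using measurable_F_M[OF X[OF that]] lu[OF that] by (intro borel_measurable_times borel_measurable_diff) auto
  have sq: "integrable M (\<lambda>z. (?x i z)\<^sup>2)" "expectation (\<lambda>z. (?x i z)\<^sup>2) = expectation (\<lambda>z. (\<xi> i z)\<^sup>2) * (u i - l i)"
    if "i \<in> I" for i
    using increment_second_moment_conditional[OF X[OF that] _ _ _ c[OF that]] lu[OF that] by auto
  have cross': "integrable M (\<lambda>z. ?x i z * ?x j z) \<and> expectation (\<lambda>z. ?x i z * ?x j z) = 0"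
    if ij: "i \<in> I" "j \<in> I" "u i \<le> l j" for i j
  proof -
    have 1: "(\<lambda>z. ?x i z * \<xi> j z) \<in> borel_measurable (F (l j))"
      using measurable_F_mono[OF X[OF ij(1)], of "l j"] X[OF ij(2)] lu[OF ij(1)] lu[OF ij(2)] ij(3)
      by (intro borel_measurable_times borel_measurable_diff B_measurable_F) auto
    have 2: "integrable M (\<lambda>z. ?x i z * \<xi> j z)"
    proof (rule Bochner_Integration.integrable_bound)
      show "integrable M (\<lambda>z. c j * ?x i z)"
        using square_integrable_imp_integrable[OF xm[OF ij(1)] sq(1)[OF ij(1)]] by simp
      show "AE z in M. norm (?x i z * \<xi> j z) \<le> norm (c j * ?x i z)"
      proof (rule AE_I2)
        fix z assume "z \<in> space M"
        from c[OF ij(2) this] have "\<bar>\<xi> j z\<bar> \<le> \<bar>c j\<bar>" by linarith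
        from mult_left_mono[OF this abs_ge_zero[of "?x i z"]]
        show "norm (?x i z * \<xi> j z) \<le> norm (c j * ?x i z)" by (simp add: abs_mult ac_simps)
      qed
      show "(\<lambda>z. ?x i z * \<xi> j z) \<in> borel_measurable M"
        using measurable_F_M[OF 1] lu[OF ij(2)] by simp
    qed
    show ?thesis
      using increment_mean_conditional[OF 1 _ _ _ 2, of "u j"] lu[OF ij(2)] by (simp add: ac_simps)
  qed
  have cross: "integrable M (\<lambda>z. ?x i z * ?x j z) \<and>
      expectation (\<lambda>z. ?x i z * ?x j z) = (if j = i then expectation (\<lambda>z. (\<xi> i z)\<^sup>2) * (u i - l i) else 0)"
    if ij: "i \<in> I" "j \<in> I" for i j
  proof (cases "i = j")
    case True then show ?thesis using sq[OF ij(1)] by (simp add: power2_eq_square)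
  next
    case False
    then show ?thesis using disj[OF ij False] cross'[OF ij] cross'[OF ij(2,1)] by (auto simp: mult.commute)
  qed
  have eq: "(\<lambda>z. (\<Sum>i\<in>I. ?x i z)\<^sup>2) = (\<lambda>z. \<Sum>i\<in>I. \<Sum>j\<in>I. ?x i z * ?x j z)"
    by (simp add: power2_eq_square sum_product)
  have int: "integrable M (\<lambda>z. (\<Sum>i\<in>I. ?x i z)\<^sup>2)"
    unfolding eq using cross by (intro Bochner_Integration.integrable_sum) auto
  have "expectation (\<lambda>z. (\<Sum>i\<in>I. ?x i z)\<^sup>2) = (\<Sum>i\<in>I. \<Sum>j\<in>I. expectation (\<lambda>z. ?x i z * ?x j z))"
    unfolding eq using cross by (subst Bochner_Integration.integral_sum) (auto intro!: Bochner_Integration.integrable_sum Bochner_Integration.integral_sum sum.cong)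
  also have "... = (\<Sum>i\<in>I. expectation (\<lambda>z. (\<xi> i z)\<^sup>2) * (u i - l i))"
    using cross I by (intro sum.cong) (auto simp: sum.delta)
  finally show ?thesis
    by (subst nn_integral_eq_integral[OF int]) auto
qed

end

section \<open>Integrals of step processes\<close>

lemma strict_grid_less:
  fixes p :: "nat \<Rightarrow> 'a::order"
  assumes "\<And>i. i < n \<Longrightarrow> p i < p (Suc i)"
  shows "i < j \<Longrightarrow> j \<le> n \<Longrightarrow> p i < p j"
proof (induction j)
  case (Suc j)
  show ?case
  proof (cases "i = j")
    case False
    then have "p i < p j" using Suc by simp
    also have "p j < p (Suc j)" using assms[of j] Suc by simp
    finally show ?thesis .
  qed (use assms[of j] Suc in simp)
qed simp

lemma strict_grid_le:
  fixes p :: "nat \<Rightarrow> 'a::order"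
  assumes "\<And>i. i < n \<Longrightarrow> p i < p (Suc i)"
  shows "i \<le> j \<Longrightarrow> j \<le> n \<Longrightarrow> p i \<le> p j"
  using strict_grid_less[of n p i j] assms by (cases "i = j") auto

lemma sum_lessThan_shift_add:
  fixes f :: "nat \<Rightarrow> 'a::comm_monoid_add"
  shows "sum f {..<a + n} = sum f {..<a} + (\<Sum>k<n. f (a + k))"
  by (induction n) (auto simp: add.assoc)

text \<open>The nearest point projection onto \<open>[a, b]\<close>. Projecting the points of one grid onto the cells of
  another describes the common refinement without enumerating it.\<close>

definition project :: "real \<Rightarrow> real \<Rightarrow> real \<Rightarrow> real" where
  "project a b x = max a (min x b)"

lemma project_telescope_outer:
  fixes f :: "real \<Rightarrow> real"
  assumes "\<And>i. i < m \<Longrightarrow> g i < g (Suc i)" and "g 0 \<le> x" "x \<le> g m" "g 0 \<le> y" "y \<le> g m"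
  shows "(\<Sum>i<m. f (project (g i) (g (Suc i)) y) - f (project (g i) (g (Suc i)) x)) = f y - f x"
proof -
  have *: "(\<Sum>i<k. f (project (g i) (g (Suc i)) w) - f (g i)) = f (min w (g k)) - f (g 0)"
    if "k \<le> m" "g 0 \<le> w" for w k
    using that
  proof (induction k)
    case (Suc k)
    have "g k < g (Suc k)" using assms(1) Suc by simp
    then show ?case using Suc by (auto simp: project_def min_def max_def)
  qed auto
  have "(\<Sum>i<m. f (project (g i) (g (Suc i)) y) - f (project (g i) (g (Suc i)) x)) =
     (\<Sum>i<m. f (project (g i) (g (Suc i)) y) - f (g i)) - (\<Sum>i<m. f (project (g i) (g (Suc i)) x) - f (g i))"
    by (simp add: sum_subtractf)
  also have "... = f y - f x"
    using *[of m x] *[of m y] assms by (simp add: min_def)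
  finally show ?thesis .
qed

lemma project_telescope_inner:
  fixes f :: "real \<Rightarrow> real"
  assumes "p 0 \<le> a" "a \<le> b" "b \<le> p n"
  shows "(\<Sum>j<n. f (project a b (p (Suc j))) - f (project a b (p j))) = f b - f a"
  using assms by (subst sum_lessThan_telescope) (auto simp: project_def)

text \<open>As \<^const>\<open>simple_predictable\<close>, but with levels that may be unbounded, so that a process
  sampled along a grid qualifies.\<close>

definition adapted_step :: "(real \<Rightarrow> 'a measure) \<Rightarrow> real \<Rightarrow> 'a step_process \<Rightarrow> bool" where
  "adapted_step F t K \<longleftrightarrow> grid K 0 = 0 \<and> grid K (steps K) = t \<and>
     (\<forall>i<steps K. grid K i < grid K (Suc i)) \<and>
     (\<forall>i<steps K. level K i \<in> borel_measurable (F (grid K i)))"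

lemma simple_predictable_adapted: "simple_predictable M F t K \<Longrightarrow> adapted_step F t K"
  by (auto simp: simple_predictable_def adapted_step_def)

lemma step_value_eq:
  assumes K: "adapted_step F t K" and i: "i < steps K" and s: "grid K i < s" "s \<le> grid K (Suc i)"
  shows "step_value K s z = level K i z"
proof -
  have "level K j z * indicator {grid K j<..grid K (Suc j)} s = (if j = i then level K i z else 0)"
    if j: "j < steps K" for j
  proof (cases j i rule: linorder_cases)
    case less
    then have "grid K (Suc j) \<le> grid K i"
      using strict_grid_le[of "steps K" "grid K" "Suc j" i] K i by (auto simp: adapted_step_def)
    then show ?thesis using s less by auto
  next
    case greater
    then have "grid K (Suc i) \<le> grid K j"
      using strict_grid_le[of "steps K" "grid K" "Suc i" j] K j by (auto simp: adapted_step_def)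
    then show ?thesis using s greater by auto
  qed (use s in auto)
  then show ?thesis using i unfolding step_value_def by (simp add: sum.delta)
qed

text \<open>The intersections of the cells of two grids, indexed by pairs, form their common
  refinement; pairs with empty intersection give degenerate intervals and contribute nothing.\<close>

lemma step_integral_difference:
  assumes K: "adapted_step F t K" and R: "adapted_step F t R"
  shows "step_integral K Z z - step_integral R Z z =
    (\<Sum>(i,j)\<in>{..<steps K} \<times> {..<steps R}. (level K i z - level R j z) *
      (Z (project (grid K i) (grid K (Suc i)) (grid R (Suc j))) z - Z (project (grid K i) (grid K (Suc i)) (grid R j)) z))"
    (is "_ = (\<Sum>(i,j)\<in>?I. (level K i z - level R j z) * ?d i j)")
proof -
  have rK: "grid K i \<in> {0..t}" if "i \<le> steps K" for i
    using strict_grid_le[of "steps K" "grid K" 0 i] strict_grid_le[of "steps K" "grid K" i "steps K"] that K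
    by (auto simp: adapted_step_def)
  have rR: "grid R i \<in> {0..t}" if "i \<le> steps R" for i
    using strict_grid_le[of "steps R" "grid R" 0 i] strict_grid_le[of "steps R" "grid R" i "steps R"] that R
    by (auto simp: adapted_step_def)
  have 1: "(\<Sum>j<steps R. ?d i j) = Z (grid K (Suc i)) z - Z (grid K i) z" if "i < steps K" for i
    by (rule project_telescope_inner[where f="\<lambda>x. Z x z"]) (use that K R rK[of i] rK[of "Suc i"] in \<open>auto simp: adapted_step_def\<close>)
  have 2: "(\<Sum>i<steps K. ?d i j) = Z (grid R (Suc j)) z - Z (grid R j) z" if "j < steps R" for j
    by (rule project_telescope_outer[where f="\<lambda>x. Z x z"]) (use that K R rR[of j] rR[of "Suc j"] in \<open>auto simp: adapted_step_def\<close>)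
  have "(\<Sum>(i,j)\<in>?I. (level K i z - level R j z) * ?d i j) =
     (\<Sum>i<steps K. \<Sum>j<steps R. level K i z * ?d i j) - (\<Sum>i<steps K. \<Sum>j<steps R. level R j z * ?d i j)"
    by (simp add: sum.cartesian_product[symmetric] algebra_simps sum_subtractf sum.distrib)
  also have "(\<Sum>i<steps K. \<Sum>j<steps R. level K i z * ?d i j) = step_integral K Z z"
    unfolding step_integral_def sum_distrib_left[symmetric] using 1 by (intro sum.cong) auto
  also have "(\<Sum>i<steps K. \<Sum>j<steps R. level R j z * ?d i j) = step_integral R Z z"
    unfolding step_integral_def by (subst sum.swap, unfold sum_distrib_left[symmetric]) (use 2 in \<open>auto intro: sum.cong\<close>)
  finally show ?thesis by simp
qed

context wiener_on
begin

text \<open>The integrators of interest satisfy the isometry of the Wiener process up to a constant;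
  this form only refers to uniformly bounded levels.\<close>

definition l2_integrator :: "real \<Rightarrow> (real \<Rightarrow> 'a \<Rightarrow> real) \<Rightarrow> bool" where
  "l2_integrator c Z \<longleftrightarrow> (\<forall>s\<in>{0..t}. Z s \<in> borel_measurable M) \<and>
    (\<forall>(I :: (nat \<times> nat) set) l u \<xi> d. finite I \<longrightarrow> 0 \<le> d \<longrightarrow>
      (\<forall>i\<in>I. 0 \<le> l i \<and> l i \<le> u i \<and> u i \<le> t \<and> \<xi> i \<in> borel_measurable (F (l i)) \<and>
        (\<forall>z\<in>space M. \<bar>\<xi> i z\<bar> \<le> d) \<and> (\<forall>j\<in>I. i \<noteq> j \<longrightarrow> u i \<le> l j \<or> u j \<le> l i)) \<longrightarrow>
      mean_square M (\<lambda>z. \<Sum>i\<in>I. \<xi> i z * (Z (u i) z - Z (l i) z)) \<le> ennreal (c * d\<^sup>2 * (\<Sum>i\<in>I. u i - l i)))"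

lemma expectation_square_le:
  fixes X :: "'a \<Rightarrow> real"
  assumes [measurable]: "X \<in> borel_measurable M" and "\<And>z. z \<in> space M \<Longrightarrow> \<bar>X z\<bar> \<le> d"
  shows "expectation (\<lambda>z. (X z)\<^sup>2) \<le> d\<^sup>2"
proof -
  have *: "(X z)\<^sup>2 \<le> d\<^sup>2" if "z \<in> space M" for z
    using assms(2)[OF that] abs_le_square_iff[of "X z" d] by simp
  have "expectation (\<lambda>z. (X z)\<^sup>2) \<le> expectation (\<lambda>_. d\<^sup>2)"
    by (rule integral_mono) (use * in \<open>auto intro!: integrable_const_bound[where B="d\<^sup>2"]\<close>)
  then show ?thesis by (simp add: prob_space)
qed

lemma l2_integrator_B: "l2_integrator 1 B"
  unfolding l2_integrator_def
proof (intro conjI allI impI ballI)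
  fix I :: "(nat \<times> nat) set" and l u \<xi> and d :: real
  assume *: "finite I" "0 \<le> d"
      "\<forall>i\<in>I. 0 \<le> l i \<and> l i \<le> u i \<and> u i \<le> t \<and> \<xi> i \<in> borel_measurable (F (l i)) \<and>
        (\<forall>z\<in>space M. \<bar>\<xi> i z\<bar> \<le> d) \<and> (\<forall>j\<in>I. i \<noteq> j \<longrightarrow> u i \<le> l j \<or> u j \<le> l i)"
  have "mean_square M (\<lambda>z. \<Sum>i\<in>I. \<xi> i z * (B (u i) z - B (l i) z)) =
    ennreal (\<Sum>i\<in>I. expectation (\<lambda>z. (\<xi> i z)\<^sup>2) * (u i - l i))"
    by (rule wiener_isometry[where c="\<lambda>_. d"]) (use * in auto)
  also have "... \<le> ennreal (\<Sum>i\<in>I. d\<^sup>2 * (u i - l i))"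
  proof (intro ennreal_leI sum_mono mult_right_mono)
    fix i assume i: "i \<in> I"
    show "expectation (\<lambda>z. (\<xi> i z)\<^sup>2) \<le> d\<^sup>2"
      by (rule expectation_square_le) (use * i measurable_F_M[of "\<xi> i" "l i"] in fastforce)+
  qed (use * in auto)
  finally show "mean_square M (\<lambda>z. \<Sum>i\<in>I. \<xi> i z * (B (u i) z - B (l i) z)) \<le> ennreal (1 * d\<^sup>2 * (\<Sum>i\<in>I. u i - l i))"
    by (simp add: sum_distrib_left)
qed auto

text \<open>Clamping the levels of a difference of two step processes changes its integral only where
  the two processes are far apart, and makes its second moment small.\<close>

lemma clamped_difference:
  assumes Z: "l2_integrator c Z" and K: "adapted_step F s K" and R: "adapted_step F s R"
    and s: "0 \<le> s" "s \<le> t" and d: "0 \<le> d"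
  obtains V where "V \<in> borel_measurable M" "mean_square M V \<le> ennreal (c * d\<^sup>2 * s)"
    "\<And>z. z \<in> space M \<Longrightarrow> V z \<noteq> step_integral K Z z - step_integral R Z z \<Longrightarrow>
       \<exists>x\<in>{0<..s}. d < \<bar>step_value K x z - step_value R x z\<bar>"
proof -
  define I where "I = {..<steps K} \<times> {..<steps R}"
  define l where "l = (\<lambda>(i,j). project (grid K i) (grid K (Suc i)) (grid R j))"
  define u where "u = (\<lambda>(i,j). project (grid K i) (grid K (Suc i)) (grid R (Suc j)))"
  \<comment> \<open>Degenerate cells get level zero: their endpoint may precede the time at which the levels are known.\<close>
  define \<xi> where "\<xi> k z = (if l k = u k then 0 else max (- d) (min d (level K (fst k) z - level R (snd k) z)))" for k z
  define V where "V z = (\<Sum>k\<in>I. \<xi> k z * (Z (u k) z - Z (l k) z))" for z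
  have gK: "grid K i < grid K (Suc i)" if "i < steps K" for i using K that by (simp add: adapted_step_def)
  have gR: "grid R i < grid R (Suc i)" if "i < steps R" for i using R that by (simp add: adapted_step_def)
  have rK: "0 \<le> grid K i" "grid K i \<le> s" if "i \<le> steps K" for i
    using strict_grid_le[of "steps K" "grid K" 0 i] strict_grid_le[of "steps K" "grid K" i "steps K"] that K
    by (auto simp: adapted_step_def)
  have lu: "0 \<le> l k \<and> l k \<le> u k \<and> u k \<le> s" if "k \<in> I" for k
    using that rK[of "fst k"] rK[of "Suc (fst k)"] gR[of "snd k"]
    by (auto simp: I_def l_def u_def project_def max_def min_def split: prod.splits)
  have disj: "u k \<le> l k' \<or> u k' \<le> l k" if k: "k \<in> I" "k' \<in> I" "k \<noteq> k'" for k k'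
  proof -
    obtain i j i' j' where eq: "k = (i,j)" "k' = (i',j')" by (cases k, cases k') auto
    have ij: "i < steps K" "j < steps R" "i' < steps K" "j' < steps R" using k eq by (auto simp: I_def)
    consider "i < i'" | "i' < i" | "i = i'" "j < j'" | "i = i'" "j' < j" using k(3) eq by fastforce
    then show ?thesis
    proof cases
      case 1
      then have "grid K (Suc i) \<le> grid K i'" using strict_grid_le[of "steps K" "grid K" "Suc i" i'] gK ij by auto
      then show ?thesis using gK[OF ij(1)] by (auto simp: eq l_def u_def project_def)
    next
      case 2
      then have "grid K (Suc i') \<le> grid K i" using strict_grid_le[of "steps K" "grid K" "Suc i'" i] gK ij by auto
      then show ?thesis using gK[OF ij(3)] by (auto simp: eq l_def u_def project_def)
    next
      case 3
      then have "grid R (Suc j) \<le> grid R j'" using strict_grid_le[of "steps R" "grid R" "Suc j" j'] gR ij by auto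
      then show ?thesis using 3 by (auto simp: eq l_def u_def project_def)
    next
      case 4
      then have "grid R (Suc j') \<le> grid R j" using strict_grid_le[of "steps R" "grid R" "Suc j'" j] gR ij by auto
      then show ?thesis using 4 by (auto simp: eq l_def u_def project_def)
    qed
  qed
  have nondeg: "grid K (fst k) \<le> l k \<and> grid R (snd k) \<le> l k \<and>
      u k \<le> grid K (Suc (fst k)) \<and> u k \<le> grid R (Suc (snd k))" if "k \<in> I" "l k \<noteq> u k" for k
    using that gK[of "fst k"] gR[of "snd k"]
    by (auto simp: I_def l_def u_def project_def max_def min_def split: prod.splits if_splits)
  have \<xi>F: "\<xi> k \<in> borel_measurable (F (l k))" if k: "k \<in> I" for k
  proof (cases "l k = u k")
    case False
    note n = nondeg[OF k False]
    have "fst k < steps K" "snd k < steps R" using k by (auto simp: I_def)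
    then have "level K (fst k) \<in> borel_measurable (F (grid K (fst k)))" "level R (snd k) \<in> borel_measurable (F (grid R (snd k)))"
      using K R by (auto simp: adapted_step_def)
    then have "level K (fst k) \<in> borel_measurable (F (l k))" "level R (snd k) \<in> borel_measurable (F (l k))"
      using n by (blast intro: measurable_F_mono)+
    then show ?thesis unfolding \<xi>_def using False by simp
  next
    case True
    then have "\<xi> k = (\<lambda>_. 0)" by (simp add: \<xi>_def fun_eq_iff)
    then show ?thesis by simp
  qed
  have Zm: "Z x \<in> borel_measurable M" if "0 \<le> x" "x \<le> t" for x
    using Z that by (auto simp: l2_integrator_def)
  show ?thesis
  proof (rule that[of V])
    show "V \<in> borel_measurable M"
      unfolding V_def
    proof (intro borel_measurable_sum borel_measurable_times borel_measurable_diff)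
      fix k assume k: "k \<in> I"
      show "\<xi> k \<in> borel_measurable M" by (rule measurable_F_M[OF \<xi>F[OF k]]) (use lu[OF k] s in auto)
      show "Z (u k) \<in> borel_measurable M" "Z (l k) \<in> borel_measurable M"
        using lu[OF k] s by (auto intro!: Zm)
    qed
    \<comment> \<open>The total length of the cells is the integral of one, computed over the common refinement.\<close>
    have "(\<Sum>k\<in>I. u k - l k) = s"
    proof -
      let ?K = "\<lparr>steps = steps K, grid = grid K, level = \<lambda>_ _. 1 :: real\<rparr> :: 'a step_process"
      let ?R = "\<lparr>steps = steps R, grid = grid R, level = \<lambda>_ _. 0 :: real\<rparr> :: 'a step_process"
      have a: "adapted_step F s ?K" "adapted_step F s ?R" using K R by (auto simp: adapted_step_def)
      have "step_integral ?K (\<lambda>x _. x) undefined = s"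
        using K by (simp add: step_integral_def sum_lessThan_telescope adapted_step_def)
      then show ?thesis using step_integral_difference[OF a, of "\<lambda>x _. x" undefined]
        by (simp add: I_def u_def l_def step_integral_def[of ?R] split_def)
    qed
    moreover have "mean_square M V \<le> ennreal (c * d\<^sup>2 * (\<Sum>k\<in>I. u k - l k))"
    proof -
      have "finite I" by (simp add: I_def)
      moreover have "\<forall>i\<in>I. 0 \<le> l i \<and> l i \<le> u i \<and> u i \<le> t \<and> \<xi> i \<in> borel_measurable (F (l i)) \<and>
        (\<forall>z\<in>space M. \<bar>\<xi> i z\<bar> \<le> d) \<and> (\<forall>j\<in>I. i \<noteq> j \<longrightarrow> u i \<le> l j \<or> u j \<le> l i)"
      proof (intro ballI conjI impI)
        fix i z assume "i \<in> I" show "\<bar>\<xi> i z\<bar> \<le> d" using d by (auto simp: \<xi>_def)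
      next
        fix i j assume "i \<in> I" "j \<in> I" "i \<noteq> j" then show "u i \<le> l j \<or> u j \<le> l i" by (rule disj)
      qed (use lu s \<xi>F in \<open>force+\<close>)
      ultimately show ?thesis using Z d unfolding l2_integrator_def V_def by blast
    qed
    ultimately show "mean_square M V \<le> ennreal (c * d\<^sup>2 * s)" by simp
    fix z assume w: "z \<in> space M" and ne: "V z \<noteq> step_integral K Z z - step_integral R Z z"
    show "\<exists>x\<in>{0<..s}. d < \<bar>step_value K x z - step_value R x z\<bar>"
    proof (rule ccontr)
      assume small: "\<not> ?thesis"
      have "\<xi> k z * (Z (u k) z - Z (l k) z) = (level K (fst k) z - level R (snd k) z) * (Z (u k) z - Z (l k) z)"
        if k: "k \<in> I" for k
      proof (cases "l k = u k")
        case False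
        then have lt: "l k < u k" using lu[OF k] by auto
        have "step_value K (u k) z = level K (fst k) z"
          by (rule step_value_eq[OF K]) (use nondeg[OF k False] lt k in \<open>auto simp: I_def\<close>)
        moreover have "step_value R (u k) z = level R (snd k) z"
          by (rule step_value_eq[OF R]) (use nondeg[OF k False] lt k in \<open>auto simp: I_def\<close>)
        moreover have "u k \<in> {0<..s}" using lt lu[OF k] by auto
        ultimately have "\<bar>level K (fst k) z - level R (snd k) z\<bar> \<le> d" using small by force
        then have "\<xi> k z = level K (fst k) z - level R (snd k) z" using False by (auto simp: \<xi>_def)
        then show ?thesis by simp
      qed simp
      then have "V z = step_integral K Z z - step_integral R Z z"
        unfolding V_def step_integral_difference[OF K R]
        by (auto simp: I_def[symmetric] l_def u_def split_def intro!: sum.cong)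
      with ne show False by simp
    qed
  qed
qed

definition far :: "'a step_process \<Rightarrow> (real \<Rightarrow> 'a \<Rightarrow> real) \<Rightarrow> real \<Rightarrow> real \<Rightarrow> 'a set" where
  "far K H s \<epsilon> = {z \<in> space M. \<exists>x\<in>{0<..s}. \<epsilon> < \<bar>step_value K x z - H x z\<bar>}"

text \<open>By continuity of the paths, an uncountable supremum reduces to one over
  rational times and grid points.\<close>

lemma far_measurable:
  assumes K: "adapted_step F s K" and s: "0 \<le> s" "s \<le> t"
    and H: "\<And>x. x \<in> {0..s} \<Longrightarrow> H x \<in> borel_measurable M"
    and cont: "\<And>z. z \<in> space M \<Longrightarrow> continuous_on {0..s} (\<lambda>x. H x z)"
  shows "far K H s \<epsilon> \<in> events"
proof -
  let ?g = "grid K"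
  have gK: "?g i < ?g (Suc i)" if "i < steps K" for i using K that by (simp add: adapted_step_def)
  have rK: "0 \<le> ?g i" "?g i \<le> s" if "i \<le> steps K" for i
    using strict_grid_le[of "steps K" "grid K" 0 i] strict_grid_le[of "steps K" "grid K" i "steps K"] that K
    by (auto simp: adapted_step_def)
  let ?Q = "\<lambda>i. (\<rat> \<inter> {?g i<..<?g (Suc i)}) \<union> {?g (Suc i)}"
  have cells: "\<exists>i<steps K. ?g i < x \<and> x \<le> ?g (Suc i)" if "0 < x" "x \<le> s" for x
  proof -
    let ?i = "LEAST i. x \<le> ?g i"
    have ex: "x \<le> ?g (steps K)" using that K by (simp add: adapted_step_def)
    have 1: "x \<le> ?g ?i" by (rule LeastI[of _ "steps K"]) (rule ex)
    have 2: "?i \<le> steps K" by (rule Least_le) (rule ex)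
    have "?i \<noteq> 0" using 1 that K by (metis adapted_step_def not_le)
    then obtain j where j: "?i = Suc j" by (cases ?i) auto
    have "\<not> x \<le> ?g j" by (rule not_less_Least) (simp add: j)
    then show ?thesis using 1 2 j by (auto intro!: exI[of _ j])
  qed
  have eq: "far K H s \<epsilon> = (\<Union>i<steps K. \<Union>x\<in>?Q i. {z \<in> space M. \<epsilon> < \<bar>level K i z - H x z\<bar>})"
  proof (intro subset_antisym subsetI)
    fix z assume "z \<in> far K H s \<epsilon>"
    then obtain x where w: "z \<in> space M" and x: "0 < x" "x \<le> s" "\<epsilon> < \<bar>step_value K x z - H x z\<bar>"
      by (auto simp: far_def)
    obtain i where i: "i < steps K" "?g i < x" "x \<le> ?g (Suc i)" using cells[OF x(1,2)] by blast
    have x3: "\<epsilon> < \<bar>level K i z - H x z\<bar>" using x(3) step_value_eq[OF K i] by simp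
    have "\<exists>q\<in>?Q i. \<epsilon> < \<bar>level K i z - H q z\<bar>"
    proof (cases "x = ?g (Suc i)")
      case False
      have "isCont (\<lambda>x. H x z) x"
        by (rule continuous_on_interior[OF cont[OF w]]) (use i False rK[of i] rK[of "Suc i"] in \<open>auto simp: interior_atLeastAtMost_real\<close>)
      then have "isCont (\<lambda>x. \<bar>level K i z - H x z\<bar>) x" by (intro continuous_intros)
      then have "eventually (\<lambda>q. \<epsilon> < \<bar>level K i z - H q z\<bar>) (at x)"
        using x3 unfolding isCont_def by (rule order_tendstoD)
      moreover have "eventually (\<lambda>q. q \<in> {?g i<..<?g (Suc i)}) (at x)"
        using i False by (intro eventually_at_in_open') auto
      ultimately have "eventually (\<lambda>q. \<epsilon> < \<bar>level K i z - H q z\<bar> \<and> q \<in> {?g i<..<?g (Suc i)}) (at x)"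
        by eventually_elim auto
      then obtain e where e: "0 < e" "\<And>q. q \<noteq> x \<Longrightarrow> dist q x < e \<Longrightarrow> \<epsilon> < \<bar>level K i z - H q z\<bar> \<and> q \<in> {?g i<..<?g (Suc i)}"
        unfolding eventually_at by auto
      obtain q where "q \<in> \<rat>" "x < q" "q < x + e" using Rats_dense_in_real[of x "x + e"] e by auto
      then show ?thesis using e(2)[of q] by (intro bexI[of _ q]) (auto simp: dist_real_def)
    qed (use x3 in auto)
    then show "z \<in> (\<Union>i<steps K. \<Union>x\<in>?Q i. {z \<in> space M. \<epsilon> < \<bar>level K i z - H x z\<bar>})" using i w by auto
  next
    fix z assume "z \<in> (\<Union>i<steps K. \<Union>x\<in>?Q i. {z \<in> space M. \<epsilon> < \<bar>level K i z - H x z\<bar>})"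
    then obtain i q where *: "i < steps K" "q \<in> ?Q i" "z \<in> space M" "\<epsilon> < \<bar>level K i z - H q z\<bar>" by blast
    have q: "?g i < q" "q \<le> ?g (Suc i)" using *(2) gK[OF *(1)] by auto
    then show "z \<in> far K H s \<epsilon>"
      using * step_value_eq[OF K *(1) q] rK[of i] rK[of "Suc i"] unfolding far_def
      by (auto intro!: bexI[of _ q])
  qed
  have "countable (?Q i)" for i by (intro countable_Un countable_Int1 countable_rat) auto
  moreover have "{z \<in> space M. \<epsilon> < \<bar>level K i z - H x z\<bar>} \<in> events"
    if i: "i \<in> {..<steps K}" and x: "x \<in> ?Q i" for i x
  proof -
    have [measurable]: "level K i \<in> borel_measurable M"
      using K i rK[of i] s by (auto simp: adapted_step_def intro!: measurable_F_M[of _ "?g i"])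
    have [measurable]: "H x \<in> borel_measurable M"
      using x i rK[of i] rK[of "Suc i"] by (intro H) auto
    show ?thesis by measurable
  qed
  ultimately show ?thesis
    unfolding eq by (intro sets.finite_UN ballI sets.countable_UN'') auto
qed

lemma step_integral_measurable:
  assumes K: "adapted_step F s K" and s: "0 \<le> s" "s \<le> t" and Z: "\<And>x. x \<in> {0..s} \<Longrightarrow> Z x \<in> borel_measurable M"
  shows "step_integral K Z \<in> borel_measurable M"
proof -
  have rK: "0 \<le> grid K i" "grid K i \<le> s" if "i \<le> steps K" for i
    using strict_grid_le[of "steps K" "grid K" 0 i] strict_grid_le[of "steps K" "grid K" i "steps K"] that K
    by (auto simp: adapted_step_def)
  have "level K i \<in> borel_measurable M" if "i < steps K" for i
    using K that rK[of i] s by (auto simp: adapted_step_def intro!: measurable_F_M[of _ "grid K i"])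
  then show ?thesis
    unfolding step_integral_def[abs_def]
    by (intro borel_measurable_sum borel_measurable_times borel_measurable_diff Z) (auto simp: rK)
qed

text \<open>Any adapted step processes approximating the integrand uniformly in probability can be
  used to compute the integral, not only bounded ones.\<close>

lemma stochastic_integral_step_limit:
  assumes Z: "l2_integrator c Z" and c: "0 \<le> c" and I: "has_stochastic_integral M F Z H s I" and s: "0 \<le> s" "s \<le> t"
    and R: "\<And>m. adapted_step F s (R m)" and lim: "\<And>\<epsilon>. 0 < \<epsilon> \<Longrightarrow> (\<lambda>m. prob (far (R m) H s \<epsilon>)) \<longlonglongrightarrow> 0"
  shows "converges_in_prob M (\<lambda>m. step_integral (R m) Z) I"
  unfolding converges_in_prob_def
proof (intro allI impI)
  fix q :: real assume q: "0 < q"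
  from I obtain K where K: "\<And>n. simple_predictable M F s (K n)"
    and farK: "\<And>\<epsilon>. 0 < \<epsilon> \<Longrightarrow> (\<lambda>n. prob (far (K n) H s \<epsilon>)) \<longlonglongrightarrow> 0"
    and limK: "\<And>\<epsilon>. 0 < \<epsilon> \<Longrightarrow> (\<lambda>n. prob {z\<in>space M. \<epsilon> < \<bar>step_integral (K n) Z z - I z\<bar>}) \<longlonglongrightarrow> 0"
    and Hm: "\<And>x. x \<in> {0..s} \<Longrightarrow> H x \<in> borel_measurable (F x)"
    and Hc: "\<And>z. z \<in> space M \<Longrightarrow> continuous_on {0..s} (\<lambda>x. H x z)"
    and [measurable]: "I \<in> borel_measurable M"
    unfolding has_stochastic_integral_def far_def by blast
  note Ka = simple_predictable_adapted[OF K]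
  have Hm': "H x \<in> borel_measurable M" if "x \<in> {0..s}" for x
    using measurable_F_M[OF Hm[OF that]] that s by simp
  have Zm: "Z x \<in> borel_measurable M" if "x \<in> {0..s}" for x
    using Z that s by (auto simp: l2_integrator_def)
  have [measurable]: "step_integral (R m) Z \<in> borel_measurable M" for m
    by (rule step_integral_measurable[OF R s Zm])
  have [measurable]: "step_integral (K m) Z \<in> borel_measurable M" for m
    by (rule step_integral_measurable[OF Ka s Zm])
  have [measurable]: "far (R m) H s \<epsilon> \<in> events" for m \<epsilon>
    by (rule far_measurable[OF R s Hm' Hc])
  have [measurable]: "far (K m) H s \<epsilon> \<in> events" for m \<epsilon>
    by (rule far_measurable[OF Ka s Hm' Hc])
  let ?P = "\<lambda>m. prob {z\<in>space M. q < \<bar>step_integral (R m) Z z - I z\<bar>}"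
  have main: "?P m \<le> prob {z\<in>space M. q/2 < \<bar>step_integral (K m) Z z - I z\<bar>} +
      (prob (far (K m) H s d) + (prob (far (R m) H s d) + c * (2 * d)\<^sup>2 * s / (q/2)\<^sup>2))" if d: "0 < d" for m d
  proof -
    obtain V where V[measurable]: "V \<in> borel_measurable M" and V2: "mean_square M V \<le> ennreal (c * (2 * d)\<^sup>2 * s)"
      and V3: "\<And>z. z \<in> space M \<Longrightarrow> V z \<noteq> step_integral (K m) Z z - step_integral (R m) Z z \<Longrightarrow>
       \<exists>x\<in>{0<..s}. 2 * d < \<bar>step_value (K m) x z - step_value (R m) x z\<bar>"
      using clamped_difference[OF Z Ka R s, of "2 * d" m m] d by auto
    have "?P m \<le> prob {z\<in>space M. q/2 < \<bar>step_integral (K m) Z z - I z\<bar>} +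
       prob (far (K m) H s d \<union> (far (R m) H s d \<union> {z\<in>space M. q/2 < \<bar>V z\<bar>}))"
    proof (rule prob_le_add)
      show "{z \<in> space M. q < \<bar>step_integral (R m) Z z - I z\<bar>} \<subseteq> {z\<in>space M. q/2 < \<bar>step_integral (K m) Z z - I z\<bar>} \<union>
        (far (K m) H s d \<union> (far (R m) H s d \<union> {z\<in>space M. q/2 < \<bar>V z\<bar>}))" (is "_ \<subseteq> ?rhs")
      proof
        fix z assume w: "z \<in> {z \<in> space M. q < \<bar>step_integral (R m) Z z - I z\<bar>}"
        show "z \<in> ?rhs"
        proof (cases "V z = step_integral (K m) Z z - step_integral (R m) Z z")
          case True
          have "\<bar>step_integral (R m) Z z - I z\<bar> \<le> \<bar>step_integral (K m) Z z - I z\<bar> + \<bar>V z\<bar>"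
            unfolding True by linarith
          then have "q/2 < \<bar>step_integral (K m) Z z - I z\<bar> \<or> q/2 < \<bar>V z\<bar>" using w by auto
          then show ?thesis using w by auto
        next
          case False
          then obtain x where x: "x \<in> {0<..s}" "2 * d < \<bar>step_value (K m) x z - step_value (R m) x z\<bar>"
            using V3[of z] w by auto
          then have "d < \<bar>step_value (K m) x z - H x z\<bar> \<or> d < \<bar>step_value (R m) x z - H x z\<bar>" by linarith
          then show ?thesis using x w unfolding far_def by blast
        qed
      qed
    qed measurable
    also have "prob (far (K m) H s d \<union> (far (R m) H s d \<union> {z\<in>space M. q/2 < \<bar>V z\<bar>})) \<le>
        prob (far (K m) H s d) + prob (far (R m) H s d \<union> {z\<in>space M. q/2 < \<bar>V z\<bar>})"
      by (rule prob_le_add) auto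
    also have "prob (far (R m) H s d \<union> {z\<in>space M. q/2 < \<bar>V z\<bar>}) \<le> prob (far (R m) H s d) + prob {z\<in>space M. q/2 < \<bar>V z\<bar>}"
      by (rule prob_le_add) auto
    also have "prob {z\<in>space M. q/2 < \<bar>V z\<bar>} \<le> c * (2 * d)\<^sup>2 * s / (q/2)\<^sup>2"
      by (rule prob_tail_L2) (use q c s V2 in auto)
    finally show ?thesis by (simp add: algebra_simps)
  qed
  show "?P \<longlonglongrightarrow> 0"
  proof (rule LIMSEQ_I)
    fix r :: real assume r: "0 < r"
    \<comment> \<open>Makes the Chebyshev term at most \<open>r/2 * (c s / (c s + 1))\<close>, which is below \<open>r/2\<close> even if \<open>c s = 0\<close>.\<close>
    define d where "d = sqrt (r / 2 / (16 * (c * s + 1))) * q"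
    have cs: "0 \<le> c * s" using c s by simp
    have d: "0 < d" using r q cs by (auto simp: d_def)
    have "d\<^sup>2 = r / 2 / (16 * (c * s + 1)) * q\<^sup>2" using r cs by (simp add: d_def power_mult_distrib)
    then have d2: "d\<^sup>2 / q\<^sup>2 = r / 2 / (16 * (c * s + 1))" using q by simp
    have *: "16 * y * (r / 2 / (16 * (y + 1))) = r/2 * (y / (y + 1))" if "0 \<le> y" for y :: real
      using that by (simp add: divide_simps)
    have "c * (2 * d)\<^sup>2 * s / (q/2)\<^sup>2 = 16 * (c * s) * (d\<^sup>2 / q\<^sup>2)"
      by (simp add: power_mult_distrib power_divide)
    also have "... = r/2 * ((c * s) / (c * s + 1))" unfolding d2 using *[OF cs] .
    also have "... < r/2 * 1" using cs r by (intro mult_strict_left_mono) (auto simp: divide_simps)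
    finally have small: "c * (2 * d)\<^sup>2 * s / (q/2)\<^sup>2 < r/2" by simp
    have "(\<lambda>m. prob {z\<in>space M. q/2 < \<bar>step_integral (K m) Z z - I z\<bar>} +
      (prob (far (K m) H s d) + (prob (far (R m) H s d) + c * (2 * d)\<^sup>2 * s / (q/2)\<^sup>2))) \<longlonglongrightarrow>
      0 + (0 + (0 + c * (2 * d)\<^sup>2 * s / (q/2)\<^sup>2))"
      using q d by (intro tendsto_add limK farK lim tendsto_const) auto
    from order_tendstoD(2)[OF this, of r] small r
    have "eventually (\<lambda>m. prob {z\<in>space M. q/2 < \<bar>step_integral (K m) Z z - I z\<bar>} +
      (prob (far (K m) H s d) + (prob (far (R m) H s d) + c * (2 * d)\<^sup>2 * s / (q/2)\<^sup>2)) < r) sequentially" by simp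
    then have "eventually (\<lambda>m. norm (?P m - 0) < r) sequentially"
      by eventually_elim (use main[OF d] in \<open>fastforce intro: order_le_less_trans\<close>)
    then show "\<exists>N. \<forall>m\<ge>N. norm (?P m - 0) < r" by (simp add: eventually_sequentially)
  qed
qed

abbreviation B_sum :: "(real \<Rightarrow> real) \<Rightarrow> (nat \<Rightarrow> real) \<Rightarrow> nat \<Rightarrow> 'a \<Rightarrow> real" where
  "B_sum f p n z \<equiv> \<Sum>i<n. f (p i) * (B (p (Suc i)) z - B (p i) z)"

text \<open>For a deterministic integrand the step functions of fine partitions are uniformly close to
  it, so that the clamped differences converge to the difference itself and Fatou's lemma bounds its
  second moment.\<close>

lemma deterministic_integral_Riemann_bound:
  assumes I: "has_stochastic_integral M F B (\<lambda>x _. \<sigma> x) s I" and s: "0 \<le> s" "s \<le> t"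
    and p: "p 0 = 0" "p n = s" "\<And>i. i < n \<Longrightarrow> p i < p (Suc i)"
    and w: "0 < w" "\<And>i x. i < n \<Longrightarrow> p i \<le> x \<Longrightarrow> x \<le> p (Suc i) \<Longrightarrow> \<bar>\<sigma> (p i) - \<sigma> x\<bar> \<le> w"
  shows "mean_square M (\<lambda>z. I z - B_sum \<sigma> p n z) \<le> ennreal ((2 * w)\<^sup>2 * s)"
proof -
  from I obtain K where K: "\<And>n. simple_predictable M F s (K n)"
    and farK: "\<And>\<epsilon>. 0 < \<epsilon> \<Longrightarrow> (\<lambda>n. prob (far (K n) (\<lambda>x _. \<sigma> x) s \<epsilon>)) \<longlonglongrightarrow> 0"
    and limK: "\<And>\<epsilon>. 0 < \<epsilon> \<Longrightarrow> (\<lambda>n. prob {z\<in>space M. \<epsilon> < \<bar>step_integral (K n) B z - I z\<bar>}) \<longlonglongrightarrow> 0"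
    and Hc: "\<And>z. z \<in> space M \<Longrightarrow> continuous_on {0..s} (\<lambda>x. \<sigma> x)"
    and [measurable]: "I \<in> borel_measurable M"
    unfolding has_stochastic_integral_def far_def by blast
  note Ka = simple_predictable_adapted[OF K]
  define R :: "'a step_process" where "R = \<lparr>steps = n, grid = p, level = \<lambda>i _. \<sigma> (p i)\<rparr>"
  have R: "adapted_step F s R" using p by (simp add: adapted_step_def R_def)
  have Rint: "step_integral R B z = B_sum \<sigma> p n z" for z
    by (simp add: step_integral_def R_def)
  have Bm: "B x \<in> borel_measurable M" if "x \<in> {0..s}" for x using that s by simp
  have [measurable]: "step_integral R B \<in> borel_measurable M"
    by (rule step_integral_measurable[OF R s Bm])
  have [measurable]: "step_integral (K m) B \<in> borel_measurable M" for m
    by (rule step_integral_measurable[OF Ka s Bm])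
  have [measurable]: "far (K m) (\<lambda>x _. \<sigma> x) s \<epsilon> \<in> events" for m \<epsilon>
    by (rule far_measurable[OF Ka s _ Hc]) auto
  have close: "\<bar>step_value R x z - \<sigma> x\<bar> \<le> w" if x: "0 < x" "x \<le> s" for x z
  proof -
    let ?i = "LEAST i. x \<le> p i"
    have 1: "x \<le> p ?i" by (rule LeastI[of _ n]) (use x p in simp)
    have 2: "?i \<le> n" by (rule Least_le) (use x p in simp)
    have "?i \<noteq> 0" using 1 x p by (metis not_le)
    then obtain j where j: "?i = Suc j" by (cases ?i) auto
    have "\<not> x \<le> p j" by (rule not_less_Least) (simp add: j)
    then show ?thesis using 1 2 j w(2)[of j x] step_value_eq[OF R, of j x z] by (simp add: R_def)
  qed
  have "\<exists>V. V \<in> borel_measurable M \<and> mean_square M V \<le> ennreal (1 * (2 * w)\<^sup>2 * s) \<and>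
    (\<forall>z\<in>space M. V z \<noteq> step_integral (K m) B z - step_integral R B z \<longrightarrow>
       (\<exists>x\<in>{0<..s}. 2 * w < \<bar>step_value (K m) x z - step_value R x z\<bar>))" for m
    using clamped_difference[OF l2_integrator_B Ka[of m] R s, of "2 * w"] w(1) by (metis less_imp_le mult_pos_pos zero_less_numeral)
  then obtain V where V[measurable]: "\<And>m. V m \<in> borel_measurable M"
    and V2: "\<And>m. mean_square M (V m) \<le> ennreal (1 * (2 * w)\<^sup>2 * s)"
    and V3: "\<And>m z. z \<in> space M \<Longrightarrow> V m z \<noteq> step_integral (K m) B z - step_integral R B z \<Longrightarrow>
       \<exists>x\<in>{0<..s}. 2 * w < \<bar>step_value (K m) x z - step_value R x z\<bar>"
    by metis
  have "converges_in_prob M V (\<lambda>z. I z - step_integral R B z)"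
    unfolding converges_in_prob_def
  proof (intro allI impI)
    fix \<epsilon> :: real assume e: "0 < \<epsilon>"
    let ?h = "\<lambda>m. prob {z\<in>space M. \<epsilon> < \<bar>step_integral (K m) B z - I z\<bar>} + prob (far (K m) (\<lambda>x _. \<sigma> x) s w)"
    show "(\<lambda>m. prob {z \<in> space M. \<epsilon> < \<bar>V m z - (I z - step_integral R B z)\<bar>}) \<longlonglongrightarrow> 0"
    proof (rule tendsto_sandwich[where f="\<lambda>_. 0" and h="?h"])
      show "?h \<longlonglongrightarrow> 0" using tendsto_add[OF limK[OF e] farK[OF w(1)]] by simp
      have "prob {z \<in> space M. \<epsilon> < \<bar>V m z - (I z - step_integral R B z)\<bar>} \<le> ?h m" for m
      proof (rule prob_le_add)
        show "{z \<in> space M. \<epsilon> < \<bar>V m z - (I z - step_integral R B z)\<bar>} \<subseteq>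
           {z\<in>space M. \<epsilon> < \<bar>step_integral (K m) B z - I z\<bar>} \<union> far (K m) (\<lambda>x _. \<sigma> x) s w"
        proof
          fix z assume a: "z \<in> {z \<in> space M. \<epsilon> < \<bar>V m z - (I z - step_integral R B z)\<bar>}"
          show "z \<in> {z\<in>space M. \<epsilon> < \<bar>step_integral (K m) B z - I z\<bar>} \<union> far (K m) (\<lambda>x _. \<sigma> x) s w"
          proof (cases "V m z = step_integral (K m) B z - step_integral R B z")
            case True
            then show ?thesis using a by auto
          next
            case False
            then obtain x where x: "x \<in> {0<..s}" "2 * w < \<bar>step_value (K m) x z - step_value R x z\<bar>"
              using V3[of z m] a by auto
            then have "w < \<bar>step_value (K m) x z - \<sigma> x\<bar>" using close[of x z] by auto
            then show ?thesis using x a unfolding far_def by blast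
          qed
        qed
      qed measurable
      then show "eventually (\<lambda>m. prob {z \<in> space M. \<epsilon> < \<bar>V m z - (I z - step_integral R B z)\<bar>} \<le> ?h m) sequentially" by simp
    qed auto
  qed
  then have "mean_square M (\<lambda>z. I z - step_integral R B z) \<le> ennreal (1 * (2 * w)\<^sup>2 * s)"
    by (rule converges_in_prob_Fatou[rotated 2]) (use V2 in auto)
  then show ?thesis by (simp add: Rint)
qed

end

section \<open>Wiener integrals and their isometry\<close>

context prob_space
begin

lemma converges_in_prob_L2_eventually:
  assumes [measurable]: "\<And>n. V n \<in> borel_measurable M" "A \<in> borel_measurable M"
    and b: "\<And>\<epsilon>. 0 < \<epsilon> \<Longrightarrow> eventually (\<lambda>n. mean_square M (\<lambda>z. V n z - A z) \<le> ennreal \<epsilon>) sequentially"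
  shows "converges_in_prob M V A"
  unfolding converges_in_prob_def
proof (intro allI impI LIMSEQ_I)
  fix \<epsilon> r :: real assume e: "0 < \<epsilon>" and r: "0 < r"
  have "0 < r / 2 * \<epsilon>\<^sup>2" using e r by simp
  from b[OF this] have "eventually (\<lambda>n. norm (prob {z \<in> space M. \<epsilon> < \<bar>V n z - A z\<bar>} - 0) < r) sequentially"
  proof eventually_elim
    case (elim n)
    have "prob {z \<in> space M. \<epsilon> < \<bar>V n z - A z\<bar>} \<le> r / 2 * \<epsilon>\<^sup>2 / \<epsilon>\<^sup>2"
      by (rule prob_tail_L2) (use elim e r in auto)
    also have "... < r" using e r by simp
    finally show ?case by simp
  qed
  then show "\<exists>N. \<forall>n\<ge>N. norm (prob {z \<in> space M. \<epsilon> < \<bar>V n z - A z\<bar>} - 0) < r"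
    by (simp add: eventually_sequentially)
qed

lemma L2_add_le:
  assumes [measurable]: "X \<in> borel_measurable M" "Y \<in> borel_measurable M"
    and "mean_square M X \<le> ennreal a" "mean_square M Y \<le> ennreal b"
    and "0 \<le> a" "0 \<le> b" and Z: "\<And>z. z \<in> space M \<Longrightarrow> \<bar>Z z\<bar> \<le> \<bar>X z\<bar> + \<bar>Y z\<bar>"
  shows "mean_square M Z \<le> ennreal (2 * a + 2 * b)"
proof -
  have "mean_square M Z \<le> (\<integral>\<^sup>+z. ennreal 2 * ennreal ((X z)\<^sup>2) + ennreal 2 * ennreal ((Y z)\<^sup>2) \<partial>M)"
  proof (rule nn_integral_mono)
    fix z assume w: "z \<in> space M"
    have "(Z z)\<^sup>2 \<le> (\<bar>X z\<bar> + \<bar>Y z\<bar>)\<^sup>2" using Z[OF w] by (metis abs_ge_zero power2_abs power_mono)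
    also have "... \<le> 2 * (X z)\<^sup>2 + 2 * (Y z)\<^sup>2"
      using sum_squares_bound[of "\<bar>X z\<bar>" "\<bar>Y z\<bar>"] by (simp add: power2_sum)
    finally have "ennreal ((Z z)\<^sup>2) \<le> ennreal (2 * (X z)\<^sup>2 + 2 * (Y z)\<^sup>2)" by (rule ennreal_leI)
    then show "ennreal ((Z z)\<^sup>2) \<le> ennreal 2 * ennreal ((X z)\<^sup>2) + ennreal 2 * ennreal ((Y z)\<^sup>2)"
      by (simp only: ennreal_mult' ennreal_plus zero_le_mult_iff zero_le_power2 zero_le_numeral simp_thms)
  qed
  also have "... = ennreal 2 * mean_square M X + ennreal 2 * mean_square M Y"
    by (subst nn_integral_add) (auto simp: nn_integral_cmult)
  also have "... \<le> ennreal 2 * ennreal a + ennreal 2 * ennreal b"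
    by (intro add_mono mult_left_mono) (use assms in auto)
  also have "... = ennreal (2 * a + 2 * b)"
    using assms(5,6) by (simp only: ennreal_mult' ennreal_plus zero_le_mult_iff zero_le_numeral simp_thms)
  finally show ?thesis .
qed

end

context wiener_on
begin

text \<open>The process \<open>N\<close> is the integral of the deterministic function \<open>h\<close> with respect to the
  Wiener process, in the concrete form used throughout: it is the mean square limit of
  Riemann sums, uniformly in time and in the partition.\<close>

definition wiener_integral :: "(real \<Rightarrow> real) \<Rightarrow> (real \<Rightarrow> 'a \<Rightarrow> real) \<Rightarrow> bool" where
  "wiener_integral h N \<longleftrightarrow> (\<forall>s\<in>{0..t}. N s \<in> borel_measurable M) \<and>
    (\<forall>\<epsilon>>0. \<exists>\<delta>>0. \<forall>s\<in>{0..t}. \<forall>n p. p 0 = 0 \<and> p n = s \<and> (\<forall>i<n. p i < p (Suc i) \<and> p (Suc i) - p i < \<delta>) \<longrightarrow>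
      mean_square M (\<lambda>z. N s z - B_sum h p n z) \<le> ennreal \<epsilon>)"

lemma wiener_integralD:
  assumes "wiener_integral h N" "0 < \<epsilon>"
  shows "\<exists>\<delta>>0. \<forall>s n p. 0 \<le> s \<longrightarrow> s \<le> t \<longrightarrow> p 0 = 0 \<longrightarrow> p n = s \<longrightarrow> (\<forall>i<n. p i < p (Suc i) \<and> p (Suc i) - p i < \<delta>) \<longrightarrow>
      mean_square M (\<lambda>z. N s z - B_sum h p n z) \<le> ennreal \<epsilon>"
proof -
  from assms obtain \<delta> where d: "0 < \<delta>" "\<forall>s\<in>{0..t}. \<forall>n p. p 0 = 0 \<and> p n = s \<and> (\<forall>i<n. p i < p (Suc i) \<and> p (Suc i) - p i < \<delta>) \<longrightarrow>
      mean_square M (\<lambda>z. N s z - B_sum h p n z) \<le> ennreal \<epsilon>"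
    unfolding wiener_integral_def by blast
  show ?thesis by (rule exI[of _ \<delta>]) (use d in auto)
qed

lemma wiener_integral_measurable: "wiener_integral h N \<Longrightarrow> 0 \<le> s \<Longrightarrow> s \<le> t \<Longrightarrow> N s \<in> borel_measurable M"
  by (simp add: wiener_integral_def)

lemma stochastic_integral_wiener_integral:
  assumes I: "\<And>s. s \<in> {0..t} \<Longrightarrow> has_stochastic_integral M F B (\<lambda>x _. \<sigma> x) s (G s)"
    and cont: "continuous_on {0..t} \<sigma>"
  shows "wiener_integral \<sigma> G"
  unfolding wiener_integral_def
proof (intro conjI ballI allI impI)
  fix s assume "s \<in> {0..t}" then show "G s \<in> borel_measurable M"
    using I unfolding has_stochastic_integral_def by blast
next
  fix \<epsilon> :: real assume e: "0 < \<epsilon>"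
  define w where "w = sqrt (\<epsilon> / (4 * t))"
  have w: "0 < w" "(2 * w)\<^sup>2 * t = \<epsilon>" using e t_pos by (auto simp: w_def power_mult_distrib)
  have "uniformly_continuous_on {0..t} \<sigma>" by (rule compact_uniformly_continuous[OF cont]) simp
  then obtain \<delta> where d: "0 < \<delta>" "\<And>x y. x \<in> {0..t} \<Longrightarrow> y \<in> {0..t} \<Longrightarrow> dist x y < \<delta> \<Longrightarrow> dist (\<sigma> x) (\<sigma> y) < w"
    unfolding uniformly_continuous_on_def using w(1) by blast
  show "\<exists>\<delta>>0. \<forall>s\<in>{0..t}. \<forall>n p. p 0 = 0 \<and> p n = s \<and> (\<forall>i<n. p i < p (Suc i) \<and> p (Suc i) - p i < \<delta>) \<longrightarrow>
      mean_square M (\<lambda>z. G s z - B_sum \<sigma> p n z) \<le> ennreal \<epsilon>"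
  proof (intro exI[of _ \<delta>] conjI d(1) ballI allI impI; elim conjE)
    fix s n and p :: "nat \<Rightarrow> real"
    assume s: "s \<in> {0..t}" and p: "p 0 = 0" "p n = s" "\<forall>i<n. p i < p (Suc i) \<and> p (Suc i) - p i < \<delta>"
    have pr: "0 \<le> p i \<and> p i \<le> t" if "i \<le> n" for i
      using strict_grid_le[of n p 0 i] strict_grid_le[of n p i n] that p s by auto
    have "mean_square M (\<lambda>z. G s z - B_sum \<sigma> p n z) \<le> ennreal ((2 * w)\<^sup>2 * s)"
    proof (rule deterministic_integral_Riemann_bound[OF I[OF s]])
      fix i x assume i: "i < n" "p i \<le> x" "x \<le> p (Suc i)"
have "p (Suc i) - p i < \<delta>" using i(1) p(3) by blast
      then have "dist (p i) x < \<delta>" using i(2,3) by (simp add: dist_real_def)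
      then show "\<bar>\<sigma> (p i) - \<sigma> x\<bar> \<le> w"
        using d(2)[of "p i" x] i pr[of i] pr[of "Suc i"] by (auto simp: dist_real_def)
    qed (use s p w in auto)
    also have "... \<le> ennreal ((2 * w)\<^sup>2 * t)" using s by (intro ennreal_leI mult_left_mono) auto
    finally show "mean_square M (\<lambda>z. G s z - B_sum \<sigma> p n z) \<le> ennreal \<epsilon>"
      using w by simp
  qed
qed

lemma wiener_integral_B: "wiener_integral (\<lambda>_. 1) B"
  unfolding wiener_integral_def
proof (intro conjI ballI allI impI)
  fix \<epsilon> :: real assume e: "0 < \<epsilon>"
  show "\<exists>\<delta>>0. \<forall>s\<in>{0..t}. \<forall>n p. p 0 = 0 \<and> p n = s \<and> (\<forall>i<n. p i < p (Suc i) \<and> p (Suc i) - p i < \<delta>) \<longrightarrow>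
      mean_square M (\<lambda>z. B s z - (\<Sum>i<n. 1 * (B (p (Suc i)) z - B (p i) z))) \<le> ennreal \<epsilon>"
  proof (intro exI[of _ 1] conjI ballI allI impI; (elim conjE)?)
    fix s n and p :: "nat \<Rightarrow> real" assume p: "p 0 = 0" "p n = s"
    have "(\<Sum>i<n. 1 * (B (p (Suc i)) z - B (p i) z)) = B s z - B 0 z" for z
      using sum_lessThan_telescope[of "\<lambda>i. B (p i) z" n] p by simp
    then have "mean_square M (\<lambda>z. B s z - (\<Sum>i<n. 1 * (B (p (Suc i)) z - B (p i) z))) = mean_square M (B 0)"
      by simp
    also have "... = (\<integral>\<^sup>+z. 0 \<partial>M)" by (rule nn_integral_cong_AE) (use B_zero in auto)
    finally show "mean_square M (\<lambda>z. B s z - (\<Sum>i<n. 1 * (B (p (Suc i)) z - B (p i) z))) \<le> ennreal \<epsilon>" by simp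
  qed simp
qed simp

definition subdivision :: "real \<Rightarrow> real \<Rightarrow> nat \<Rightarrow> nat \<Rightarrow> real" where
  "subdivision l u n k = l + real k * (u - l) / real n"

lemma subdivision_endpoints: "subdivision l u n 0 = l" "0 < n \<Longrightarrow> subdivision l u n n = u"
  by (simp_all add: subdivision_def)

lemma subdivision_diff: "subdivision l u n (Suc k) - subdivision l u n k = (u - l) / real n"
  by (simp add: subdivision_def add_divide_distrib[symmetric] diff_divide_distrib[symmetric] algebra_simps)

lemma subdivision_range:
  assumes "l \<le> u" "k \<le> n" "0 < n"
  shows "l \<le> subdivision l u n k" "subdivision l u n k \<le> u"
proof -
  show "l \<le> subdivision l u n k" using assms by (simp add: subdivision_def)
  have "real k * (u - l) \<le> real n * (u - l)" using assms by (intro mult_right_mono) auto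
  then show "subdivision l u n k \<le> u" using assms by (simp add: subdivision_def field_simps)
qed

lemma subdivision_mono:
  assumes "l \<le> u" "j \<le> k" shows "subdivision l u n j \<le> subdivision l u n k"
  unfolding subdivision_def using assms by (intro add_left_mono divide_right_mono mult_right_mono) auto

text \<open>The partition of \<open>[0, u]\<close> may be chosen to contain \<open>l\<close>; the sums up to \<open>l\<close> and up to \<open>u\<close> then
  differ by a sum over \<open>[l, u]\<close>.\<close>

lemma wiener_integral_increment:
  assumes N: "wiener_integral h N" and lu: "0 \<le> l" "l \<le> u" "u \<le> t"
  shows "converges_in_prob M
    (\<lambda>n z. \<Sum>k<Suc n. h (subdivision l u (Suc n) k) * (B (subdivision l u (Suc n) (Suc k)) z - B (subdivision l u (Suc n) k) z))
    (\<lambda>z. N u z - N l z)"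
proof (cases "l = u")
  case True
  then show ?thesis by (simp add: subdivision_def converges_in_prob_const)
next
  case False
  then have ul: "l < u" using lu by simp
  let ?r = "\<lambda>n. subdivision l u (Suc n)"
  have rng: "0 \<le> ?r n k \<and> ?r n k \<le> t" if "k \<le> Suc n" for n k
    using subdivision_range[of l u k "Suc n"] that lu by auto
  have [measurable]: "N u \<in> borel_measurable M" "N l \<in> borel_measurable M"
    using wiener_integral_measurable[OF N] lu by auto
  show ?thesis
  proof (rule converges_in_prob_L2_eventually)
    show "(\<lambda>z. \<Sum>k<Suc n. h (?r n k) * (B (?r n (Suc k)) z - B (?r n k) z)) \<in> borel_measurable M" for n
      by (intro borel_measurable_sum borel_measurable_times borel_measurable_diff borel_measurable_const B_measurable') (use rng in auto)
    fix \<epsilon> :: real assume e: "0 < \<epsilon>"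
    then have e4: "0 < \<epsilon> / 4" by simp
    from wiener_integralD[OF N e4] obtain \<delta> where d: "0 < \<delta>" and bnd: "\<forall>s n p. 0 \<le> s \<longrightarrow> s \<le> t \<longrightarrow> p 0 = 0 \<longrightarrow> p n = s \<longrightarrow> (\<forall>i<n. p i < p (Suc i) \<and> p (Suc i) - p i < \<delta>) \<longrightarrow>
      mean_square M (\<lambda>z. N s z - B_sum h p n z) \<le> ennreal (\<epsilon>/4)"
      by (elim exE conjE)
    have "(\<lambda>n. t / real (Suc n)) \<longlonglongrightarrow> 0"
      using tendsto_mult_right_zero[OF LIMSEQ_inverse_real_of_nat, of t] by (simp add: field_simps)
    from order_tendstoD(2)[OF this d]
    show "eventually (\<lambda>n. mean_square M (\<lambda>z. (\<Sum>k<Suc n. h (?r n k) * (B (?r n (Suc k)) z - B (?r n k) z)) - (N u z - N l z)) \<le> ennreal \<epsilon>) sequentially"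
    proof eventually_elim
      case (elim n)
      \<comment> \<open>A partition of \<open>[0, u]\<close> through \<open>l\<close>; its first block is empty if \<open>l = 0\<close>, since partitions are strict.\<close>
      define a where "a = (if l = 0 then 0 else Suc n)"
      define p where "p k = (if k < a then subdivision 0 l (Suc n) k else ?r n (k - a))" for k
      have p0: "p 0 = 0" by (auto simp: p_def a_def subdivision_endpoints)
      have pa: "p a = l" by (simp add: p_def subdivision_endpoints)
      have pn: "p (a + Suc n) = u" by (simp add: p_def subdivision_endpoints)
      have pk: "p (a + k) = ?r n k" for k by (simp add: p_def)
      have small: "(u - l) / real (Suc n) < \<delta>" "l / real (Suc n) < \<delta>"
        by (rule le_less_trans[OF divide_right_mono elim], use lu in simp, simp)+
      have step: "p k < p (Suc k) \<and> p (Suc k) - p k < \<delta>" if "k < a + Suc n" for k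
      proof (cases "k < a")
        case True
        then have l0: "0 < l" and aS: "a = Suc n" using lu by (auto simp: a_def split: if_splits)
        have "p (Suc k) = subdivision 0 l (Suc n) (Suc k)"
        proof (cases "Suc k < a")
          case False
          then have "Suc k = a" using True by simp
          then show ?thesis using pa aS subdivision_endpoints(2)[of "Suc n" 0 l] by simp
        qed (simp add: p_def)
        then have "p (Suc k) - p k = l / real (Suc n)"
          using True subdivision_diff[of 0 l "Suc n" k] by (simp add: p_def)
        moreover have "0 < l / real (Suc n)" using l0 by simp
        ultimately show ?thesis using small by linarith
      next
        case False
        then have "p (Suc k) - p k = (u - l) / real (Suc n)"
          using subdivision_diff[of l u "Suc n" "k - a"] by (simp add: p_def Suc_diff_le)
        moreover have "0 < (u - l) / real (Suc n)" using ul by simp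
        ultimately show ?thesis using small by linarith
      qed
      let ?f = "\<lambda>z i. h (p i) * (B (p (Suc i)) z - B (p i) z)"
      have prng: "0 \<le> p k \<and> p k \<le> t" if "k \<le> a + Suc n" for k
        using strict_grid_le[of "a + Suc n" p 0 k] strict_grid_le[of "a + Suc n" p k "a + Suc n"] step that p0 pn lu by auto
      have fm: "(\<lambda>z. \<Sum>i<k. ?f z i) \<in> borel_measurable M" if "k \<le> a + Suc n" for k
        by (intro borel_measurable_sum borel_measurable_times borel_measurable_diff borel_measurable_const B_measurable') (use prng that in auto)
      have 1: "mean_square M (\<lambda>z. N u z - (\<Sum>i<a + Suc n. ?f z i)) \<le> ennreal (\<epsilon>/4)"
        by (rule bnd[rule_format]) (use lu p0 pn step in auto)
      have 2: "mean_square M (\<lambda>z. N l z - (\<Sum>i<a. ?f z i)) \<le> ennreal (\<epsilon>/4)"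
        by (rule bnd[rule_format]) (use lu p0 pa step in auto)
      have split: "(\<Sum>i<a + Suc n. ?f z i) = (\<Sum>i<a. ?f z i) + (\<Sum>k<Suc n. h (?r n k) * (B (?r n (Suc k)) z - B (?r n k) z))" for z
        unfolding sum_lessThan_shift_add[of "?f z"] using pk[of "Suc _"] by (simp add: pk)
      have "mean_square M (\<lambda>z. (\<Sum>k<Suc n. h (?r n k) * (B (?r n (Suc k)) z - B (?r n k) z)) - (N u z - N l z)) \<le> ennreal (2 * (\<epsilon>/4) + 2 * (\<epsilon>/4))"
      proof (rule L2_add_le[OF _ _ 1 2])
        fix z
        show "\<bar>(\<Sum>k<Suc n. h (?r n k) * (B (?r n (Suc k)) z - B (?r n k) z)) - (N u z - N l z)\<bar> \<le>
          \<bar>N u z - (\<Sum>i<a + Suc n. ?f z i)\<bar> + \<bar>N l z - (\<Sum>i<a. ?f z i)\<bar>"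
          using split[of z] by linarith
      qed (use e fm in \<open>auto intro!: borel_measurable_diff simp del: sum.lessThan_Suc\<close>)
      then show ?case by simp
    qed
  qed measurable
qed

text \<open>Isometry for combinations of increments of \<open>G\<close> and of the Wiener process over the same
  intervals: subdividing each interval turns the sum into an elementary integral with respect to
  the Wiener process, and Fatou's lemma passes to the limit.\<close>

lemma integrator_isometry_bounded:
  assumes G: "wiener_integral \<sigma> G"
    and I: "finite I" and lu: "\<And>i. i \<in> I \<Longrightarrow> 0 \<le> l i \<and> l i \<le> u i \<and> u i \<le> t"
    and disj: "\<And>i j. i \<in> I \<Longrightarrow> j \<in> I \<Longrightarrow> i \<noteq> j \<Longrightarrow> u i \<le> l j \<or> u j \<le> l i"
    and X: "\<And>i. i \<in> I \<Longrightarrow> \<xi> i \<in> borel_measurable (F (l i))"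
    and c: "\<And>i z. i \<in> I \<Longrightarrow> z \<in> space M \<Longrightarrow> \<bar>\<xi> i z\<bar> \<le> c"
    and k: "\<And>i s. i \<in> I \<Longrightarrow> l i \<le> s \<Longrightarrow> s \<le> u i \<Longrightarrow> \<bar>x i * \<sigma> s + \<nu> i\<bar> \<le> \<kappa> i"
  shows "mean_square M (\<lambda>z. \<Sum>i\<in>I. \<xi> i z * (x i * (G (u i) z - G (l i) z) + \<nu> i * (B (u i) z - B (l i) z)))
    \<le> (\<Sum>i\<in>I. mean_square M (\<xi> i) * ennreal ((\<kappa> i)\<^sup>2 * (u i - l i)))"
proof -
  let ?r = "\<lambda>n i. subdivision (l i) (u i) (Suc n)"
  have rng: "l i \<le> ?r n i k \<and> ?r n i k \<le> u i" if "i \<in> I" "k \<le> Suc n" for n i k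
    using subdivision_range[of "l i" "u i" k "Suc n"] that lu by auto
  have Xm[measurable]: "\<xi> i \<in> borel_measurable M" if "i \<in> I" for i
    using measurable_F_M[OF X[OF that]] lu[OF that] by simp
  have Gm[measurable]: "G (u i) \<in> borel_measurable M" "G (l i) \<in> borel_measurable M" if "i \<in> I" for i
    using wiener_integral_measurable[OF G] lu[OF that] by auto
  let ?d = "\<lambda>n i k z. B (?r n i (Suc k)) z - B (?r n i k) z"
  let ?V = "\<lambda>n z. \<Sum>i\<in>I. \<xi> i z * (x i * (\<Sum>k<Suc n. \<sigma> (?r n i k) * ?d n i k z) + \<nu> i * (B (u i) z - B (l i) z))"
  have dm: "?d n i k \<in> borel_measurable M" if "i \<in> I" "k < Suc n" for n i k
    by (intro borel_measurable_diff B_measurable') (use rng[of i k n] rng[of i "Suc k" n] lu[of i] that in auto)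
  have Bm: "(\<lambda>z. B (u i) z - B (l i) z) \<in> borel_measurable M" if "i \<in> I" for i
    by (intro borel_measurable_diff B_measurable') (use lu[OF that] in auto)
  have sm: "(\<lambda>z. \<Sum>k<Suc n. \<sigma> (?r n i k) * ?d n i k z) \<in> borel_measurable M" if "i \<in> I" for i n
    by (intro borel_measurable_sum borel_measurable_times borel_measurable_const dm that) simp
  have Gdm: "(\<lambda>z. G (u i) z - G (l i) z) \<in> borel_measurable M" if "i \<in> I" for i
    by (intro borel_measurable_diff Gm that)
  have inner: "(\<lambda>z. x i * (\<Sum>k<Suc n. \<sigma> (?r n i k) * ?d n i k z) + \<nu> i * (B (u i) z - B (l i) z)) \<in> borel_measurable M"
    if "i \<in> I" for n i
    by (intro borel_measurable_add borel_measurable_times borel_measurable_const borel_measurable_sum dm Bm) (use that in auto)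
  have inner': "(\<lambda>z. x i * (G (u i) z - G (l i) z) + \<nu> i * (B (u i) z - B (l i) z)) \<in> borel_measurable M"
    if "i \<in> I" for i
    by (intro borel_measurable_add borel_measurable_times borel_measurable_const Gdm Bm that)
  have conv: "converges_in_prob M ?V (\<lambda>z. \<Sum>i\<in>I. \<xi> i z * (x i * (G (u i) z - G (l i) z) + \<nu> i * (B (u i) z - B (l i) z)))"
  proof (rule converges_in_prob_sum[OF I])
    fix i assume i: "i \<in> I"
    have "converges_in_prob M (\<lambda>n z. x i * (\<Sum>k<Suc n. \<sigma> (?r n i k) * ?d n i k z)) (\<lambda>z. x i * (G (u i) z - G (l i) z))"
      by (rule converges_in_prob_cmult[OF _ _ wiener_integral_increment[OF G]])
        (use i lu[OF i] sm[OF i] Gdm[OF i] in \<open>auto simp del: sum.lessThan_Suc\<close>)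
    then have "converges_in_prob M (\<lambda>n z. x i * (\<Sum>k<Suc n. \<sigma> (?r n i k) * ?d n i k z) + \<nu> i * (B (u i) z - B (l i) z))
       (\<lambda>z. x i * (G (u i) z - G (l i) z) + \<nu> i * (B (u i) z - B (l i) z))"
      by (rule converges_in_prob_add[OF _ _ _ _ _ converges_in_prob_const, rotated 4])
       (use sm[OF i] Gdm[OF i] Bm[OF i] in \<open>auto simp del: sum.lessThan_Suc\<close>)
    then show "converges_in_prob M (\<lambda>n z. \<xi> i z * (x i * (\<Sum>k<Suc n. \<sigma> (?r n i k) * ?d n i k z) + \<nu> i * (B (u i) z - B (l i) z)))
       (\<lambda>z. \<xi> i z * (x i * (G (u i) z - G (l i) z) + \<nu> i * (B (u i) z - B (l i) z)))"
      by (rule converges_in_prob_mult_bounded[OF _ _ _ _ c[OF i], rotated 3]) (use i in \<open>auto intro!: inner inner' simp del: sum.lessThan_Suc\<close>)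
  next
    fix i n assume i: "i \<in> I"
    show "(\<lambda>z. \<xi> i z * (x i * (\<Sum>k<Suc n. \<sigma> (?r n i k) * ?d n i k z) + \<nu> i * (B (u i) z - B (l i) z))) \<in> borel_measurable M"
      by (intro borel_measurable_times inner i Xm)
    show "(\<lambda>z. \<xi> i z * (x i * (G (u i) z - G (l i) z) + \<nu> i * (B (u i) z - B (l i) z))) \<in> borel_measurable M"
      by (intro borel_measurable_times inner' i Xm)
  qed
  have bound: "mean_square M (?V n) \<le> (\<Sum>i\<in>I. mean_square M (\<xi> i) * ennreal ((\<kappa> i)\<^sup>2 * (u i - l i)))" for n
  proof -
    let ?J = "I \<times> {..<Suc n}"
    let ?c = "\<lambda>(i,k). x i * \<sigma> (?r n i k) + \<nu> i"
    have sq_int: "integrable M (\<lambda>z. (\<xi> i z)\<^sup>2)" if "i \<in> I" for i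
    proof (rule integrable_const_bound[where B="c\<^sup>2"])
      show "AE z in M. norm ((\<xi> i z)\<^sup>2) \<le> c\<^sup>2"
        using c[OF that] by (intro AE_I2) (metis abs_ge_zero norm_power real_norm_def power_mono)
    qed (use that in auto)
    have kc: "\<bar>?c ik\<bar> \<le> \<kappa> (fst ik)" if "ik \<in> ?J" for ik
      using k[of "fst ik" "?r n (fst ik) (snd ik)"] rng[of "fst ik" "snd ik" n] that by auto
    have Veq: "?V n z = (\<Sum>ik\<in>?J. (\<xi> (fst ik) z * ?c ik) * (B (?r n (fst ik) (Suc (snd ik))) z - B (?r n (fst ik) (snd ik)) z))" for z
    proof -
      have tel: "B (u i) z - B (l i) z = (\<Sum>k<Suc n. ?d n i k z)" for i
        using sum_lessThan_telescope[of "\<lambda>k. B (?r n i k) z" "Suc n"] subdivision_endpoints(2)[of "Suc n" "l i" "u i"]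
        by (simp add: subdivision_endpoints del: sum.lessThan_Suc)
      have "?V n z = (\<Sum>i\<in>I. \<Sum>k<Suc n. (\<xi> i z * (x i * \<sigma> (?r n i k) + \<nu> i)) * ?d n i k z)"
        unfolding tel by (simp add: sum_distrib_left sum.distrib[symmetric] algebra_simps del: sum.lessThan_Suc)
      then show ?thesis by (simp add: sum.cartesian_product split_def del: sum.lessThan_Suc)
    qed
    have "mean_square M (?V n) =
        ennreal (\<Sum>ik\<in>?J. expectation (\<lambda>z. (\<xi> (fst ik) z * ?c ik)\<^sup>2) * (?r n (fst ik) (Suc (snd ik)) - ?r n (fst ik) (snd ik)))"
      unfolding Veq
    proof (rule wiener_isometry[where c="\<lambda>ik. c * \<kappa> (fst ik)"])
      show "finite ?J" using I by simp
      fix ik assume ik: "ik \<in> ?J"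
      then have i: "fst ik \<in> I" and kk: "snd ik < Suc n" by auto
      show "0 \<le> ?r n (fst ik) (snd ik) \<and> ?r n (fst ik) (snd ik) \<le> ?r n (fst ik) (Suc (snd ik)) \<and> ?r n (fst ik) (Suc (snd ik)) \<le> t"
        using rng[OF i, of "snd ik" n] rng[OF i, of "Suc (snd ik)" n] kk lu[OF i] subdivision_mono[of "l (fst ik)" "u (fst ik)" "snd ik" "Suc (snd ik)"] by auto
      show "(\<lambda>z. \<xi> (fst ik) z * ?c ik) \<in> borel_measurable (F (?r n (fst ik) (snd ik)))"
        using measurable_F_mono[OF X[OF i]] rng[OF i, of "snd ik" n] kk by (intro borel_measurable_times borel_measurable_const) auto
      show "\<bar>\<xi> (fst ik) z * ?c ik\<bar> \<le> c * \<kappa> (fst ik)" if "z \<in> space M" for z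
        unfolding abs_mult by (intro mult_mono c i that kc ik) (use c[OF i that] in auto)
      fix jk assume jk: "jk \<in> ?J" "ik \<noteq> jk"
      show "?r n (fst ik) (Suc (snd ik)) \<le> ?r n (fst jk) (snd jk) \<or> ?r n (fst jk) (Suc (snd jk)) \<le> ?r n (fst ik) (snd ik)"
      proof (cases "fst ik = fst jk")
        case True
        then have "snd ik \<noteq> snd jk" using jk by (auto simp: prod_eq_iff)
        then have "Suc (snd ik) \<le> snd jk \<or> Suc (snd jk) \<le> snd ik" by linarith
        then show ?thesis using True subdivision_mono[of "l (fst ik)" "u (fst ik)"] lu[OF i] by auto
      next
        case False
        have j: "fst jk \<in> I" and jj: "snd jk < Suc n" using jk by auto
        show ?thesis
          using disj[OF i j False] rng[OF i, of "snd ik" n] rng[OF i, of "Suc (snd ik)" n] rng[OF j, of "snd jk" n] rng[OF j, of "Suc (snd jk)" n] kk jj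
          by (smt (verit) Suc_leI less_imp_le_nat)
      qed
    qed
    also have "... \<le> ennreal (\<Sum>ik\<in>?J. (expectation (\<lambda>z. (\<xi> (fst ik) z)\<^sup>2) * (\<kappa> (fst ik))\<^sup>2) * ((u (fst ik) - l (fst ik)) / real (Suc n)))"
    proof (rule ennreal_leI, rule sum_mono)
      fix ik assume ik: "ik \<in> ?J"
      have "(?c ik)\<^sup>2 \<le> (\<kappa> (fst ik))\<^sup>2" using power_mono[OF kc[OF ik] abs_ge_zero, of 2] by (simp only: power2_abs)
      then have "expectation (\<lambda>z. (\<xi> (fst ik) z)\<^sup>2) * (?c ik)\<^sup>2 * ((u (fst ik) - l (fst ik)) / real (Suc n)) \<le> (expectation (\<lambda>z. (\<xi> (fst ik) z)\<^sup>2) * (\<kappa> (fst ik))\<^sup>2) * ((u (fst ik) - l (fst ik)) / real (Suc n))"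
        using lu ik by (intro mult_right_mono mult_left_mono) auto
      then show "expectation (\<lambda>z. (\<xi> (fst ik) z * ?c ik)\<^sup>2) * (?r n (fst ik) (Suc (snd ik)) - ?r n (fst ik) (snd ik)) \<le>
         (expectation (\<lambda>z. (\<xi> (fst ik) z)\<^sup>2) * (\<kappa> (fst ik))\<^sup>2) * ((u (fst ik) - l (fst ik)) / real (Suc n))"
        by (simp only: subdivision_diff power_mult_distrib integral_mult_left_zero)
    qed
    also have "(\<Sum>ik\<in>?J. (expectation (\<lambda>z. (\<xi> (fst ik) z)\<^sup>2) * (\<kappa> (fst ik))\<^sup>2) * ((u (fst ik) - l (fst ik)) / real (Suc n))) =
       (\<Sum>i\<in>I. \<Sum>k<Suc n. (expectation (\<lambda>z. (\<xi> i z)\<^sup>2) * (\<kappa> i)\<^sup>2) * ((u i - l i) / real (Suc n)))"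
      by (simp only: sum.cartesian_product split_def)
    also have "... = (\<Sum>i\<in>I. expectation (\<lambda>z. (\<xi> i z)\<^sup>2) * ((\<kappa> i)\<^sup>2 * (u i - l i)))"
      by (intro sum.cong refl) (simp only: sum_constant card_lessThan, simp)
    also have "ennreal ... = (\<Sum>i\<in>I. ennreal (expectation (\<lambda>z. (\<xi> i z)\<^sup>2) * ((\<kappa> i)\<^sup>2 * (u i - l i))))"
      by (rule sum_ennreal[symmetric]) (use lu in auto)
    also have "... = (\<Sum>i\<in>I. mean_square M (\<xi> i) * ennreal ((\<kappa> i)\<^sup>2 * (u i - l i)))"
      using lu sq_int by (intro sum.cong refl) (simp add: ennreal_mult nn_integral_eq_integral)
    finally show ?thesis .
  qed
  show ?thesis
  proof (rule converges_in_prob_Fatou[OF _ _ conv])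
    show "?V n \<in> borel_measurable M" for n
      by (intro borel_measurable_sum borel_measurable_times inner Xm)
    show "(\<lambda>z. \<Sum>i\<in>I. \<xi> i z * (x i * (G (u i) z - G (l i) z) + \<nu> i * (B (u i) z - B (l i) z))) \<in> borel_measurable M"
      by (intro borel_measurable_sum borel_measurable_times inner' Xm)
  qed (use bound in auto)
qed

text \<open>Truncating the levels reduces this to bounded ones, and Fatou's lemma removes the
  truncation.\<close>

lemma integrator_isometry:
  assumes G: "wiener_integral \<sigma> G"
    and I: "finite I" and lu: "\<And>i. i \<in> I \<Longrightarrow> 0 \<le> l i \<and> l i \<le> u i \<and> u i \<le> t"
    and disj: "\<And>i j. i \<in> I \<Longrightarrow> j \<in> I \<Longrightarrow> i \<noteq> j \<Longrightarrow> u i \<le> l j \<or> u j \<le> l i"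
    and X: "\<And>i. i \<in> I \<Longrightarrow> \<xi> i \<in> borel_measurable (F (l i))"
    and k: "\<And>i s. i \<in> I \<Longrightarrow> l i \<le> s \<Longrightarrow> s \<le> u i \<Longrightarrow> \<bar>x i * \<sigma> s + \<nu> i\<bar> \<le> \<kappa> i"
  shows "mean_square M (\<lambda>z. \<Sum>i\<in>I. \<xi> i z * (x i * (G (u i) z - G (l i) z) + \<nu> i * (B (u i) z - B (l i) z)))
    \<le> (\<Sum>i\<in>I. mean_square M (\<xi> i) * ennreal ((\<kappa> i)\<^sup>2 * (u i - l i)))"
    (is "?L \<le> ?R")
proof -
  let ?e = "\<lambda>i z. x i * (G (u i) z - G (l i) z) + \<nu> i * (B (u i) z - B (l i) z)"
  define \<zeta> where "\<zeta> n i z = max (- real n) (min (real n) (\<xi> i z))" for n i z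
  have Xm: "\<xi> i \<in> borel_measurable M" if "i \<in> I" for i
    using measurable_F_M[OF X[OF that]] lu[OF that] by simp
  have \<zeta>F: "\<zeta> n i \<in> borel_measurable (F (l i))" if "i \<in> I" for n i
    unfolding \<zeta>_def[abs_def] using X[OF that] by measurable
  have em: "?e i \<in> borel_measurable M" if "i \<in> I" for i
    by (intro borel_measurable_add borel_measurable_times borel_measurable_const borel_measurable_diff B_measurable' wiener_integral_measurable[OF G])
      (use lu[OF that] in auto)
  have m: "(\<lambda>z. ennreal ((\<Sum>i\<in>I. \<zeta> n i z * ?e i z)\<^sup>2)) \<in> borel_measurable M" for n
  proof -
    have "\<zeta> n i \<in> borel_measurable M" if "i \<in> I" for i
      using measurable_F_M[OF \<zeta>F[OF that]] lu[OF that] by auto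
    then show ?thesis
      by (intro measurable_compose[OF _ measurable_ennreal] borel_measurable_power borel_measurable_sum borel_measurable_times em) auto
  qed
  have lim: "(\<lambda>n. ennreal ((\<Sum>i\<in>I. \<zeta> n i z * ?e i z)\<^sup>2)) \<longlonglongrightarrow> ennreal ((\<Sum>i\<in>I. \<xi> i z * ?e i z)\<^sup>2)" for z
  proof -
    have "(\<lambda>n. \<zeta> n i z) \<longlonglongrightarrow> \<xi> i z" for i
    proof (rule tendsto_eventually)
      obtain n0 where "\<bar>\<xi> i z\<bar> \<le> real n0" using real_arch_simple by blast
      then show "eventually (\<lambda>n. \<zeta> n i z = \<xi> i z) sequentially"
        unfolding eventually_sequentially \<zeta>_def by (intro exI[of _ n0]) auto
    qed
    then show ?thesis by (intro tendsto_intros)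
  qed
  have "?L = (\<integral>\<^sup>+z. liminf (\<lambda>n. ennreal ((\<Sum>i\<in>I. \<zeta> n i z * ?e i z)\<^sup>2)) \<partial>M)"
    by (intro nn_integral_cong lim_imp_Liminf[OF _ lim, symmetric]) simp
  also have "... \<le> liminf (\<lambda>n. \<integral>\<^sup>+z. ennreal ((\<Sum>i\<in>I. \<zeta> n i z * ?e i z)\<^sup>2) \<partial>M)"
    by (rule nn_integral_liminf[OF m])
  also have "... \<le> liminf (\<lambda>n. ?R)"
  proof (rule Liminf_mono, rule always_eventually, rule allI)
    fix n
    have "mean_square M (\<lambda>z. \<Sum>i\<in>I. \<zeta> n i z * ?e i z) \<le>
        (\<Sum>i\<in>I. mean_square M (\<zeta> n i) * ennreal ((\<kappa> i)\<^sup>2 * (u i - l i)))"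
      by (rule integrator_isometry_bounded[OF G I lu disj \<zeta>F, where c="real n"]) (auto simp: \<zeta>_def k)
    also have "... \<le> ?R"
    proof (intro sum_mono mult_right_mono nn_integral_mono ennreal_leI)
      fix i z
      have "\<bar>\<zeta> n i z\<bar> \<le> \<bar>\<xi> i z\<bar>" by (auto simp: \<zeta>_def)
      then show "(\<zeta> n i z)\<^sup>2 \<le> (\<xi> i z)\<^sup>2" by (simp add: abs_le_square_iff)
    qed simp
    finally show "mean_square M (\<lambda>z. \<Sum>i\<in>I. \<zeta> n i z * ?e i z) \<le> ?R" .
  qed
  also have "... = ?R" by (simp add: Liminf_const)
  finally show ?thesis .
qed

lemma l2_integrator_wiener_integral:
  assumes G: "wiener_integral \<sigma> G" and b: "\<And>s. s \<in> {0..t} \<Longrightarrow> \<bar>\<sigma> s\<bar> \<le> c"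
  shows "l2_integrator (c\<^sup>2) G"
  unfolding l2_integrator_def
proof (intro conjI allI impI ballI)
  fix s assume "s \<in> {0..t}" then show "G s \<in> borel_measurable M" using wiener_integral_measurable[OF G] by auto
next
  fix I :: "(nat \<times> nat) set" and l u \<xi> and d :: real
  assume *: "finite I" "0 \<le> d"
      "\<forall>i\<in>I. 0 \<le> l i \<and> l i \<le> u i \<and> u i \<le> t \<and> \<xi> i \<in> borel_measurable (F (l i)) \<and>
        (\<forall>z\<in>space M. \<bar>\<xi> i z\<bar> \<le> d) \<and> (\<forall>j\<in>I. i \<noteq> j \<longrightarrow> u i \<le> l j \<or> u j \<le> l i)"
  have "mean_square M (\<lambda>z. \<Sum>i\<in>I. \<xi> i z * (1 * (G (u i) z - G (l i) z) + 0 * (B (u i) z - B (l i) z)))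
     \<le> (\<Sum>i\<in>I. mean_square M (\<xi> i) * ennreal (c\<^sup>2 * (u i - l i)))"
    by (rule integrator_isometry[OF G]) (use * b in auto)
  also have "... \<le> (\<Sum>i\<in>I. ennreal (d\<^sup>2) * ennreal (c\<^sup>2 * (u i - l i)))"
  proof (intro sum_mono mult_right_mono)
    fix i assume i: "i \<in> I"
    have "mean_square M (\<xi> i) \<le> nn_mean M (\<lambda>z. d\<^sup>2)"
      using * i by (intro nn_integral_mono ennreal_leI) (metis abs_ge_zero power2_abs power_mono)
    then show "mean_square M (\<xi> i) \<le> ennreal (d\<^sup>2)" by (simp add: emeasure_space_1)
  qed simp
  also have "... = (\<Sum>i\<in>I. ennreal (d\<^sup>2 * (c\<^sup>2 * (u i - l i))))"
    using * by (intro sum.cong) (auto simp: ennreal_mult)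
  also have "... = ennreal (\<Sum>i\<in>I. d\<^sup>2 * (c\<^sup>2 * (u i - l i)))" by (rule sum_ennreal) (use * in auto)
  also have "(\<Sum>i\<in>I. d\<^sup>2 * (c\<^sup>2 * (u i - l i))) = c\<^sup>2 * d\<^sup>2 * (\<Sum>i\<in>I. u i - l i)"
    by (simp add: sum_distrib_left ac_simps)
  finally show "mean_square M (\<lambda>z. \<Sum>i\<in>I. \<xi> i z * (G (u i) z - G (l i) z)) \<le> ennreal (c\<^sup>2 * d\<^sup>2 * (\<Sum>i\<in>I. u i - l i))"
    by simp
qed

end

section \<open>Partitions of equal variance\<close>

context prob_space
begin

lemma converges_in_prob_L1_eventually:
  assumes [measurable]: "\<And>n. V n \<in> borel_measurable M" "A \<in> borel_measurable M"
    and b: "\<And>\<epsilon>. 0 < \<epsilon> \<Longrightarrow> eventually (\<lambda>n. nn_mean M (\<lambda>z. \<bar>V n z - A z\<bar>) \<le> ennreal \<epsilon>) sequentially"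
  shows "converges_in_prob M V A"
  unfolding converges_in_prob_def
proof (intro allI impI LIMSEQ_I)
  fix \<epsilon> r :: real assume e: "0 < \<epsilon>" and r: "0 < r"
  have "0 < r / 2 * \<epsilon>" using e r by simp
  from b[OF this] have "eventually (\<lambda>n. norm (prob {z \<in> space M. \<epsilon> < \<bar>V n z - A z\<bar>} - 0) < r) sequentially"
  proof eventually_elim
    case (elim n)
    have "prob {z \<in> space M. \<epsilon> < \<bar>V n z - A z\<bar>} \<le> r / 2 * \<epsilon> / \<epsilon>"
      by (rule prob_tail_L1) (use elim e r in auto)
    also have "... < r" using e r by simp
    finally show ?case by simp
  qed
  then show "\<exists>N. \<forall>n\<ge>N. norm (prob {z \<in> space M. \<epsilon> < \<bar>V n z - A z\<bar>} - 0) < r"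
    by (simp add: eventually_sequentially)
qed

text \<open>By Young's inequality, \<open>|X\<^sup>2 - Y\<^sup>2| \<le> (1 + 1/\<theta>) (X - Y)\<^sup>2 + \<theta> Y\<^sup>2\<close>. With \<open>\<theta>\<close> small, an error that is
  small in mean square yields an error of the squares that is small relative to \<open>Y\<^sup>2\<close>.\<close>

lemma square_difference_L1:
  assumes [measurable]: "X \<in> borel_measurable M" "Y \<in> borel_measurable M"
    and a: "mean_square M (\<lambda>z. X z - Y z) \<le> ennreal a" and b: "mean_square M Y \<le> ennreal b"
    and ab: "0 \<le> a" "0 \<le> b" and \<theta>: "0 < \<theta>"
  shows "nn_mean M (\<lambda>z. \<bar>(X z)\<^sup>2 - (Y z)\<^sup>2\<bar>) \<le> ennreal ((1 + 1 / \<theta>) * a + \<theta> * b)"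
proof -
  have pt: "\<bar>x\<^sup>2 - y\<^sup>2\<bar> \<le> (1 + 1 / \<theta>) * (x - y)\<^sup>2 + \<theta> * y\<^sup>2" for x y :: real
  proof -
    have "\<bar>x\<^sup>2 - y\<^sup>2\<bar> = \<bar>(x - y)\<^sup>2 + 2 * ((x - y) * y)\<bar>" by (simp add: power2_eq_square algebra_simps)
    also have "... \<le> (x - y)\<^sup>2 + 2 * (\<bar>x - y\<bar> * \<bar>y\<bar>)"
      by (rule order_trans[OF abs_triangle_ineq]) (simp add: abs_mult)
    also have "2 * (\<bar>x - y\<bar> * \<bar>y\<bar>) \<le> (x - y)\<^sup>2 / \<theta> + \<theta> * y\<^sup>2"
    proof -
      have "0 \<le> (\<bar>x - y\<bar> - \<theta> * \<bar>y\<bar>)\<^sup>2 / \<theta>" using \<theta> by simp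
      also have "... = (x - y)\<^sup>2 / \<theta> + \<theta> * y\<^sup>2 - 2 * (\<bar>x - y\<bar> * \<bar>y\<bar>)"
        using \<theta> by (simp add: power2_diff power_mult_distrib field_simps) (simp add: power2_eq_square)
      finally show ?thesis by simp
    qed
    finally show ?thesis by (simp add: algebra_simps)
  qed
  have "nn_mean M (\<lambda>z. \<bar>(X z)\<^sup>2 - (Y z)\<^sup>2\<bar>) \<le>
      (\<integral>\<^sup>+z. ennreal (1 + 1 / \<theta>) * ennreal ((X z - Y z)\<^sup>2) + ennreal \<theta> * ennreal ((Y z)\<^sup>2) \<partial>M)"
  proof (rule nn_integral_mono)
    fix z
    have "ennreal \<bar>(X z)\<^sup>2 - (Y z)\<^sup>2\<bar> \<le> ennreal ((1 + 1 / \<theta>) * (X z - Y z)\<^sup>2 + \<theta> * (Y z)\<^sup>2)" by (rule ennreal_leI[OF pt])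
    also have "... = ennreal (1 + 1 / \<theta>) * ennreal ((X z - Y z)\<^sup>2) + ennreal \<theta> * ennreal ((Y z)\<^sup>2)"
      using \<theta> by (subst ennreal_plus) (auto simp: ennreal_mult intro!: mult_nonneg_nonneg add_nonneg_nonneg)
    finally show "ennreal \<bar>(X z)\<^sup>2 - (Y z)\<^sup>2\<bar> \<le> ennreal (1 + 1 / \<theta>) * ennreal ((X z - Y z)\<^sup>2) + ennreal \<theta> * ennreal ((Y z)\<^sup>2)" .
  qed
  also have "... = ennreal (1 + 1 / \<theta>) * mean_square M (\<lambda>z. X z - Y z) + ennreal \<theta> * mean_square M Y"
    by (subst nn_integral_add) (auto simp: nn_integral_cmult)
  also have "... \<le> ennreal (1 + 1 / \<theta>) * ennreal a + ennreal \<theta> * ennreal b"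
    by (intro add_mono mult_left_mono a b) auto
  also have "... = ennreal ((1 + 1 / \<theta>) * a + \<theta> * b)"
    using \<theta> ab by (subst ennreal_plus) (auto simp: ennreal_mult intro!: mult_nonneg_nonneg add_nonneg_nonneg)
  finally show ?thesis .
qed

end

lemma small_theta_choice:
  fixes b \<epsilon> :: real
  assumes "0 < \<epsilon>" "0 \<le> b"
  obtains \<theta> a where "0 < \<theta>" "0 < a" "(1 + 1 / \<theta>) * a + \<theta> * b \<le> \<epsilon>"
proof (rule that)
  define \<theta> where "\<theta> = \<epsilon> / (2 * (b + 1))"
  define a where "a = \<epsilon> / (2 * (1 + 1 / \<theta>))"
  show t: "0 < \<theta>" using assms by (simp add: \<theta>_def)
  then have p: "0 < 1 + 1 / \<theta>" by (simp add: add_pos_pos)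
  then show "0 < a" using assms by (simp add: a_def)
  have "y * (\<epsilon> / (2 * y)) = \<epsilon> / 2" if "0 < y" for y :: real using that by simp
  from this[OF p] have "(1 + 1 / \<theta>) * a = \<epsilon> / 2" unfolding a_def .
  moreover have "\<theta> * b \<le> \<epsilon> / 2" using assms by (simp add: \<theta>_def field_simps)
  ultimately show "(1 + 1 / \<theta>) * a + \<theta> * b \<le> \<epsilon>" by linarith
qed

locale wiener_martingale = wiener_on +
  fixes h :: "real \<Rightarrow> real" and N :: "real \<Rightarrow> 'a \<Rightarrow> real"
  assumes h_cont: "continuous_on {0..t} h" and h_pos: "\<And>s. s \<in> {0..t} \<Longrightarrow> 0 < h s"
    and N_integral: "wiener_integral h N"
    and N_adapted: "\<And>s. s \<in> {0..t} \<Longrightarrow> N s \<in> borel_measurable (F s)"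
    and N_cont: "\<And>z. z \<in> space M \<Longrightarrow> continuous_on {0..t} (\<lambda>s. N s z)"
begin

lemma N_measurable[measurable]: "s \<in> {0..t} \<Longrightarrow> N s \<in> borel_measurable M"
  using wiener_integral_measurable[OF N_integral] by auto

definition v :: "real \<Rightarrow> real" where "v s = integral {0..s} (\<lambda>x. (h x)\<^sup>2)"

lemma h2_cont: "continuous_on {0..t} (\<lambda>x. (h x)\<^sup>2)"
  by (intro continuous_intros h_cont)

lemma v_deriv: "s \<in> {0..t} \<Longrightarrow> (v has_real_derivative (h s)\<^sup>2) (at s within {0..t})"
  unfolding v_def[abs_def] by (rule integral_has_real_derivative[OF h2_cont])

lemma v_cont: "continuous_on {0..t} v"
  by (rule DERIV_continuous_on[OF v_deriv])

lemma v_0[simp]: "v 0 = 0" by (simp add: v_def)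

lemma v_diff: "0 \<le> s \<Longrightarrow> s \<le> u \<Longrightarrow> u \<le> t \<Longrightarrow> integral {s..u} (\<lambda>x. (h x)\<^sup>2) = v u - v s"
  unfolding v_def
  using Henstock_Kurzweil_Integration.integral_combine[of 0 s u "\<lambda>x. (h x)\<^sup>2"]
    integrable_continuous_real[OF continuous_on_subset[OF h2_cont, of "{0..u}"]] by auto


lemma v_mvt:
  assumes "0 \<le> s" "s < u" "u \<le> t"
  obtains \<nu> where "s < \<nu>" "\<nu> < u" "v u - v s = (u - s) * (h \<nu>)\<^sup>2"
proof -
  have "\<exists>\<nu>\<in>{s<..<u}. v u - v s = (\<lambda>x. (h \<nu>)\<^sup>2 * x) (u - s)"
  proof (rule mvt[OF assms(2) continuous_on_subset[OF v_cont]])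
    fix x assume x: "s < x" "x < u"
    have "(v has_real_derivative (h x)\<^sup>2) (at x within {0..t})" by (rule v_deriv) (use x assms in auto)
    then have "(v has_real_derivative (h x)\<^sup>2) (at x)"
      using x assms by (subst (asm) at_within_interior) (auto simp: interior_atLeastAtMost_real)
    then show "(v has_derivative (\<lambda>y. (h x)\<^sup>2 * y)) (at x)" by (simp add: has_field_derivative_def)
  qed (use assms in auto)
  then show ?thesis using that by (auto simp: mult.commute)
qed

lemma h_lower: obtains c where "0 < c" "\<And>s. s \<in> {0..t} \<Longrightarrow> c \<le> h s"
proof -
  obtain x where x: "x \<in> {0..t}" "\<And>y. y \<in> {0..t} \<Longrightarrow> h x \<le> h y"
    using continuous_attains_inf[OF _ _ h_cont] t_pos by auto
  show ?thesis by (rule that[of "h x"]) (use x h_pos in auto)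
qed

lemma v_growth: obtains c where "0 < c" "\<And>s u. 0 \<le> s \<Longrightarrow> s \<le> u \<Longrightarrow> u \<le> t \<Longrightarrow> c * (u - s) \<le> v u - v s"
proof -
  obtain c where c: "0 < c" "\<And>s. s \<in> {0..t} \<Longrightarrow> c \<le> h s" by (rule h_lower) blast
  show ?thesis
  proof (rule that[of "c\<^sup>2"])
    fix s u assume su: "0 \<le> s" "s \<le> u" "u \<le> t"
    show "c\<^sup>2 * (u - s) \<le> v u - v s"
    proof (cases "s = u")
      case False
      then obtain \<nu> where \<nu>: "s < \<nu>" "\<nu> < u" "v u - v s = (u - s) * (h \<nu>)\<^sup>2" using v_mvt[of s u] su by auto
      have "c\<^sup>2 \<le> (h \<nu>)\<^sup>2" using c(2)[of \<nu>] c(1) \<nu> su by (intro power_mono) auto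
      then show ?thesis unfolding \<nu>(3) using su by (subst mult.commute) (rule mult_left_mono, auto)
    qed simp
  qed (use c in auto)
qed

definition V :: real where "V = v t"

lemma V_pos: "0 < V"
proof -
  obtain c where c: "0 < c" "\<And>s u. 0 \<le> s \<Longrightarrow> s \<le> u \<Longrightarrow> u \<le> t \<Longrightarrow> c * (u - s) \<le> v u - v s" by (rule v_growth) blast
  have "0 < c * (t - 0)" using c(1) t_pos by simp
  also have "... \<le> v t - v 0" by (rule c(2)) (use t_pos in auto)
  finally show ?thesis by (simp add: V_def)
qed

text \<open>The grid cuts the clock, not the time, into equal parts. The choice is unique because \<open>v\<close> is
  strictly increasing.\<close>

definition vgrid :: "nat \<Rightarrow> nat \<Rightarrow> real" where
  "vgrid m k = (SOME s. s \<in> {0..t} \<and> v s = real k * V / real (Suc m))"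

lemma vgrid:
  assumes "k \<le> Suc m"
  shows "vgrid m k \<in> {0..t}" "v (vgrid m k) = real k * V / real (Suc m)"
proof -
  have "real k * V \<le> real (Suc m) * V" using assms V_pos by (intro mult_right_mono) auto
  then have "real k * V / real (Suc m) \<le> v t" by (simp add: V_def field_simps)
  moreover have "v 0 \<le> real k * V / real (Suc m)" using V_pos by simp
  ultimately have "\<exists>s\<ge>0. s \<le> t \<and> v s = real k * V / real (Suc m)"
    using IVT'[OF _ _ _ v_cont] t_pos by auto
  then have "\<exists>s. s \<in> {0..t} \<and> v s = real k * V / real (Suc m)" by auto
  from someI_ex[OF this] show "vgrid m k \<in> {0..t}" "v (vgrid m k) = real k * V / real (Suc m)"
    unfolding vgrid_def by auto
qed

lemma v_less: "0 \<le> s \<Longrightarrow> s < u \<Longrightarrow> u \<le> t \<Longrightarrow> v s < v u"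
proof -
  assume su: "0 \<le> s" "s < u" "u \<le> t"
  obtain c where c: "0 < c" "\<And>s u. 0 \<le> s \<Longrightarrow> s \<le> u \<Longrightarrow> u \<le> t \<Longrightarrow> c * (u - s) \<le> v u - v s" by (rule v_growth) blast
  have "0 < c * (u - s)" using c(1) su by simp
  also have "... \<le> v u - v s" by (rule c(2)) (use su in auto)
  finally show ?thesis by simp
qed

lemma vgrid_0: "vgrid m 0 = 0"
  using vgrid[of 0 m] v_less[of 0 "vgrid m 0"] by (cases "vgrid m 0 = 0") auto

lemma vgrid_end: "vgrid m (Suc m) = t"
proof -
  have "real (Suc m) * V / real (Suc m) = V" by (rule nonzero_mult_div_cancel_left) simp
  then have "v (vgrid m (Suc m)) = v t" using vgrid(2)[of "Suc m" m] by (simp only: V_def)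
  then show ?thesis using vgrid(1)[of "Suc m" m] v_less[of "vgrid m (Suc m)" t] by (cases "vgrid m (Suc m) = t") auto
qed

lemma vgrid_step:
  assumes "k < Suc m"
  shows "vgrid m k < vgrid m (Suc k)" "v (vgrid m (Suc k)) - v (vgrid m k) = V / real (Suc m)"
proof -
  have k: "k \<le> Suc m" "Suc k \<le> Suc m" using assms by auto
  show d: "v (vgrid m (Suc k)) - v (vgrid m k) = V / real (Suc m)"
  proof -
    have "real (Suc k) * V / n - real k * V / n = V / n" for n :: real
      by (simp add: diff_divide_distrib[symmetric] algebra_simps)
    then show ?thesis unfolding vgrid(2)[OF k(1)] vgrid(2)[OF k(2)] .
  qed
  have p: "0 < V / real (Suc m)" using V_pos by simp
  show "vgrid m k < vgrid m (Suc k)"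
  proof (rule ccontr)
    assume "\<not> ?thesis"
    then have "vgrid m (Suc k) \<le> vgrid m k" by simp
    then have "v (vgrid m (Suc k)) \<le> v (vgrid m k)"
      using v_less[of "vgrid m (Suc k)" "vgrid m k"] vgrid(1)[OF k(1)] vgrid(1)[OF k(2)]
      by (cases "vgrid m (Suc k) = vgrid m k") auto
    then show False using d p by linarith
  qed
qed

lemma vgrid_mono: "j \<le> k \<Longrightarrow> k \<le> Suc m \<Longrightarrow> vgrid m j \<le> vgrid m k"
  by (rule strict_grid_le[of "Suc m"]) (use vgrid_step in auto)

lemma vgrid_mesh:
  assumes "0 < \<delta>" shows "eventually (\<lambda>m. \<forall>k<Suc m. vgrid m (Suc k) - vgrid m k < \<delta>) sequentially"
proof -
  obtain c where c: "0 < c" "\<And>s u. 0 \<le> s \<Longrightarrow> s \<le> u \<Longrightarrow> u \<le> t \<Longrightarrow> c * (u - s) \<le> v u - v s" by (rule v_growth) blast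
  have "(\<lambda>m. V / real (Suc m)) \<longlonglongrightarrow> 0"
    using tendsto_mult_right_zero[OF LIMSEQ_inverse_real_of_nat, of V] by (simp add: field_simps)
  from order_tendstoD(2)[OF this, of "c * \<delta>"] c assms
  have "eventually (\<lambda>m. V / real (Suc m) < c * \<delta>) sequentially" by simp
  then show ?thesis
  proof eventually_elim
    case (elim m)
    show ?case
    proof (intro allI impI)
      fix k assume k: "k < Suc m"
      have "c * (vgrid m (Suc k) - vgrid m k) \<le> V / real (Suc m)"
        using c(2)[of "vgrid m k" "vgrid m (Suc k)"] vgrid(1)[of k m] vgrid(1)[of "Suc k" m] vgrid_step[OF k] k by auto
      also have "... < c * \<delta>" by (rule elim)
      finally show "vgrid m (Suc k) - vgrid m k < \<delta>" using c(1) by simp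
    qed
  qed
qed

lemma vgrid_oscillation:
  fixes f :: "real \<Rightarrow> real"
  assumes f: "continuous_on {0..t} f" and e: "0 < \<epsilon>"
  shows "eventually (\<lambda>m. \<forall>k<Suc m. \<forall>x\<in>{vgrid m k..vgrid m (Suc k)}. \<forall>y\<in>{vgrid m k..vgrid m (Suc k)}. \<bar>f x - f y\<bar> \<le> \<epsilon>) sequentially"
proof -
  have "uniformly_continuous_on {0..t} f" by (rule compact_uniformly_continuous[OF f]) simp
  then obtain \<delta> where d: "0 < \<delta>" "\<And>x y. x \<in> {0..t} \<Longrightarrow> y \<in> {0..t} \<Longrightarrow> dist x y < \<delta> \<Longrightarrow> dist (f x) (f y) < \<epsilon>"
    unfolding uniformly_continuous_on_def using e by blast
  from vgrid_mesh[OF d(1)] show ?thesis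
  proof eventually_elim
    case (elim m)
    show ?case
    proof (intro allI impI ballI)
      fix k x y assume k: "k < Suc m" and x: "x \<in> {vgrid m k..vgrid m (Suc k)}" and y: "y \<in> {vgrid m k..vgrid m (Suc k)}"
      have "vgrid m (Suc k) - vgrid m k < \<delta>" using elim k by blast
      then have "dist x y < \<delta>" using x y by (auto simp: dist_real_def abs_less_iff)
      moreover have "x \<in> {0..t}" "y \<in> {0..t}" using x y vgrid(1)[of k m] vgrid(1)[of "Suc k" m] k by auto
      ultimately show "\<bar>f x - f y\<bar> \<le> \<epsilon>" using d(2)[of x y] by (simp add: dist_real_def)
    qed
  qed
qed

text \<open>On each cell the clock advances by \<open>V / (m + 1)\<close>, so this is a Riemann sum for \<open>\<integral> f dv\<close>.\<close>

lemma vgrid_Riemann_sum: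
  fixes f :: "real \<Rightarrow> real"
  assumes f: "continuous_on {0..t} f"
  shows "(\<lambda>m. \<Sum>k<Suc m. f (vgrid m k) * (V / real (Suc m))) \<longlonglongrightarrow> integral {0..t} (\<lambda>s. f s * (h s)\<^sup>2)"
proof (rule LIMSEQ_I)
  fix r :: real assume r: "0 < r"
  define \<epsilon> where "\<epsilon> = r / (2 * V)"
  have e: "0 < \<epsilon>" using r V_pos by (simp add: \<epsilon>_def)
  have fh: "continuous_on {0..t} (\<lambda>s. f s * (h s)\<^sup>2)" by (intro continuous_intros f h_cont)
  from vgrid_oscillation[OF f e]
  have "eventually (\<lambda>m. norm ((\<Sum>k<Suc m. f (vgrid m k) * (V / real (Suc m))) - integral {0..t} (\<lambda>s. f s * (h s)\<^sup>2)) < r) sequentially"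
  proof eventually_elim
    case (elim m)
    let ?p = "vgrid m"
    have split: "integral {0..?p j} (\<lambda>s. f s * (h s)\<^sup>2) = (\<Sum>k<j. integral {?p k..?p (Suc k)} (\<lambda>s. f s * (h s)\<^sup>2))"
      if "j \<le> Suc m" for j
      using that
    proof (induction j)
      case (Suc j)
      have "integral {0..?p j} (\<lambda>s. f s * (h s)\<^sup>2) + integral {?p j..?p (Suc j)} (\<lambda>s. f s * (h s)\<^sup>2) = integral {0..?p (Suc j)} (\<lambda>s. f s * (h s)\<^sup>2)"
        by (rule Henstock_Kurzweil_Integration.integral_combine)
          (use vgrid(1)[of j m] vgrid(1)[of "Suc j" m] vgrid_step[of j m] Suc.prems in
           \<open>auto intro!: integrable_continuous_real continuous_on_subset[OF fh]\<close>)
      then show ?case using Suc by simp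
    qed (simp add: vgrid_0)
    have "\<bar>f (?p k) * (V / real (Suc m)) - integral {?p k..?p (Suc k)} (\<lambda>s. f s * (h s)\<^sup>2)\<bar> \<le> \<epsilon> * (V / real (Suc m))"
      if k: "k < Suc m" for k
    proof -
      note pk = vgrid(1)[of k m] vgrid(1)[of "Suc k" m] vgrid_step[OF k]
      have i1: "(\<lambda>s. f s * (h s)\<^sup>2) integrable_on {?p k..?p (Suc k)}"
        by (rule integrable_continuous_real[OF continuous_on_subset[OF fh]]) (use pk k in auto)
      have i2: "(\<lambda>s. (h s)\<^sup>2) integrable_on {?p k..?p (Suc k)}"
        by (rule integrable_continuous_real[OF continuous_on_subset[OF h2_cont]]) (use pk k in auto)
      have iv: "integral {?p k..?p (Suc k)} (\<lambda>s. (h s)\<^sup>2) = V / real (Suc m)"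
        using v_diff[of "?p k" "?p (Suc k)"] pk k by auto
      have "f (?p k) * (V / real (Suc m)) - integral {?p k..?p (Suc k)} (\<lambda>s. f s * (h s)\<^sup>2)
         = integral {?p k..?p (Suc k)} (\<lambda>s. f (?p k) * (h s)\<^sup>2 - f s * (h s)\<^sup>2)"
        by (subst Henstock_Kurzweil_Integration.integral_diff[OF integrable_on_mult_right[OF i2] i1])
          (simp add: iv)
      also have "norm ... \<le> integral {?p k..?p (Suc k)} (\<lambda>s. \<epsilon> * (h s)\<^sup>2)"
      proof (rule integral_norm_bound_integral)
        fix s assume s: "s \<in> {?p k..?p (Suc k)}"
        have "\<bar>f (?p k) - f s\<bar> \<le> \<epsilon>" using elim k s pk(3) by auto
        then have "\<bar>f (?p k) - f s\<bar> * (h s)\<^sup>2 \<le> \<epsilon> * (h s)\<^sup>2" by (rule mult_right_mono) simp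
        then show "norm (f (?p k) * (h s)\<^sup>2 - f s * (h s)\<^sup>2) \<le> \<epsilon> * (h s)\<^sup>2"
          by (simp add: left_diff_distrib[symmetric] abs_mult)
      qed (use i1 i2 in \<open>auto intro!: Henstock_Kurzweil_Integration.integrable_diff integrable_on_mult_right\<close>)
      also have "... = \<epsilon> * (V / real (Suc m))" using iv by simp
      finally show ?thesis by simp
    qed
    then have "\<bar>\<Sum>k<Suc m. f (?p k) * (V / real (Suc m)) - integral {?p k..?p (Suc k)} (\<lambda>s. f s * (h s)\<^sup>2)\<bar> \<le> (\<Sum>k<Suc m. \<epsilon> * (V / real (Suc m)))"
      by (intro order_trans[OF sum_abs] sum_mono) auto
    also have "... = \<epsilon> * V" by (simp only: sum_constant card_lessThan) simp
    also have "... < r" using V_pos r by (simp add: \<epsilon>_def)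
    finally show ?case using split[of "Suc m"] vgrid_end[of m] by (simp add: sum_subtractf del: sum.lessThan_Suc)
  qed
  then show "\<exists>N. \<forall>m\<ge>N. norm ((\<Sum>k<Suc m. f (vgrid m k) * (V / real (Suc m))) - integral {0..t} (\<lambda>s. f s * (h s)\<^sup>2)) < r"
    by (simp add: eventually_sequentially)
qed

text \<open>On each cell, \<open>h\<close> is replaced by its root mean square. The resulting increments all have
  the variance \<open>V / (m + 1)\<close> exactly, which makes them independent copies of each other.\<close>

definition cell_coeff :: "nat \<Rightarrow> nat \<Rightarrow> real" where
  "cell_coeff m k = sqrt (V / real (Suc m) / (vgrid m (Suc k) - vgrid m k))"

definition cell_incr :: "nat \<Rightarrow> nat \<Rightarrow> 'a \<Rightarrow> real" where
  "cell_incr m k z = cell_coeff m k * (B (vgrid m (Suc k)) z - B (vgrid m k) z)"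

definition walk :: "nat \<Rightarrow> nat \<Rightarrow> 'a \<Rightarrow> real" where
  "walk m k z = (\<Sum>j<k. cell_incr m j z)"

lemma cell_coeff_pos: "k < Suc m \<Longrightarrow> 0 < cell_coeff m k"
  using vgrid_step(1)[of k m] V_pos by (simp add: cell_coeff_def)

lemma cell_coeff_square: "k < Suc m \<Longrightarrow> (cell_coeff m k)\<^sup>2 * (vgrid m (Suc k) - vgrid m k) = V / real (Suc m)"
  using vgrid_step(1)[of k m] V_pos by (simp add: cell_coeff_def)

lemma cell_coeff_close:
  assumes e: "0 < \<epsilon>"
  shows "eventually (\<lambda>m. \<forall>k<Suc m. \<forall>x\<in>{vgrid m k..vgrid m (Suc k)}. \<bar>h x - cell_coeff m k\<bar> \<le> \<epsilon>) sequentially"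
  using vgrid_oscillation[OF h_cont e]
proof eventually_elim
  case (elim m)
  show ?case
  proof (intro allI impI ballI)
    fix k x assume k: "k < Suc m" and x: "x \<in> {vgrid m k..vgrid m (Suc k)}"
    note pk = vgrid(1)[of k m] vgrid(1)[of "Suc k" m] vgrid_step[OF k]
    obtain \<nu> where \<nu>: "vgrid m k < \<nu>" "\<nu> < vgrid m (Suc k)"
      "v (vgrid m (Suc k)) - v (vgrid m k) = (vgrid m (Suc k) - vgrid m k) * (h \<nu>)\<^sup>2"
      using v_mvt[of "vgrid m k" "vgrid m (Suc k)"] pk k by auto
    have "V / real (Suc m) / (vgrid m (Suc k) - vgrid m k) = (h \<nu>)\<^sup>2" using \<nu>(3) pk(3) unfolding pk(4) by simp
    moreover have "0 < h \<nu>" using \<nu> pk k by (intro h_pos) auto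
    ultimately have "cell_coeff m k = h \<nu>" by (simp add: cell_coeff_def)
    then show "\<bar>h x - cell_coeff m k\<bar> \<le> \<epsilon>" using elim k x \<nu> by auto
  qed
qed

lemma cell_incr_adapted: "k < Suc m \<Longrightarrow> cell_incr m k \<in> borel_measurable (F (vgrid m (Suc k)))"
  unfolding cell_incr_def[abs_def] using vgrid(1)[of k m] vgrid(1)[of "Suc k" m] vgrid_step(1)[of k m]
  by (intro borel_measurable_times borel_measurable_diff borel_measurable_const B_measurable_F) auto

lemma walk_adapted: "k \<le> Suc m \<Longrightarrow> walk m k \<in> borel_measurable (F (vgrid m k))"
  unfolding walk_def[abs_def]
  by (intro borel_measurable_sum measurable_F_mono[OF cell_incr_adapted]) (auto intro: vgrid_mono)

lemma cell_incr_measurable: "k < Suc m \<Longrightarrow> cell_incr m k \<in> borel_measurable M"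
  using measurable_F_M[OF cell_incr_adapted] vgrid(1)[of "Suc k" m] by auto

lemma walk_measurable: "k \<le> Suc m \<Longrightarrow> walk m k \<in> borel_measurable M"
  using measurable_F_M[OF walk_adapted] vgrid(1)[of k m] by auto

lemma vgrid_isometry:
  assumes n: "n \<le> Suc m"
  shows "mean_square M (\<lambda>z. \<Sum>k<n. c k * (B (vgrid m (Suc k)) z - B (vgrid m k) z)) =
    ennreal (\<Sum>k<n. (c k)\<^sup>2 * (vgrid m (Suc k) - vgrid m k))"
proof -
  have "mean_square M (\<lambda>z. \<Sum>k\<in>{..<n}. (\<lambda>_. c k) z * (B (vgrid m (Suc k)) z - B (vgrid m k) z)) =
    ennreal (\<Sum>k\<in>{..<n}. expectation (\<lambda>z. ((\<lambda>_. c k) z)\<^sup>2) * (vgrid m (Suc k) - vgrid m k))"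
  proof (rule wiener_isometry[where c="\<lambda>k. \<bar>c k\<bar>"])
    fix i assume "i \<in> {..<n}"
    then show "0 \<le> vgrid m i \<and> vgrid m i \<le> vgrid m (Suc i) \<and> vgrid m (Suc i) \<le> t"
      using n vgrid(1)[of i m] vgrid(1)[of "Suc i" m] vgrid_step(1)[of i m] by auto
  next
    fix i j assume "i \<in> {..<n}" "j \<in> {..<n}" "i \<noteq> j"
    then show "vgrid m (Suc i) \<le> vgrid m j \<or> vgrid m (Suc j) \<le> vgrid m i"
      using n by (cases "i < j") (auto intro!: vgrid_mono)
  qed auto
  then show ?thesis by (simp add: prob_space)
qed

lemma walk_second_moment:
  assumes "k \<le> Suc m" shows "mean_square M (walk m k) = ennreal (real k * (V / real (Suc m)))"
proof -
  have "(\<Sum>j<k. (cell_coeff m j)\<^sup>2 * (vgrid m (Suc j) - vgrid m j)) = (\<Sum>j<k. V / real (Suc m))"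
    using assms by (intro sum.cong cell_coeff_square) auto
  then show ?thesis
    using vgrid_isometry[OF assms, of "cell_coeff m"] by (simp add: walk_def cell_incr_def)
qed

lemma walk_second_moment_le:
  assumes "k \<le> Suc m" shows "mean_square M (walk m k) \<le> ennreal V"
proof -
  have "real k * V \<le> real (Suc m) * V" using assms V_pos by (intro mult_right_mono) auto
  then have "real k * (V / real (Suc m)) \<le> V" by (simp add: field_simps)
  then show ?thesis using walk_second_moment[OF assms] by (simp add: ennreal_leI)
qed

text \<open>The walk and a Riemann sum for \<open>N\<close> are sums of the same increments of \<open>B\<close>, with coefficients that
  are uniformly close on fine grids; the isometry turns this into closeness in mean square.\<close>

lemma walk_approximates:
  assumes e: "0 < \<epsilon>"
  shows "eventually (\<lambda>m. \<forall>k\<le>Suc m. mean_square M (\<lambda>z. N (vgrid m k) z - walk m k z) \<le> ennreal \<epsilon>) sequentially"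
proof -
  have e4: "0 < \<epsilon> / 4" using e by simp
  from wiener_integralD[OF N_integral e4] obtain \<delta> where d: "0 < \<delta>" and
    bnd: "\<forall>s n p. 0 \<le> s \<longrightarrow> s \<le> t \<longrightarrow> p 0 = 0 \<longrightarrow> p n = s \<longrightarrow> (\<forall>i<n. p i < p (Suc i) \<and> p (Suc i) - p i < \<delta>) \<longrightarrow>
      mean_square M (\<lambda>z. N s z - B_sum h p n z) \<le> ennreal (\<epsilon>/4)"
    by (elim exE conjE)
  define w where "w = sqrt (\<epsilon> / (4 * t))"
  have w: "0 < w" "w\<^sup>2 * t = \<epsilon> / 4" using e t_pos by (auto simp: w_def)
  from vgrid_mesh[OF d] cell_coeff_close[OF w(1)] show ?thesis
  proof eventually_elim
    case (elim m)
    show ?case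
    proof (intro allI impI)
      fix k assume k: "k \<le> Suc m"
      let ?S = "\<lambda>z. \<Sum>i<k. h (vgrid m i) * (B (vgrid m (Suc i)) z - B (vgrid m i) z)"
      let ?D = "\<lambda>z. \<Sum>i<k. (h (vgrid m i) - cell_coeff m i) * (B (vgrid m (Suc i)) z - B (vgrid m i) z)"
      have Bm: "B (vgrid m i) \<in> borel_measurable M" if "i \<le> Suc m" for i using vgrid(1)[OF that] by simp
      have Sm: "?S \<in> borel_measurable M" "?D \<in> borel_measurable M"
        using k by (auto intro!: borel_measurable_sum borel_measurable_times borel_measurable_diff Bm)
      have Nm: "N (vgrid m k) \<in> borel_measurable M" using vgrid(1)[OF k] by simp
      have 1: "mean_square M (\<lambda>z. N (vgrid m k) z - ?S z) \<le> ennreal (\<epsilon>/4)"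
        by (rule bnd[rule_format]) (use vgrid(1)[OF k] vgrid_0 vgrid_step elim k in auto)
      have "mean_square M ?D = ennreal (\<Sum>i<k. (h (vgrid m i) - cell_coeff m i)\<^sup>2 * (vgrid m (Suc i) - vgrid m i))"
        by (rule vgrid_isometry[OF k])
      also have "... \<le> ennreal (\<Sum>i<k. w\<^sup>2 * (vgrid m (Suc i) - vgrid m i))"
      proof (intro ennreal_leI sum_mono mult_right_mono)
        fix i assume i: "i \<in> {..<k}"
        then have "\<bar>h (vgrid m i) - cell_coeff m i\<bar> \<le> w" using elim(2) vgrid_step(1)[of i m] k by auto
        from power_mono[OF this abs_ge_zero, of 2]
        show "(h (vgrid m i) - cell_coeff m i)\<^sup>2 \<le> w\<^sup>2" by (simp only: power2_abs)
        show "0 \<le> vgrid m (Suc i) - vgrid m i" using vgrid_step(1)[of i m] k i by auto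
      qed
      also have "(\<Sum>i<k. w\<^sup>2 * (vgrid m (Suc i) - vgrid m i)) = w\<^sup>2 * vgrid m k"
        by (simp add: sum_distrib_left[symmetric] sum_lessThan_telescope vgrid_0)
      also have "ennreal (w\<^sup>2 * vgrid m k) \<le> ennreal (\<epsilon>/4)"
        unfolding w(2)[symmetric] using vgrid(1)[OF k] by (intro ennreal_leI mult_left_mono) auto
      finally have 2: "mean_square M ?D \<le> ennreal (\<epsilon>/4)" .
      have "mean_square M (\<lambda>z. N (vgrid m k) z - walk m k z) \<le> ennreal (2 * (\<epsilon>/4) + 2 * (\<epsilon>/4))"
      proof (rule L2_add_le[OF _ _ 1 2])
        fix z
        have "?D z = ?S z - walk m k z"
          by (simp add: walk_def cell_incr_def left_diff_distrib sum_subtractf)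
        then show "\<bar>N (vgrid m k) z - walk m k z\<bar> \<le> \<bar>N (vgrid m k) z - ?S z\<bar> + \<bar>?D z\<bar>" by linarith
      qed (use e Sm Nm in auto)
      then show "mean_square M (\<lambda>z. N (vgrid m k) z - walk m k z) \<le> ennreal \<epsilon>" by simp
    qed
  qed
qed

lemma walk_square_approximates:
  assumes e: "0 < \<epsilon>"
  shows "eventually (\<lambda>m. \<forall>k\<le>Suc m. nn_mean M (\<lambda>z. \<bar>(N (vgrid m k) z)\<^sup>2 - (walk m k z)\<^sup>2\<bar>) \<le> ennreal \<epsilon>) sequentially"
proof -
  obtain \<theta> a where \<theta>: "0 < \<theta>" "0 < a" "(1 + 1 / \<theta>) * a + \<theta> * V \<le> \<epsilon>"
    using small_theta_choice[OF e less_imp_le[OF V_pos]] by blast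
  from walk_approximates[OF \<theta>(2)] show ?thesis
  proof eventually_elim
    case (elim m)
    show ?case
    proof (intro allI impI)
      fix k assume k: "k \<le> Suc m"
      have "nn_mean M (\<lambda>z. \<bar>(N (vgrid m k) z)\<^sup>2 - (walk m k z)\<^sup>2\<bar>) \<le> ennreal ((1 + 1 / \<theta>) * a + \<theta> * V)"
        by (rule square_difference_L1) (use k elim \<theta> V_pos vgrid(1)[OF k] walk_measurable[OF k] walk_second_moment_le[OF k] in auto)
      also have "... \<le> ennreal \<epsilon>" by (rule ennreal_leI[OF \<theta>(3)])
      finally show "nn_mean M (\<lambda>z. \<bar>(N (vgrid m k) z)\<^sup>2 - (walk m k z)\<^sup>2\<bar>) \<le> ennreal \<epsilon>" .
    qed
  qed
qed

text \<open>The walk has second moment exactly \<open>V\<close> at the last grid point, where it approximates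
  \<open>N t\<close> in mean square.\<close>

lemma N_second_moment: "mean_square M (N t) = ennreal V"
proof (rule antisym)
  have *: "\<exists>Z. Z \<in> borel_measurable M \<and> mean_square M Z = ennreal V \<and>
     nn_mean M (\<lambda>z. \<bar>(N t z)\<^sup>2 - (Z z)\<^sup>2\<bar>) \<le> ennreal \<epsilon>" if e: "0 < \<epsilon>" for \<epsilon>
  proof -
    from walk_square_approximates[OF e] obtain m where
      m: "\<forall>k\<le>Suc m. nn_mean M (\<lambda>z. \<bar>(N (vgrid m k) z)\<^sup>2 - (walk m k z)\<^sup>2\<bar>) \<le> ennreal \<epsilon>"
      by (auto simp: eventually_sequentially)
    show ?thesis
      using m walk_second_moment[of "Suc m" m] walk_measurable[of "Suc m" m] vgrid_end[of m]
      by (intro exI[of _ "walk m (Suc m)"]) auto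
  qed
  have [measurable]: "N t \<in> borel_measurable M" using t_pos by simp
  show "mean_square M (N t) \<le> ennreal V"
  proof (rule ennreal_le_epsilon)
    fix e :: real assume "0 < e"
    then obtain Z where [measurable]: "Z \<in> borel_measurable M" and Z: "mean_square M Z = ennreal V"
     "nn_mean M (\<lambda>z. \<bar>(N t z)\<^sup>2 - (Z z)\<^sup>2\<bar>) \<le> ennreal e" using * by blast
    have "mean_square M (N t) \<le> (\<integral>\<^sup>+z. ennreal ((Z z)\<^sup>2) + ennreal \<bar>(N t z)\<^sup>2 - (Z z)\<^sup>2\<bar> \<partial>M)"
      by (intro nn_integral_mono) (auto simp: ennreal_plus[symmetric] simp del: ennreal_plus intro!: ennreal_leI)
    also have "... \<le> ennreal V + ennreal e" by (subst nn_integral_add) (use Z in auto)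
    finally show "mean_square M (N t) \<le> ennreal V + ennreal e" .
  qed
  show "ennreal V \<le> mean_square M (N t)"
  proof (rule ennreal_le_epsilon)
    fix e :: real assume "0 < e"
    then obtain Z where [measurable]: "Z \<in> borel_measurable M" and Z: "mean_square M Z = ennreal V"
     "nn_mean M (\<lambda>z. \<bar>(N t z)\<^sup>2 - (Z z)\<^sup>2\<bar>) \<le> ennreal e" using * by blast
    have "ennreal V \<le> (\<integral>\<^sup>+z. ennreal ((N t z)\<^sup>2) + ennreal \<bar>(N t z)\<^sup>2 - (Z z)\<^sup>2\<bar> \<partial>M)"
      unfolding Z(1)[symmetric] by (intro nn_integral_mono) (auto simp: ennreal_plus[symmetric] simp del: ennreal_plus intro!: ennreal_leI)
    also have "... \<le> mean_square M (N t) + ennreal e" by (subst nn_integral_add) (use Z in auto)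
    finally show "ennreal V \<le> mean_square M (N t) + ennreal e" .
  qed
qed

end

section \<open>The joint law of the terminal value and the quadratic functional\<close>

text \<open>The discrete counterpart of \<open>a \<integral> W dW + b \<integral> W\<^sup>2\<close> for a random walk with \<open>n\<close> steps \<open>x\<close>. Of the
  martingale to be approximated, only the fineness of the partition enters.\<close>

definition walk_functional :: "real \<Rightarrow> real \<Rightarrow> nat \<Rightarrow> (nat \<Rightarrow> real) \<Rightarrow> real" where
  "walk_functional a b n x =
    a * (((\<Sum>j<n. x j)\<^sup>2 - 1) / 2) + b * ((\<Sum>k<n. (\<Sum>j<k. x j)\<^sup>2) / real n)"

lemma walk_functional_measurable:
  "walk_functional a b n \<in> borel_measurable (PiM {..<n} (\<lambda>_. borel))"
proof -
  have [measurable]: "(\<lambda>x. \<Sum>j<k. x j :: real) \<in> borel_measurable (PiM {..<n} (\<lambda>_. borel))" if "k \<le> n" for k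
    by (intro borel_measurable_sum measurable_component_singleton) (use that in auto)
  have "(\<lambda>x. \<Sum>k<n. (\<Sum>j<k. x j :: real)\<^sup>2) \<in> borel_measurable (PiM {..<n} (\<lambda>_. borel))"
    by (intro borel_measurable_sum borel_measurable_power) auto
  then show ?thesis unfolding walk_functional_def[abs_def] by measurable
qed

lemma walk_functional_restrict: "walk_functional a b n (restrict x {..<n}) = walk_functional a b n x"
proof -
  have "(\<Sum>j<k. restrict x {..<n} j) = (\<Sum>j<k. x j)" if "k \<le> n" for k
    using that by (intro sum.cong) auto
  then show ?thesis by (simp add: walk_functional_def)
qed

context wiener_martingale
begin

text \<open>By Ito's formula, \<open>endpoint\<close> is \<open>V\<^sup>-\<^sup>1 \<integral> N dN\<close>; both functionals are normalized to be invariant under a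
  change of the clock.\<close>

definition endpoint :: "'a \<Rightarrow> real" where "endpoint z = ((N t z)\<^sup>2 / V - 1) / 2"

definition energy :: "'a \<Rightarrow> real" where "energy z = integral {0..t} (\<lambda>s. (N s z)\<^sup>2 * (h s)\<^sup>2) / V\<^sup>2"

lemma N_square_Riemann:
  assumes "z \<in> space M"
  shows "(\<lambda>m. \<Sum>k<Suc m. (N (vgrid m k) z)\<^sup>2 * (V / real (Suc m))) \<longlonglongrightarrow> integral {0..t} (\<lambda>s. (N s z)\<^sup>2 * (h s)\<^sup>2)"
  by (rule vgrid_Riemann_sum) (intro continuous_intros N_cont assms)

lemma N_vgrid_measurable: "k \<le> Suc m \<Longrightarrow> N (vgrid m k) \<in> borel_measurable M"
  using vgrid(1)[of k m] by simp

lemma energy_measurable[measurable]: "energy \<in> borel_measurable M"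
proof -
  have "(\<lambda>z. integral {0..t} (\<lambda>s. (N s z)\<^sup>2 * (h s)\<^sup>2)) \<in> borel_measurable M"
    by (rule borel_measurable_LIMSEQ_real[OF N_square_Riemann])
      (assumption, intro borel_measurable_sum borel_measurable_times borel_measurable_power borel_measurable_const N_vgrid_measurable, simp)
  then show ?thesis unfolding energy_def[abs_def] by simp
qed

lemma endpoint_measurable[measurable]: "endpoint \<in> borel_measurable M"
proof -
  have "N t \<in> borel_measurable M" using t_pos by simp
  then show ?thesis unfolding endpoint_def[abs_def] by simp
qed

lemma walk_square_sum_measurable:
  "(\<lambda>z. \<Sum>k<Suc m. (walk m k z)\<^sup>2 * (V / real (Suc m))) \<in> borel_measurable M"
  by (intro borel_measurable_sum borel_measurable_times borel_measurable_power walk_measurable) auto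

lemma walk_square_converges: "converges_in_prob M (\<lambda>m z. (walk m (Suc m) z)\<^sup>2) (\<lambda>z. (N t z)\<^sup>2)"
proof -
  have [measurable]: "N t \<in> borel_measurable M" using t_pos by simp
  have [measurable]: "walk m (Suc m) \<in> borel_measurable M" for m by (rule walk_measurable) simp
  show ?thesis
  proof (rule converges_in_prob_L1_eventually)
    fix \<epsilon> :: real assume "0 < \<epsilon>"
    from walk_square_approximates[OF this]
    show "eventually (\<lambda>m. nn_mean M (\<lambda>z. \<bar>(walk m (Suc m) z)\<^sup>2 - (N t z)\<^sup>2\<bar>) \<le> ennreal \<epsilon>) sequentially"
      by eventually_elim (use vgrid_end in \<open>auto simp: abs_minus_commute\<close>)
  qed measurable
qed

lemma walk_functional_converges:
  "converges_in_prob M (\<lambda>m z. walk_functional a b (Suc m) (\<lambda>j. cell_incr m j z / sqrt V)) (\<lambda>z. a * endpoint z + b * energy z)"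
proof -
  have Ntm[measurable]: "N t \<in> borel_measurable M" using t_pos by simp
  have wm[measurable]: "walk m (Suc m) \<in> borel_measurable M" for m by (rule walk_measurable) simp
  let ?E = "\<lambda>z. integral {0..t} (\<lambda>s. (N s z)\<^sup>2 * (h s)\<^sup>2)"
  let ?R = "\<lambda>m z. \<Sum>k<Suc m. (N (vgrid m k) z)\<^sup>2 * (V / real (Suc m))"
  let ?S = "\<lambda>m z. \<Sum>k<Suc m. (walk m k z)\<^sup>2 * (V / real (Suc m))"
  have Em: "?E \<in> borel_measurable M"
    using borel_measurable_times[OF energy_measurable borel_measurable_const[of "V\<^sup>2"]] V_pos by (simp add: energy_def)
  have Rm: "?R m \<in> borel_measurable M" for m
    by (intro borel_measurable_sum borel_measurable_times borel_measurable_power N_vgrid_measurable) auto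
  have Sm: "?S m \<in> borel_measurable M" for m by (rule walk_square_sum_measurable)
  have 2: "converges_in_prob M ?R ?E"
    by (rule converges_in_prob_AE[OF Rm Em]) (use N_square_Riemann in auto)
  have 3: "converges_in_prob M (\<lambda>m z. ?S m z - ?R m z) (\<lambda>_. 0)"
  proof (rule converges_in_prob_L1_eventually)
    fix \<epsilon> :: real assume e: "0 < \<epsilon>"
    then have e2: "0 < \<epsilon> / V" using V_pos by simp
    from walk_square_approximates[OF e2]
    show "eventually (\<lambda>m. nn_mean M (\<lambda>z. \<bar>?S m z - ?R m z - 0\<bar>) \<le> ennreal \<epsilon>) sequentially"
    proof eventually_elim
      case (elim m)
      let ?d = "\<lambda>k z. \<bar>(N (vgrid m k) z)\<^sup>2 - (walk m k z)\<^sup>2\<bar>"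
      have dm: "(\<lambda>z. ennreal (?d k z)) \<in> borel_measurable M" if "k < Suc m" for k
      proof -
        have [measurable]: "N (vgrid m k) \<in> borel_measurable M" "walk m k \<in> borel_measurable M"
          using that N_vgrid_measurable[of k m] walk_measurable[of k m] by auto
        show ?thesis by measurable
      qed
      have "nn_mean M (\<lambda>z. \<bar>?S m z - ?R m z - 0\<bar>) \<le> (\<integral>\<^sup>+z. (\<Sum>k<Suc m. ennreal (V / real (Suc m)) * ennreal (?d k z)) \<partial>M)"
      proof (rule nn_integral_mono)
        fix z
        have "\<bar>?S m z - ?R m z - 0\<bar> = \<bar>\<Sum>k<Suc m. ((walk m k z)\<^sup>2 - (N (vgrid m k) z)\<^sup>2) * (V / real (Suc m))\<bar>"
          by (simp only: sum_subtractf left_diff_distrib diff_0_right)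
        also have "... \<le> (\<Sum>k<Suc m. \<bar>((walk m k z)\<^sup>2 - (N (vgrid m k) z)\<^sup>2) * (V / real (Suc m))\<bar>)" by (rule sum_abs)
        also have "... = (\<Sum>k<Suc m. V / real (Suc m) * ?d k z)"
          using V_pos by (intro sum.cong refl) (simp add: abs_mult abs_minus_commute)
        finally have "ennreal \<bar>?S m z - ?R m z - 0\<bar> \<le> ennreal (\<Sum>k<Suc m. V / real (Suc m) * ?d k z)" by (rule ennreal_leI)
        also have "... = (\<Sum>k<Suc m. ennreal (V / real (Suc m) * ?d k z))"
          by (rule sum_ennreal[symmetric]) (use V_pos in auto)
        also have "... = (\<Sum>k<Suc m. ennreal (V / real (Suc m)) * ennreal (?d k z))"
          using V_pos by (intro sum.cong refl ennreal_mult) auto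
        finally show "ennreal \<bar>?S m z - ?R m z - 0\<bar> \<le> (\<Sum>k<Suc m. ennreal (V / real (Suc m)) * ennreal (?d k z))" .
      qed
      also have "... = (\<Sum>k<Suc m. ennreal (V / real (Suc m)) * nn_mean M (?d k))"
        by (subst nn_integral_sum) (auto intro!: sum.cong nn_integral_cmult dm borel_measurable_times_ennreal simp del: sum.lessThan_Suc)
      also have "... \<le> (\<Sum>k<Suc m. ennreal (V / real (Suc m)) * ennreal (\<epsilon> / V))"
        using elim by (intro sum_mono mult_left_mono) auto
      also have "... = (\<Sum>k<Suc m. ennreal (V / real (Suc m) * (\<epsilon> / V)))"
        using V_pos e by (intro sum.cong refl ennreal_mult[symmetric]) auto
      also have "... = ennreal (\<Sum>k<Suc m. V / real (Suc m) * (\<epsilon> / V))" by (rule sum_ennreal) (use V_pos e in auto)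
      also have "(\<Sum>k<Suc m. V / real (Suc m) * (\<epsilon> / V)) = \<epsilon>" using V_pos by (simp only: sum_constant card_lessThan) simp
      finally show ?case .
    qed
  qed (use Rm Sm in \<open>auto simp del: sum.lessThan_Suc\<close>)
  have "converges_in_prob M (\<lambda>m z. (?S m z - ?R m z) + ?R m z) (\<lambda>z. 0 + ?E z)"
    by (rule converges_in_prob_add[OF _ _ _ _ 3 2]) (use Rm Sm Em in \<open>auto simp del: sum.lessThan_Suc\<close>)
  then have 4: "converges_in_prob M ?S ?E" by (simp del: sum.lessThan_Suc)
  have "converges_in_prob M (\<lambda>m z. a / (2 * V) * (walk m (Suc m) z)\<^sup>2) (\<lambda>z. a / (2 * V) * (N t z)\<^sup>2)"
    by (rule converges_in_prob_cmult[OF _ _ walk_square_converges]) measurable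
  moreover have "converges_in_prob M (\<lambda>m z. b / V\<^sup>2 * ?S m z) (\<lambda>z. b / V\<^sup>2 * ?E z)"
    by (rule converges_in_prob_cmult[OF Sm Em 4])
  ultimately have "converges_in_prob M (\<lambda>m z. a / (2 * V) * (walk m (Suc m) z)\<^sup>2 + b / V\<^sup>2 * ?S m z) (\<lambda>z. a / (2 * V) * (N t z)\<^sup>2 + b / V\<^sup>2 * ?E z)"
    by (rule converges_in_prob_add[rotated 4]) (use Sm Em in \<open>auto simp del: sum.lessThan_Suc\<close>)
  then have "converges_in_prob M (\<lambda>m z. (a / (2 * V) * (walk m (Suc m) z)\<^sup>2 + b / V\<^sup>2 * ?S m z) - a / 2) (\<lambda>z. (a / (2 * V) * (N t z)\<^sup>2 + b / V\<^sup>2 * ?E z) - a / 2)"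
    by (rule converges_in_prob_diff[OF _ _ _ _ _ converges_in_prob_const, rotated 4]) (use Sm Em in \<open>auto simp del: sum.lessThan_Suc\<close>)
  moreover have "walk_functional a b (Suc m) (\<lambda>j. cell_incr m j z / sqrt V) = (a / (2 * V) * (walk m (Suc m) z)\<^sup>2 + b / V\<^sup>2 * ?S m z) - a / 2" for m z
  proof -
    have s: "(\<Sum>j<k. cell_incr m j z / sqrt V)\<^sup>2 = (walk m k z)\<^sup>2 / V" for k
      unfolding walk_def sum_divide_distrib[symmetric] power_divide using V_pos by simp
    have "b * ((\<Sum>k<Suc m. (walk m k z)\<^sup>2 / V) / real (Suc m)) = b / V\<^sup>2 * ?S m z"
      unfolding sum_distrib_right[symmetric] sum_divide_distrib[symmetric] using V_pos
      by (simp add: power2_eq_square del: sum.lessThan_Suc)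
    moreover have "a * ((w / V - 1) / 2) + X = (a / (2 * V) * w + X) - a / 2" for w X
      using V_pos by (simp add: field_simps)
    ultimately show ?thesis unfolding walk_functional_def s by (simp only:)
  qed
  moreover have "a * endpoint z + b * energy z = (a / (2 * V) * (N t z)\<^sup>2 + b / V\<^sup>2 * ?E z) - a / 2" for z
    unfolding endpoint_def energy_def by (simp add: field_simps)
  ultimately show ?thesis by (simp only:)
qed

text \<open>The normalized increments of the walk are independent centred normal variables of variance
  \<open>1 / (m + 1)\<close>, whatever the martingale is.\<close>

lemma walk_functional_law:
  "walk_functional a b (Suc m) \<circ> (\<lambda>z j. cell_incr m j z / sqrt V) \<in> borel_measurable M"
  "prob {z \<in> space M. walk_functional a b (Suc m) (\<lambda>j. cell_incr m j z / sqrt V) \<le> \<nu>} =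
    measure (PiM {..<Suc m} (\<lambda>_. density lborel (normal_density 0 (sqrt (1 / real (Suc m))))))
      {x \<in> space (PiM {..<Suc m} (\<lambda>_. borel)). walk_functional a b (Suc m) x \<le> \<nu>}"
proof -
  let ?I = "{..<Suc m}"
  let ?X = "\<lambda>j z. cell_coeff m j / sqrt V * (B (vgrid m (Suc j)) z - B (vgrid m j) z)"
  have Xeq: "cell_incr m j z / sqrt V = ?X j z" for j z by (simp add: cell_incr_def)
  have "indep_vars (\<lambda>_. borel) (\<lambda>i z. B (vgrid m (Suc i)) z - B (vgrid m i) z) ?I"
    by (rule increments_indep) (use vgrid(1)[of _ m] vgrid_step[of _ m] in auto)
  then have ind: "indep_vars (\<lambda>_. borel) ?X ?I"
    by (rule indep_vars_compose2[where Y="\<lambda>i y. cell_coeff m i / sqrt V * y"]) auto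
  have Xm: "?X j \<in> borel_measurable M" if "j \<in> ?I" for j
    using that vgrid(1)[of j m] vgrid(1)[of "Suc j" m] by (auto intro!: borel_measurable_times borel_measurable_diff)
  have law: "distr M borel (?X j) = density lborel (normal_density 0 (sqrt (1 / real (Suc m))))" if j: "j \<in> ?I" for j
  proof -
    have jS: "j < Suc m" using j by simp
    let ?d = "vgrid m (Suc j) - vgrid m j"
    have d: "0 < ?d" using vgrid_step(1)[OF jS] by simp
    have "distributed M lborel (\<lambda>z. 0 + ?X j z) (normal_density (0 + cell_coeff m j / sqrt V * 0) (\<bar>cell_coeff m j / sqrt V\<bar> * sqrt ?d))"
      by (rule normal_density_affine[OF increment_normal])
        (use vgrid(1)[of j m] vgrid(1)[of "Suc j" m] vgrid_step(1)[OF jS] jS cell_coeff_pos[OF jS] V_pos in auto)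
    moreover have "\<bar>cell_coeff m j / sqrt V\<bar> * sqrt ?d = sqrt (1 / real (Suc m))"
    proof -
      have "\<bar>cell_coeff m j / sqrt V\<bar> * sqrt ?d = sqrt ((cell_coeff m j)\<^sup>2 * ?d / V)"
        using cell_coeff_pos[OF jS] V_pos by (simp add: real_sqrt_mult real_sqrt_divide)
      then show ?thesis unfolding cell_coeff_square[OF jS] using V_pos by simp
    qed
    ultimately have "distributed M lborel (?X j) (normal_density 0 (sqrt (1 / real (Suc m))))" by simp
    from distributed_distr_eq_density[OF this] show ?thesis
      by (subst distr_cong[OF refl sets_lborel[symmetric] refl]) auto
  qed
  have "distr M (PiM ?I (\<lambda>_. borel)) (\<lambda>z. \<lambda>j\<in>?I. ?X j z) = PiM ?I (\<lambda>j. distr M borel (?X j))"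
    by (rule iffD1[OF indep_vars_iff_distr_eq_PiM' ind]) (use Xm in auto)
  also have "... = PiM ?I (\<lambda>_. density lborel (normal_density 0 (sqrt (1 / real (Suc m)))))"
    by (rule PiM_cong[OF refl law])
  finally have D: "distr M (PiM ?I (\<lambda>_. borel)) (\<lambda>z. \<lambda>j\<in>?I. ?X j z) = PiM ?I (\<lambda>_. density lborel (normal_density 0 (sqrt (1 / real (Suc m)))))" .
  have rm: "(\<lambda>z. \<lambda>j\<in>?I. ?X j z) \<in> measurable M (PiM ?I (\<lambda>_. borel))"
    by (rule measurable_restrict) (rule Xm)
  have eq: "walk_functional a b (Suc m) (\<lambda>j. cell_incr m j z / sqrt V) = walk_functional a b (Suc m) (\<lambda>j\<in>?I. ?X j z)" for z
    unfolding Xeq walk_functional_restrict ..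
  show "walk_functional a b (Suc m) \<circ> (\<lambda>z j. cell_incr m j z / sqrt V) \<in> borel_measurable M"
    unfolding comp_def eq by (rule measurable_compose[OF rm walk_functional_measurable])
  have S: "{x \<in> space (PiM ?I (\<lambda>_. borel)). walk_functional a b (Suc m) x \<le> \<nu>} \<in> sets (PiM ?I (\<lambda>_. borel))"
    using walk_functional_measurable[of a b "Suc m"] by measurable
  have vi: "(\<lambda>z. \<lambda>j\<in>?I. ?X j z) -` {x \<in> space (PiM ?I (\<lambda>_. borel)). walk_functional a b (Suc m) x \<le> \<nu>} \<inter> space M =
     {z \<in> space M. walk_functional a b (Suc m) (\<lambda>j. cell_incr m j z / sqrt V) \<le> \<nu>}"
    unfolding eq using measurable_space[OF rm] by blast
  show "prob {z \<in> space M. walk_functional a b (Suc m) (\<lambda>j. cell_incr m j z / sqrt V) \<le> \<nu>} =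
    measure (PiM {..<Suc m} (\<lambda>_. density lborel (normal_density 0 (sqrt (1 / real (Suc m))))))
      {x \<in> space (PiM {..<Suc m} (\<lambda>_. borel)). walk_functional a b (Suc m) x \<le> \<nu>}"
    unfolding D[symmetric] measure_distr[OF rm S] vi ..
qed

end

text \<open>Brownian scaling in law. It suffices to compare linear combinations of the two functionals,
  since an inequality for their quotient is a linear inequality.\<close>

lemma endpoint_energy_law:
  assumes "wiener_martingale M B t h N" "wiener_martingale M' B' t' h' N'"
  shows "measure M {z\<in>space M. a * wiener_martingale.endpoint t h N z + b * wiener_martingale.energy t h N z \<le> \<nu>} =
    measure M' {z\<in>space M'. a * wiener_martingale.endpoint t' h' N' z + b * wiener_martingale.energy t' h' N' z \<le> \<nu>}"
proof -
  interpret A: wiener_martingale M B t h N by fact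
  interpret A': wiener_martingale M' B' t' h' N' by fact
  show ?thesis
  proof (rule limit_in_prob_same_law[OF A.prob_space_axioms A'.prob_space_axioms _ _ _ _ A.walk_functional_converges A'.walk_functional_converges])
    show "(\<lambda>z. walk_functional a b (Suc m) (\<lambda>j. A.cell_incr m j z / sqrt A.V)) \<in> borel_measurable M" for m
      using A.walk_functional_law(1)[of a b m] by (simp add: comp_def)
    show "(\<lambda>z. walk_functional a b (Suc m) (\<lambda>j. A'.cell_incr m j z / sqrt A'.V)) \<in> borel_measurable M'" for m
      using A'.walk_functional_law(1)[of a b m] by (simp add: comp_def)
  qed (simp_all only: A.walk_functional_law(2) A'.walk_functional_law(2) eventually_True simp_thms, measurable)
qed

section \<open>Integration of the martingale against itself\<close>

context wiener_martingale
begin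

lemma vgrid_steps_adapted:
  assumes "\<And>x. x \<in> {0..t} \<Longrightarrow> H x \<in> borel_measurable (F x)"
  shows "adapted_step F t \<lparr>steps = Suc m, grid = vgrid m, level = \<lambda>k. H (vgrid m k)\<rparr>"
  using assms vgrid(1)[of _ m] vgrid_step(1)[of _ m] by (simp add: adapted_step_def vgrid_0 vgrid_end less_Suc_eq_le)

lemma vgrid_cell:
  assumes "0 < x" "x \<le> t" obtains k where "k < Suc m" "vgrid m k < x" "x \<le> vgrid m (Suc k)"
proof -
  let ?i = "LEAST i. x \<le> vgrid m i"
  have ex: "x \<le> vgrid m (Suc m)" using assms vgrid_end by simp
  have 1: "x \<le> vgrid m ?i" by (rule LeastI[of _ "Suc m"]) (rule ex)
  have 2: "?i \<le> Suc m" by (rule Least_le) (rule ex)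
  have "?i \<noteq> 0" using 1 assms vgrid_0 by (metis not_le)
  then obtain j where j: "?i = Suc j" by (cases ?i) auto
  have "\<not> x \<le> vgrid m j" by (rule not_less_Least) (simp add: j)
  then show ?thesis using 1 2 j by (intro that[of j]) auto
qed

text \<open>Freezing a continuous integrand at the grid points gives step processes that converge to it
  uniformly on every path, hence uniformly in probability.\<close>

lemma stochastic_integral_vgrid:
  assumes Z: "l2_integrator c Z" and c: "0 \<le> c" and I: "has_stochastic_integral M F Z H t I"
  shows "converges_in_prob M (\<lambda>m z. \<Sum>k<Suc m. H (vgrid m k) z * (Z (vgrid m (Suc k)) z - Z (vgrid m k) z)) I"
proof -
  let ?R = "\<lambda>m. \<lparr>steps = Suc m, grid = vgrid m, level = \<lambda>k. H (vgrid m k)\<rparr>"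
  have HF: "H x \<in> borel_measurable (F x)" if "x \<in> {0..t}" for x
    using I that unfolding has_stochastic_integral_def by blast
  have Hc: "continuous_on {0..t} (\<lambda>x. H x z)" if "z \<in> space M" for z
    using I that unfolding has_stochastic_integral_def by blast
  note R = vgrid_steps_adapted[of H, OF HF]
  have HM: "H x \<in> borel_measurable M" if "x \<in> {0..t}" for x using measurable_F_M[OF HF[OF that]] that by simp
  have far: "far (?R m) H t \<epsilon> \<in> events" for m \<epsilon>
    by (rule far_measurable[OF R _ _ HM Hc]) (use t_pos in auto)
  have "(\<lambda>m. prob (far (?R m) H t \<epsilon>)) \<longlonglongrightarrow> 0" if e: "0 < \<epsilon>" for \<epsilon>
  proof -
    have "(\<lambda>m. expectation (indicator (far (?R m) H t \<epsilon>))) \<longlonglongrightarrow> expectation (\<lambda>_. 0 :: real)"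
    proof (rule integral_dominated_convergence[where w="\<lambda>_. 1"])
      show "AE z in M. (\<lambda>m. indicator (far (?R m) H t \<epsilon>) z :: real) \<longlonglongrightarrow> 0"
      proof (rule AE_I2, rule tendsto_eventually)
        fix z assume w: "z \<in> space M"
        from vgrid_oscillation[OF Hc[OF w] e]
        show "eventually (\<lambda>m. indicator (far (?R m) H t \<epsilon>) z = (0::real)) sequentially"
        proof eventually_elim
          case (elim m)
          have "\<bar>step_value (?R m) x z - H x z\<bar> \<le> \<epsilon>" if x: "x \<in> {0<..t}" for x
          proof -
            obtain k where k: "k < Suc m" "vgrid m k < x" "x \<le> vgrid m (Suc k)" using vgrid_cell[of x m] x by auto
            then show ?thesis using step_value_eq[OF R, of k m x z] elim by auto
          qed
          then show ?case by (auto simp: far_def indicator_def not_less)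
        qed
      qed
    qed (use far in \<open>auto simp: indicator_def intro!: borel_measurable_indicator\<close>)
    then show ?thesis using far by simp
  qed
  from stochastic_integral_step_limit[OF Z c I _ _ R this] t_pos
  have "converges_in_prob M (\<lambda>m. step_integral (?R m) Z) I" by simp
  then show ?thesis unfolding step_integral_def[abs_def] by (simp del: sum.lessThan_Suc)
qed

lemma vgrid_integrator_isometry:
  assumes G: "wiener_integral \<sigma> G"
    and X: "\<And>k. k < Suc m \<Longrightarrow> \<xi> k \<in> borel_measurable (F (vgrid m k))"
    and k: "\<And>k s. k < Suc m \<Longrightarrow> vgrid m k \<le> s \<Longrightarrow> s \<le> vgrid m (Suc k) \<Longrightarrow> \<bar>x k * \<sigma> s + \<nu> k\<bar> \<le> \<kappa> k"
  shows "mean_square M (\<lambda>z. \<Sum>k<Suc m. \<xi> k z * (x k * (G (vgrid m (Suc k)) z - G (vgrid m k) z) +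
        \<nu> k * (B (vgrid m (Suc k)) z - B (vgrid m k) z)))
    \<le> (\<Sum>k<Suc m. mean_square M (\<xi> k) * ennreal ((\<kappa> k)\<^sup>2 * (vgrid m (Suc k) - vgrid m k)))"
proof (rule integrator_isometry[OF G])
  fix i assume "i \<in> {..<Suc m}"
  then show "0 \<le> vgrid m i \<and> vgrid m i \<le> vgrid m (Suc i) \<and> vgrid m (Suc i) \<le> t"
    using vgrid(1)[of i m] vgrid(1)[of "Suc i" m] vgrid_step(1)[of i m] by auto
next
  fix i j assume "i \<in> {..<Suc m}" "j \<in> {..<Suc m}" "i \<noteq> j"
  then show "vgrid m (Suc i) \<le> vgrid m j \<or> vgrid m (Suc j) \<le> vgrid m i"
    by (cases "i < j") (auto intro!: vgrid_mono)
qed (use X k in auto)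

lemma vgrid_isometry_uniform:
  assumes G: "wiener_integral \<sigma> G"
    and X: "\<And>k. k < Suc m \<Longrightarrow> \<xi> k \<in> borel_measurable (F (vgrid m k))"
    and k: "\<And>k s. k < Suc m \<Longrightarrow> vgrid m k \<le> s \<Longrightarrow> s \<le> vgrid m (Suc k) \<Longrightarrow> \<bar>x k * \<sigma> s + \<nu> k\<bar> \<le> \<kappa>"
    and a: "0 \<le> a" "\<And>k. k < Suc m \<Longrightarrow> mean_square M (\<xi> k) \<le> ennreal a"
  shows "mean_square M (\<lambda>z. \<Sum>k<Suc m. \<xi> k z * (x k * (G (vgrid m (Suc k)) z - G (vgrid m k) z) +
        \<nu> k * (B (vgrid m (Suc k)) z - B (vgrid m k) z))) \<le> ennreal (a * \<kappa>\<^sup>2 * t)"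
proof -
  have "mean_square M (\<lambda>z. \<Sum>k<Suc m. \<xi> k z * (x k * (G (vgrid m (Suc k)) z - G (vgrid m k) z) +
        \<nu> k * (B (vgrid m (Suc k)) z - B (vgrid m k) z)))
    \<le> (\<Sum>k<Suc m. mean_square M (\<xi> k) * ennreal (\<kappa>\<^sup>2 * (vgrid m (Suc k) - vgrid m k)))"
    by (rule vgrid_integrator_isometry[OF G X k])
  also have "... \<le> (\<Sum>k<Suc m. ennreal a * ennreal (\<kappa>\<^sup>2 * (vgrid m (Suc k) - vgrid m k)))"
    by (intro sum_mono mult_right_mono a) auto
  also have "... = (\<Sum>k<Suc m. ennreal (a * (\<kappa>\<^sup>2 * (vgrid m (Suc k) - vgrid m k))))"
    using a vgrid_step(1)[of _ m] by (intro sum.cong refl ennreal_mult[symmetric] mult_nonneg_nonneg) (auto simp: less_imp_le)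
  also have "... = ennreal (\<Sum>k<Suc m. a * (\<kappa>\<^sup>2 * (vgrid m (Suc k) - vgrid m k)))"
    using a vgrid_step(1)[of _ m] by (intro sum_ennreal mult_nonneg_nonneg) (auto simp: less_imp_le)
  also have "(\<Sum>k<Suc m. a * (\<kappa>\<^sup>2 * (vgrid m (Suc k) - vgrid m k))) = a * \<kappa>\<^sup>2 * t"
    by (simp only: sum_distrib_left[symmetric] sum_lessThan_telescope) (simp add: vgrid_0 vgrid_end)
  finally show ?thesis .
qed

text \<open>The centred squares of the cell increments are orthogonal with second moments of order
  \<open>V\<^sup>2 / m\<^sup>2\<close>, so their sum over \<open>m\<close> cells vanishes in mean square.\<close>

lemma cell_incr_square_centred:
  assumes X: "X \<in> borel_measurable (F (vgrid m k))" and i: "integrable M X" and k: "k < Suc m"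
  shows "integrable M (\<lambda>z. X z * ((cell_incr m k z)\<^sup>2 - V / real (Suc m)))"
    "expectation (\<lambda>z. X z * ((cell_incr m k z)\<^sup>2 - V / real (Suc m))) = 0"
proof -
  note pk = vgrid(1)[of k m] vgrid(1)[of "Suc k" m] vgrid_step(1)[OF k]
  let ?d = "\<lambda>z. B (vgrid m (Suc k)) z - B (vgrid m k) z"
  let ?q = "\<lambda>y. (cell_coeff m k)\<^sup>2 * y\<^sup>2 - V / real (Suc m)"
  have p: "0 \<le> vgrid m k" "vgrid m k < vgrid m (Suc k)" "vgrid m (Suc k) \<le> t" using pk k by auto
  have "indep_var borel ((\<lambda>x. x) \<circ> X) borel (?q \<circ> ?d)"
    by (rule indep_var_compose[OF F_indep_increment[OF X p]]) auto
  then have ind: "indep_var borel X borel (\<lambda>z. ?q (?d z))" by (simp add: comp_def)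
  have qi: "integrable M (\<lambda>z. ?q (?d z))" using increment_moments(3)[OF p] by simp
  have "expectation (\<lambda>z. ?q (?d z)) = (cell_coeff m k)\<^sup>2 * (vgrid m (Suc k) - vgrid m k) - V / real (Suc m)"
    using increment_moments(2,3)[OF p] by (simp add: prob_space)
  then have q0: "expectation (\<lambda>z. ?q (?d z)) = 0" using cell_coeff_square[OF k] by simp
  have eq: "(cell_incr m k z)\<^sup>2 - V / real (Suc m) = ?q (?d z)" for z
    by (simp add: cell_incr_def power_mult_distrib)
  show "integrable M (\<lambda>z. X z * ((cell_incr m k z)\<^sup>2 - V / real (Suc m)))"
    "expectation (\<lambda>z. X z * ((cell_incr m k z)\<^sup>2 - V / real (Suc m))) = 0"
    unfolding eq using indep_var_integrable[OF ind i qi] indep_var_lebesgue_integral[OF ind i qi] q0 by auto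
qed

lemma cell_incr_fourth_moment:
  assumes k: "k < Suc m"
  shows "integrable M (\<lambda>z. ((cell_incr m k z)\<^sup>2 - V / real (Suc m))\<^sup>2)"
    "expectation (\<lambda>z. ((cell_incr m k z)\<^sup>2 - V / real (Suc m))\<^sup>2) = 2 * (V / real (Suc m))\<^sup>2"
proof -
  note pk = vgrid(1)[of k m] vgrid(1)[of "Suc k" m] vgrid_step(1)[OF k]
  have p: "0 \<le> vgrid m k" "vgrid m k < vgrid m (Suc k)" "vgrid m (Suc k) \<le> t" using pk k by auto
  define \<Delta> where "\<Delta> = vgrid m (Suc k) - vgrid m k"
  have \<Delta>: "0 < \<Delta>" "0 < sqrt \<Delta>" using p by (auto simp: \<Delta>_def)
  let ?d = "\<lambda>z. B (vgrid m (Suc k)) z - B (vgrid m k) z"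
  note D = increment_normal[OF p, folded \<Delta>_def]
  have i4: "integrable M (\<lambda>z. (?d z)^4)"
    using distributed_integrable[OF D, of "\<lambda>x. x^4"] integrable_normal_moment[OF \<Delta>(2), of 0 4] by simp
  have "expectation (\<lambda>z. (?d z)^4) = 3 * \<Delta>\<^sup>2"
    using distributed_integral[OF D, of "\<lambda>x. x^4"] integral_normal_moment_even[OF \<Delta>(2), of 0 2] \<Delta>
    by (simp add: fact_numeral power_divide power4_eq_xxxx power2_eq_square)
  note e4 = this
  note e2 = increment_moments(2,3)[OF p, folded \<Delta>_def]
  let ?c = "cell_coeff m k"
  have c: "?c\<^sup>2 * \<Delta> = V / real (Suc m)" using cell_coeff_square[OF k] by (simp add: \<Delta>_def)
  have eq: "((cell_incr m k z)\<^sup>2 - V / real (Suc m))\<^sup>2 = ?c^4 * (?d z)^4 - 2 * ?c^4 * \<Delta> * (?d z)\<^sup>2 + ?c^4 * \<Delta>\<^sup>2" for z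
    unfolding cell_incr_def c[symmetric] by (simp add: power2_eq_square power4_eq_xxxx algebra_simps)
  show "integrable M (\<lambda>z. ((cell_incr m k z)\<^sup>2 - V / real (Suc m))\<^sup>2)"
    unfolding eq using i4 e2 by simp
  have "expectation (\<lambda>z. ((cell_incr m k z)\<^sup>2 - V / real (Suc m))\<^sup>2) = ?c^4 * (3 * \<Delta>\<^sup>2) - 2 * ?c^4 * \<Delta> * \<Delta> + ?c^4 * \<Delta>\<^sup>2"
    unfolding eq using i4 e2 e4 by (simp add: prob_space)
  also have "... = 2 * (?c\<^sup>2 * \<Delta>)\<^sup>2" by (simp add: power2_eq_square power4_eq_xxxx algebra_simps)
  finally show "expectation (\<lambda>z. ((cell_incr m k z)\<^sup>2 - V / real (Suc m))\<^sup>2) = 2 * (V / real (Suc m))\<^sup>2" unfolding c .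
qed

lemma walk_quadratic_variation:
  "mean_square M (\<lambda>z. (\<Sum>k<Suc m. (cell_incr m k z)\<^sup>2) - V) \<le> ennreal (2 * V\<^sup>2 / real (Suc m))"
proof -
  let ?q = "\<lambda>k z. (cell_incr m k z)\<^sup>2 - V / real (Suc m)"
  have sumV: "(\<Sum>k<Suc m. V / real (Suc m)) = V" by (simp only: sum_constant card_lessThan) simp
  have qm: "?q k \<in> borel_measurable M" if "k < Suc m" for k using cell_incr_measurable[OF that] by simp
  have qi: "integrable M (?q k)" if "k < Suc m" for k
    by (rule square_integrable_imp_integrable[OF qm[OF that] cell_incr_fourth_moment(1)[OF that]])
  have cross': "integrable M (\<lambda>z. ?q i z * ?q j z) \<and> expectation (\<lambda>z. ?q i z * ?q j z) = 0"
    if ij: "i < j" "j < Suc m" for i j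
  proof -
    have "?q i \<in> borel_measurable (F (vgrid m j))"
      using measurable_F_mono[OF cell_incr_adapted[of i m] vgrid_mono[of "Suc i" j m]] ij by auto
    then show ?thesis using cell_incr_square_centred[of "?q i" m j] qi[of i] ij by auto
  qed
  have cross: "integrable M (\<lambda>z. ?q i z * ?q j z) \<and> expectation (\<lambda>z. ?q i z * ?q j z) = (if j = i then 2 * (V / real (Suc m))\<^sup>2 else 0)"
    if ij: "i < Suc m" "j < Suc m" for i j
  proof (cases i j rule: linorder_cases)
    case equal
    then show ?thesis using cell_incr_fourth_moment[OF ij(1)] by (simp add: power2_eq_square)
  next
    case less then show ?thesis using cross'[OF less ij(2)] by simp
  next
    case greater then show ?thesis using cross'[OF greater ij(1)] by (simp add: mult.commute)
  qed
  have eq: "((\<Sum>k<Suc m. (cell_incr m k z)\<^sup>2) - V)\<^sup>2 = (\<Sum>i<Suc m. \<Sum>j<Suc m. ?q i z * ?q j z)" for z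
  proof -
    have "(\<Sum>k<Suc m. (cell_incr m k z)\<^sup>2) - V = (\<Sum>k<Suc m. ?q k z)"
      by (simp only: sum_subtractf sumV)
    then show ?thesis by (simp only: power2_eq_square sum_product)
  qed
  have int: "integrable M (\<lambda>z. ((\<Sum>k<Suc m. (cell_incr m k z)\<^sup>2) - V)\<^sup>2)"
    unfolding eq by (intro Bochner_Integration.integrable_sum) (use cross in auto)
  have "expectation (\<lambda>z. ((\<Sum>k<Suc m. (cell_incr m k z)\<^sup>2) - V)\<^sup>2) = (\<Sum>i<Suc m. expectation (\<lambda>z. \<Sum>j<Suc m. ?q i z * ?q j z))"
    unfolding eq by (rule Bochner_Integration.integral_sum, rule Bochner_Integration.integrable_sum) (use cross in auto)
  also have "... = (\<Sum>i<Suc m. \<Sum>j<Suc m. expectation (\<lambda>z. ?q i z * ?q j z))"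
    by (intro sum.cong refl Bochner_Integration.integral_sum) (use cross in auto)
  also have "... = (\<Sum>i<Suc m. \<Sum>j<Suc m. if j = i then 2 * (V / real (Suc m))\<^sup>2 else 0)"
    by (intro sum.cong refl) (use cross in auto)
  also have "... = (\<Sum>i<Suc m. 2 * (V / real (Suc m))\<^sup>2)" by (intro sum.cong refl) (simp only: sum.delta finite_lessThan if_True)
  also have "... = 2 * V\<^sup>2 / real (Suc m)"
  proof -
    have "n * (2 * (V / n)\<^sup>2) = 2 * V\<^sup>2 / n" if "n \<noteq> 0" for n :: real
      using that by (simp add: power2_eq_square)
    from this[of "real (Suc m)"] show ?thesis by (simp only: sum_constant card_lessThan)
  qed
  finally show ?thesis using nn_integral_eq_integral[OF int] by simp
qed

text \<open>Ito's formula for the square, in the form of sums over the grid. The martingale at the grid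
  points is replaced by the walk and its increments by those of the walk, at
  negligible cost in mean square; for the walk the formula is an algebraic identity.\<close>

lemma ito_square_sum:
  assumes cont: "continuous_on {0..t} \<sigma>" "continuous_on {0..t} e" and h: "\<And>s. s \<in> {0..t} \<Longrightarrow> h s = e s * \<sigma> s"
    and G: "wiener_integral \<sigma> G"
  shows "converges_in_prob M (\<lambda>m z. \<Sum>k<Suc m. N (vgrid m k) z * (e (vgrid m k) * (G (vgrid m (Suc k)) z - G (vgrid m k) z)))
    (\<lambda>z. ((N t z)\<^sup>2 - V) / 2)"
proof -
  let ?p = "vgrid"
  have pr: "?p m k \<in> {0..t}" if "k \<le> Suc m" for m k using vgrid(1)[OF that] .
  have [measurable]: "N t \<in> borel_measurable M" using t_pos by simp
  have [measurable]: "walk m (Suc m) \<in> borel_measurable M" for m by (rule walk_measurable) simp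
  \<comment> \<open>The cost of replacing \<open>N\<close> by the walk, and of replacing the increments of \<open>G\<close> by those of the walk.\<close>
  let ?A = "\<lambda>m z. \<Sum>k<Suc m. (N (?p m k) z - walk m k z) * (e (?p m k) * (G (?p m (Suc k)) z - G (?p m k) z) + 0 * (B (?p m (Suc k)) z - B (?p m k) z))"
  let ?C = "\<lambda>m z. \<Sum>k<Suc m. walk m k z * (e (?p m k) * (G (?p m (Suc k)) z - G (?p m k) z) + - cell_coeff m k * (B (?p m (Suc k)) z - B (?p m k) z))"
  let ?Q = "\<lambda>m z. \<Sum>k<Suc m. (cell_incr m k z)\<^sup>2"
  have meas: "N (?p m k) \<in> borel_measurable M" "walk m k \<in> borel_measurable M" "G (?p m k) \<in> borel_measurable M" "B (?p m k) \<in> borel_measurable M"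
    if "k \<le> Suc m" for m k
    using pr[OF that] walk_measurable[OF that] wiener_integral_measurable[OF G] by auto
  have Am: "?A m \<in> borel_measurable M" for m
    by (intro borel_measurable_sum borel_measurable_times borel_measurable_diff borel_measurable_add borel_measurable_const meas) auto
  have Cm: "?C m \<in> borel_measurable M" for m
    by (intro borel_measurable_sum borel_measurable_times borel_measurable_diff borel_measurable_add borel_measurable_const meas) auto
  have Qm: "?Q m \<in> borel_measurable M" for m
    by (intro borel_measurable_sum borel_measurable_power cell_incr_measurable) auto
  obtain \<sigma>0 where \<sigma>0: "0 < \<sigma>0" "\<And>s. s \<in> {0..t} \<Longrightarrow> \<bar>\<sigma> s\<bar> \<le> \<sigma>0"
    using compact_imp_bounded[OF compact_continuous_image[OF cont(1) compact_Icc]]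
    unfolding bounded_pos by auto
  obtain e0 where e0: "0 < e0" "\<And>s. s \<in> {0..t} \<Longrightarrow> \<bar>e s\<bar> \<le> e0"
    using compact_imp_bounded[OF compact_continuous_image[OF cont(2) compact_Icc]]
    unfolding bounded_pos by auto
  have walkF: "walk m k \<in> borel_measurable (F (?p m k))" if "k < Suc m" for m k
    using walk_adapted[of k m] that by simp
  have A0: "converges_in_prob M ?A (\<lambda>_. 0)"
  proof (rule converges_in_prob_L2_eventually)
    fix \<epsilon> :: real assume eps: "0 < \<epsilon>"
    define a where "a = \<epsilon> / ((e0 * \<sigma>0)\<^sup>2 * t)"
    have a: "0 < a" "a * (e0 * \<sigma>0)\<^sup>2 * t = \<epsilon>" using eps e0 \<sigma>0 t_pos by (auto simp: a_def)
    from walk_approximates[OF a(1)]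
    show "eventually (\<lambda>m. mean_square M (\<lambda>z. ?A m z - 0) \<le> ennreal \<epsilon>) sequentially"
    proof eventually_elim
      case (elim m)
      have "mean_square M (?A m) \<le> ennreal (a * (e0 * \<sigma>0)\<^sup>2 * t)"
      proof (rule vgrid_isometry_uniform[OF G])
        fix k assume k: "k < Suc m"
        show "(\<lambda>z. N (?p m k) z - walk m k z) \<in> borel_measurable (F (?p m k))"
          using N_adapted[OF pr[of k m]] walkF[OF k] k by (intro borel_measurable_diff) auto
        show "mean_square M (\<lambda>z. N (?p m k) z - walk m k z) \<le> ennreal a" using elim k by auto
        fix s assume s: "?p m k \<le> s" "s \<le> ?p m (Suc k)"
        have "\<bar>e (?p m k)\<bar> * \<bar>\<sigma> s\<bar> \<le> e0 * \<sigma>0"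
          by (intro mult_mono e0 \<sigma>0) (use s pr[of k m] pr[of "Suc k" m] k e0 in auto)
        then show "\<bar>e (?p m k) * \<sigma> s + 0\<bar> \<le> e0 * \<sigma>0" by (simp add: abs_mult)
      qed (use a in auto)
      then show ?case using a(2) by simp
    qed
  qed (use Am in auto)
  have C0: "converges_in_prob M ?C (\<lambda>_. 0)"
  proof (rule converges_in_prob_L2_eventually)
    fix \<epsilon> :: real assume eps: "0 < \<epsilon>"
    define \<kappa> where "\<kappa> = sqrt (\<epsilon> / (V * t))"
    have \<kappa>: "0 < \<kappa>" "V * \<kappa>\<^sup>2 * t = \<epsilon>" using eps V_pos t_pos by (auto simp: \<kappa>_def)
    have k1: "0 < \<kappa> / 2 / \<sigma>0" and k2: "0 < \<kappa> / 2" using \<kappa> \<sigma>0 by auto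
    from vgrid_oscillation[OF cont(2) k1] cell_coeff_close[OF k2]
    show "eventually (\<lambda>m. mean_square M (\<lambda>z. ?C m z - 0) \<le> ennreal \<epsilon>) sequentially"
    proof eventually_elim
      case (elim m)
      have "mean_square M (?C m) \<le> ennreal (V * \<kappa>\<^sup>2 * t)"
      proof (rule vgrid_isometry_uniform[OF G walkF])
        fix k assume k: "k < Suc m"
        show "mean_square M (walk m k) \<le> ennreal V" by (rule walk_second_moment_le) (use k in simp)
        fix s assume s: "?p m k \<le> s" "s \<le> ?p m (Suc k)"
        have st: "s \<in> {0..t}" using s pr[of k m] pr[of "Suc k" m] k by auto
        have "\<bar>e (?p m k) - e s\<bar> \<le> \<kappa> / 2 / \<sigma>0" using elim(1) k s by auto
        then have "\<bar>e (?p m k) - e s\<bar> * \<bar>\<sigma> s\<bar> \<le> \<kappa> / 2 / \<sigma>0 * \<sigma>0"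
          by (intro mult_mono \<sigma>0 st) (use k1 in auto)
        then have "\<bar>e (?p m k) * \<sigma> s - h s\<bar> \<le> \<kappa> / 2"
          using \<sigma>0(1) by (simp add: h[OF st] abs_mult[symmetric] left_diff_distrib)
        moreover have "\<bar>h s - cell_coeff m k\<bar> \<le> \<kappa> / 2" using elim(2) k s by auto
        ultimately show "\<bar>e (?p m k) * \<sigma> s + - cell_coeff m k\<bar> \<le> \<kappa>" by linarith
      qed (use V_pos in auto)
      then show ?case using \<kappa>(2) by simp
    qed
  qed (use Cm in auto)
  have Q0: "converges_in_prob M ?Q (\<lambda>_. V)"
  proof (rule converges_in_prob_L2)
    show "(\<lambda>m. 2 * V\<^sup>2 / real (Suc m)) \<longlonglongrightarrow> 0"
      using tendsto_mult_right_zero[OF LIMSEQ_inverse_real_of_nat, of "2 * V\<^sup>2"] by (simp add: field_simps)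
    show "eventually (\<lambda>m. mean_square M (\<lambda>z. ?Q m z - V) \<le> ennreal (2 * V\<^sup>2 / real (Suc m))) sequentially"
      by (rule always_eventually, rule allI, rule walk_quadratic_variation)
  qed (use Qm in auto)
  have "converges_in_prob M (\<lambda>m z. (walk m (Suc m) z)\<^sup>2 - ?Q m z) (\<lambda>z. (N t z)\<^sup>2 - V)"
    by (rule converges_in_prob_diff[OF _ _ _ _ walk_square_converges Q0]) (use Qm in auto)
  then have W1: "converges_in_prob M (\<lambda>m z. 1/2 * ((walk m (Suc m) z)\<^sup>2 - ?Q m z)) (\<lambda>z. 1/2 * ((N t z)\<^sup>2 - V))"
    by (rule converges_in_prob_cmult[rotated 2]) (use Qm in \<open>auto simp del: sum.lessThan_Suc\<close>)
  have AC: "converges_in_prob M (\<lambda>m z. ?A m z + ?C m z) (\<lambda>_. 0 + 0)"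
    by (rule converges_in_prob_add[OF Am _ Cm _ A0 C0]) auto
  have ACm: "(\<lambda>z. ?A m z + ?C m z) \<in> borel_measurable M" for m by (rule borel_measurable_add[OF Am Cm])
  have W1m: "(\<lambda>z. 1/2 * ((walk m (Suc m) z)\<^sup>2 - ?Q m z)) \<in> borel_measurable M" for m
    using Qm[of m] by (simp del: sum.lessThan_Suc)
  have "converges_in_prob M (\<lambda>m z. (?A m z + ?C m z) + 1/2 * ((walk m (Suc m) z)\<^sup>2 - ?Q m z)) (\<lambda>z. (0 + 0) + 1/2 * ((N t z)\<^sup>2 - V))"
    by (rule converges_in_prob_add[OF ACm _ W1m _ AC W1]) auto
  moreover have "(?A m z + ?C m z) + 1/2 * ((walk m (Suc m) z)\<^sup>2 - ?Q m z) =
      (\<Sum>k<Suc m. N (vgrid m k) z * (e (vgrid m k) * (G (vgrid m (Suc k)) z - G (vgrid m k) z)))" for m z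
  proof -
    have "(\<Sum>k<n. walk m k z * cell_incr m k z) = 1/2 * ((walk m n z)\<^sup>2 - (\<Sum>k<n. (cell_incr m k z)\<^sup>2))" for n
      by (induction n) (simp_all add: walk_def power2_sum algebra_simps)
    from this[of "Suc m", symmetric] show ?thesis
      by (simp only:) (simp add: sum.distrib[symmetric] cell_incr_def algebra_simps del: sum.lessThan_Suc)
  qed
  ultimately show ?thesis by (simp only:) simp
qed

end

section \<open>Pathwise integrals of continuous processes\<close>

lemma LBINT_eq_integral:
  fixes f :: "real \<Rightarrow> real"
  assumes "continuous_on {a..b} f"
  shows "(LBINT s:{a..b}. f s) = integral {a..b} f"
  by (rule set_borel_integral_eq_integral(2)[OF borel_integrable_atLeastAtMost'[OF assms]])

lemma nn_integral_eq_integral_Icc: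
  fixes f :: "real \<Rightarrow> real"
  assumes f: "continuous_on {a..b} f" and pos: "\<And>s. s \<in> {a..b} \<Longrightarrow> 0 \<le> f s"
  shows "(\<integral>\<^sup>+s. ennreal (indicator {a..b} s * f s) \<partial>lborel) = ennreal (integral {a..b} f)"
proof -
  have i: "integrable lborel (\<lambda>s. indicator {a..b} s * f s)"
    using borel_integrable_atLeastAtMost'[OF f] by (simp add: set_integrable_def)
  have "(\<integral>\<^sup>+s. ennreal (indicator {a..b} s * f s) \<partial>lborel) = ennreal (LBINT s. indicator {a..b} s * f s)"
    by (rule nn_integral_eq_integral[OF i]) (auto simp: indicator_def pos)
  then show ?thesis using LBINT_eq_integral[OF f] by (simp add: set_lebesgue_integral_def)
qed

lemma integral_partition:
  fixes f :: "real \<Rightarrow> real"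
  assumes g0: "g 0 = 0" and k: "k \<le> m" and f: "continuous_on {0..t} f"
    and g: "\<And>i. i < m \<Longrightarrow> g i < g (Suc i)" "\<And>i. i \<le> m \<Longrightarrow> g i \<in> {0..t}"
  shows "integral {0..g k} f = (\<Sum>i<k. integral {g i..g (Suc i)} f)"
  using k
proof (induction k)
  case (Suc k)
  have "integral {0..g k} f + integral {g k..g (Suc k)} f = integral {0..g (Suc k)} f"
    by (rule Henstock_Kurzweil_Integration.integral_combine)
      (use g(2)[of k] g(2)[of "Suc k"] g(1)[of k] Suc.prems in \<open>auto intro!: integrable_continuous_real continuous_on_subset[OF f]\<close>)
  then show ?case using Suc by simp
qed (simp add: g0)

lemma project_in: "a \<le> b \<Longrightarrow> project a b s \<in> {a..b}"
  by (auto simp: project_def)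

lemma project_id: "s \<in> {a..b} \<Longrightarrow> project a b s = s"
  by (auto simp: project_def)

context prob_space
begin

text \<open>By continuity in time, the process is the limit of its values at the times rounded down to
  multiples of \<open>1 / (n + 1)\<close>. The projection extends it to all times.\<close>

lemma continuous_process_measurable:
  fixes \<Phi> :: "real \<Rightarrow> 'a \<Rightarrow> real"
  assumes ab: "a \<le> b" and m: "\<And>s. s \<in> {a..b} \<Longrightarrow> \<Phi> s \<in> borel_measurable M"
    and c: "\<And>z. z \<in> space M \<Longrightarrow> continuous_on {a..b} (\<lambda>s. \<Phi> s z)"
  shows "(\<lambda>(s, z). \<Phi> (project a b s) z) \<in> borel_measurable (lborel \<Otimes>\<^sub>M M)"
proof (rule borel_measurable_LIMSEQ_real[where u="\<lambda>n (s, z). \<Phi> (project a b (real_of_int \<lfloor>real (Suc n) * s\<rfloor> / real (Suc n))) z"])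
  let ?q = "\<lambda>n x. real_of_int \<lfloor>real (Suc n) * x\<rfloor> / real (Suc n)"
  fix p :: "real \<times> 'a" assume p: "p \<in> space (lborel \<Otimes>\<^sub>M M)"
  obtain s z where p_eq: "p = (s, z)" "z \<in> space M" using p by (cases p) (auto simp: space_pair_measure)
  have "(\<lambda>n. ?q n s) \<longlonglongrightarrow> s"
  proof (rule tendsto_sandwich[where f="\<lambda>n. s - 1 / real (Suc n)" and h="\<lambda>_. s"])
    have "s - 1 / real (Suc n) \<le> ?q n s" for n
    proof -
      have "real (Suc n) * s - 1 \<le> real_of_int \<lfloor>real (Suc n) * s\<rfloor>" by linarith
      then have "(real (Suc n) * s - 1) / real (Suc n) \<le> ?q n s" by (rule divide_right_mono) simp
      moreover have "(real (Suc n) * s - 1) / real (Suc n) = s - 1 / real (Suc n)"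
        by (simp only: diff_divide_distrib) simp
      ultimately show ?thesis by simp
    qed
    then show "eventually (\<lambda>n. s - 1 / real (Suc n) \<le> ?q n s) sequentially" by simp
    have "?q n s \<le> s" for n
    proof -
      have "real_of_int \<lfloor>real (Suc n) * s\<rfloor> \<le> real (Suc n) * s" by linarith
      then have "?q n s \<le> (real (Suc n) * s) / real (Suc n)" by (rule divide_right_mono) simp
      then show ?thesis by (simp del: of_nat_Suc)
    qed
    then show "eventually (\<lambda>n. ?q n s \<le> s) sequentially" by simp
    show "(\<lambda>n. s - 1 / real (Suc n)) \<longlonglongrightarrow> s"
      using tendsto_diff[OF tendsto_const[of s] LIMSEQ_inverse_real_of_nat] by (simp add: field_simps)
  qed simp
  then have "(\<lambda>n. project a b (?q n s)) \<longlonglongrightarrow> project a b s" unfolding project_def by (intro tendsto_intros)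
  then have "(\<lambda>n. \<Phi> (project a b (?q n s)) z) \<longlonglongrightarrow> \<Phi> (project a b s) z"
    by (rule continuous_on_tendsto_compose[OF c[OF p_eq(2)]]) (auto intro!: project_in ab always_eventually simp del: atLeastAtMost_iff)
  then show "(\<lambda>n. (\<lambda>(s, z). \<Phi> (project a b (?q n s)) z) p) \<longlonglongrightarrow> (\<lambda>(s, z). \<Phi> (project a b s) z) p"
    by (simp add: p_eq)
next
  fix n
  have "(\<lambda>p. (\<lambda>i p. \<Phi> (project a b (real_of_int i / real (Suc n))) (snd p)) (\<lfloor>real (Suc n) * fst p\<rfloor>) p) \<in> borel_measurable (lborel \<Otimes>\<^sub>M M)"
  proof (rule measurable_compose_countable[where f="\<lambda>i p. \<Phi> (project a b (real_of_int i / real (Suc n))) (snd p)"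
        and g="\<lambda>p. \<lfloor>real (Suc n) * fst p\<rfloor>"])
    fix i :: int
    show "(\<lambda>p. \<Phi> (project a b (real_of_int i / real (Suc n))) (snd p)) \<in> borel_measurable (lborel \<Otimes>\<^sub>M M)"
      by (rule measurable_compose[OF measurable_snd m[OF project_in[OF ab]]])
  next
    have "(\<lambda>p. real (Suc n) * fst p) \<in> borel_measurable (lborel \<Otimes>\<^sub>M M)" by measurable
    then show "(\<lambda>p. \<lfloor>real (Suc n) * fst p\<rfloor>) \<in> measurable (lborel \<Otimes>\<^sub>M M) (count_space UNIV)"
      by measurable
  qed
  then show "(\<lambda>(s, z). \<Phi> (project a b (real_of_int \<lfloor>real (Suc n) * s\<rfloor> / real (Suc n))) z) \<in> borel_measurable (lborel \<Otimes>\<^sub>M M)"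
    by (simp add: split_def)
qed

lemma integral_process_measurable:
  fixes \<Phi> :: "real \<Rightarrow> 'a \<Rightarrow> real"
  assumes ab: "a \<le> b" and m: "\<And>s. s \<in> {a..b} \<Longrightarrow> \<Phi> s \<in> borel_measurable M"
    and c: "\<And>z. z \<in> space M \<Longrightarrow> continuous_on {a..b} (\<lambda>s. \<Phi> s z)"
  shows "(\<lambda>z. integral {a..b} (\<lambda>s. \<Phi> s z)) \<in> borel_measurable M"
proof -
  have *: "(\<lambda>(s, z). \<Phi> (project a b s) z) \<in> borel_measurable (lborel \<Otimes>\<^sub>M M)"
    by (rule continuous_process_measurable[OF ab m c])
  have "(\<lambda>(z, s). (\<lambda>(s, z). \<Phi> (project a b s) z) (s, z)) \<in> borel_measurable (M \<Otimes>\<^sub>M lborel)"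
    using measurable_compose[OF measurable_pair_swap' *] by (simp add: split_def)
  then have "(\<lambda>(z, s). indicator {a..b} s *\<^sub>R \<Phi> (project a b s) z) \<in> borel_measurable (M \<Otimes>\<^sub>M lborel)"
    by (simp add: split_def)
  then have "(\<lambda>z. LBINT s. indicator {a..b} s *\<^sub>R \<Phi> (project a b s) z) \<in> borel_measurable M"
    by (rule lborel.borel_measurable_lebesgue_integral)
  moreover have "(LBINT s. indicator {a..b} s *\<^sub>R \<Phi> (project a b s) z) = integral {a..b} (\<lambda>s. \<Phi> s z)" if "z \<in> space M" for z
  proof -
    have "(LBINT s. indicator {a..b} s *\<^sub>R \<Phi> (project a b s) z) = (LBINT s:{a..b}. \<Phi> s z)"
      unfolding set_lebesgue_integral_def by (intro Bochner_Integration.integral_cong refl) (auto simp: indicator_def project_id)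
    then show ?thesis using LBINT_eq_integral[OF c[OF that]] by simp
  qed
  ultimately show ?thesis by (simp cong: measurable_cong)
qed

text \<open>Tonelli's theorem interchanges expectation and integration.\<close>

lemma expected_integral_le:
  fixes \<Phi> :: "real \<Rightarrow> 'a \<Rightarrow> real"
  assumes ab: "a \<le> b" and m: "\<And>s. s \<in> {a..b} \<Longrightarrow> \<Phi> s \<in> borel_measurable M"
    and c: "\<And>z. z \<in> space M \<Longrightarrow> continuous_on {a..b} (\<lambda>s. \<Phi> s z)"
    and pos: "\<And>s z. s \<in> {a..b} \<Longrightarrow> z \<in> space M \<Longrightarrow> 0 \<le> \<Phi> s z"
    and g: "continuous_on {a..b} g" "\<And>s. s \<in> {a..b} \<Longrightarrow> 0 \<le> g s"
    and k: "0 \<le> k" "\<And>s. s \<in> {a..b} \<Longrightarrow> nn_mean M (\<Phi> s) \<le> ennreal k"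
  shows "nn_mean M (\<lambda>z. integral {a..b} (\<lambda>s. g s * \<Phi> s z)) \<le> ennreal (k * integral {a..b} g)"
proof -
  interpret P: pair_sigma_finite lborel M
    by (rule pair_sigma_finite.intro) (rule lborel.sigma_finite_measure_axioms sigma_finite_measure_axioms)+
  let ?f = "\<lambda>s z. indicator {a..b} s * (g s * \<Phi> (project a b s) z)"
  have gm: "(\<lambda>s. indicator {a..b} s * g s) \<in> borel_measurable lborel"
    using borel_integrable_atLeastAtMost'[OF g(1)] by (auto simp: set_integrable_def intro: borel_measurable_integrable)
  have fm: "(\<lambda>p. ennreal (?f (fst p) (snd p))) \<in> borel_measurable (lborel \<Otimes>\<^sub>M M)"
  proof -
    have "(\<lambda>p. (\<lambda>s. indicator {a..b} s * g s) (fst p) * (\<lambda>(s, z). \<Phi> (project a b s) z) p) \<in> borel_measurable (lborel \<Otimes>\<^sub>M M)"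
      by (rule borel_measurable_times[OF measurable_compose[OF measurable_fst gm] continuous_process_measurable[OF ab m c]])
    then show ?thesis by (simp add: split_def mult.assoc)
  qed
  have "nn_mean M (\<lambda>z. integral {a..b} (\<lambda>s. g s * \<Phi> s z)) = (\<integral>\<^sup>+z. (\<integral>\<^sup>+s. ennreal (?f s z) \<partial>lborel) \<partial>M)"
  proof (rule nn_integral_cong)
    fix z assume w: "z \<in> space M"
    have "(\<integral>\<^sup>+s. ennreal (?f s z) \<partial>lborel) = (\<integral>\<^sup>+s. ennreal (indicator {a..b} s * (g s * \<Phi> s z)) \<partial>lborel)"
      by (intro nn_integral_cong) (auto simp: indicator_def project_id)
    also have "... = ennreal (integral {a..b} (\<lambda>s. g s * \<Phi> s z))"
      by (rule nn_integral_eq_integral_Icc) (use w g c pos in \<open>auto intro!: continuous_intros\<close>)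
    finally show "ennreal (integral {a..b} (\<lambda>s. g s * \<Phi> s z)) = (\<integral>\<^sup>+s. ennreal (?f s z) \<partial>lborel)" ..
  qed
  also have "... = (\<integral>\<^sup>+s. nn_mean M (?f s) \<partial>lborel)"
    by (rule P.Fubini') (use fm in \<open>simp add: split_def\<close>)
  also have "... \<le> (\<integral>\<^sup>+s. ennreal (indicator {a..b} s * (k * g s)) \<partial>lborel)"
  proof (rule nn_integral_mono)
    fix s :: real
    show "nn_mean M (?f s) \<le> ennreal (indicator {a..b} s * (k * g s))"
    proof (cases "s \<in> {a..b}")
      case True
      have "nn_mean M (?f s) = (\<integral>\<^sup>+z. ennreal (g s) * ennreal (\<Phi> s z) \<partial>M)"
        using True pos g(2)[OF True] by (intro nn_integral_cong) (auto simp: project_id ennreal_mult)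
      also have "... = ennreal (g s) * nn_mean M (\<Phi> s)" using m[OF True] by (intro nn_integral_cmult) simp
      also have "... \<le> ennreal (g s) * ennreal k" by (intro mult_left_mono k True) simp
      also have "... = ennreal (indicator {a..b} s * (k * g s))" using True g(2)[OF True] k by (simp add: ennreal_mult mult.commute)
      finally show ?thesis .
    qed simp
  qed
  also have "... = ennreal (integral {a..b} (\<lambda>s. k * g s))"
    by (rule nn_integral_eq_integral_Icc) (use g k in \<open>auto intro!: continuous_intros\<close>)
  finally show ?thesis by simp
qed

end

text \<open>The integral of \<open>g (x - f)\<^sup>2\<close> is a nonnegative quadratic polynomial in \<open>x\<close>.\<close>

lemma integral_Cauchy_Schwarz:
  fixes g f :: "real \<Rightarrow> real"
  assumes g: "continuous_on {a..b} g" "\<And>s. s \<in> {a..b} \<Longrightarrow> 0 \<le> g s" and f: "continuous_on {a..b} f"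
  shows "(integral {a..b} (\<lambda>s. g s * f s))\<^sup>2 \<le> integral {a..b} g * integral {a..b} (\<lambda>s. g s * (f s)\<^sup>2)"
proof -
  let ?I = "integral {a..b} (\<lambda>s. g s * f s)" and ?J = "integral {a..b} g" and ?K = "integral {a..b} (\<lambda>s. g s * (f s)\<^sup>2)"
  have i: "g integrable_on {a..b}" "(\<lambda>s. g s * f s) integrable_on {a..b}" "(\<lambda>s. g s * (f s)\<^sup>2) integrable_on {a..b}"
    by (intro integrable_continuous_real continuous_intros g f)+
  have q: "0 \<le> x\<^sup>2 * ?J - 2 * x * ?I + ?K" for x
  proof -
    have "0 \<le> integral {a..b} (\<lambda>s. g s * (x - f s)\<^sup>2)"
      by (rule integral_nonneg) (use g f in \<open>auto intro!: integrable_continuous_real continuous_intros\<close>)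
    also have "(\<lambda>s. g s * (x - f s)\<^sup>2) = (\<lambda>s. (x\<^sup>2 * g s - (2 * x) * (g s * f s)) + g s * (f s)\<^sup>2)"
      by (rule ext) (simp add: power2_eq_square algebra_simps)
    also have "integral {a..b} ... = (x\<^sup>2 * ?J - 2 * x * ?I) + ?K"
      by (subst Henstock_Kurzweil_Integration.integral_add, intro Henstock_Kurzweil_Integration.integrable_diff integrable_on_mult_right i, rule i,
        subst Henstock_Kurzweil_Integration.integral_diff, (intro integrable_on_mult_right i)+, simp)
    finally show ?thesis by simp
  qed
  have J: "0 \<le> ?J" by (rule integral_nonneg[OF i(1)]) (use g in auto)
  show ?thesis
  proof (cases "?J = 0")
    case True
    have "?I = 0"
    proof (rule ccontr)
      assume I: "?I \<noteq> 0"
      have "2 * ((?K + 1) / (2 * ?I)) * ?I = ?K + 1" using I by simp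
      then show False using q[of "(?K + 1) / (2 * ?I)"] True by simp
    qed
    then show ?thesis using True by simp
  next
    case False
    then have Jp: "0 < ?J" using J by simp
    have "0 \<le> ?K - ?I\<^sup>2 / ?J" using q[of "?I / ?J"] False by (simp add: power2_eq_square field_simps)
    then show ?thesis using Jp by (simp add: field_simps)
  qed
qed

text \<open>The right-hand side of the assumption, discounted by \<open>exp(- \<integral> w)\<close>, is nonincreasing.\<close>

lemma gronwall:
  fixes \<phi> w :: "real \<Rightarrow> real"
  assumes t: "0 \<le> t" and \<phi>: "continuous_on {0..t} \<phi>" and w: "continuous_on {0..t} w" "\<And>s. s \<in> {0..t} \<Longrightarrow> 0 \<le> w s"
    and le: "\<And>s. s \<in> {0..t} \<Longrightarrow> \<phi> s \<le> A + integral {0..s} (\<lambda>x. w x * \<phi> x)"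
  shows "\<phi> t \<le> A * exp (integral {0..t} w)"
proof -
  let ?P = "\<lambda>s. A + integral {0..s} (\<lambda>x. w x * \<phi> x)" and ?W = "\<lambda>s. integral {0..s} w"
  have dP: "(?P has_real_derivative w s * \<phi> s) (at s within {0..t})" if "s \<in> {0..t}" for s
    using DERIV_add[OF DERIV_const[of A] integral_has_real_derivative[OF continuous_on_mult[OF w(1) \<phi>] that]] by simp
  have dW: "(?W has_real_derivative w s) (at s within {0..t})" if "s \<in> {0..t}" for s
    by (rule integral_has_real_derivative[OF w(1) that])
  have dQ: "((\<lambda>s. ?P s * exp (- ?W s)) has_real_derivative exp (- ?W s) * w s * (\<phi> s - ?P s)) (at s within {0..t})"
    if s: "s \<in> {0..t}" for s
    by (rule derivative_eq_intros dP[OF s] dW[OF s] refl)+ (simp add: algebra_simps)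
  have "?P t * exp (- ?W t) \<le> ?P 0 * exp (- ?W 0)"
  proof (rule DERIV_nonpos_imp_decreasing_open[OF t])
    fix s assume s: "0 < s" "s < t"
    have "((\<lambda>s. ?P s * exp (- ?W s)) has_real_derivative exp (- ?W s) * w s * (\<phi> s - ?P s)) (at s)"
      using dQ[of s] s at_within_interior[of s "{0..t}"] by (simp add: interior_atLeastAtMost_real)
    moreover have "exp (- ?W s) * w s * (\<phi> s - ?P s) \<le> 0"
      using le[of s] w(2)[of s] s by (intro mult_nonneg_nonpos) auto
    ultimately show "\<exists>y. ((\<lambda>s. ?P s * exp (- ?W s)) has_real_derivative y) (at s) \<and> y \<le> 0" by blast
  next
    show "continuous_on {0..t} (\<lambda>s. ?P s * exp (- ?W s))" by (rule DERIV_continuous_on[OF dQ])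
  qed
  then have "?P t \<le> A * exp (?W t)" by (simp add: exp_minus field_simps)
  moreover have "\<phi> t \<le> ?P t" using le[of t] t by simp
  ultimately show ?thesis by linarith
qed

section \<open>Discounting a Wiener integral\<close>

context wiener_on
begin

text \<open>Integration by parts: multiplying \<open>G\<close> by \<open>e\<close>, where \<open>e = - w e\<close>, and adding the
  absolutely continuous correction gives the Wiener integral with integrand \<open>e \<sigma>\<close>. For sums, this
  is Abel's summation formula.\<close>

lemma wiener_integral_discounted:
  assumes G: "wiener_integral \<sigma> G" and \<sigma>: "continuous_on {0..t} \<sigma>"
    and Gc: "\<And>z. z \<in> space M \<Longrightarrow> continuous_on {0..t} (\<lambda>s. G s z)"
    and w: "continuous_on {0..t} w" and e: "\<And>s. s \<in> {0..t} \<Longrightarrow> (e has_real_derivative - (w s * e s)) (at s within {0..t})"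
    and Nm: "\<And>s. s \<in> {0..t} \<Longrightarrow> N s \<in> borel_measurable M"
    and N: "\<And>s. s \<in> {0..t} \<Longrightarrow> AE z in M. N s z = e s * G s z + integral {0..s} (\<lambda>x. w x * e x * G x z)"
  shows "wiener_integral (\<lambda>s. e s * \<sigma> s) N"
  unfolding wiener_integral_def
proof (intro conjI ballI allI impI Nm)
  fix \<epsilon> :: real assume eps: "0 < \<epsilon>"
  have ec: "continuous_on {0..t} e" by (rule DERIV_continuous_on[OF e])
  have wec: "continuous_on {0..t} (\<lambda>x. w x * e x)" by (intro continuous_intros w ec)
  have bounded: "\<exists>c>0. \<forall>s\<in>{0..t}. \<bar>f s\<bar> \<le> c" if "continuous_on {0..t} f" for f :: "real \<Rightarrow> real"
    using compact_imp_bounded[OF compact_continuous_image[OF that compact_Icc]] unfolding bounded_pos by auto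
  obtain e0 where e0: "0 < e0" "\<And>s. s \<in> {0..t} \<Longrightarrow> \<bar>e s\<bar> \<le> e0" using bounded[OF ec] by blast
  obtain c0 where c0: "0 < c0" "\<And>s. s \<in> {0..t} \<Longrightarrow> \<bar>w s * e s\<bar> \<le> c0" using bounded[OF wec] by blast
  obtain \<sigma>0 where \<sigma>0: "0 < \<sigma>0" "\<And>s. s \<in> {0..t} \<Longrightarrow> \<bar>\<sigma> s\<bar> \<le> \<sigma>0" using bounded[OF \<sigma>] by blast
  define C where "C = 2 * e0\<^sup>2 + 2 * (t\<^sup>2 * c0\<^sup>2 * 4)"
  have C: "0 < C" unfolding C_def using e0 c0 by (intro add_pos_nonneg) auto
  define \<eta> where "\<eta> = \<epsilon> / C"
  have \<eta>: "0 < \<eta>" "\<eta> * C = \<epsilon>" using eps C by (auto simp: \<eta>_def)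
  from wiener_integralD[OF G \<eta>(1)] obtain \<delta>0 where \<delta>0: "0 < \<delta>0" and
    bnd: "\<forall>s n p. 0 \<le> s \<longrightarrow> s \<le> t \<longrightarrow> p 0 = 0 \<longrightarrow> p n = s \<longrightarrow> (\<forall>i<n. p i < p (Suc i) \<and> p (Suc i) - p i < \<delta>0) \<longrightarrow>
      mean_square M (\<lambda>z. G s z - B_sum \<sigma> p n z) \<le> ennreal \<eta>"
    by (elim exE conjE)
  define \<delta> where "\<delta> = min \<delta>0 (\<eta> / \<sigma>0\<^sup>2)"
  have \<delta>: "0 < \<delta>" "\<delta> \<le> \<delta>0" "\<sigma>0\<^sup>2 * \<delta> \<le> \<eta>"
    using \<delta>0 \<eta> \<sigma>0 by (auto simp: \<delta>_def min_def field_simps)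
  show "\<exists>\<delta>>0. \<forall>s\<in>{0..t}. \<forall>n p. p 0 = 0 \<and> p n = s \<and> (\<forall>i<n. p i < p (Suc i) \<and> p (Suc i) - p i < \<delta>) \<longrightarrow>
      mean_square M (\<lambda>z. N s z - B_sum (\<lambda>s. e s * \<sigma> s) p n z) \<le> ennreal \<epsilon>"
  proof (intro exI[of _ \<delta>] conjI \<delta>(1) ballI allI impI; elim conjE)
    fix s n and p :: "nat \<Rightarrow> real"
    assume s: "s \<in> {0..t}" and p0: "p 0 = 0" and pn: "p n = s" and p: "\<forall>i<n. p i < p (Suc i) \<and> p (Suc i) - p i < \<delta>"
    have pr: "p i \<in> {0..s}" if "i \<le> n" for i
      using strict_grid_le[of n p 0 i] strict_grid_le[of n p i n] that p p0 pn by auto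
    have pt: "p i \<in> {0..t}" if "i \<le> n" for i using pr[OF that] s by auto
    define S where "S k z = B_sum \<sigma> p k z" for k z
    have Bm: "B (p i) \<in> borel_measurable M" if "i \<le> n" for i using pt[OF that] by simp
    have Sm: "S k \<in> borel_measurable M" if "k \<le> n" for k
      unfolding S_def[abs_def] using that by (intro borel_measurable_sum borel_measurable_times borel_measurable_diff Bm) auto
    have Gm: "G x \<in> borel_measurable M" if "x \<in> {0..t}" for x using wiener_integral_measurable[OF G] that by simp
    have SG: "mean_square M (\<lambda>z. G (p k) z - S k z) \<le> ennreal \<eta>" if k: "k \<le> n" for k
      unfolding S_def
    proof (rule bnd[rule_format])
      fix i assume "i < k"
      then have "p i < p (Suc i)" "p (Suc i) - p i < \<delta>" using p k by auto
      then show "p i < p (Suc i) \<and> p (Suc i) - p i < \<delta>0" using \<delta>(2) by linarith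
    qed (use pt[OF k] p0 in auto)
    \<comment> \<open>Inside a cell, \<open>G x\<close> is close to the sum over a partition ending at \<open>x\<close>, and one increment is missing.\<close>
    have close: "mean_square M (\<lambda>z. G x z - S (Suc j) z) \<le> ennreal (4 * \<eta>)"
      if j: "j < n" and x: "x \<in> {p j..p (Suc j)}" for j x
    proof -
      have xt: "0 \<le> x" "x \<le> t" using x pt[of j] pt[of "Suc j"] j by auto
      let ?T = "\<lambda>z. S j z + \<sigma> (p j) * (B x z - B (p j) z)"
      have Tm: "?T \<in> borel_measurable M"
        using j xt by (intro borel_measurable_add Sm borel_measurable_times borel_measurable_diff Bm B_measurable') auto
      have 1: "mean_square M (\<lambda>z. G x z - ?T z) \<le> ennreal \<eta>"
      proof (cases "x = p j")
        case True
        then show ?thesis using SG[of j] j by simp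
      next
        case False
        let ?p = "p(Suc j := x)"
        have "mean_square M (\<lambda>z. G x z - B_sum \<sigma> ?p (Suc j) z) \<le> ennreal \<eta>"
        proof (rule bnd[rule_format])
          fix i assume i: "i < Suc j"
          have pi: "p i < p (Suc i)" "p (Suc i) - p i < \<delta>" using p i j by auto
          show "?p i < ?p (Suc i) \<and> ?p (Suc i) - ?p i < \<delta>0"
            using pi i x False \<delta>(2) by (cases "i = j") auto
        qed (use xt p0 in auto)
        moreover have "B_sum \<sigma> ?p (Suc j) z = ?T z" for z
          by (simp add: S_def)
        ultimately show ?thesis by simp
      qed
      let ?D = "\<lambda>z. \<Sum>i\<in>{()}. (\<lambda>_. \<sigma> (p j)) z * (B (p (Suc j)) z - B x z)"
      have "mean_square M ?D = ennreal (\<Sum>i\<in>{()}. expectation (\<lambda>z. ((\<lambda>_. \<sigma> (p j)) z)\<^sup>2) * (p (Suc j) - x))"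
        by (rule wiener_isometry[where c="\<lambda>_. \<bar>\<sigma> (p j)\<bar>"]) (use xt x pt[of "Suc j"] j in auto)
      also have "... = ennreal ((\<sigma> (p j))\<^sup>2 * (p (Suc j) - x))" by (simp add: prob_space)
      also have "... \<le> ennreal (\<sigma>0\<^sup>2 * \<delta>)"
      proof (intro ennreal_leI mult_mono)
        show "(\<sigma> (p j))\<^sup>2 \<le> \<sigma>0\<^sup>2" using power_mono[OF \<sigma>0(2)[of "p j"] abs_ge_zero, of 2] pt[of j] j by simp
        have "p (Suc j) - p j < \<delta>" using p j by auto
        then show "p (Suc j) - x \<le> \<delta>" using x by auto
      qed (use x in auto)
      also have "... \<le> ennreal \<eta>" by (rule ennreal_leI[OF \<delta>(3)])
      finally have 2: "mean_square M ?D \<le> ennreal \<eta>" .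
      have "mean_square M (\<lambda>z. G x z - S (Suc j) z) \<le> ennreal (2 * \<eta> + 2 * \<eta>)"
      proof (rule L2_add_le[OF _ _ 1 2])
        show "(\<lambda>z. G x z - ?T z) \<in> borel_measurable M" using Gm[of x] xt Tm by simp
        show "?D \<in> borel_measurable M" using Bm[of "Suc j"] j B_measurable'[OF xt] by simp
        fix z
        have "G x z - S (Suc j) z = (G x z - ?T z) - ?D z" by (simp add: S_def algebra_simps)
        then show "\<bar>G x z - S (Suc j) z\<bar> \<le> \<bar>G x z - ?T z\<bar> + \<bar>?D z\<bar>" by linarith
      qed (use \<eta> in auto)
      then show ?thesis by simp
    qed
    let ?K = "\<lambda>j z. integral {p j..p (Suc j)} (\<lambda>x. 1 * (G x z - S (Suc j) z)\<^sup>2)"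
    have Gcj: "continuous_on {p j..p (Suc j)} (\<lambda>x. G x z)" if "j < n" "z \<in> space M" for j z
      by (rule continuous_on_subset[OF Gc[OF that(2)]]) (use that pt[of j] pt[of "Suc j"] in auto)
    have Km: "?K j \<in> borel_measurable M" if j: "j < n" for j
    proof (rule integral_process_measurable)
      fix x assume "x \<in> {p j..p (Suc j)}"
      then show "(\<lambda>z. 1 * (G x z - S (Suc j) z)\<^sup>2) \<in> borel_measurable M"
        using Gm[of x] Sm[of "Suc j"] pt[of j] pt[of "Suc j"] j by simp
    qed (use p j Gcj in \<open>auto intro!: continuous_intros simp: less_imp_le\<close>)
    have K: "nn_mean M (?K j) \<le> ennreal (4 * \<eta> * (p (Suc j) - p j))" if j: "j < n" for j
    proof -
      have "nn_mean M (?K j) \<le> ennreal (4 * \<eta> * integral {p j..p (Suc j)} (\<lambda>_. 1))"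
      proof (rule expected_integral_le)
        fix x assume x: "x \<in> {p j..p (Suc j)}"
        then show "(\<lambda>z. (G x z - S (Suc j) z)\<^sup>2) \<in> borel_measurable M"
          using Gm[of x] Sm[of "Suc j"] pt[of j] pt[of "Suc j"] j by simp
        show "mean_square M (\<lambda>z. G x z - S (Suc j) z) \<le> ennreal (4 * \<eta>)" by (rule close[OF j x])
      qed (use p j Gcj \<eta> in \<open>auto intro!: continuous_intros simp: less_imp_le\<close>)
      then show ?thesis using p j by (simp add: less_imp_le)
    qed
    let ?R = "\<lambda>z. sqrt (s * (c0\<^sup>2 * (\<Sum>j<n. ?K j z)))"
    have K0: "0 \<le> ?K j z" if "j < n" "z \<in> space M" for j z
      by (rule integral_nonneg) (use that Gcj in \<open>auto intro!: integrable_continuous_real continuous_intros\<close>)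
    have tel: "(\<Sum>j<n. p (Suc j) - p j) = s" by (simp add: sum_lessThan_telescope p0 pn)
    \<comment> \<open>By Abel summation, the error is an error at time \<open>s\<close> plus integrals of \<open>G - S\<close> over the cells.\<close>
    have path: "\<bar>(e s * G s z + integral {0..s} (\<lambda>x. w x * e x * G x z)) - B_sum (\<lambda>s. e s * \<sigma> s) p n z\<bar>
       \<le> \<bar>e0 * (G s z - S n z)\<bar> + \<bar>?R z\<bar>" if om: "z \<in> space M" for z
    proof -
      have weG: "continuous_on {0..s} (\<lambda>x. w x * e x * G x z)"
        by (intro continuous_intros continuous_on_subset[OF wec] continuous_on_subset[OF Gc[OF om]]) (use s in auto)
      have split: "integral {0..p k} (\<lambda>x. w x * e x * G x z) = (\<Sum>j<k. integral {p j..p (Suc j)} (\<lambda>x. w x * e x * G x z))"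
        if "k \<le> n" for k
        proof (rule integral_partition[where g=p and m=n, OF p0 that weG])
        show "p i \<in> {0..s}" if "i \<le> n" for i by (rule pr[OF that])
      qed (use p in auto)
      have abel: "(\<Sum>i<k. e (p i) * (S (Suc i) z - S i z)) = e (p k) * S k z - (\<Sum>i<k. S (Suc i) z * (e (p (Suc i)) - e (p i)))" for k
        by (induction k) (simp_all add: S_def algebra_simps)
      have ftc: "integral {p j..p (Suc j)} (\<lambda>x. w x * e x) = e (p j) - e (p (Suc j))" if j: "j < n" for j
      proof (rule integral_unique)
        have "((\<lambda>x. - (w x * e x)) has_integral e (p (Suc j)) - e (p j)) {p j..p (Suc j)}"
        proof (rule fundamental_theorem_of_calculus)
          fix x assume "x \<in> {p j..p (Suc j)}"
          then have "(e has_real_derivative - (w x * e x)) (at x within {p j..p (Suc j)})"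
            using pt[of j] pt[of "Suc j"] j by (intro DERIV_subset[OF e]) auto
          then show "(e has_vector_derivative - (w x * e x)) (at x within {p j..p (Suc j)})"
            by (simp add: has_real_derivative_iff_has_vector_derivative)
        qed (use p j in \<open>auto simp: less_imp_le\<close>)
        from has_integral_neg[OF this]
        show "((\<lambda>x. w x * e x) has_integral e (p j) - e (p (Suc j))) {p j..p (Suc j)}" by simp
      qed
      let ?y = "\<lambda>j. integral {p j..p (Suc j)} (\<lambda>x. w x * e x * (G x z - S (Suc j) z))"
      have y: "?y j = integral {p j..p (Suc j)} (\<lambda>x. w x * e x * G x z) - S (Suc j) z * (e (p j) - e (p (Suc j)))" if j: "j < n" for j
      proof -
        have c1: "continuous_on {p j..p (Suc j)} (\<lambda>x. w x * e x)"
          by (rule continuous_on_subset[OF wec]) (use pt[of j] pt[of "Suc j"] j in auto)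
        have "?y j = integral {p j..p (Suc j)} (\<lambda>x. w x * e x * G x z - S (Suc j) z * (w x * e x))"
          by (simp add: algebra_simps)
        also have "... = integral {p j..p (Suc j)} (\<lambda>x. w x * e x * G x z) - S (Suc j) z * integral {p j..p (Suc j)} (\<lambda>x. w x * e x)"
          by (subst Henstock_Kurzweil_Integration.integral_diff)
           (use c1 Gcj[OF j om] in \<open>auto intro!: integrable_continuous_real continuous_intros\<close>)
        finally show ?thesis using ftc[OF j] by simp
      qed
      have "(e s * G s z + integral {0..s} (\<lambda>x. w x * e x * G x z)) - B_sum (\<lambda>s. e s * \<sigma> s) p n z
        = e s * (G s z - S n z) + (\<Sum>j<n. ?y j)"
      proof -
        have a1: "B_sum (\<lambda>s. e s * \<sigma> s) p n z = (\<Sum>i<n. e (p i) * (S (Suc i) z - S i z))"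
          by (intro sum.cong refl) (simp add: S_def mult.assoc)
        have a2: "(\<Sum>j<n. ?y j) = integral {0..s} (\<lambda>x. w x * e x * G x z) + (\<Sum>i<n. S (Suc i) z * (e (p (Suc i)) - e (p i)))"
        proof -
          have "(\<Sum>j<n. ?y j) = (\<Sum>j<n. integral {p j..p (Suc j)} (\<lambda>x. w x * e x * G x z) + S (Suc j) z * (e (p (Suc j)) - e (p j)))"
            by (intro sum.cong refl, subst y) (simp_all add: algebra_simps)
          then show ?thesis using split[of n] pn by (simp add: sum.distrib)
        qed
        show ?thesis unfolding a1 a2 abel[of n] pn by (simp add: algebra_simps)
      qed
      moreover have "\<bar>\<Sum>j<n. ?y j\<bar> \<le> ?R z"
      proof -
        have yj: "(?y j)\<^sup>2 \<le> (p (Suc j) - p j) * (c0\<^sup>2 * ?K j z)" if j: "j < n" for j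
        proof -
          have c1: "continuous_on {p j..p (Suc j)} (\<lambda>x. w x * e x)"
            by (rule continuous_on_subset[OF wec]) (use pt[of j] pt[of "Suc j"] j in auto)
          have "(?y j)\<^sup>2 = (integral {p j..p (Suc j)} (\<lambda>x. 1 * (w x * e x * (G x z - S (Suc j) z))))\<^sup>2" by simp
          also have "... \<le> integral {p j..p (Suc j)} (\<lambda>_. 1) * integral {p j..p (Suc j)} (\<lambda>x. 1 * (w x * e x * (G x z - S (Suc j) z))\<^sup>2)"
            by (rule integral_Cauchy_Schwarz) (use c1 Gcj[OF j om] in \<open>auto intro!: continuous_intros\<close>)
          also have "... \<le> (p (Suc j) - p j) * (c0\<^sup>2 * ?K j z)"
          proof -
            have "integral {p j..p (Suc j)} (\<lambda>x. 1 * (w x * e x * (G x z - S (Suc j) z))\<^sup>2) \<le> integral {p j..p (Suc j)} (\<lambda>x. c0\<^sup>2 * (1 * (G x z - S (Suc j) z)\<^sup>2))"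
            proof (rule integral_le)
              fix x assume "x \<in> {p j..p (Suc j)}"
              then have "\<bar>w x * e x\<bar> \<le> c0" using c0(2)[of x] pt[of j] pt[of "Suc j"] j by auto
              from power_mono[OF this abs_ge_zero, of 2] have "(w x * e x)\<^sup>2 \<le> c0\<^sup>2" by (simp only: power2_abs)
              from mult_right_mono[OF this zero_le_power2[of "G x z - S (Suc j) z"]]
              show "1 * (w x * e x * (G x z - S (Suc j) z))\<^sup>2 \<le> c0\<^sup>2 * (1 * (G x z - S (Suc j) z)\<^sup>2)"
                by (simp only: power_mult_distrib[of "w x * e x"] mult_1_left)
            qed (use c1 Gcj[OF j om] in \<open>auto intro!: integrable_continuous_real continuous_intros\<close>)
            then have "integral {p j..p (Suc j)} (\<lambda>x. 1 * (w x * e x * (G x z - S (Suc j) z))\<^sup>2) \<le> c0\<^sup>2 * ?K j z" by simp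
            moreover have "integral {p j..p (Suc j)} (\<lambda>_. 1 :: real) = p (Suc j) - p j" using p j by (simp add: less_imp_le)
            moreover have "0 \<le> p (Suc j) - p j" using p j by (simp add: less_imp_le)
            ultimately show ?thesis by (simp only:) (rule mult_left_mono)
          qed
          finally show ?thesis .
        qed
        have "\<bar>?y j\<bar> \<le> sqrt (p (Suc j) - p j) * sqrt (c0\<^sup>2 * ?K j z)" if j: "j < n" for j
          using real_le_rsqrt[of "\<bar>?y j\<bar>"] yj[OF j] by (simp add: real_sqrt_mult[symmetric])
        then have "\<bar>\<Sum>j<n. ?y j\<bar> \<le> (\<Sum>j<n. sqrt (p (Suc j) - p j) * sqrt (c0\<^sup>2 * ?K j z))"
          by (intro order_trans[OF sum_abs] sum_mono) auto
        also have "... \<le> sqrt ((\<Sum>j<n. sqrt (p (Suc j) - p j) * sqrt (c0\<^sup>2 * ?K j z))\<^sup>2)" by (simp only: real_sqrt_abs abs_ge_self)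
        also have "... \<le> sqrt ((\<Sum>j<n. (sqrt (p (Suc j) - p j))\<^sup>2) * (\<Sum>j<n. (sqrt (c0\<^sup>2 * ?K j z))\<^sup>2))"
          by (intro real_sqrt_le_mono Cauchy_Schwarz_ineq_sum)
        also have "(\<Sum>j<n. (sqrt (p (Suc j) - p j))\<^sup>2) = s"
          unfolding tel[symmetric] using p by (intro sum.cong refl) (simp add: less_imp_le)
        also have "(\<Sum>j<n. (sqrt (c0\<^sup>2 * ?K j z))\<^sup>2) = c0\<^sup>2 * (\<Sum>j<n. ?K j z)"
          unfolding sum_distrib_left by (intro sum.cong refl real_sqrt_pow2 mult_nonneg_nonneg K0 om) auto
        finally show ?thesis .
      qed
      moreover have "\<bar>e s * (G s z - S n z)\<bar> \<le> \<bar>e0 * (G s z - S n z)\<bar>"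
        unfolding abs_mult using e0(2)[OF s] by (intro mult_right_mono) auto
      ultimately show ?thesis by linarith
    qed
    have Rm: "?R \<in> borel_measurable M"
      by (intro borel_measurable_sqrt[THEN measurable_compose[rotated]] borel_measurable_times borel_measurable_const borel_measurable_sum Km) auto
    have 1: "mean_square M (\<lambda>z. e0 * (G s z - S n z)) \<le> ennreal (e0\<^sup>2 * \<eta>)"
    proof -
      have "mean_square M (\<lambda>z. e0 * (G s z - S n z)) = ennreal (e0\<^sup>2) * mean_square M (\<lambda>z. G s z - S n z)"
        using Gm[OF s] Sm[of n] by (subst nn_integral_cmult[symmetric]) (auto simp: power_mult_distrib ennreal_mult)
      also have "... \<le> ennreal (e0\<^sup>2) * ennreal \<eta>" using SG[of n] pn by (intro mult_left_mono) auto
      finally show ?thesis using \<eta> by (simp add: ennreal_mult)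
    qed
    have 2: "mean_square M ?R \<le> ennreal (t\<^sup>2 * c0\<^sup>2 * 4 * \<eta>)"
    proof -
      have "mean_square M ?R = (\<integral>\<^sup>+z. (\<Sum>j<n. ennreal (s * c0\<^sup>2) * ennreal (?K j z)) \<partial>M)"
      proof (rule nn_integral_cong)
        fix z assume om: "z \<in> space M"
        have "0 \<le> (\<Sum>j<n. ?K j z)" by (intro sum_nonneg K0 om) auto
        then have "(?R z)\<^sup>2 = s * (c0\<^sup>2 * (\<Sum>j<n. ?K j z))"
          using s by (intro real_sqrt_pow2 mult_nonneg_nonneg) auto
        also have "... = (\<Sum>j<n. s * c0\<^sup>2 * ?K j z)" by (simp only: sum_distrib_left mult.assoc)
        also have "ennreal ... = (\<Sum>j<n. ennreal (s * c0\<^sup>2 * ?K j z))"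
          by (rule sum_ennreal[symmetric], intro mult_nonneg_nonneg K0 om) (use s in auto)
        also have "... = (\<Sum>j<n. ennreal (s * c0\<^sup>2) * ennreal (?K j z))"
          using s om by (intro sum.cong refl ennreal_mult K0) auto
        finally show "ennreal ((?R z)\<^sup>2) = (\<Sum>j<n. ennreal (s * c0\<^sup>2) * ennreal (?K j z))" .
      qed
      also have "... = (\<Sum>j<n. ennreal (s * c0\<^sup>2) * nn_mean M (?K j))"
        using Km by (subst nn_integral_sum) (auto intro!: sum.cong nn_integral_cmult)
      also have "... \<le> (\<Sum>j<n. ennreal (s * c0\<^sup>2) * ennreal (4 * \<eta> * (p (Suc j) - p j)))"
        by (intro sum_mono mult_left_mono K) auto
      also have "... = (\<Sum>j<n. ennreal (s * c0\<^sup>2 * (4 * \<eta> * (p (Suc j) - p j))))"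
        using s \<eta> p by (intro sum.cong refl ennreal_mult[symmetric]) (auto simp: less_imp_le)
      also have "... = ennreal (\<Sum>j<n. s * c0\<^sup>2 * (4 * \<eta> * (p (Suc j) - p j)))"
        by (rule sum_ennreal) (use s \<eta> p in \<open>auto simp: less_imp_le\<close>)
      also have "(\<Sum>j<n. s * c0\<^sup>2 * (4 * \<eta> * (p (Suc j) - p j))) = s * c0\<^sup>2 * (4 * \<eta> * s)"
        by (simp only: sum_distrib_left[symmetric] tel)
      also have "... = s\<^sup>2 * (c0\<^sup>2 * 4 * \<eta>)" by (simp add: power2_eq_square)
      also have "... \<le> t\<^sup>2 * (c0\<^sup>2 * 4 * \<eta>)" using s \<eta> by (intro mult_right_mono power_mono) auto
      finally show ?thesis by (simp add: mult.assoc ennreal_leI)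
    qed
    have "mean_square M (\<lambda>z. N s z - B_sum (\<lambda>s. e s * \<sigma> s) p n z) =
      mean_square M (\<lambda>z. (e s * G s z + integral {0..s} (\<lambda>x. w x * e x * G x z)) - B_sum (\<lambda>s. e s * \<sigma> s) p n z)"
      by (rule nn_integral_cong_AE) (use N[OF s] in \<open>eventually_elim, simp\<close>)
    also have "... \<le> ennreal (2 * (e0\<^sup>2 * \<eta>) + 2 * (t\<^sup>2 * c0\<^sup>2 * 4 * \<eta>))"
      by (rule L2_add_le[OF _ Rm 1 2 _ _ path]) (use Gm[OF s] Sm[of n] \<eta> in auto)
    also have "2 * (e0\<^sup>2 * \<eta>) + 2 * (t\<^sup>2 * c0\<^sup>2 * 4 * \<eta>) = \<epsilon>" unfolding \<eta>(2)[symmetric] C_def by (simp add: algebra_simps)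
    finally show "mean_square M (\<lambda>z. N s z - B_sum (\<lambda>s. e s * \<sigma> s) p n z) \<le> ennreal \<epsilon>" .
  qed
qed

end

section \<open>The time horizon\<close>

lemma horizon_Icc: "t \<in> horizon T \<Longrightarrow> {0..t} \<subseteq> horizon T"
  by (auto simp: horizon_def intro: order_le_less_trans[of "ereal _" "ereal t"])

lemma horizon_0: "0 < T \<Longrightarrow> 0 \<in> horizon T"
  by (simp add: horizon_def zero_ereal_def[symmetric])

lemma horizon_le: "t \<in> horizon T \<Longrightarrow> 0 \<le> s \<Longrightarrow> s \<le> t \<Longrightarrow> s \<in> horizon T"
  using horizon_Icc[of t T] by auto

lemma horizon_greater:
  assumes "s \<in> horizon T" obtains u where "u \<in> horizon T" "s < u"
proof -
  have "ereal s < T" using assms by (simp add: horizon_def)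
  then obtain u where "ereal s < ereal u" "ereal u < T" using ereal_dense2 by blast
  then show ?thesis using assms by (intro that[of u]) (auto simp: horizon_def)
qed

lemma eventually_at_horizon:
  assumes "0 < T"
  shows "eventually P (at_horizon T) \<longleftrightarrow> (\<exists>t1\<in>horizon T. \<forall>t\<in>horizon T. t1 \<le> t \<longrightarrow> P t)"
proof (cases T)
  case (real r)
  then have r: "0 < r" using assms by simp
  have "eventually P (at_left r) \<longleftrightarrow> (\<exists>t1. 0 \<le> t1 \<and> t1 < r \<and> (\<forall>t. 0 \<le> t \<longrightarrow> t < r \<longrightarrow> t1 \<le> t \<longrightarrow> P t))"
  proof
    assume "eventually P (at_left r)"
    then obtain b where b: "b < r" "\<And>y. b < y \<Longrightarrow> y < r \<Longrightarrow> P y"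
      using eventually_at_left[OF r] by auto
    obtain c where c: "max 0 b < c" "c < r" using dense[of "max 0 b" r] b r by auto
    show "\<exists>t1. 0 \<le> t1 \<and> t1 < r \<and> (\<forall>t. 0 \<le> t \<longrightarrow> t < r \<longrightarrow> t1 \<le> t \<longrightarrow> P t)"
      by (rule exI[of _ c]) (use b c in auto)
  next
    assume "\<exists>t1. 0 \<le> t1 \<and> t1 < r \<and> (\<forall>t. 0 \<le> t \<longrightarrow> t < r \<longrightarrow> t1 \<le> t \<longrightarrow> P t)"
    then obtain t1 where "0 \<le> t1" "t1 < r" "\<And>t. 0 \<le> t \<Longrightarrow> t < r \<Longrightarrow> t1 \<le> t \<Longrightarrow> P t" by blast
    then show "eventually P (at_left r)" unfolding eventually_at_left[OF r] by (intro exI[of _ t1]) auto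
  qed
  then show ?thesis using real by (auto simp: at_horizon_def horizon_def)
next
  case PInf
  have "eventually P at_top \<longleftrightarrow> (\<exists>t1\<ge>0. \<forall>t\<ge>0. t1 \<le> t \<longrightarrow> P t)"
  proof
    assume "eventually P at_top"
    then obtain N where "\<And>n. N \<le> n \<Longrightarrow> P n" by (auto simp: eventually_at_top_linorder)
    then show "\<exists>t1\<ge>0. \<forall>t\<ge>0. t1 \<le> t \<longrightarrow> P t" by (intro exI[of _ "max 0 N"]) auto
  next
    assume "\<exists>t1\<ge>0. \<forall>t\<ge>0. t1 \<le> t \<longrightarrow> P t"
    then obtain t1 where "0 \<le> t1" "\<And>t. 0 \<le> t \<Longrightarrow> t1 \<le> t \<Longrightarrow> P t" by blast
    then show "eventually P at_top" unfolding eventually_at_top_linorder by (intro exI[of _ t1]) auto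
  qed
  then show ?thesis using PInf by (auto simp: at_horizon_def horizon_def)
next
  case MInf
  then show ?thesis using assms by simp
qed

lemma wiener_process_subset:
  assumes W: "wiener_process M J B" and sub: "J' \<subseteq> J"
  shows "wiener_process M J' B"
  unfolding wiener_process_def
proof (intro conjI ballI allI impI)
  fix z assume "z \<in> space M"
  then show "continuous_on J' (\<lambda>t. B t z)"
    using W sub unfolding wiener_process_def by (blast intro: continuous_on_subset)
next
  fix n :: nat and \<tau> :: "nat \<Rightarrow> real"
  assume "(\<forall>i\<le>n. \<tau> i \<in> J') \<and> (\<forall>i<n. \<tau> i < \<tau> (Suc i))"
  then have "(\<forall>i\<le>n. \<tau> i \<in> J) \<and> (\<forall>i<n. \<tau> i < \<tau> (Suc i))" using sub by blast
  then show "prob_space.indep_vars M (\<lambda>_. borel) (\<lambda>i z. B (\<tau> (Suc i)) z - B (\<tau> i) z) {..<n}"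
    using W unfolding wiener_process_def by blast
next
  fix s t assume "s \<in> J'" "t \<in> J'" "s < t"
  then show "distributed M lborel (\<lambda>z. B t z - B s z) (normal_density 0 (sqrt (t - s)))"
    using W sub unfolding wiener_process_def by blast
qed (use W sub in \<open>auto simp: wiener_process_def\<close>)

lemma abs_pow_sublinear:
  assumes \<gamma>: "0 \<le> \<gamma>" "\<gamma> < 1" and \<delta>: "0 < \<delta>"
  obtains c where "0 \<le> c" "\<And>x. abs_pow x \<gamma> \<le> c + \<delta> * \<bar>x\<bar>"
proof (cases "\<gamma> = 0")
  case True
  show ?thesis by (rule that[of 1]) (use True \<delta> in \<open>auto simp: abs_pow_def\<close>)
next
  case False
  define R where "R = \<delta> powr (1 / (\<gamma> - 1))"
  have R: "0 < R" using \<delta> by (simp add: R_def)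
  show ?thesis
  proof (rule that[of "R powr \<gamma>"])
    fix x
    show "abs_pow x \<gamma> \<le> R powr \<gamma> + \<delta> * \<bar>x\<bar>"
    proof (cases "\<bar>x\<bar> \<le> R")
      case True
      then have "\<bar>x\<bar> powr \<gamma> \<le> R powr \<gamma>" using \<gamma> by (intro powr_mono2) auto
      then show ?thesis using False \<delta> by (simp add: abs_pow_def add_increasing2)
    next
      case xR: False
      have x: "0 < \<bar>x\<bar>" using xR R by linarith
      have "\<bar>x\<bar> powr (\<gamma> - 1) \<le> R powr (\<gamma> - 1)"
        by (rule powr_mono2') (use xR R \<gamma> in auto)
      also have "... = \<delta>" using \<gamma> \<delta> by (simp add: R_def powr_powr)
      finally have "\<bar>x\<bar> powr (\<gamma> - 1) * \<bar>x\<bar> \<le> \<delta> * \<bar>x\<bar>" by (rule mult_right_mono) simp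
      moreover have "\<bar>x\<bar> powr (\<gamma> - 1) * \<bar>x\<bar> = \<bar>x\<bar> powr \<gamma>"
        using x powr_add[of "\<bar>x\<bar>" "\<gamma> - 1" 1] by simp
      ultimately show ?thesis using False by (simp add: abs_pow_def add_increasing)
    qed
  qed simp
qed

lemma abs_pow_le_one_plus: "0 \<le> \<gamma> \<Longrightarrow> \<gamma> < 1 \<Longrightarrow> abs_pow x \<gamma> \<le> 1 + \<bar>x\<bar>"
proof -
  assume \<gamma>: "0 \<le> \<gamma>" "\<gamma> < 1"
  have "\<bar>x\<bar> powr \<gamma> \<le> (1 + \<bar>x\<bar>) powr \<gamma>" using \<gamma> by (intro powr_mono2) auto
  also have "... \<le> (1 + \<bar>x\<bar>) powr 1" using \<gamma> by (intro powr_mono) auto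
  finally show ?thesis by (auto simp: abs_pow_def)
qed

lemma abs_pow_divide: "0 < e \<Longrightarrow> 0 \<le> \<gamma> \<Longrightarrow> e * abs_pow (x / e) \<gamma> = e powr (1 - \<gamma>) * abs_pow x \<gamma>"
  by (auto simp: abs_pow_def powr_divide abs_divide powr_diff)

section \<open>The perturbed diffusion\<close>

locale perturbed_diffusion =
  fixes T :: ereal and b \<sigma> a r :: "real \<Rightarrow> real" and L \<gamma> \<alpha> C :: real
    and M :: "'a measure" and B X Y S :: "real \<Rightarrow> 'a \<Rightarrow> real"
  assumes T_pos: "0 < T"
    and b_cont: "continuous_on (horizon T) b"
    and \<sigma>_cont: "continuous_on (horizon T) \<sigma>"
    and \<sigma>_pos: "\<And>t. t \<in> horizon T \<Longrightarrow> 0 < \<sigma> t"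
    and a_eq: "\<And>x. a x = x + r x"
    and L: "0 \<le> L" and \<gamma>: "0 \<le> \<gamma>" "\<gamma> < 1"
    and r_growth: "\<And>x. \<bar>r x\<bar> \<le> L * (1 + abs_pow x \<gamma>)"
    and r_cont: "continuous_on UNIV r"
    and B: "wiener_process M (horizon T) B"
    and X: "strong_solution M B T \<alpha> b \<sigma> (\<lambda>x. x) X"
    and Y: "strong_solution M B T \<alpha> b \<sigma> a Y"
    and S: "stochastic_integral_process M (aug_filtration M B) T Y
              (\<lambda>s z. b s * a (Y s z) / (\<sigma> s)\<^sup>2) S"
    and info_X: "filterlim (fisher_info M b \<sigma> (\<lambda>x. x) X) at_top (at_horizon T)"
    and C_lim: "((\<lambda>t. b t / (\<sigma> t)\<^sup>2 * exp (2 * \<alpha> * (LBINT w:{0..t}. b w))) \<longlongrightarrow> C) (at_horizon T)"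
    and C_nz: "C \<noteq> 0"
    and sign: "sgn \<alpha> = sgn C \<or> \<alpha> = 0"
begin

sublocale prob_space M using B by (simp add: wiener_process_def)

abbreviation "F \<equiv> aug_filtration M B"

lemma wiener_on_Icc: "t \<in> horizon T \<Longrightarrow> 0 < t \<Longrightarrow> wiener_on M B t"
  by (rule wiener_on.intro[OF wiener_process_subset[OF B horizon_Icc]])

lemma cont_Icc: "continuous_on (horizon T) f \<Longrightarrow> t \<in> horizon T \<Longrightarrow> continuous_on {0..t} f"
  by (rule continuous_on_subset[OF _ horizon_Icc])

lemma a_cont: "continuous_on UNIV a"
proof -
  have "a = (\<lambda>x. x + r x)" using a_eq by auto
  then show ?thesis using r_cont by (simp add: continuous_on_add)
qed

lemma X_cont: "z \<in> space M \<Longrightarrow> continuous_on (horizon T) (\<lambda>s. X s z)"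
  using X by (simp add: strong_solution_def)

lemma Y_cont: "z \<in> space M \<Longrightarrow> continuous_on (horizon T) (\<lambda>s. Y s z)"
  using Y by (simp add: strong_solution_def)

lemma aY_cont: "z \<in> space M \<Longrightarrow> continuous_on (horizon T) (\<lambda>s. a (Y s z))"
  by (rule continuous_on_compose2[OF a_cont Y_cont]) auto

lemma rY_cont: "z \<in> space M \<Longrightarrow> continuous_on (horizon T) (\<lambda>s. r (Y s z))"
  by (rule continuous_on_compose2[OF r_cont Y_cont]) auto

lemma X_adapted: "s \<in> horizon T \<Longrightarrow> X s \<in> borel_measurable (F s)"
  using X by (simp add: strong_solution_def)

lemma Y_adapted: "s \<in> horizon T \<Longrightarrow> Y s \<in> borel_measurable (F s)"
  using Y by (simp add: strong_solution_def)

lemma F_measurable: "s \<in> horizon T \<Longrightarrow> f \<in> borel_measurable (F s) \<Longrightarrow> f \<in> borel_measurable M"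
proof -
  assume s: "s \<in> horizon T" and f: "f \<in> borel_measurable (F s)"
  obtain u where u: "u \<in> horizon T" "s < u" by (rule horizon_greater[OF s])
  then have "0 < u" using s by (auto simp: horizon_def)
  then interpret W: wiener_on M B u by (rule wiener_on_Icc[OF u(1)])
  show "f \<in> borel_measurable M" by (rule W.measurable_F_M[OF f]) (use u in simp)
qed

lemma X_measurable: "s \<in> horizon T \<Longrightarrow> X s \<in> borel_measurable M"
  by (rule F_measurable[OF _ X_adapted])

lemma Y_measurable: "s \<in> horizon T \<Longrightarrow> Y s \<in> borel_measurable M"
  by (rule F_measurable[OF _ Y_adapted])

lemma a_measurable[measurable]: "a \<in> borel_measurable borel"
  by (rule borel_measurable_continuous_onI[OF a_cont])

lemma r_measurable[measurable]: "r \<in> borel_measurable borel"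
  by (rule borel_measurable_continuous_onI[OF r_cont])

text \<open>In terms of the discount factor \<open>e\<close>, the linear solution is \<open>X = N / e\<close> with a martingale \<open>N\<close> that has
  integrand \<open>h\<close> and clock \<open>v\<close>. The function whose limit \<open>C\<close> is assumed to exist is \<open>\<psi>\<close>.\<close>

definition w :: "real \<Rightarrow> real" where "w s = \<alpha> * b s"
definition \<beta> :: "real \<Rightarrow> real" where "\<beta> s = integral {0..s} w"
definition e :: "real \<Rightarrow> real" where "e s = exp (- \<beta> s)"
definition h :: "real \<Rightarrow> real" where "h s = e s * \<sigma> s"
definition v :: "real \<Rightarrow> real" where "v s = integral {0..s} (\<lambda>x. (h x)\<^sup>2)"
definition \<psi> :: "real \<Rightarrow> real" where "\<psi> s = b s / (h s)\<^sup>2"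

lemma w_cont: "continuous_on (horizon T) w"
  unfolding w_def[abs_def] by (intro continuous_intros b_cont)

lemma \<beta>_deriv: "t \<in> horizon T \<Longrightarrow> s \<in> {0..t} \<Longrightarrow> (\<beta> has_real_derivative w s) (at s within {0..t})"
  unfolding \<beta>_def[abs_def] by (rule integral_has_real_derivative[OF cont_Icc[OF w_cont]])

lemma e_deriv: "t \<in> horizon T \<Longrightarrow> s \<in> {0..t} \<Longrightarrow> (e has_real_derivative - (w s * e s)) (at s within {0..t})"
  unfolding e_def[abs_def] by (rule derivative_eq_intros \<beta>_deriv refl | assumption)+ simp

lemma continuous_on_horizonI:
  fixes f :: "real \<Rightarrow> real"
  assumes "\<And>t. t \<in> horizon T \<Longrightarrow> continuous_on {0..t} f"
  shows "continuous_on (horizon T) f"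
proof (rule continuous_on_eq_continuous_within[THEN iffD2], rule ballI)
  fix s assume s: "s \<in> horizon T"
  obtain u where u: "u \<in> horizon T" "s < u" by (rule horizon_greater[OF s])
  have "continuous (at s within {0..u}) f"
    using assms[OF u(1)] u s by (auto simp: continuous_on_eq_continuous_within horizon_def)
  moreover have "at s within horizon T = at s within {0..u}"
  proof (rule at_within_nhd[of _ "{..<u}"])
    show "horizon T \<inter> {..<u} - {s} = {0..u} \<inter> {..<u} - {s}"
      using horizon_Icc[OF u(1)] by (auto simp: horizon_def)
  qed (use u in auto)
  ultimately show "continuous (at s within horizon T) f" by simp
qed

lemma e_cont: "continuous_on (horizon T) e"
  by (rule continuous_on_horizonI, rule DERIV_continuous_on, rule e_deriv)

lemma \<beta>_cont: "continuous_on (horizon T) \<beta>"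
  by (rule continuous_on_horizonI, rule DERIV_continuous_on, rule \<beta>_deriv)

lemma e_pos[simp]: "0 < e s" by (simp add: e_def)

lemma h_cont: "continuous_on (horizon T) h"
  unfolding h_def[abs_def] by (intro continuous_intros e_cont \<sigma>_cont)

lemma h_pos: "s \<in> horizon T \<Longrightarrow> 0 < h s"
  using \<sigma>_pos by (simp add: h_def)

lemma h2_cont: "continuous_on (horizon T) (\<lambda>x. (h x)\<^sup>2)"
  by (intro continuous_intros h_cont)

lemma v_deriv: "t \<in> horizon T \<Longrightarrow> s \<in> {0..t} \<Longrightarrow> (v has_real_derivative (h s)\<^sup>2) (at s within {0..t})"
  unfolding v_def[abs_def] by (rule integral_has_real_derivative[OF cont_Icc[OF h2_cont]])

lemma v_cont: "continuous_on (horizon T) v"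
  by (rule continuous_on_horizonI, rule DERIV_continuous_on, rule v_deriv)

lemma \<psi>_cont: "continuous_on (horizon T) \<psi>"
  unfolding \<psi>_def[abs_def] by (intro continuous_intros b_cont h_cont) (use h_pos in force)

lemma v_0[simp]: "v 0 = 0" by (simp add: v_def)

lemma v_mono: "t \<in> horizon T \<Longrightarrow> 0 \<le> s \<Longrightarrow> s \<le> t \<Longrightarrow> v s \<le> v t"
proof -
  assume t: "t \<in> horizon T" and s: "0 \<le> s" "s \<le> t"
  have "s \<in> horizon T" by (rule horizon_le[OF t s])
  then show "v s \<le> v t"
    unfolding v_def using s t
    by (intro integral_subset_le integrable_continuous_real cont_Icc[OF h2_cont]) auto
qed

lemma v_nonneg: "s \<in> horizon T \<Longrightarrow> 0 \<le> v s"
  using v_mono[of s 0] by (auto simp: horizon_def)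

lemma v_le: "t \<in> horizon T \<Longrightarrow> s \<in> {0..t} \<Longrightarrow> v s \<le> v t"
  using v_mono by auto

section \<open>The driving martingale\<close>

text \<open>The martingale part \<open>\<integral> \<sigma> dB\<close> of the solutions, as a continuous functional of the paths.\<close>

definition noise :: "(real \<Rightarrow> real) \<Rightarrow> (real \<Rightarrow> 'a \<Rightarrow> real) \<Rightarrow> real \<Rightarrow> 'a \<Rightarrow> real" where
  "noise f Z s z = Z s z - Z 0 z - integral {0..s} (\<lambda>x. w x * f (Z x z))"

lemma drift_cont:
  assumes Z: "strong_solution M B T \<alpha> b \<sigma> f Z" and f: "continuous_on UNIV f" and z: "z \<in> space M"
  shows "continuous_on (horizon T) (\<lambda>x. w x * f (Z x z))"
  by (intro continuous_intros w_cont continuous_on_compose2[OF f]) (use Z z in \<open>auto simp: strong_solution_def\<close>)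

lemma noise_cont:
  assumes Z: "strong_solution M B T \<alpha> b \<sigma> f Z" and f: "continuous_on UNIV f" and z: "z \<in> space M"
  shows "continuous_on (horizon T) (\<lambda>s. noise f Z s z)"
proof -
  have "continuous_on (horizon T) (\<lambda>s. integral {0..s} (\<lambda>x. w x * f (Z x z)))"
    by (rule continuous_on_horizonI, rule indefinite_integral_continuous_1, rule integrable_continuous_real, rule cont_Icc[OF drift_cont[OF assms]])
  then show ?thesis unfolding noise_def
    using Z z by (intro continuous_intros) (auto simp: strong_solution_def)
qed

lemma noise_integral:
  assumes Z: "strong_solution M B T \<alpha> b \<sigma> f Z" and f: "continuous_on UNIV f"
    and t: "t \<in> horizon T" "0 < t"
  shows "wiener_on.wiener_integral M B t \<sigma> (noise f Z)"
proof -
  interpret W: wiener_on M B t by (rule wiener_on_Icc[OF t])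
  show ?thesis
  proof (rule W.stochastic_integral_wiener_integral)
    show "continuous_on {0..t} \<sigma>" by (rule cont_Icc[OF \<sigma>_cont t(1)])
    fix s assume s: "s \<in> {0..t}"
    then have sH: "s \<in> horizon T" using horizon_Icc[OF t(1)] by blast
    have H: "has_stochastic_integral M F B (\<lambda>s _. \<sigma> s) s (\<lambda>z. Z s z - Z 0 z - (LBINT x:{0..s}. \<alpha> * b x * f (Z x z)))"
      using Z sH by (simp add: strong_solution_def)
    have eq: "Z s z - Z 0 z - (LBINT x:{0..s}. \<alpha> * b x * f (Z x z)) = noise f Z s z" if "z \<in> space M" for z
      using LBINT_eq_integral[OF cont_Icc[OF drift_cont[OF Z f that] sH]] by (simp add: noise_def w_def)
    have m: "noise f Z s \<in> borel_measurable M"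
      using H unfolding has_stochastic_integral_def by (metis (no_types, lifting) eq measurable_cong)
    from H show "has_stochastic_integral M F B (\<lambda>s _. \<sigma> s) s (noise f Z s)"
      unfolding has_stochastic_integral_def using m eq by (simp cong: conj_cong Collect_cong)
  qed
qed

lemma noise_measurable:
  assumes Z: "strong_solution M B T \<alpha> b \<sigma> f Z" and f: "continuous_on UNIV f" and s: "s \<in> horizon T"
  shows "noise f Z s \<in> borel_measurable M"
proof -
  obtain u where u: "u \<in> horizon T" "s < u" by (rule horizon_greater[OF s])
  then have "0 < u" using s by (auto simp: horizon_def)
  then interpret W: wiener_on M B u by (rule wiener_on_Icc[OF u(1)])
  show ?thesis by (rule W.wiener_integral_measurable[OF noise_integral[OF Z f u(1) \<open>0 < u\<close>]])
      (use s u in \<open>auto simp: horizon_def\<close>)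
qed

abbreviation "GX \<equiv> noise (\<lambda>x. x) X"
abbreviation "G \<equiv> noise a Y"

lemmas GX_cont = noise_cont[OF X continuous_on_id]
lemmas G_cont = noise_cont[OF Y a_cont]

text \<open>Both solutions are driven by the same noise: the mean square limit determines the integral
  up to null sets, and continuity of the paths makes the exceptional set independent
  of time.\<close>

lemma same_noise: "AE z in M. \<forall>s\<in>horizon T. GX s z = G s z"
proof -
  have *: "AE z in M. GX s z = G s z" if s: "s \<in> horizon T" for s
  proof (cases "s = 0")
    case True
    then show ?thesis by (simp add: noise_def)
  next
    case False
    then have s0: "0 < s" using s by (auto simp: horizon_def)
    interpret W: wiener_on M B s by (rule wiener_on_Icc[OF s s0])
    note GX = noise_integral[OF X continuous_on_id s s0] and G = noise_integral[OF Y a_cont s s0]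
    let ?V = "\<lambda>n z. \<Sum>k<Suc n. \<sigma> (W.subdivision 0 s (Suc n) k) * (B (W.subdivision 0 s (Suc n) (Suc k)) z - B (W.subdivision 0 s (Suc n) k) z)"
    have "AE z in M. GX s z - GX 0 z = G s z - G 0 z"
    proof (rule converges_in_prob_unique[of ?V])
      show "converges_in_prob M ?V (\<lambda>z. GX s z - GX 0 z)" by (rule W.wiener_integral_increment[OF GX]) (use s0 in auto)
      show "converges_in_prob M ?V (\<lambda>z. G s z - G 0 z)" by (rule W.wiener_integral_increment[OF G]) (use s0 in auto)
      have "0 \<le> W.subdivision 0 s (Suc n) k \<and> W.subdivision 0 s (Suc n) k \<le> s" if "k \<le> Suc n" for n k
        using W.subdivision_range[of 0 s k "Suc n"] s0 that by auto
      then show "?V n \<in> borel_measurable M" for n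
        by (intro borel_measurable_sum borel_measurable_times borel_measurable_const borel_measurable_diff W.B_measurable') auto
    qed (use noise_measurable[OF X continuous_on_id] noise_measurable[OF Y a_cont] s horizon_0[OF T_pos] in \<open>auto intro!: borel_measurable_diff\<close>)
    then show ?thesis by (simp add: noise_def)
  qed
  have "AE z in M. \<forall>q\<in>\<rat> \<inter> horizon T. GX q z = G q z"
    by (rule AE_ball_countable') (auto intro: * countable_rat countable_Int1)
  then show ?thesis
    using AE_space
  proof eventually_elim
    case (elim z)
    show ?case
    proof (rule ballI, rule ccontr)
      fix s assume s: "s \<in> horizon T" and ne: "GX s z \<noteq> G s z"
      obtain u where u: "u \<in> horizon T" "s < u" by (rule horizon_greater[OF s])
      let ?f = "\<lambda>x. GX x z - G x z"
      have "continuous_on (horizon T) ?f" by (intro continuous_intros GX_cont G_cont elim)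
      then obtain d where d: "0 < d" "\<And>x. x \<in> horizon T \<Longrightarrow> dist x s < d \<Longrightarrow> dist (?f x) (?f s) < \<bar>?f s\<bar>"
        using s ne unfolding continuous_on_iff by (metis (no_types, lifting) right_minus_eq zero_less_abs_iff)
      obtain q where q: "q \<in> \<rat>" "s < q" "q < min u (s + d)"
        using Rats_dense_in_real[of s "min u (s + d)"] u d by auto
      have "0 \<le> s" using s by (simp add: horizon_def)
      then have qH: "q \<in> horizon T" using q by (intro horizon_le[OF u(1)]) auto
      have "dist (?f q) (?f s) < \<bar>?f s\<bar>" by (rule d(2)[OF qH]) (use q in \<open>auto simp: dist_real_def\<close>)
      moreover have "?f q = 0" using elim q qH by auto
      ultimately show False by (simp add: dist_real_def)
    qed
  qed
qed

definition N :: "real \<Rightarrow> 'a \<Rightarrow> real" where "N s z = e s * X s z"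
definition D :: "real \<Rightarrow> 'a \<Rightarrow> real" where "D s z = e s * (Y s z - X s z)"

lemma N_plus_D: "N s z + D s z = e s * Y s z"
  by (simp add: N_def D_def algebra_simps)

lemma N_cont: "z \<in> space M \<Longrightarrow> continuous_on (horizon T) (\<lambda>s. N s z)"
  unfolding N_def by (intro continuous_intros e_cont X_cont)

lemma D_cont: "z \<in> space M \<Longrightarrow> continuous_on (horizon T) (\<lambda>s. D s z)"
  unfolding D_def by (intro continuous_intros e_cont X_cont Y_cont)

lemma N_adapted: "s \<in> horizon T \<Longrightarrow> N s \<in> borel_measurable (F s)"
  unfolding N_def[abs_def] by (intro borel_measurable_times borel_measurable_const X_adapted)

lemma N_measurable: "s \<in> horizon T \<Longrightarrow> N s \<in> borel_measurable M"
  by (rule F_measurable[OF _ N_adapted])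

lemma D_measurable: "s \<in> horizon T \<Longrightarrow> D s \<in> borel_measurable M"
  unfolding D_def[abs_def] by (intro borel_measurable_times borel_measurable_const borel_measurable_diff X_measurable Y_measurable)

text \<open>Integration by parts, with \<open>e' = - w e\<close>.\<close>

lemma discounted_primitive:
  assumes t: "t \<in> horizon T" and f: "continuous_on (horizon T) f"
  shows "e t * integral {0..t} f = integral {0..t} (\<lambda>x. e x * (f x - w x * integral {0..x} f))"
proof -
  have t0: "0 \<le> t" using t by (simp add: horizon_def)
  have "((\<lambda>x. e x * (f x - w x * integral {0..x} f)) has_integral e t * integral {0..t} f - e 0 * integral {0..0} f) {0..t}"
  proof (rule fundamental_theorem_of_calculus[OF t0])
    fix x assume x: "x \<in> {0..t}"
    have "((\<lambda>x. e x * integral {0..x} f) has_real_derivative - (w x * e x) * integral {0..x} f + f x * e x) (at x within {0..t})"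
      by (rule DERIV_mult[OF e_deriv[OF t x] integral_has_real_derivative[OF cont_Icc[OF f t] x]])
    then show "((\<lambda>x. e x * integral {0..x} f) has_vector_derivative e x * (f x - w x * integral {0..x} f)) (at x within {0..t})"
      by (simp add: has_real_derivative_iff_has_vector_derivative algebra_simps)
  qed
  from integral_unique[OF this] show ?thesis by simp
qed

lemma N_formula:
  assumes t: "t \<in> horizon T"
  shows "AE z in M. N t z = e t * GX t z + integral {0..t} (\<lambda>x. w x * e x * GX x z)"
proof -
  have "AE z in M. X 0 z = 0" using X by (simp add: strong_solution_def)
  then show ?thesis
    using AE_space
  proof eventually_elim
    case (elim z)
    let ?f = "\<lambda>x. w x * X x z"
    have f: "continuous_on (horizon T) ?f" by (rule drift_cont[OF X continuous_on_id elim(2)])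
    have X: "X x z = GX x z + integral {0..x} ?f" for x using elim(1) by (simp add: noise_def)
    have "N t z = e t * GX t z + e t * integral {0..t} ?f"
      unfolding N_def by (subst X) (simp add: algebra_simps)
    also have "e t * integral {0..t} ?f = integral {0..t} (\<lambda>x. e x * (?f x - w x * integral {0..x} ?f))"
      by (rule discounted_primitive[OF t f])
    also have "(\<lambda>x. e x * (?f x - w x * integral {0..x} ?f)) = (\<lambda>x. w x * e x * GX x z)"
    proof
      fix x
      have "?f x - w x * integral {0..x} ?f = w x * GX x z" using X[of x] by (simp add: algebra_simps)
      then show "e x * (?f x - w x * integral {0..x} ?f) = w x * e x * GX x z" by simp
    qed
    finally show ?case .
  qed
qed

text \<open>The noise cancels in the difference of the two equations, and discounting removes the linear
  part of the drift; only the perturbation \<open>r\<close> is left.\<close>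

lemma D_formula: "AE z in M. \<forall>t\<in>horizon T. D t z = integral {0..t} (\<lambda>x. w x * e x * r (Y x z))"
proof -
  have "AE z in M. X 0 z = 0" "AE z in M. Y 0 z = 0" using X Y by (simp_all add: strong_solution_def)
  then show ?thesis
    using same_noise AE_space
  proof eventually_elim
    case (elim z)
    show ?case
    proof
      fix t assume t: "t \<in> horizon T"
      let ?f = "\<lambda>x. w x * a (Y x z) - w x * X x z"
      have fY: "continuous_on (horizon T) (\<lambda>x. w x * a (Y x z))" by (rule drift_cont[OF Y a_cont elim(4)])
      have fX: "continuous_on (horizon T) (\<lambda>x. w x * X x z)" by (rule drift_cont[OF X continuous_on_id elim(4)])
      have f: "continuous_on (horizon T) ?f" by (intro continuous_intros fX fY)
      have diff: "Y x z - X x z = integral {0..x} ?f" if x: "x \<in> horizon T" for x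
      proof -
        have "integral {0..x} ?f = integral {0..x} (\<lambda>x. w x * a (Y x z)) - integral {0..x} (\<lambda>x. w x * X x z)"
          by (intro Henstock_Kurzweil_Integration.integral_diff integrable_continuous_real cont_Icc[OF fX x] cont_Icc[OF fY x])
        moreover have "GX x z = G x z" using elim(3) x by blast
        ultimately show ?thesis using elim(1,2) by (simp add: noise_def)
      qed
      have "D t z = integral {0..t} (\<lambda>x. e x * (?f x - w x * integral {0..x} ?f))"
        unfolding D_def diff[OF t] by (rule discounted_primitive[OF t f])
      also have "... = integral {0..t} (\<lambda>x. w x * e x * r (Y x z))"
      proof (rule Henstock_Kurzweil_Integration.integral_cong)
        fix x assume "x \<in> {0..t}"
        then have "x \<in> horizon T" using horizon_Icc[OF t] by blast
        from diff[OF this] show "e x * (?f x - w x * integral {0..x} ?f) = w x * e x * r (Y x z)"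
          by (simp add: a_eq algebra_simps)
      qed
      finally show "D t z = integral {0..t} (\<lambda>x. w x * e x * r (Y x z))" .
    qed
  qed
qed

lemma martingale: "t \<in> horizon T \<Longrightarrow> 0 < t \<Longrightarrow> wiener_martingale M B t h N"
proof -
  assume t: "t \<in> horizon T" "0 < t"
  interpret W: wiener_on M B t by (rule wiener_on_Icc[OF t])
  have tH: "s \<in> horizon T" if "s \<in> {0..t}" for s using horizon_Icc[OF t(1)] that by blast
  show ?thesis
  proof (unfold_locales)
    show "continuous_on {0..t} h" by (rule cont_Icc[OF h_cont t(1)])
    show "W.wiener_integral h N"
      unfolding h_def[abs_def]
      by (rule W.wiener_integral_discounted[OF noise_integral[OF X continuous_on_id t] cont_Icc[OF \<sigma>_cont t(1)]
         cont_Icc[OF GX_cont t(1)] cont_Icc[OF w_cont t(1)] e_deriv[OF t(1)] N_measurable[OF tH] N_formula[OF tH]])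
  qed (auto intro!: h_pos N_adapted cont_Icc[OF N_cont t(1)] tH simp del: atLeastAtMost_iff)
qed

lemma martingale_v: "wiener_martingale.v h s = v s" if "t \<in> horizon T" "0 < t"
  unfolding v_def wiener_martingale.v_def[OF martingale[OF that]] ..

lemma N_second_moment:
  assumes s: "s \<in> horizon T" shows "mean_square M (N s) = ennreal (v s)"
proof (cases "s = 0")
  case True
  have "mean_square M (N s) = (\<integral>\<^sup>+z. 0 \<partial>M)"
    using X by (intro nn_integral_cong_AE) (auto simp: True N_def strong_solution_def)
  then show ?thesis by (simp add: True)
next
  case False
  then have s0: "0 < s" using s by (auto simp: horizon_def)
  interpret W: wiener_martingale M B s h N by (rule martingale[OF s s0])
  show ?thesis using W.N_second_moment martingale_v[OF s s0] by (simp add: W.V_def)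
qed

lemma N_square_integrable:
  assumes s: "s \<in> horizon T"
  shows "integrable M (\<lambda>z. (N s z)\<^sup>2)" "expectation (\<lambda>z. (N s z)\<^sup>2) = v s"
proof -
  show i: "integrable M (\<lambda>z. (N s z)\<^sup>2)"
    by (rule integrableI_bounded) (use N_measurable[OF s] N_second_moment[OF s] in auto)
  show "expectation (\<lambda>z. (N s z)\<^sup>2) = v s"
    using nn_integral_eq_integral[OF i] N_second_moment[OF s] v_nonneg[OF s] by simp
qed

end

section \<open>Asymptotics of the deterministic coefficients\<close>

context perturbed_diffusion
begin

lemma e_nz[simp]: "e s \<noteq> 0"
  using e_pos[of s] by linarith

lemma no_drift: "\<alpha> = 0 \<Longrightarrow> w s = 0" "\<alpha> = 0 \<Longrightarrow> \<beta> s = 0"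
proof -
  assume "\<alpha> = 0"
  then have "\<alpha> * x = 0" for x by simp
  then show w: "w s = 0" for s unfolding w_def .
  show "\<beta> s = 0" unfolding \<beta>_def w by simp
qed

lemma \<beta>_eq: "t \<in> horizon T \<Longrightarrow> \<beta> t = \<alpha> * (LBINT x:{0..t}. b x)"
  using LBINT_eq_integral[OF cont_Icc[OF b_cont]] by (simp add: \<beta>_def w_def[abs_def])

lemma \<psi>_limit:
  assumes "0 < \<epsilon>" obtains t1 where "t1 \<in> horizon T" "\<And>s. s \<in> horizon T \<Longrightarrow> t1 \<le> s \<Longrightarrow> \<bar>\<psi> s - C\<bar> < \<epsilon>"
proof -
  from tendstoD[OF C_lim assms] obtain t1 where t1: "t1 \<in> horizon T"
    "\<forall>t\<in>horizon T. t1 \<le> t \<longrightarrow> dist (b t / (\<sigma> t)\<^sup>2 * exp (2 * \<alpha> * (LBINT w:{0..t}. b w))) C < \<epsilon>"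
    unfolding eventually_at_horizon[OF T_pos] by blast
  have "b t / (\<sigma> t)\<^sup>2 * exp (2 * \<alpha> * (LBINT w:{0..t}. b w)) = \<psi> t" if "t \<in> horizon T" for t
  proof -
    have "exp (2 * \<alpha> * (LBINT w:{0..t}. b w)) = exp (\<beta> t) ^ 2"
      unfolding \<beta>_eq[OF that] by (simp add: power2_eq_square exp_add[symmetric])
    then show ?thesis by (simp add: \<psi>_def h_def e_def exp_minus power_mult_distrib field_simps)
  qed
  with t1 show ?thesis by (intro that[OF t1(1)]) (auto simp: dist_real_def)
qed

lemma bounded_on_horizon:
  fixes f :: "real \<Rightarrow> real"
  assumes f: "continuous_on (horizon T) f" and t1: "t1 \<in> horizon T"
    and k: "\<And>s. s \<in> horizon T \<Longrightarrow> t1 \<le> s \<Longrightarrow> \<bar>f s\<bar> \<le> k"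
  obtains c where "0 < c" "\<And>s. s \<in> horizon T \<Longrightarrow> \<bar>f s\<bar> \<le> c"
proof -
  obtain c where c: "0 < c" "\<And>s. s \<in> {0..t1} \<Longrightarrow> \<bar>f s\<bar> \<le> c"
    using compact_imp_bounded[OF compact_continuous_image[OF cont_Icc[OF f t1] compact_Icc]]
    unfolding bounded_pos by auto
  show ?thesis
  proof (rule that[of "max c k"])
    fix s assume s: "s \<in> horizon T"
    show "\<bar>f s\<bar> \<le> max c k"
      using c(2)[of s] k[OF s] s by (cases "s \<le> t1") (auto simp: horizon_def)
  qed (use c in auto)
qed

lemma \<psi>_bounded: obtains c where "0 < c" "\<And>s. s \<in> horizon T \<Longrightarrow> \<bar>\<psi> s\<bar> \<le> c"
proof -
  obtain t1 where t1: "t1 \<in> horizon T" "\<And>s. s \<in> horizon T \<Longrightarrow> t1 \<le> s \<Longrightarrow> \<bar>\<psi> s - C\<bar> < 1" by (rule \<psi>_limit[OF zero_less_one]) blast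
  have "\<bar>\<psi> s\<bar> \<le> \<bar>C\<bar> + 1" if "s \<in> horizon T" "t1 \<le> s" for s using t1(2)[OF that] by linarith
  then show ?thesis using bounded_on_horizon[OF \<psi>_cont t1(1)] that by blast
qed

lemma fisher_info_X_le:
  assumes t: "t \<in> horizon T" and c: "\<And>s. s \<in> horizon T \<Longrightarrow> \<bar>\<psi> s\<bar> \<le> c"
  shows "fisher_info M b \<sigma> (\<lambda>x. x) X t \<le> c\<^sup>2 * (v t)\<^sup>2"
proof -
  have tH: "s \<in> horizon T" if "s \<in> {0..t}" for s using horizon_Icc[OF t] that by blast
  have ex: "(b s)\<^sup>2 / (\<sigma> s)\<^sup>2 * expectation (\<lambda>z. (X s z)\<^sup>2) = (\<psi> s)\<^sup>2 * v s * (h s)\<^sup>2" if s: "s \<in> {0..t}" for s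
  proof -
    have "expectation (\<lambda>z. (N s z)\<^sup>2) = (e s)\<^sup>2 * expectation (\<lambda>z. (X s z)\<^sup>2)"
      by (simp add: N_def power_mult_distrib)
    then have "expectation (\<lambda>z. (X s z)\<^sup>2) = v s / (e s)\<^sup>2"
      using N_square_integrable(2)[OF tH[OF s]] by (simp add: field_simps)
    then show ?thesis using \<sigma>_pos[OF tH[OF s]] by (simp add: \<psi>_def h_def power_mult_distrib power_divide power2_eq_square)
  qed
  have cont: "continuous_on {0..t} (\<lambda>s. (\<psi> s)\<^sup>2 * v s * (h s)\<^sup>2)"
    by (intro continuous_intros cont_Icc[OF \<psi>_cont t] cont_Icc[OF v_cont t] cont_Icc[OF h_cont t])
  have "fisher_info M b \<sigma> (\<lambda>x. x) X t = (LBINT s:{0..t}. (\<psi> s)\<^sup>2 * v s * (h s)\<^sup>2)"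
    unfolding fisher_info_def by (rule set_lebesgue_integral_cong) (use ex in auto)
  also have "... = integral {0..t} (\<lambda>s. (\<psi> s)\<^sup>2 * v s * (h s)\<^sup>2)" by (rule LBINT_eq_integral[OF cont])
  also have "... \<le> integral {0..t} (\<lambda>s. c\<^sup>2 * v t * (h s)\<^sup>2)"
  proof (rule integral_le)
    fix s assume s: "s \<in> {0..t}"
    have "(\<psi> s)\<^sup>2 \<le> c\<^sup>2" using power_mono[OF c[OF tH[OF s]] abs_ge_zero, of 2] by simp
    then show "(\<psi> s)\<^sup>2 * v s * (h s)\<^sup>2 \<le> c\<^sup>2 * v t * (h s)\<^sup>2"
      using v_le[OF t s] v_nonneg[OF tH[OF s]] by (intro mult_right_mono mult_mono) auto
  qed (use cont in \<open>auto intro!: integrable_continuous_real continuous_intros cont_Icc[OF h_cont t]\<close>)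
  also have "... = c\<^sup>2 * v t * v t"
    by (simp only: Henstock_Kurzweil_Integration.integral_mult_right v_def[of t, symmetric])
  also have "... = c\<^sup>2 * (v t)\<^sup>2" by (simp add: power2_eq_square)
  finally show ?thesis .
qed

text \<open>The Fisher information of \<open>X\<close> is at most a constant times \<open>v\<^sup>2\<close>, because \<open>\<psi>\<close> is bounded.\<close>

lemma v_unbounded:
  obtains t1 where "t1 \<in> horizon T" "0 < t1" "\<And>s. s \<in> horizon T \<Longrightarrow> t1 \<le> s \<Longrightarrow> Z \<le> v s"
proof -
  obtain c where c: "0 < c" "\<And>s. s \<in> horizon T \<Longrightarrow> \<bar>\<psi> s\<bar> \<le> c" by (rule \<psi>_bounded) blast
  define \<nu> where "\<nu> = max Z 1"
  have "eventually (\<lambda>t. c\<^sup>2 * \<nu>\<^sup>2 < fisher_info M b \<sigma> (\<lambda>x. x) X t) (at_horizon T)"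
    using info_X by (simp add: filterlim_at_top_dense)
  then obtain t1 where t1: "t1 \<in> horizon T" "\<And>t. t \<in> horizon T \<Longrightarrow> t1 \<le> t \<Longrightarrow> c\<^sup>2 * \<nu>\<^sup>2 < fisher_info M b \<sigma> (\<lambda>x. x) X t"
    unfolding eventually_at_horizon[OF T_pos] by blast
  have *: "\<nu> \<le> v s" if s: "s \<in> horizon T" "t1 \<le> s" for s
  proof (rule ccontr)
    assume "\<not> \<nu> \<le> v s"
    then have "(v s)\<^sup>2 \<le> \<nu>\<^sup>2" using v_nonneg[OF s(1)] by (intro power_mono) auto
    then have "c\<^sup>2 * (v s)\<^sup>2 \<le> c\<^sup>2 * \<nu>\<^sup>2" by (rule mult_left_mono) simp
    then show False using t1(2)[OF s] fisher_info_X_le[OF s(1) c(2)] by linarith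
  qed
  have "t1 \<noteq> 0" using *[OF t1(1)] v_0 by (auto simp: \<nu>_def)
  then have "0 < t1" using t1(1) by (auto simp: horizon_def)
  then show ?thesis using * by (intro that[OF t1(1)]) (auto simp: \<nu>_def)
qed

text \<open>This is where the sign condition enters: towards the end of the horizon the drift coefficient
  is positive and dominates the variance growth.\<close>

lemma drift_dominates:
  assumes \<alpha>: "\<alpha> \<noteq> 0"
  obtains t1 k where "t1 \<in> horizon T" "0 < k" "\<And>s. s \<in> horizon T \<Longrightarrow> t1 \<le> s \<Longrightarrow> 0 < w s \<and> (h s)\<^sup>2 \<le> k * w s"
proof -
  have aC: "0 < \<alpha> * C" using sign \<alpha> C_nz by (auto simp: sgn_if zero_less_mult_iff split: if_splits)
  have "0 < \<bar>C\<bar> / 2" using C_nz by simp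
  then obtain t1 where t1: "t1 \<in> horizon T" "\<And>s. s \<in> horizon T \<Longrightarrow> t1 \<le> s \<Longrightarrow> \<bar>\<psi> s - C\<bar> < \<bar>C\<bar> / 2" by (rule \<psi>_limit) blast
  show ?thesis
  proof (rule that[OF t1(1), of "2 / (\<alpha> * C)"])
    show "0 < 2 / (\<alpha> * C)" using aC by simp
    fix s assume s: "s \<in> horizon T" "t1 \<le> s"
    have "\<bar>\<alpha> * (\<psi> s - C)\<bar> \<le> \<bar>\<alpha>\<bar> * (\<bar>C\<bar> / 2)"
      unfolding abs_mult using t1(2)[OF s] by (intro mult_left_mono) auto
    also have "\<bar>\<alpha>\<bar> * (\<bar>C\<bar> / 2) = \<alpha> * C / 2" using aC by (simp add: abs_mult[symmetric])
    finally have "- (\<alpha> * C / 2) \<le> \<alpha> * (\<psi> s - C)" by (simp only: abs_le_iff) linarith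
    then have "\<alpha> * C / 2 \<le> \<alpha> * \<psi> s" unfolding right_diff_distrib by linarith
    moreover have "w s = \<alpha> * \<psi> s * (h s)\<^sup>2" using h_pos[OF s(1)] by (simp add: w_def \<psi>_def)
    ultimately have le: "\<alpha> * C / 2 * (h s)\<^sup>2 \<le> w s" by (simp only: mult_right_mono zero_le_power2)
    moreover have "0 < \<alpha> * C / 2 * (h s)\<^sup>2" using aC h_pos[OF s(1)] by simp
    ultimately have "0 < w s" by linarith
    moreover have "(h s)\<^sup>2 \<le> 2 / (\<alpha> * C) * w s" using le aC by (simp add: field_simps)
    ultimately show "0 < w s \<and> (h s)\<^sup>2 \<le> 2 / (\<alpha> * C) * w s" ..
  qed
qed

lemma integral_split:
  fixes f :: "real \<Rightarrow> real"
  assumes f: "continuous_on (horizon T) f" and t: "t \<in> horizon T" and s: "0 \<le> s" "s \<le> t"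
  shows "integral {0..t} f = integral {0..s} f + integral {s..t} f"
  by (rule Henstock_Kurzweil_Integration.integral_combine[symmetric])
    (use s in \<open>auto intro!: integrable_continuous_real cont_Icc[OF f t]\<close>)

lemma cont_sub: "continuous_on (horizon T) f \<Longrightarrow> t \<in> horizon T \<Longrightarrow> 0 \<le> s \<Longrightarrow> continuous_on {s..t} f"
  by (rule continuous_on_subset[OF cont_Icc]) auto

lemma e_bounded: obtains c where "0 < c" "\<And>s. s \<in> horizon T \<Longrightarrow> e s \<le> c"
proof (cases "\<alpha> = 0")
  case True
  have "e s \<le> 1" for s unfolding e_def no_drift(2)[OF True] by simp
  then show ?thesis by (intro that[of 1]) auto
next
  case False
  obtain t1 k where t1: "t1 \<in> horizon T" "0 < k" "\<And>s. s \<in> horizon T \<Longrightarrow> t1 \<le> s \<Longrightarrow> 0 < w s \<and> (h s)\<^sup>2 \<le> k * w s"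
    by (rule drift_dominates[OF False]) blast
  have t10: "0 \<le> t1" using t1(1) by (simp add: horizon_def)
  have "\<bar>e s\<bar> \<le> e t1" if s: "s \<in> horizon T" "t1 \<le> s" for s
  proof -
    have "0 \<le> integral {t1..s} w"
      by (rule integral_nonneg[OF integrable_continuous_real[OF cont_sub[OF w_cont s(1) t10]]])
        (use t1(3) horizon_le[OF s(1)] t10 in \<open>force intro: less_imp_le\<close>)
    then have "\<beta> t1 \<le> \<beta> s" using integral_split[OF w_cont s(1) t10 s(2)] by (simp add: \<beta>_def)
    then show ?thesis by (simp add: e_def)
  qed
  from bounded_on_horizon[OF e_cont t1(1) this] obtain c where "0 < c" "\<And>s. s \<in> horizon T \<Longrightarrow> \<bar>e s\<bar> \<le> c" by blast
  then have "e s \<le> c" if "s \<in> horizon T" for s using abs_ge_self[of "e s"] order_trans that by blast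
  with \<open>0 < c\<close> show ?thesis by (rule that)
qed

text \<open>The weight governing the perturbation decays exponentially in \<open>\<beta>\<close>, while \<open>v\<close> grows at most
  linearly in \<open>\<beta>\<close>; this uses \<open>\<gamma> < 1\<close>.\<close>

definition weight :: "real \<Rightarrow> real" where "weight s = \<bar>w s\<bar> * exp (- (1 - \<gamma>) * \<beta> s)"

lemma weight_cont: "continuous_on (horizon T) weight"
  unfolding weight_def[abs_def] by (intro continuous_intros w_cont \<beta>_cont)

lemma weight_nonneg: "0 \<le> weight s" by (simp add: weight_def)

lemma weight_integral_bounded:
  obtains k where "0 \<le> k" "\<And>t. t \<in> horizon T \<Longrightarrow> integral {0..t} (\<lambda>s. weight s * (1 + v s)) \<le> k"
proof (cases "\<alpha> = 0")
  case True
  have "weight s = 0" for s unfolding weight_def no_drift(1)[OF True] by simp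
  then show ?thesis by (intro that[of 0]) auto
next
  case False
  obtain t1 k where t1: "t1 \<in> horizon T" "0 < k" "\<And>s. s \<in> horizon T \<Longrightarrow> t1 \<le> s \<Longrightarrow> 0 < w s \<and> (h s)\<^sup>2 \<le> k * w s"
    by (rule drift_dominates[OF False]) blast
  have t10: "0 \<le> t1" using t1(1) by (simp add: horizon_def)
  \<comment> \<open>One half of the exponential decay absorbs the growth of \<open>v\<close>, the other half makes the tail integrable.\<close>
  define \<theta> where "\<theta> = (1 - \<gamma>) / 2"
  have \<theta>: "0 < \<theta>" using \<gamma> by (simp add: \<theta>_def)
  define A where "A = 1 + v t1 - k * \<beta> t1"
  define k1 where "k1 = \<bar>A\<bar> * exp (- \<theta> * \<beta> t1) + k / \<theta>"
  have k1: "0 \<le> k1" using t1 \<theta> by (simp add: k1_def)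
  let ?f = "\<lambda>s. weight s * (1 + v s)"
  have fc: "continuous_on (horizon T) ?f" by (intro continuous_intros weight_cont v_cont)
  have f0: "0 \<le> ?f s" if "s \<in> horizon T" for s using weight_nonneg v_nonneg[OF that] by simp
  have tail: "?f s \<le> k1 * (w s * exp (- \<theta> * \<beta> s))" if s: "s \<in> horizon T" "t1 \<le> s" for s
  proof -
    have w0: "0 < w x \<and> (h x)\<^sup>2 \<le> k * w x" if "x \<in> {t1..s}" for x
      using t1(3)[of x] horizon_le[OF s(1)] that t10 by auto
    have i: "w integrable_on {t1..s}" by (rule integrable_continuous_real[OF cont_sub[OF w_cont s(1) t10]])
    have "integral {t1..s} (\<lambda>x. (h x)\<^sup>2) \<le> integral {t1..s} (\<lambda>x. k * w x)"
      by (rule integral_le) (use i w0 in \<open>auto intro!: integrable_continuous_real cont_sub[OF h2_cont s(1) t10] integrable_on_mult_right\<close>)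
    then have v: "1 + v s \<le> A + k * \<beta> s"
      using integral_split[OF w_cont s(1) t10 s(2)] integral_split[OF h2_cont s(1) t10 s(2)]
      by (simp add: A_def v_def \<beta>_def algebra_simps)
    have "0 \<le> integral {t1..s} w" by (rule integral_nonneg[OF i]) (use w0 in \<open>force intro: less_imp_le\<close>)
    then have \<beta>: "\<beta> t1 \<le> \<beta> s" using integral_split[OF w_cont s(1) t10 s(2)] by (simp add: \<beta>_def)
    have ex: "exp (- \<theta> * \<beta> s) \<le> exp (- \<theta> * \<beta> t1)" using \<theta> \<beta> by simp
    have "A * exp (- \<theta> * \<beta> s) \<le> \<bar>A\<bar> * exp (- \<theta> * \<beta> t1)"
      by (rule order_trans[OF mult_right_mono[OF abs_ge_self] mult_left_mono[OF ex]]) auto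
    moreover have "k * \<beta> s * exp (- \<theta> * \<beta> s) \<le> k / \<theta>"
    proof -
      have "\<theta> * \<beta> s \<le> exp (\<theta> * \<beta> s)" using exp_ge_add_one_self[of "\<theta> * \<beta> s"] by linarith
      then have "\<theta> * \<beta> s * exp (- \<theta> * \<beta> s) \<le> 1" by (simp add: exp_minus field_simps)
      then have "k / \<theta> * (\<theta> * \<beta> s * exp (- \<theta> * \<beta> s)) \<le> k / \<theta> * 1" using t1 \<theta> by (intro mult_left_mono) auto
      then show ?thesis using \<theta> by simp
    qed
    ultimately have "(A + k * \<beta> s) * exp (- \<theta> * \<beta> s) \<le> k1" by (simp add: k1_def algebra_simps)
    moreover have "(1 + v s) * exp (- \<theta> * \<beta> s) \<le> (A + k * \<beta> s) * exp (- \<theta> * \<beta> s)" using v by (rule mult_right_mono) simp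
    ultimately have "(1 + v s) * exp (- \<theta> * \<beta> s) \<le> k1" by linarith
    then have "(w s * exp (- \<theta> * \<beta> s)) * ((1 + v s) * exp (- \<theta> * \<beta> s)) \<le> (w s * exp (- \<theta> * \<beta> s)) * k1"
      using t1(3)[OF s] by (intro mult_left_mono) (auto simp: less_imp_le)
    moreover have "?f s = (w s * exp (- \<theta> * \<beta> s)) * ((1 + v s) * exp (- \<theta> * \<beta> s))"
    proof -
      have "exp (- (1 - \<gamma>) * \<beta> s) = exp (- \<theta> * \<beta> s) * exp (- \<theta> * \<beta> s)"
        by (simp add: exp_add[symmetric] \<theta>_def algebra_simps add_divide_distrib[symmetric])
      then show ?thesis using t1(3)[OF s] by (simp add: weight_def)
    qed
    ultimately show ?thesis by (simp only: mult.commute[of k1])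
  qed
  define K where "K = integral {0..t1} ?f + k1 * exp (- \<theta> * \<beta> t1) / \<theta>"
  have p: "0 \<le> k1 * exp (- \<theta> * \<beta> t1) / \<theta>" using k1 \<theta> by simp
  have i0: "0 \<le> integral {0..t1} ?f"
    by (rule integral_nonneg[OF integrable_continuous_real[OF cont_Icc[OF fc t1(1)]]]) (use f0 horizon_Icc[OF t1(1)] in blast)
  show ?thesis
  proof (rule that[of K])
    show "0 \<le> K" using i0 p by (simp add: K_def)
    fix t assume t: "t \<in> horizon T"
    have t0: "0 \<le> t" using t by (simp add: horizon_def)
    show "integral {0..t} ?f \<le> K"
    proof (cases "t \<le> t1")
      case True
      have "integral {0..t} ?f \<le> integral {0..t1} ?f"
        by (rule integral_subset_le) (use True f0 horizon_Icc[OF t1(1)] in \<open>auto intro!: integrable_continuous_real cont_Icc[OF fc t] cont_Icc[OF fc t1(1)]\<close>)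
      then show ?thesis using p by (simp add: K_def)
    next
      case False
      then have tt: "t1 \<le> t" by simp
      have gc: "continuous_on (horizon T) (\<lambda>s. k1 * (w s * exp (- \<theta> * \<beta> s)))" by (intro continuous_intros w_cont \<beta>_cont)
      have "integral {t1..t} ?f \<le> integral {t1..t} (\<lambda>s. k1 * (w s * exp (- \<theta> * \<beta> s)))"
      proof (rule integral_le)
        fix s assume "s \<in> {t1..t}"
        then show "?f s \<le> k1 * (w s * exp (- \<theta> * \<beta> s))" using tail[of s] horizon_le[OF t, of s] t10 by auto
      qed (intro integrable_continuous_real cont_sub[OF fc t t10] cont_sub[OF gc t t10])+
      also have "... = k1 * ((exp (- \<theta> * \<beta> t1) - exp (- \<theta> * \<beta> t)) / \<theta>)"
      proof -
        have "((\<lambda>s. w s * exp (- \<theta> * \<beta> s)) has_integral (- (exp (- \<theta> * \<beta> t) / \<theta>)) - (- (exp (- \<theta> * \<beta> t1) / \<theta>))) {t1..t}"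
        proof (rule fundamental_theorem_of_calculus[OF tt])
          fix x assume x: "x \<in> {t1..t}"
          have "(\<beta> has_real_derivative w x) (at x within {t1..t})"
            by (rule DERIV_subset[OF \<beta>_deriv[OF t]]) (use x t10 in auto)
          then have "((\<lambda>s. - (exp (- \<theta> * \<beta> s) / \<theta>)) has_real_derivative w x * exp (- \<theta> * \<beta> x)) (at x within {t1..t})"
            using \<theta> by (auto intro!: derivative_eq_intros)
          then show "((\<lambda>s. - (exp (- \<theta> * \<beta> s) / \<theta>)) has_vector_derivative w x * exp (- \<theta> * \<beta> x)) (at x within {t1..t})"
            by (simp add: has_real_derivative_iff_has_vector_derivative)
        qed
        from integral_unique[OF this] show ?thesis by (simp add: diff_divide_distrib)
      qed
      also have "... \<le> k1 * (exp (- \<theta> * \<beta> t1) / \<theta>)"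
        using k1 \<theta> by (intro mult_left_mono divide_right_mono) auto
      finally show ?thesis using integral_split[OF fc t t10 tt] by (simp add: K_def)
    qed
  qed
qed

section \<open>The perturbation is negligible in mean square\<close>

text \<open>Dividing by \<open>1 + v\<close> makes the bound uniform in time, so that the weighted integral of
  \<open>(1 + |N|)\<^sup>2\<close> can be estimated with \<open>weight_integral_bounded\<close>.\<close>

lemma one_plus_N_second_moment:
  assumes s: "s \<in> horizon T"
  shows "nn_mean M (\<lambda>z. (1 + \<bar>N s z\<bar>)\<^sup>2 / (1 + v s)) \<le> ennreal 2"
proof -
  have vs: "0 < 1 + v s" using v_nonneg[OF s] by linarith
  have "mean_square M (\<lambda>z. 1 + \<bar>N s z\<bar>) \<le> ennreal (2 * 1 + 2 * v s)"
    by (rule L2_add_le[where X="\<lambda>_. 1" and Y="N s"])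
      (use N_measurable[OF s] N_second_moment[OF s] v_nonneg[OF s] in \<open>auto simp: emeasure_space_1\<close>)
  then have "ennreal (1 / (1 + v s)) * mean_square M (\<lambda>z. 1 + \<bar>N s z\<bar>) \<le> ennreal (1 / (1 + v s)) * ennreal (2 * 1 + 2 * v s)"
    by (rule mult_left_mono) simp
  also have "... = ennreal (1 / (1 + v s) * (2 * 1 + 2 * v s))" using vs v_nonneg[OF s] by (intro ennreal_mult[symmetric]) auto
  also have "1 / (1 + v s) * (2 * 1 + 2 * v s) = 2" using vs by (simp add: field_simps)
  also have "ennreal (1 / (1 + v s)) * mean_square M (\<lambda>z. 1 + \<bar>N s z\<bar>) = nn_mean M (\<lambda>z. (1 + \<bar>N s z\<bar>)\<^sup>2 / (1 + v s))"
    using N_measurable[OF s] vs by (subst nn_integral_cmult[symmetric]) (auto simp: ennreal_mult[symmetric])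
  finally show ?thesis .
qed

text \<open>The discounted difference \<open>D\<close> of the two solutions stays bounded in mean square: since the
  perturbation is sublinear, its contribution is controlled by the integrable weight and
  Gronwall's inequality applies path by path.\<close>

lemma D_second_moment_bounded:
  obtains K where "0 \<le> K" "\<And>t. t \<in> horizon T \<Longrightarrow> mean_square M (D t) \<le> ennreal K"
proof -
  obtain k where k: "0 \<le> k" "\<And>t. t \<in> horizon T \<Longrightarrow> integral {0..t} (\<lambda>s. weight s * (1 + v s)) \<le> k"
    by (rule weight_integral_bounded) blast
  obtain c where c: "0 < c" "\<And>s. s \<in> horizon T \<Longrightarrow> e s \<le> c" by (rule e_bounded) blast
  define e1 where "e1 = max 1 c"
  define L1 where "L1 = L * (e1 + 1)"
  have e1: "1 \<le> e1" by (simp add: e1_def)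
  have L1: "0 \<le> L1" using L e1 by (simp add: L1_def)
  let ?w = "\<lambda>s. L1 * weight s"
  have wc: "continuous_on (horizon T) ?w" by (intro continuous_intros weight_cont)
  have w0: "0 \<le> ?w s" for s using L1 weight_nonneg by simp
  have wv: "continuous_on (horizon T) (\<lambda>s. ?w s * (1 + v s))" by (intro continuous_intros weight_cont v_cont)
  define k' where "k' = L1 * k"
  have k'0: "0 \<le> k'" using L1 k by (simp add: k'_def)
  have iwv: "integral {0..t} (\<lambda>s. ?w s * (1 + v s)) \<le> k'" if t: "t \<in> horizon T" for t
  proof -
    have "integral {0..t} (\<lambda>s. ?w s * (1 + v s)) = L1 * integral {0..t} (\<lambda>s. weight s * (1 + v s))"
      by (simp add: mult.assoc)
    then show ?thesis unfolding k'_def using mult_left_mono[OF k(2)[OF t] L1] by simp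
  qed
  have iw: "integral {0..t} ?w \<le> k'" if t: "t \<in> horizon T" for t
  proof -
    have "integral {0..t} ?w \<le> integral {0..t} (\<lambda>s. ?w s * (1 + v s))"
    proof (rule integral_le)
      fix s assume "s \<in> {0..t}"
      then have "0 \<le> v s" using v_nonneg horizon_Icc[OF t] by blast
      then have "?w s * 1 \<le> ?w s * (1 + v s)" by (intro mult_left_mono w0) auto
      then show "?w s \<le> ?w s * (1 + v s)" by simp
    qed (auto intro!: integrable_continuous_real cont_Icc[OF wc t] cont_Icc[OF wv t])
    then show ?thesis using iwv[OF t] by linarith
  qed
  \<comment> \<open>From \<open>e |N + D|\<^sup>\<gamma> / e\<^sup>\<gamma>\<close>, the factor \<open>e\<close> to the power \<open>1 - \<gamma>\<close> splits off and yields the weight.\<close>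
  have drift: "\<bar>w s * e s * r (Y s z)\<bar> \<le> ?w s * (1 + \<bar>N s z\<bar>) + ?w s * \<bar>D s z\<bar>" if s: "s \<in> horizon T" for s z
  proof -
    have pw: "e s powr (1 - \<gamma>) = exp (- (1 - \<gamma>) * \<beta> s)" by (simp add: powr_def e_def algebra_simps)
    have "e s = e s powr (1 - \<gamma>) * e s powr \<gamma>" using less_imp_le[OF e_pos[of s]] by (simp add: powr_add[symmetric])
    also have "... \<le> e s powr (1 - \<gamma>) * e1"
    proof (rule mult_left_mono)
      have "e s powr \<gamma> \<le> e1 powr \<gamma>" by (rule powr_mono2) (use c(2)[OF s] \<gamma> less_imp_le[OF e_pos[of s]] in \<open>auto simp: e1_def\<close>)
      also have "... \<le> e1 powr 1" using e1 \<gamma> by (intro powr_mono) auto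
      finally show "e s powr \<gamma> \<le> e1" using e1 by simp
    qed simp
    finally have 1: "e s \<le> e s powr (1 - \<gamma>) * e1" .
    have "Y s z = (N s z + D s z) / e s" using N_plus_D[of s z] e_pos[of s] by simp
    then have "e s * abs_pow (Y s z) \<gamma> = e s powr (1 - \<gamma>) * abs_pow (N s z + D s z) \<gamma>"
      using abs_pow_divide[OF e_pos \<gamma>(1)] by simp
    also have "... \<le> e s powr (1 - \<gamma>) * (1 + \<bar>N s z + D s z\<bar>)"
      by (intro mult_left_mono abs_pow_le_one_plus \<gamma>) simp
    also have "... \<le> e s powr (1 - \<gamma>) * (1 + \<bar>N s z\<bar> + \<bar>D s z\<bar>)"
      by (intro mult_left_mono) auto
    finally have "e s * (1 + abs_pow (Y s z) \<gamma>) \<le> e s powr (1 - \<gamma>) * (e1 + (1 + \<bar>N s z\<bar> + \<bar>D s z\<bar>))"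
      using 1 by (simp add: algebra_simps)
    also have "... \<le> e s powr (1 - \<gamma>) * ((e1 + 1) * (1 + \<bar>N s z\<bar> + \<bar>D s z\<bar>))"
    proof (rule mult_left_mono)
      have "e1 * 1 \<le> e1 * (1 + \<bar>N s z\<bar> + \<bar>D s z\<bar>)" using e1 by (intro mult_left_mono) auto
      then show "e1 + (1 + \<bar>N s z\<bar> + \<bar>D s z\<bar>) \<le> (e1 + 1) * (1 + \<bar>N s z\<bar> + \<bar>D s z\<bar>)"
        unfolding distrib_right by simp
    qed simp
    finally have 2: "e s * (1 + abs_pow (Y s z) \<gamma>) \<le> e s powr (1 - \<gamma>) * ((e1 + 1) * (1 + \<bar>N s z\<bar> + \<bar>D s z\<bar>))" .
    have "\<bar>w s * e s * r (Y s z)\<bar> = \<bar>w s\<bar> * (e s * \<bar>r (Y s z)\<bar>)" using less_imp_le[OF e_pos[of s]] by (simp add: abs_mult)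
    also have "... \<le> \<bar>w s\<bar> * (e s * (L * (1 + abs_pow (Y s z) \<gamma>)))"
      using less_imp_le[OF e_pos[of s]] by (intro mult_left_mono r_growth) auto
    also have "... = \<bar>w s\<bar> * L * (e s * (1 + abs_pow (Y s z) \<gamma>))" by simp
    also have "... \<le> \<bar>w s\<bar> * L * (e s powr (1 - \<gamma>) * ((e1 + 1) * (1 + \<bar>N s z\<bar> + \<bar>D s z\<bar>)))"
      using L by (intro mult_left_mono 2) auto
    also have "... = ?w s * (1 + \<bar>N s z\<bar>) + ?w s * \<bar>D s z\<bar>"
      unfolding pw by (simp add: weight_def L1_def algebra_simps)
    finally show ?thesis .
  qed
  show ?thesis
  proof (rule that[of "exp k' ^ 2 * (k' * (2 * k'))"])
    show "0 \<le> exp k' ^ 2 * (k' * (2 * k'))" using k'0 by simp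
    fix t assume t: "t \<in> horizon T"
    have t0: "0 \<le> t" using t by (simp add: horizon_def)
    have tH: "s \<in> horizon T" if "s \<in> {0..t}" for s using horizon_Icc[OF t] that by blast
    let ?\<Phi> = "\<lambda>s z. (1 + \<bar>N s z\<bar>)\<^sup>2 / (1 + v s)"
    let ?I = "\<lambda>z. integral {0..t} (\<lambda>s. ?w s * (1 + v s) * ?\<Phi> s z)"
    have v1: "0 < 1 + v s" if "s \<in> {0..t}" for s using v_nonneg[OF tH[OF that]] by linarith
    have \<Phi>c: "continuous_on {0..t} (\<lambda>s. ?\<Phi> s z)" if "z \<in> space M" for z
      by (intro continuous_intros cont_Icc[OF v_cont t] cont_Icc[OF N_cont[OF that] t]) (use v1 in force)
    have \<Phi>m: "?\<Phi> s \<in> borel_measurable M" if "s \<in> {0..t}" for s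
      using N_measurable[OF tH[OF that]] by measurable
    have I: "nn_mean M ?I \<le> ennreal (2 * k')"
    proof -
      have "nn_mean M ?I \<le> ennreal (2 * integral {0..t} (\<lambda>s. ?w s * (1 + v s)))"
      proof (rule expected_integral_le[OF t0 \<Phi>m \<Phi>c])
        fix s assume s: "s \<in> {0..t}"
        show "0 \<le> ?\<Phi> s z" for z using v1[OF s] by simp
        show "0 \<le> ?w s * (1 + v s)" using w0[of s] v1[OF s] by (simp add: less_imp_le)
        show "nn_mean M (?\<Phi> s) \<le> ennreal 2" by (rule one_plus_N_second_moment[OF tH[OF s]])
      qed (use cont_Icc[OF wv t] in auto)
      also have "... \<le> ennreal (2 * k')" using iwv[OF t] by (intro ennreal_leI) simp
      finally show ?thesis .
    qed
    have path: "AE z in M. (D t z)\<^sup>2 \<le> exp k' ^ 2 * (k' * ?I z)"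
      using D_formula AE_space
    proof eventually_elim
      case (elim z)
      note Nc = cont_Icc[OF N_cont[OF elim(2)] t] and Dc = cont_Icc[OF D_cont[OF elim(2)] t]
      note wct = cont_Icc[OF wc t]
      let ?A = "integral {0..t} (\<lambda>s. ?w s * (1 + \<bar>N s z\<bar>))"
      have c1: "continuous_on {0..t} (\<lambda>s. ?w s * (1 + \<bar>N s z\<bar>))" by (intro continuous_on_mult continuous_intros wct Nc)
      have c2: "continuous_on {0..t} (\<lambda>s. ?w s * \<bar>D s z\<bar>)" by (intro continuous_on_mult continuous_intros wct Dc)
      have c3: "continuous_on {0..t} (\<lambda>s. w s * e s * r (Y s z))"
        by (intro continuous_intros cont_Icc[OF w_cont t] cont_Icc[OF e_cont t] cont_Icc[OF rY_cont[OF elim(2)] t])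
      have "\<bar>D t z\<bar> \<le> ?A * exp (integral {0..t} ?w)"
      proof (rule gronwall[OF t0])
        show "continuous_on {0..t} (\<lambda>s. \<bar>D s z\<bar>)" by (intro continuous_intros Dc)
        fix s assume s: "s \<in> {0..t}"
        then have ss: "{0..s} \<subseteq> {0..t}" by auto
        have "\<bar>D s z\<bar> = norm (integral {0..s} (\<lambda>x. w x * e x * r (Y x z)))" using elim(1) tH[OF s] by simp
        also have "... \<le> integral {0..s} (\<lambda>x. ?w x * (1 + \<bar>N x z\<bar>) + ?w x * \<bar>D x z\<bar>)"
        proof (rule integral_norm_bound_integral)
          fix x assume "x \<in> {0..s}"
          then show "norm (w x * e x * r (Y x z)) \<le> ?w x * (1 + \<bar>N x z\<bar>) + ?w x * \<bar>D x z\<bar>"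
            using drift[of x z] tH[of x] ss by auto
        qed (intro integrable_continuous_real continuous_on_subset[OF _ ss] continuous_on_add c1 c2 c3)+
        also have "... = integral {0..s} (\<lambda>x. ?w x * (1 + \<bar>N x z\<bar>)) + integral {0..s} (\<lambda>x. ?w x * \<bar>D x z\<bar>)"
          by (intro Henstock_Kurzweil_Integration.integral_add integrable_continuous_real continuous_on_subset[OF _ ss] c1 c2)
        also have "integral {0..s} (\<lambda>x. ?w x * (1 + \<bar>N x z\<bar>)) \<le> ?A"
          by (rule integral_subset_le[OF ss]) (use w0 in \<open>auto intro!: integrable_continuous_real continuous_on_subset[OF c1 ss] c1 mult_nonneg_nonneg\<close>)
        finally show "\<bar>D s z\<bar> \<le> ?A + integral {0..s} (\<lambda>x. ?w x * \<bar>D x z\<bar>)" by simp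
      qed (use wct w0 in auto)
      moreover have A0: "0 \<le> ?A" by (rule integral_nonneg[OF integrable_continuous_real[OF c1]]) (use w0 in \<open>auto intro!: mult_nonneg_nonneg\<close>)
      ultimately have "\<bar>D t z\<bar> \<le> ?A * exp k'"
        using iw[OF t] by (meson exp_le_cancel_iff mult_left_mono order_trans)
      from power_mono[OF this abs_ge_zero, of 2] have "(D t z)\<^sup>2 \<le> (?A * exp k')\<^sup>2" by (simp only: power2_abs)
      also have "... = exp k' ^ 2 * ?A\<^sup>2" by (simp add: power_mult_distrib)
      also have "... \<le> exp k' ^ 2 * (k' * ?I z)"
      proof (rule mult_left_mono)
        have "?A\<^sup>2 \<le> integral {0..t} ?w * integral {0..t} (\<lambda>s. ?w s * (1 + \<bar>N s z\<bar>)\<^sup>2)"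
          by (rule integral_Cauchy_Schwarz) (use wct w0 Nc in \<open>auto intro!: continuous_intros\<close>)
        also have "integral {0..t} (\<lambda>s. ?w s * (1 + \<bar>N s z\<bar>)\<^sup>2) = ?I z"
          by (rule Henstock_Kurzweil_Integration.integral_cong) (use v1 in force)
        also have "integral {0..t} ?w * ?I z \<le> k' * ?I z"
        proof (rule mult_right_mono[OF iw[OF t]])
          show "0 \<le> ?I z"
          proof (rule integral_nonneg[OF integrable_continuous_real])
            show "continuous_on {0..t} (\<lambda>s. ?w s * (1 + v s) * ?\<Phi> s z)"
              by (rule continuous_on_mult[OF cont_Icc[OF wv t] \<Phi>c[OF elim(2)]])
            fix s assume s: "s \<in> {0..t}"
            show "0 \<le> ?w s * (1 + v s) * ?\<Phi> s z" using v1[OF s] by (intro mult_nonneg_nonneg[OF mult_nonneg_nonneg[OF w0 less_imp_le[OF v1[OF s]]]]) simp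
          qed
        qed
        finally show "?A\<^sup>2 \<le> k' * ?I z" .
      qed simp
      finally show ?case .
    qed
    have Im: "?I \<in> borel_measurable M"
    proof (rule integral_process_measurable[OF t0])
      fix s assume s: "s \<in> {0..t}"
      show "(\<lambda>z. ?w s * (1 + v s) * ?\<Phi> s z) \<in> borel_measurable M" by (intro borel_measurable_times borel_measurable_const \<Phi>m[OF s])
    next
      fix z assume "z \<in> space M"
      then show "continuous_on {0..t} (\<lambda>s. ?w s * (1 + v s) * ?\<Phi> s z)"
        by (rule continuous_on_mult[OF cont_Icc[OF wv t] \<Phi>c])
    qed
    have "mean_square M (D t) \<le> (\<integral>\<^sup>+z. ennreal (exp k' ^ 2 * k') * ennreal (?I z) \<partial>M)"
    proof (rule nn_integral_mono_AE)
      show "AE z in M. ennreal ((D t z)\<^sup>2) \<le> ennreal (exp k' ^ 2 * k') * ennreal (?I z)"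
        using path
      proof eventually_elim
        case (elim z)
        then have "ennreal ((D t z)\<^sup>2) \<le> ennreal ((exp k' ^ 2 * k') * ?I z)" by (intro ennreal_leI) (simp add: mult.assoc)
        also have "... = ennreal (exp k' ^ 2 * k') * ennreal (?I z)" using k'0 by (intro ennreal_mult') simp
        finally show ?case .
      qed
    qed
    also have "... = ennreal (exp k' ^ 2 * k') * nn_mean M ?I" using Im by (intro nn_integral_cmult) simp
    also have "... \<le> ennreal (exp k' ^ 2 * k') * ennreal (2 * k')" by (intro mult_left_mono I) simp
    also have "... = ennreal (exp k' ^ 2 * (k' * (2 * k')))" using k'0 by (simp add: ennreal_mult[symmetric] mult.assoc)
    finally show "mean_square M (D t) \<le> ennreal (exp k' ^ 2 * (k' * (2 * k')))" .
  qed
qed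

text \<open>The score has the integrand \<open>e (\<rho> + C N)\<close>, of which \<open>C e N\<close> is the leading part.\<close>

definition \<rho> :: "real \<Rightarrow> 'a \<Rightarrow> real" where
  "\<rho> s z = \<psi> s * (N s z + D s z + e s * r (Y s z)) - C * N s z"

lemma integrand_eq:
  assumes s: "s \<in> horizon T"
  shows "b s * a (Y s z) / (\<sigma> s)\<^sup>2 = e s * (\<rho> s z + C * N s z)"
proof -
  have 1: "\<rho> s z + C * N s z = \<psi> s * (e s * a (Y s z))" by (simp add: \<rho>_def N_plus_D a_eq algebra_simps)
  have 2: "\<psi> s * (e s)\<^sup>2 = b s / (\<sigma> s)\<^sup>2" by (simp add: \<psi>_def h_def power_mult_distrib)
  have "e s * (\<rho> s z + C * N s z) = \<psi> s * (e s)\<^sup>2 * a (Y s z)" unfolding 1 by (simp add: power2_eq_square)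
  then show ?thesis unfolding 2 by simp
qed

lemma \<rho>_measurable: "s \<in> horizon T \<Longrightarrow> \<rho> s \<in> borel_measurable M"
  unfolding \<rho>_def[abs_def]
  by (intro borel_measurable_diff borel_measurable_times borel_measurable_add borel_measurable_const N_measurable D_measurable
      measurable_compose[OF Y_measurable r_measurable])

lemma \<rho>_cont: "z \<in> space M \<Longrightarrow> continuous_on (horizon T) (\<lambda>s. \<rho> s z)"
  unfolding \<rho>_def by (intro continuous_intros \<psi>_cont N_cont D_cont e_cont rY_cont)

text \<open>Late in time, \<open>\<psi> - C\<close> is small, which leaves a small multiple of \<open>v\<close>; the contribution of \<open>D\<close> is
  bounded, and by sublinearity that of \<open>r\<close> is a constant plus a small multiple of the second moment
  of \<open>e Y = N + D\<close>. Early in time, all second moments are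
  bounded.\<close>

lemma \<rho>_second_moment:
  assumes eps: "0 < \<epsilon>"
  obtains k where "0 \<le> k" "\<And>s. s \<in> horizon T \<Longrightarrow> mean_square M (\<rho> s) \<le> ennreal (k + \<epsilon> * v s)"
proof -
  obtain K where K: "0 \<le> K" "\<And>t. t \<in> horizon T \<Longrightarrow> mean_square M (D t) \<le> ennreal K"
    by (rule D_second_moment_bounded) blast
  obtain c where c: "0 < c" "\<And>s. s \<in> horizon T \<Longrightarrow> \<bar>\<psi> s\<bar> \<le> c" by (rule \<psi>_bounded) blast
  obtain e0 where e0: "0 < e0" "\<And>s. s \<in> horizon T \<Longrightarrow> e s \<le> e0" by (rule e_bounded) blast
  define \<delta> where "\<delta> = sqrt (\<epsilon> / 12)"
  have \<delta>: "0 < \<delta>" "12 * \<delta>\<^sup>2 = \<epsilon>" using eps by (auto simp: \<delta>_def)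
  define \<epsilon>2 where "\<epsilon>2 = \<delta> / (c * L + 1)"
  have cL: "0 \<le> c * L" using c L by simp
  have \<epsilon>2: "0 < \<epsilon>2" using \<delta> cL by (simp add: \<epsilon>2_def)
  have \<epsilon>2': "c * (L * \<epsilon>2) \<le> \<delta>"
  proof -
    have "c * (L * \<epsilon>2) = \<delta> * (c * L / (c * L + 1))" by (simp add: \<epsilon>2_def)
    also have "... \<le> \<delta> * 1" using cL \<delta> by (intro mult_left_mono) auto
    finally show ?thesis by simp
  qed
  obtain c2 where c2: "0 \<le> c2" "\<And>x. abs_pow x \<gamma> \<le> c2 + \<epsilon>2 * \<bar>x\<bar>" using abs_pow_sublinear[OF \<gamma> \<epsilon>2] by blast
  define K1 where "K1 = L * e0 * (1 + c2)"
  have K1: "0 \<le> K1" using L e0 c2 by (simp add: K1_def)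
  obtain t1 where t1: "t1 \<in> horizon T" "\<And>s. s \<in> horizon T \<Longrightarrow> t1 \<le> s \<Longrightarrow> \<bar>\<psi> s - C\<bar> < \<delta>" by (rule \<psi>_limit[OF \<delta>(1)]) blast
  let ?p = "\<lambda>s. \<bar>\<psi> s - C\<bar> + \<delta>"
  define q where "q = c * (1 + L * \<epsilon>2)"
  have er: "e s * \<bar>r (Y s z)\<bar> \<le> K1 + L * \<epsilon>2 * (\<bar>N s z\<bar> + \<bar>D s z\<bar>)" if s: "s \<in> horizon T" for s z
  proof -
    have "e s * \<bar>r (Y s z)\<bar> \<le> e s * (L * (1 + (c2 + \<epsilon>2 * \<bar>Y s z\<bar>)))"
      using less_imp_le[OF e_pos[of s]] L c2(2)[of "Y s z"]
      by (intro mult_left_mono order_trans[OF r_growth]) auto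
    also have "... = L * e s * (1 + c2) + L * \<epsilon>2 * \<bar>e s * Y s z\<bar>"
      using less_imp_le[OF e_pos[of s]] by (simp add: abs_mult algebra_simps)
    also have "L * e s * (1 + c2) \<le> K1"
      unfolding K1_def using L e0(2)[OF s] c2 by (intro mult_right_mono mult_left_mono) auto
    also have "L * \<epsilon>2 * \<bar>e s * Y s z\<bar> \<le> L * \<epsilon>2 * (\<bar>N s z\<bar> + \<bar>D s z\<bar>)"
      unfolding N_plus_D[symmetric] using L \<epsilon>2 by (intro mult_left_mono abs_triangle_ineq) auto
    finally show ?thesis by simp
  qed
  have \<rho>le: "\<bar>\<rho> s z\<bar> \<le> ?p s * \<bar>N s z\<bar> + q * \<bar>D s z\<bar> + c * K1" if s: "s \<in> horizon T" for s z
  proof -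
    have "\<rho> s z = (\<psi> s - C) * N s z + \<psi> s * D s z + \<psi> s * (e s * r (Y s z))" by (simp add: \<rho>_def algebra_simps)
    then have "\<bar>\<rho> s z\<bar> \<le> \<bar>\<psi> s - C\<bar> * \<bar>N s z\<bar> + \<bar>\<psi> s\<bar> * \<bar>D s z\<bar> + \<bar>\<psi> s\<bar> * (e s * \<bar>r (Y s z)\<bar>)"
    proof -
      have 3: "\<bar>x + y + \<nu>\<bar> \<le> \<bar>x\<bar> + \<bar>y\<bar> + \<bar>\<nu>\<bar>" for x y \<nu> :: real by linarith
      have "\<bar>\<psi> s * (e s * r (Y s z))\<bar> = \<bar>\<psi> s\<bar> * (e s * \<bar>r (Y s z)\<bar>)"
        using abs_of_pos[OF e_pos[of s]] by (simp add: abs_mult)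
      with 3[of "(\<psi> s - C) * N s z" "\<psi> s * D s z" "\<psi> s * (e s * r (Y s z))"]
      show ?thesis unfolding \<open>\<rho> s z = _\<close> by (simp only: abs_mult)
    qed
    also have "\<bar>\<psi> s\<bar> * \<bar>D s z\<bar> \<le> c * \<bar>D s z\<bar>" by (intro mult_right_mono c s) auto
    also have "\<bar>\<psi> s\<bar> * (e s * \<bar>r (Y s z)\<bar>) \<le> c * (K1 + L * \<epsilon>2 * (\<bar>N s z\<bar> + \<bar>D s z\<bar>))"
      by (intro mult_mono c s er) (use c less_imp_le[OF e_pos[of s]] in auto)
    also have "c * (K1 + L * \<epsilon>2 * (\<bar>N s z\<bar> + \<bar>D s z\<bar>)) = c * (L * \<epsilon>2) * \<bar>N s z\<bar> + c * L * \<epsilon>2 * \<bar>D s z\<bar> + c * K1"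
      by (simp add: algebra_simps)
    also have "c * (L * \<epsilon>2) * \<bar>N s z\<bar> \<le> \<delta> * \<bar>N s z\<bar>" by (intro mult_right_mono \<epsilon>2') auto
    finally show ?thesis by (simp add: q_def algebra_simps)
  qed
  have q0: "0 \<le> q" using c L \<epsilon>2 by (simp add: q_def)
  define k where "k = 3 * (c + \<bar>C\<bar> + \<delta>)\<^sup>2 * v t1 + 3 * q\<^sup>2 * K + 3 * (c * K1)\<^sup>2"
  show ?thesis
  proof (rule that[of k])
    show "0 \<le> k" using v_nonneg[OF t1(1)] K by (simp add: k_def)
    fix s assume s: "s \<in> horizon T"
    have pt: "ennreal ((\<rho> s z)\<^sup>2) \<le> ennreal (3 * (?p s)\<^sup>2) * ennreal ((N s z)\<^sup>2) + ennreal (3 * q\<^sup>2) * ennreal ((D s z)\<^sup>2) + ennreal (3 * (c * K1)\<^sup>2)" for z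
    proof -
      have three: "(x + y + \<nu>)\<^sup>2 \<le> 3 * x\<^sup>2 + 3 * y\<^sup>2 + 3 * \<nu>\<^sup>2" for x y \<nu> :: real
      proof -
        have "0 \<le> (x - y)\<^sup>2 + (y - \<nu>)\<^sup>2 + (x - \<nu>)\<^sup>2" by simp
        then show ?thesis by (simp add: power2_eq_square algebra_simps)
      qed
      have "(\<rho> s z)\<^sup>2 \<le> (?p s * \<bar>N s z\<bar> + q * \<bar>D s z\<bar> + c * K1)\<^sup>2"
        using power_mono[OF \<rho>le[OF s, of z] abs_ge_zero, of 2] by simp
      also have "... \<le> 3 * (?p s * \<bar>N s z\<bar>)\<^sup>2 + 3 * (q * \<bar>D s z\<bar>)\<^sup>2 + 3 * (c * K1)\<^sup>2" by (rule three)
      also have "... = 3 * (?p s)\<^sup>2 * (N s z)\<^sup>2 + 3 * q\<^sup>2 * (D s z)\<^sup>2 + 3 * (c * K1)\<^sup>2" by (simp add: power_mult_distrib)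
      finally have "ennreal ((\<rho> s z)\<^sup>2) \<le> ennreal (3 * (?p s)\<^sup>2 * (N s z)\<^sup>2 + 3 * q\<^sup>2 * (D s z)\<^sup>2 + 3 * (c * K1)\<^sup>2)" by (rule ennreal_leI)
      also have "... = ennreal (3 * (?p s)\<^sup>2) * ennreal ((N s z)\<^sup>2) + ennreal (3 * q\<^sup>2) * ennreal ((D s z)\<^sup>2) + ennreal (3 * (c * K1)\<^sup>2)"
        by (simp only: ennreal_mult'' ennreal_plus zero_le_power2 zero_le_mult_iff add_nonneg_nonneg zero_le_numeral simp_thms)
      finally show ?thesis .
    qed
    have m: "(\<lambda>z. ennreal ((N s z)\<^sup>2)) \<in> borel_measurable M" "(\<lambda>z. ennreal ((D s z)\<^sup>2)) \<in> borel_measurable M"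
      using N_measurable[OF s] D_measurable[OF s] by auto
    have "mean_square M (\<rho> s) \<le> (\<integral>\<^sup>+z. ennreal (3 * (?p s)\<^sup>2) * ennreal ((N s z)\<^sup>2) + ennreal (3 * q\<^sup>2) * ennreal ((D s z)\<^sup>2) + ennreal (3 * (c * K1)\<^sup>2) \<partial>M)"
      by (rule nn_integral_mono) (rule pt)
    also have "... = ennreal (3 * (?p s)\<^sup>2) * mean_square M (N s) + ennreal (3 * q\<^sup>2) * mean_square M (D s) + ennreal (3 * (c * K1)\<^sup>2)"
      using m by (simp add: nn_integral_add nn_integral_cmult emeasure_space_1)
    also have "... \<le> ennreal (3 * (?p s)\<^sup>2) * ennreal (v s) + ennreal (3 * q\<^sup>2) * ennreal K + ennreal (3 * (c * K1)\<^sup>2)"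
      unfolding N_second_moment[OF s] by (intro add_mono mult_left_mono K s order_refl) auto
    also have "... = ennreal (3 * (?p s)\<^sup>2 * v s + 3 * q\<^sup>2 * K + 3 * (c * K1)\<^sup>2)"
      using K(1) v_nonneg[OF s]
      by (simp only: ennreal_mult'' ennreal_plus zero_le_power2 zero_le_mult_iff add_nonneg_nonneg zero_le_numeral simp_thms)
    also have "... \<le> ennreal (k + \<epsilon> * v s)"
    proof (rule ennreal_leI)
      have "3 * (?p s)\<^sup>2 * v s \<le> 3 * (c + \<bar>C\<bar> + \<delta>)\<^sup>2 * v t1 + \<epsilon> * v s"
      proof (cases "t1 \<le> s")
        case True
        have "(?p s)\<^sup>2 \<le> (2 * \<delta>)\<^sup>2" using t1(2)[OF s True] \<delta> by (intro power_mono) auto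
        then have "3 * (?p s)\<^sup>2 * v s \<le> 3 * (2 * \<delta>)\<^sup>2 * v s" using v_nonneg[OF s] by (intro mult_right_mono) auto
        also have "3 * (2 * \<delta>)\<^sup>2 = \<epsilon>" using \<delta> by (simp add: power_mult_distrib)
        finally show ?thesis using v_nonneg[OF t1(1)] by (simp add: add_increasing)
      next
        case False
        have "?p s \<le> c + \<bar>C\<bar> + \<delta>" using c(2)[OF s] by linarith
        then have "(?p s)\<^sup>2 \<le> (c + \<bar>C\<bar> + \<delta>)\<^sup>2" using \<delta> by (intro power_mono) auto
        moreover have "v s \<le> v t1" using False s by (intro v_mono[OF t1(1)]) (auto simp: horizon_def)
        ultimately have "3 * (?p s)\<^sup>2 * v s \<le> 3 * (c + \<bar>C\<bar> + \<delta>)\<^sup>2 * v t1" using v_nonneg[OF s] by (intro mult_mono) auto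
        then show ?thesis using eps v_nonneg[OF s] by (simp add: add_increasing2)
      qed
      then show "3 * (?p s)\<^sup>2 * v s + 3 * q\<^sup>2 * K + 3 * (c * K1)\<^sup>2 \<le> k + \<epsilon> * v s" by (simp add: k_def)
    qed
    finally show "mean_square M (\<rho> s) \<le> ennreal (k + \<epsilon> * v s)" .
  qed
qed

text \<open>The constant in \<open>\<rho>_second_moment\<close> is absorbed because \<open>v\<close> is unbounded.\<close>

lemma \<rho>_negligible:
  assumes eta: "0 < \<eta>"
  obtains t1 where "t1 \<in> horizon T" "0 < t1"
    "\<And>t s. t \<in> horizon T \<Longrightarrow> t1 \<le> t \<Longrightarrow> s \<in> {0..t} \<Longrightarrow> mean_square M (\<rho> s) \<le> ennreal (\<eta> * v t)"
proof -
  have e2: "0 < \<eta> / 2" using eta by simp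
  obtain k where k: "0 \<le> k" "\<And>s. s \<in> horizon T \<Longrightarrow> mean_square M (\<rho> s) \<le> ennreal (k + \<eta> / 2 * v s)"
    by (rule \<rho>_second_moment[OF e2]) blast
  obtain t1 where t1: "t1 \<in> horizon T" "0 < t1" "\<And>s. s \<in> horizon T \<Longrightarrow> t1 \<le> s \<Longrightarrow> 2 * k / \<eta> \<le> v s"
    by (rule v_unbounded[of "2 * k / \<eta>"]) blast
  show ?thesis
  proof (rule that[OF t1(1,2)])
    fix t s assume t: "t \<in> horizon T" "t1 \<le> t" and s: "s \<in> {0..t}"
    have "k \<le> \<eta> / 2 * v t" using t1(3)[OF t] eta by (simp add: field_simps)
    moreover have "\<eta> / 2 * v s \<le> \<eta> / 2 * v t" using v_le[OF t(1) s] e2 by (intro mult_left_mono) auto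
    ultimately have "k + \<eta> / 2 * v s \<le> \<eta> * v t" by (simp add: field_simps)
    then show "mean_square M (\<rho> s) \<le> ennreal (\<eta> * v t)"
      using k(2)[of s] horizon_Icc[OF t(1)] s by (meson ennreal_leI order_trans subsetD)
  qed
qed

end

section \<open>Numerator, denominator and Fisher information\<close>

context perturbed_diffusion
begin

abbreviation integrand :: "real \<Rightarrow> 'a \<Rightarrow> real" where
  "integrand s z \<equiv> b s * a (Y s z) / (\<sigma> s)\<^sup>2"

abbreviation obs :: "real \<Rightarrow> 'a \<Rightarrow> real" where
  "obs t z \<equiv> observed_info b \<sigma> a Y t z"

text \<open>The score at the true parameter, that is, the numerator of the estimation error.\<close>

definition Q :: "real \<Rightarrow> 'a \<Rightarrow> real" where "Q t z = S t z - \<alpha> * obs t z"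

lemma integrand_cont: "z \<in> space M \<Longrightarrow> continuous_on (horizon T) (\<lambda>s. integrand s z)"
proof -
  assume "z \<in> space M"
  moreover have "(\<sigma> s)\<^sup>2 \<noteq> 0" if "s \<in> horizon T" for s using \<sigma>_pos[OF that] by simp
  ultimately show ?thesis by (intro continuous_intros b_cont \<sigma>_cont aY_cont) auto
qed

lemma integrand_adapted: "s \<in> horizon T \<Longrightarrow> integrand s \<in> borel_measurable (F s)"
  by (intro borel_measurable_divide borel_measurable_times borel_measurable_const measurable_compose[OF Y_adapted a_measurable])

lemma obs_eq:
  assumes t: "t \<in> horizon T" and z: "z \<in> space M"
  shows "obs t z = integral {0..t} (\<lambda>s. (h s)\<^sup>2 * (\<rho> s z + C * N s z)\<^sup>2)"
    "\<alpha> * obs t z = integral {0..t} (\<lambda>s. integrand s z * (w s * a (Y s z)))"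
proof -
  have tH: "s \<in> horizon T" if "s \<in> {0..t}" for s using horizon_Icc[OF t] that by blast
  have c1: "continuous_on {0..t} (\<lambda>s. (h s)\<^sup>2 * (\<rho> s z + C * N s z)\<^sup>2)"
    by (intro continuous_intros cont_Icc[OF h_cont t] cont_Icc[OF \<rho>_cont[OF z] t] cont_Icc[OF N_cont[OF z] t])
  have eq: "(b s)\<^sup>2 * (a (Y s z))\<^sup>2 / (\<sigma> s)\<^sup>2 = (h s)\<^sup>2 * (\<rho> s z + C * N s z)\<^sup>2" if s: "s \<in> {0..t}" for s
  proof -
    have "(b s)\<^sup>2 * (a (Y s z))\<^sup>2 / (\<sigma> s)\<^sup>2 = (\<sigma> s)\<^sup>2 * (integrand s z)\<^sup>2"
      using \<sigma>_pos[OF tH[OF s]] by (simp add: power_mult_distrib power_divide power2_eq_square)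
    then show ?thesis unfolding integrand_eq[OF tH[OF s]] h_def by (simp add: power_mult_distrib)
  qed
  have "obs t z = (LBINT s:{0..t}. (h s)\<^sup>2 * (\<rho> s z + C * N s z)\<^sup>2)"
    unfolding observed_info_def by (rule set_lebesgue_integral_cong) (use eq in auto)
  also have "... = integral {0..t} (\<lambda>s. (h s)\<^sup>2 * (\<rho> s z + C * N s z)\<^sup>2)" by (rule LBINT_eq_integral[OF c1])
  finally show 1: "obs t z = integral {0..t} (\<lambda>s. (h s)\<^sup>2 * (\<rho> s z + C * N s z)\<^sup>2)" .
  have "\<alpha> * obs t z = integral {0..t} (\<lambda>s. \<alpha> * ((h s)\<^sup>2 * (\<rho> s z + C * N s z)\<^sup>2))" unfolding 1 by simp
  also have "... = integral {0..t} (\<lambda>s. integrand s z * (w s * a (Y s z)))"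
  proof (rule Henstock_Kurzweil_Integration.integral_cong)
    fix s assume s: "s \<in> {0..t}"
    show "\<alpha> * ((h s)\<^sup>2 * (\<rho> s z + C * N s z)\<^sup>2) = integrand s z * (w s * a (Y s z))"
      unfolding eq[OF s, symmetric] w_def by (simp add: power2_eq_square)
  qed
  finally show "\<alpha> * obs t z = integral {0..t} (\<lambda>s. integrand s z * (w s * a (Y s z)))" .
qed

lemma obs_measurable: "t \<in> horizon T \<Longrightarrow> obs t \<in> borel_measurable M"
proof -
  assume t: "t \<in> horizon T"
  have tH: "s \<in> horizon T" if "s \<in> {0..t}" for s using horizon_Icc[OF t] that by blast
  have "(\<lambda>z. integral {0..t} (\<lambda>s. (h s)\<^sup>2 * (\<rho> s z + C * N s z)\<^sup>2)) \<in> borel_measurable M"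
  proof (rule integral_process_measurable)
    fix s assume s: "s \<in> {0..t}"
    show "(\<lambda>z. (h s)\<^sup>2 * (\<rho> s z + C * N s z)\<^sup>2) \<in> borel_measurable M"
      using \<rho>_measurable[OF tH[OF s]] N_measurable[OF tH[OF s]] by measurable
  next
    fix z assume z: "z \<in> space M"
    show "continuous_on {0..t} (\<lambda>s. (h s)\<^sup>2 * (\<rho> s z + C * N s z)\<^sup>2)"
      by (intro continuous_intros cont_Icc[OF h_cont t] cont_Icc[OF \<rho>_cont[OF z] t] cont_Icc[OF N_cont[OF z] t])
  qed (use t in \<open>simp add: horizon_def\<close>)
  then show ?thesis using obs_eq(1)[OF t] by (simp cong: measurable_cong)
qed

lemma S_integral: "t \<in> horizon T \<Longrightarrow> has_stochastic_integral M F Y integrand t (S t)"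
  using S unfolding stochastic_integral_process_def by blast

lemma S_measurable: "t \<in> horizon T \<Longrightarrow> S t \<in> borel_measurable M"
  using S_integral unfolding has_stochastic_integral_def by blast

lemma Q_measurable: "t \<in> horizon T \<Longrightarrow> Q t \<in> borel_measurable M"
  unfolding Q_def[abs_def] by (intro borel_measurable_diff borel_measurable_times borel_measurable_const S_measurable obs_measurable)

text \<open>Integrating a step process against the drift is ordinary integration, which is continuous
  under uniform convergence; removing the drift from the integrator \<open>Y\<close> therefore subtracts
  \<open>\<alpha>\<close> times the observed information.\<close>

lemma Q_integral:
  assumes t: "t \<in> horizon T" "0 < t"
  shows "has_stochastic_integral M F G integrand t (Q t)"
proof -
  interpret W: wiener_on M B t by (rule wiener_on_Icc[OF t])
  from S_integral[OF t(1)] obtain K where K: "\<And>n. simple_predictable M F t (K n)"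
    and farK: "\<And>\<epsilon>. 0 < \<epsilon> \<Longrightarrow> (\<lambda>n. prob (W.far (K n) integrand t \<epsilon>)) \<longlonglongrightarrow> 0"
    and limK: "\<And>\<epsilon>. 0 < \<epsilon> \<Longrightarrow> (\<lambda>n. prob {z\<in>space M. \<epsilon> < \<bar>step_integral (K n) Y z - S t z\<bar>}) \<longlonglongrightarrow> 0"
    unfolding has_stochastic_integral_def W.far_def by blast
  have tH: "s \<in> horizon T" if "s \<in> {0..t}" for s using horizon_Icc[OF t(1)] that by blast
  note Ka = simple_predictable_adapted[OF K]
  let ?f = "\<lambda>z s. w s * a (Y s z)"
  have fc: "continuous_on {0..t} (?f z)" if "z \<in> space M" for z by (rule cont_Icc[OF drift_cont[OF Y a_cont that] t(1)])
  have Hc: "continuous_on {0..t} (\<lambda>s. integrand s z)" if "z \<in> space M" for z by (rule cont_Icc[OF integrand_cont[OF that] t(1)])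
  define R where "R z = integral {0..t} (\<lambda>s. \<bar>?f z s\<bar>)" for z
  have R0: "0 \<le> R z" if "z \<in> space M" for z
    unfolding R_def by (rule integral_nonneg) (use fc[OF that] in \<open>auto intro!: integrable_continuous_real continuous_on_rabs\<close>)
  have Rm[measurable]: "R \<in> borel_measurable M"
    unfolding R_def[abs_def]
  proof (rule integral_process_measurable)
    fix s assume "s \<in> {0..t}"
    then show "(\<lambda>z. \<bar>?f z s\<bar>) \<in> borel_measurable M"
      using measurable_compose[OF Y_measurable[OF tH] a_measurable] by simp
  qed (use t fc in \<open>auto intro: continuous_on_rabs\<close>)
  have drift: "\<bar>(step_integral (K n) Y z - step_integral (K n) G z) - \<alpha> * obs t z\<bar> \<le> \<delta> * R z"
    if z: "z \<in> space M" and nf: "z \<notin> W.far (K n) integrand t \<delta>" for n z \<delta>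
  proof -
    let ?g = "grid (K n)" and ?m = "steps (K n)" and ?l = "\<lambda>i. level (K n) i z"
    have gm: "?g i < ?g (Suc i)" if "i < ?m" for i using Ka[of n] that by (simp add: adapted_step_def)
    have g0: "?g 0 = 0" "?g ?m = t" using Ka[of n] by (auto simp: adapted_step_def)
    have gr: "?g i \<in> {0..t}" if "i \<le> ?m" for i
      using strict_grid_le[of ?m ?g 0 i] strict_grid_le[of ?m ?g i ?m] gm g0 that by auto
    have fci: "continuous_on {?g i..?g (Suc i)} (?f z)" "continuous_on {?g i..?g (Suc i)} (\<lambda>s. integrand s z)" if "i < ?m" for i
      using gr[of i] gr[of "Suc i"] that by (auto intro!: continuous_on_subset[OF fc[OF z]] continuous_on_subset[OF Hc[OF z]])
    have split: "integral {0..?g k} f = (\<Sum>i<k. integral {?g i..?g (Suc i)} f)" if "k \<le> ?m" "continuous_on {0..t} f" for k and f :: "real \<Rightarrow> real"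
      by (rule integral_partition[OF g0(1) that(1) that(2) gm gr])
    have YG: "Y s z = G s z + Y 0 z + integral {0..s} (?f z)" for s by (simp add: noise_def)
    have "step_integral (K n) Y z - step_integral (K n) G z = (\<Sum>i<?m. ?l i * integral {?g i..?g (Suc i)} (?f z))"
      unfolding step_integral_def sum_subtractf[symmetric]
    proof (rule sum.cong[OF refl])
      fix i assume "i \<in> {..<?m}"
      then have i: "i < ?m" by simp
      have "integral {0..?g (Suc i)} (?f z) = integral {0..?g i} (?f z) + integral {?g i..?g (Suc i)} (?f z)"
        using split[of i "?f z"] split[of "Suc i" "?f z"] i fc[OF z] by simp
      then show "?l i * (Y (?g (Suc i)) z - Y (?g i) z) - ?l i * (G (?g (Suc i)) z - G (?g i) z) = ?l i * integral {?g i..?g (Suc i)} (?f z)"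
        unfolding YG[of "?g (Suc i)"] YG[of "?g i"] by (simp add: algebra_simps)
    qed
    moreover have "\<alpha> * obs t z = (\<Sum>i<?m. integral {?g i..?g (Suc i)} (\<lambda>s. integrand s z * ?f z s))"
      unfolding obs_eq(2)[OF t(1) z] using split[of ?m "\<lambda>s. integrand s z * ?f z s"] g0 continuous_on_mult[OF Hc[OF z] fc[OF z]] by simp
    ultimately have "\<bar>(step_integral (K n) Y z - step_integral (K n) G z) - \<alpha> * obs t z\<bar> =
        \<bar>\<Sum>i<?m. ?l i * integral {?g i..?g (Suc i)} (?f z) - integral {?g i..?g (Suc i)} (\<lambda>s. integrand s z * ?f z s)\<bar>"
      by (simp add: sum_subtractf)
    also have "... \<le> (\<Sum>i<?m. \<delta> * integral {?g i..?g (Suc i)} (\<lambda>s. \<bar>?f z s\<bar>))"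
    proof (rule order_trans[OF sum_abs sum_mono])
      fix i assume "i \<in> {..<?m}"
      then have i: "i < ?m" by simp
      have near: "\<bar>?l i - integrand s z\<bar> \<le> \<delta>" if s: "s \<in> {?g i..?g (Suc i)}" for s
      proof (rule continuous_le_on_closure[of "{?g i<..?g (Suc i)}" "\<lambda>s. \<bar>?l i - integrand s z\<bar>"])
        show "continuous_on (closure {?g i<..?g (Suc i)}) (\<lambda>s. \<bar>?l i - integrand s z\<bar>)"
          using fci(2)[OF i] gm[OF i] by (auto intro!: continuous_intros)
        show "s \<in> closure {?g i<..?g (Suc i)}" using s gm[OF i] by simp
        fix x assume x: "x \<in> {?g i<..?g (Suc i)}"
        then have "step_value (K n) x z = ?l i" by (intro step_value_eq[OF Ka i]) auto
        moreover have "x \<in> {0<..t}" using x gr[of i] gr[of "Suc i"] i by auto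
        ultimately show "\<bar>?l i - integrand x z\<bar> \<le> \<delta>" using nf z unfolding W.far_def by force
      qed
      have diff: "?l i * integral {?g i..?g (Suc i)} (?f z) - integral {?g i..?g (Suc i)} (\<lambda>s. integrand s z * ?f z s)
        = integral {?g i..?g (Suc i)} (\<lambda>s. ?l i * ?f z s - integrand s z * ?f z s)"
      proof (subst Henstock_Kurzweil_Integration.integral_diff)
        show "(\<lambda>s. ?l i * ?f z s) integrable_on {?g i..?g (Suc i)}"
          by (intro integrable_continuous_real continuous_on_mult[OF continuous_on_const fci(1)[OF i]])
        show "(\<lambda>s. integrand s z * ?f z s) integrable_on {?g i..?g (Suc i)}"
          by (intro integrable_continuous_real continuous_on_mult[OF fci(2)[OF i] fci(1)[OF i]])
      qed simp
      have "norm (integral {?g i..?g (Suc i)} (\<lambda>s. ?l i * ?f z s - integrand s z * ?f z s)) \<le> integral {?g i..?g (Suc i)} (\<lambda>s. \<delta> * norm (?f z s))"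
      proof (rule integral_norm_bound_integral)
        show "(\<lambda>s. ?l i * ?f z s - integrand s z * ?f z s) integrable_on {?g i..?g (Suc i)}"
          by (intro integrable_continuous_real continuous_on_diff continuous_on_mult continuous_on_const fci i)
        show "(\<lambda>s. \<delta> * norm (?f z s)) integrable_on {?g i..?g (Suc i)}"
          by (intro integrable_continuous_real continuous_on_mult continuous_on_const continuous_on_norm fci(1)[OF i])
        fix s assume s: "s \<in> {?g i..?g (Suc i)}"
        have "\<bar>?l i - integrand s z\<bar> * \<bar>?f z s\<bar> \<le> \<delta> * \<bar>?f z s\<bar>" by (intro mult_right_mono near s) simp
        then show "norm (?l i * ?f z s - integrand s z * ?f z s) \<le> \<delta> * norm (?f z s)"
          unfolding left_diff_distrib[symmetric] real_norm_def abs_mult[of "?l i - integrand s z"] .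
      qed
      then show "\<bar>?l i * integral {?g i..?g (Suc i)} (?f z) - integral {?g i..?g (Suc i)} (\<lambda>s. integrand s z * ?f z s)\<bar> \<le> \<delta> * integral {?g i..?g (Suc i)} (\<lambda>s. \<bar>?f z s\<bar>)"
        unfolding diff by (simp only: real_norm_def Henstock_Kurzweil_Integration.integral_mult_right)
    qed
    also have "... = \<delta> * R z"
    proof -
      have "continuous_on {0..t} (\<lambda>s. \<bar>?f z s\<bar>)" by (intro continuous_intros fc[OF z])
      from split[OF order_refl this] g0 show ?thesis by (simp add: R_def sum_distrib_left)
    qed
    finally show ?thesis .
  qed
  have Ym: "Y x \<in> borel_measurable M" if "x \<in> {0..t}" for x by (rule Y_measurable[OF tH[OF that]])
  have Gm: "G x \<in> borel_measurable M" if "x \<in> {0..t}" for x by (rule noise_measurable[OF Y a_cont tH[OF that]])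
  have t0: "0 \<le> t" using t by simp
  have [measurable]: "step_integral (K n) Y \<in> borel_measurable M" for n by (rule W.step_integral_measurable[OF Ka t0 order_refl Ym])
  have [measurable]: "step_integral (K n) G \<in> borel_measurable M" for n by (rule W.step_integral_measurable[OF Ka t0 order_refl Gm])
  have [measurable]: "S t \<in> borel_measurable M" "Q t \<in> borel_measurable M" "obs t \<in> borel_measurable M"
    using S_measurable Q_measurable obs_measurable t by auto
  have [measurable]: "W.far (K n) integrand t \<epsilon> \<in> events" for n \<epsilon>
    by (rule W.far_measurable[OF Ka t0 order_refl F_measurable[OF tH integrand_adapted[OF tH]] Hc])
  have lim: "(\<lambda>n. prob {z\<in>space M. \<epsilon> < \<bar>step_integral (K n) G z - Q t z\<bar>}) \<longlonglongrightarrow> 0" if e: "0 < \<epsilon>" for \<epsilon>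
  proof (rule LIMSEQ_I)
    fix x :: real assume x: "0 < x"
    let ?ES = "\<lambda>n. {z\<in>space M. \<epsilon>/2 < \<bar>step_integral (K n) Y z - S t z\<bar>}" and ?EG = "\<lambda>n. {z\<in>space M. \<epsilon> < \<bar>step_integral (K n) G z - Q t z\<bar>}" and ?ER = "\<lambda>k. {z\<in>space M. \<epsilon>/2 < \<bar>R z * inverse (real (Suc k)) - 0\<bar>}"
    have "converges_in_prob M (\<lambda>n z. R z * inverse (real (Suc n))) (\<lambda>_. 0)"
      by (rule converges_in_prob_AE) (use tendsto_mult_right_zero[OF LIMSEQ_inverse_real_of_nat] in auto)
    from converges_in_probD[OF this, of "\<epsilon>/2"] e
    have "(\<lambda>n. prob {z\<in>space M. \<epsilon>/2 < \<bar>R z * inverse (real (Suc n)) - 0\<bar>}) \<longlonglongrightarrow> 0" by simp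
    from order_tendstoD(2)[OF this, of "x/2"] x
    obtain k where k: "prob (?ER k) < x/2"
      by (auto simp: eventually_sequentially)
    define \<delta> where "\<delta> = inverse (real (Suc k))"
    have d: "0 < \<delta>" by (simp add: \<delta>_def)
    have e2: "0 < \<epsilon>/2" using e by simp
    have "(\<lambda>n. prob (?ES n) + prob (W.far (K n) integrand t \<delta>)) \<longlonglongrightarrow> 0"
      using tendsto_add[OF limK[OF e2] farK[OF d]] by simp
    from order_tendstoD(2)[OF this, of "x/2"] x
    have "eventually (\<lambda>n. prob (?ES n) + prob (W.far (K n) integrand t \<delta>) < x/2) sequentially" by simp
    then have "eventually (\<lambda>n. norm (prob (?EG n) - 0) < x) sequentially"
    proof eventually_elim
      case (elim n)
      have "prob (?EG n) \<le> prob (?ES n) +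
        prob (W.far (K n) integrand t \<delta> \<union> ?ER k)"
      proof (rule prob_le_add)
        show "?EG n \<subseteq> ?ES n \<union>
          (W.far (K n) integrand t \<delta> \<union> ?ER k)"
        proof
          fix z assume w: "z \<in> ?EG n"
          then have om: "z \<in> space M" by simp
          show "z \<in> ?ES n \<union>
            (W.far (K n) integrand t \<delta> \<union> ?ER k)"
          proof (cases "z \<in> W.far (K n) integrand t \<delta>")
            case False
            have "\<bar>(step_integral (K n) Y z - step_integral (K n) G z) - \<alpha> * obs t z\<bar> \<le> \<delta> * R z" by (rule drift[OF om False])
            moreover have "step_integral (K n) G z - Q t z = (step_integral (K n) Y z - S t z) - ((step_integral (K n) Y z - step_integral (K n) G z) - \<alpha> * obs t z)"
              by (simp add: Q_def)
            ultimately have "\<epsilon>/2 < \<bar>step_integral (K n) Y z - S t z\<bar> \<or> \<epsilon>/2 < \<delta> * R z" using w by (simp only: mem_Collect_eq) linarith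
            then have "\<epsilon>/2 < \<bar>step_integral (K n) Y z - S t z\<bar> \<or> \<epsilon>/2 < \<bar>R z * inverse (real (Suc k)) - 0\<bar>"
              using R0[OF om] d by (simp only: \<delta>_def diff_0_right mult.commute[of "R z"]) linarith
            then show ?thesis using om by blast
          qed simp
        qed
      qed measurable
      also have "prob (W.far (K n) integrand t \<delta> \<union> ?ER k) \<le>
        prob (W.far (K n) integrand t \<delta>) + prob (?ER k)"
        by (rule prob_le_add) auto
      finally have "prob (?EG n) < x" using elim k by linarith
      then show ?case by simp
    qed
    then show "\<exists>no. \<forall>n\<ge>no. norm (prob (?EG n) - 0) < x"
      by (simp only: eventually_sequentially)
  qed
  show ?thesis
    unfolding has_stochastic_integral_def
    using integrand_adapted[OF tH] Hc Q_measurable[OF t(1)] K lim farK[unfolded W.far_def]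
    by (intro conjI ballI exI[of _ K] allI impI) auto
qed

lemma \<rho>_adapted: "s \<in> horizon T \<Longrightarrow> \<rho> s \<in> borel_measurable (F s)"
proof -
  assume s: "s \<in> horizon T"
  have "(\<lambda>z. integrand s z / e s - C * N s z) \<in> borel_measurable (F s)"
    by (intro borel_measurable_diff borel_measurable_divide borel_measurable_times borel_measurable_const integrand_adapted N_adapted
      measurable_compose[OF Y_adapted a_measurable] s)
  moreover have "(\<lambda>z. integrand s z / e s - C * N s z) = \<rho> s" by (rule ext) (simp add: integrand_eq[OF s])
  ultimately show ?thesis by simp
qed

text \<open>The integrand differs from \<open>C e N\<close> by \<open>e \<rho>\<close>. The constant is not sharp: on a fine
  grid \<open>e \<sigma>\<close> is at most twice the cell coefficient.\<close>

lemma numerator_bound: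
  assumes t: "t \<in> horizon T" "0 < t" and k: "0 \<le> \<kappa>" "\<And>s. s \<in> {0..t} \<Longrightarrow> mean_square M (\<rho> s) \<le> ennreal \<kappa>"
  shows "mean_square M (\<lambda>z. Q t z - C * (((N t z)\<^sup>2 - v t) / 2)) \<le> ennreal (4 * \<kappa> * v t)"
proof -
  interpret W: wiener_martingale M B t h N by (rule martingale[OF t])
  have V: "W.V = v t" using martingale_v[OF t] by (simp add: W.V_def)
  have tH: "s \<in> horizon T" if "s \<in> {0..t}" for s using horizon_Icc[OF t(1)] that by blast
  have pH: "W.vgrid m j \<in> horizon T" if "j \<le> Suc m" for j m using tH[OF W.vgrid(1)[OF that]] .
  note Gw = noise_integral[OF Y a_cont t]
  have \<sigma>c: "continuous_on {0..t} \<sigma>" by (rule cont_Icc[OF \<sigma>_cont t(1)])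
  have ec: "continuous_on {0..t} e" by (rule cont_Icc[OF e_cont t(1)])
  obtain \<sigma>0 where \<sigma>0: "0 < \<sigma>0" "\<And>s. s \<in> {0..t} \<Longrightarrow> \<bar>\<sigma> s\<bar> \<le> \<sigma>0"
    using compact_imp_bounded[OF compact_continuous_image[OF \<sigma>c compact_Icc]] unfolding bounded_pos by auto
  obtain h0 where h0: "0 < h0" "\<And>s. s \<in> {0..t} \<Longrightarrow> h0 \<le> h s" by (rule W.h_lower) blast
  let ?p = "W.vgrid"
  let ?dG = "\<lambda>m j z. G (?p m (Suc j)) z - G (?p m j) z"
  let ?A = "\<lambda>m z. \<Sum>j<Suc m. integrand (?p m j) z * ?dG m j z"
  let ?B = "\<lambda>m z. \<Sum>j<Suc m. N (?p m j) z * (e (?p m j) * ?dG m j z)"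
  \<comment> \<open>The vanishing summand brings this into the form of \<open>vgrid_integrator_isometry\<close>.\<close>
  let ?D = "\<lambda>m z. \<Sum>j<Suc m. \<rho> (?p m j) z * (e (?p m j) * ?dG m j z + 0 * (B (?p m (Suc j)) z - B (?p m j) z))"
  let ?E = "\<lambda>z. ((N t z)\<^sup>2 - W.V) / 2"
  have Gm: "G (?p m j) \<in> borel_measurable M" if "j \<le> Suc m" for j m by (rule noise_measurable[OF Y a_cont pH[OF that]])
  have Am: "?A m \<in> borel_measurable M" for m
    by (intro borel_measurable_sum borel_measurable_times[OF F_measurable[OF pH integrand_adapted[OF pH]]] borel_measurable_diff Gm) auto
  have Bm: "?B m \<in> borel_measurable M" for m
    by (intro borel_measurable_sum borel_measurable_times borel_measurable_const borel_measurable_diff Gm N_measurable pH) auto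
  have Em: "?E \<in> borel_measurable M" using N_measurable[OF t(1)] by simp
  have "W.l2_integrator (\<sigma>0\<^sup>2) G" by (rule W.l2_integrator_wiener_integral[OF Gw \<sigma>0(2)])
  then have cA: "converges_in_prob M ?A (Q t)"
    by (rule W.stochastic_integral_vgrid[OF _ _ Q_integral[OF t]]) simp
  have cB: "converges_in_prob M ?B ?E"
    by (rule W.ito_square_sum[OF \<sigma>c ec _ Gw]) (simp add: h_def)
  have cB': "converges_in_prob M (\<lambda>m z. C * ?B m z) (\<lambda>z. C * ?E z)" by (rule converges_in_prob_cmult[OF Bm Em cB])
  have "converges_in_prob M (\<lambda>m z. ?A m z - C * ?B m z) (\<lambda>z. Q t z - C * ?E z)"
    by (rule converges_in_prob_diff[OF Am Q_measurable[OF t(1)] borel_measurable_times[OF borel_measurable_const Bm] borel_measurable_times[OF borel_measurable_const Em] cA cB'])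
  moreover have eqD: "?A m z - C * ?B m z = ?D m z" for m z
  proof -
    have "?A m z - C * ?B m z = (\<Sum>j<Suc m. integrand (?p m j) z * ?dG m j z - C * (N (?p m j) z * (e (?p m j) * ?dG m j z)))"
      by (simp only: sum_distrib_left sum_subtractf)
    also have "... = ?D m z"
    proof (rule sum.cong[OF refl])
      fix j assume "j \<in> {..<Suc m}"
      then have "?p m j \<in> horizon T" by (intro pH) simp
      from integrand_eq[OF this]
      show "integrand (?p m j) z * ?dG m j z - C * (N (?p m j) z * (e (?p m j) * ?dG m j z)) =
        \<rho> (?p m j) z * (e (?p m j) * ?dG m j z + 0 * (B (?p m (Suc j)) z - B (?p m j) z))"
        by (simp only:) (simp add: algebra_simps)
    qed
    finally show ?thesis .
  qed
  ultimately have cD: "converges_in_prob M ?D (\<lambda>z. Q t z - C * ?E z)" by (simp only:)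
  have Dm: "?D m \<in> borel_measurable M" for m
    unfolding eqD[symmetric] by (intro borel_measurable_diff Am borel_measurable_times borel_measurable_const Bm)
  have h4: "0 < h0 / 4" "0 < h0 / 4 / \<sigma>0" using h0 \<sigma>0 by auto
  have "mean_square M (\<lambda>z. Q t z - C * ?E z) \<le> ennreal (4 * \<kappa> * v t)"
  proof (rule converges_in_prob_Fatou[OF Dm _ cD])
    show "(\<lambda>z. Q t z - C * ?E z) \<in> borel_measurable M"
      by (intro borel_measurable_diff Q_measurable[OF t(1)] borel_measurable_times[OF borel_measurable_const Em])
    from W.vgrid_oscillation[OF ec h4(2)] W.cell_coeff_close[OF h4(1)]
    show "eventually (\<lambda>m. mean_square M (?D m) \<le> ennreal (4 * \<kappa> * v t)) sequentially"
    proof eventually_elim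
      case (elim m)
      have "mean_square M (?D m) \<le>
        (\<Sum>j<Suc m. mean_square M (\<rho> (?p m j)) * ennreal ((2 * W.cell_coeff m j)\<^sup>2 * (?p m (Suc j) - ?p m j)))"
      proof (rule W.vgrid_integrator_isometry[OF Gw])
        fix j assume j: "j < Suc m"
        show "\<rho> (?p m j) \<in> borel_measurable (F (?p m j))" by (rule \<rho>_adapted[OF pH]) (use j in simp)
        fix s assume s: "?p m j \<le> s" "s \<le> ?p m (Suc j)"
        have st: "s \<in> {0..t}" using s W.vgrid(1)[of j m] W.vgrid(1)[of "Suc j" m] j by auto
        have "\<bar>e (?p m j) - e s\<bar> \<le> h0 / 4 / \<sigma>0" using elim(1) j s by auto
        then have "\<bar>e (?p m j) - e s\<bar> * \<bar>\<sigma> s\<bar> \<le> h0 / 4 / \<sigma>0 * \<sigma>0"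
          by (intro mult_mono \<sigma>0 st) (use h4 in auto)
        then have "\<bar>(e (?p m j) - e s) * \<sigma> s\<bar> \<le> h0 / 4" using \<sigma>0(1) by (simp add: abs_mult)
        moreover have "\<bar>h s - W.cell_coeff m j\<bar> \<le> h0 / 4" using elim(2) j s by auto
        moreover have "e (?p m j) * \<sigma> s = (e (?p m j) - e s) * \<sigma> s + h s" by (simp add: h_def algebra_simps)
        moreover have "h0 \<le> h s" by (rule h0(2)[OF st])
        ultimately show "\<bar>e (?p m j) * \<sigma> s + 0\<bar> \<le> 2 * W.cell_coeff m j" using h0(1) by linarith
      qed
      also have "... \<le> (\<Sum>j<Suc m. ennreal \<kappa> * ennreal (4 * (v t / real (Suc m))))"
      proof (rule sum_mono)
        fix j assume "j \<in> {..<Suc m}"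
        then have j: "j < Suc m" by simp
        have "(2 * W.cell_coeff m j)\<^sup>2 * (?p m (Suc j) - ?p m j) = 4 * (v t / real (Suc m))"
          using W.cell_coeff_square[OF j] by (simp only: power_mult_distrib V mult.assoc) simp
        then show "mean_square M (\<rho> (?p m j)) * ennreal ((2 * W.cell_coeff m j)\<^sup>2 * (?p m (Suc j) - ?p m j)) \<le> ennreal \<kappa> * ennreal (4 * (v t / real (Suc m)))"
          using k(2)[OF W.vgrid(1)[of j m]] j by (simp only:) (rule mult_right_mono, auto)
      qed
      also have "... = (\<Sum>j<Suc m. ennreal (\<kappa> * (4 * (v t / real (Suc m)))))"
        using k(1) v_nonneg[OF t(1)] by (intro sum.cong refl ennreal_mult[symmetric]) auto
      also have "... = ennreal (\<Sum>j<Suc m. \<kappa> * (4 * (v t / real (Suc m))))"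
        by (rule sum_ennreal) (use k(1) v_nonneg[OF t(1)] in auto)
      also have "(\<Sum>j<Suc m. \<kappa> * (4 * (v t / real (Suc m)))) = 4 * \<kappa> * v t"
        by (simp only: sum_constant card_lessThan) simp
      finally show ?case .
    qed
  qed
  then show ?thesis by (simp only: V)
qed

lemma square_difference_bound:
  assumes s: "s \<in> horizon T" "v s \<le> V" and k: "0 \<le> \<kappa>" "mean_square M (\<rho> s) \<le> ennreal \<kappa>" and \<theta>: "0 < \<theta>"
  shows "nn_mean M (\<lambda>z. \<bar>(\<rho> s z + C * N s z)\<^sup>2 - (C * N s z)\<^sup>2\<bar>) \<le> ennreal ((1 + 1 / \<theta>) * \<kappa> + \<theta> * (C\<^sup>2 * V))"
proof (rule square_difference_L1)
  show "(\<lambda>z. \<rho> s z + C * N s z) \<in> borel_measurable M" "(\<lambda>z. C * N s z) \<in> borel_measurable M"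
    using \<rho>_measurable[OF s(1)] N_measurable[OF s(1)] by auto
  have "mean_square M (\<lambda>z. C * N s z) = ennreal (C\<^sup>2) * mean_square M (N s)"
    using N_measurable[OF s(1)] by (subst nn_integral_cmult[symmetric]) (auto simp: power_mult_distrib ennreal_mult)
  also have "... = ennreal (C\<^sup>2 * v s)" unfolding N_second_moment[OF s(1)] by (simp add: ennreal_mult')
  also have "... \<le> ennreal (C\<^sup>2 * V)" using s by (intro ennreal_leI mult_left_mono) auto
  finally show "mean_square M (\<lambda>z. C * N s z) \<le> ennreal (C\<^sup>2 * V)" .
  show "0 \<le> C\<^sup>2 * V" using s v_nonneg[OF s(1)] by simp
qed (use k \<theta> in auto)

lemma denominator_bound:
  assumes t: "t \<in> horizon T" "0 < t" and k: "0 \<le> \<kappa>" "\<And>s. s \<in> {0..t} \<Longrightarrow> mean_square M (\<rho> s) \<le> ennreal \<kappa>" and \<theta>: "0 < \<theta>"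
  shows "nn_mean M (\<lambda>z. \<bar>obs t z - C\<^sup>2 * integral {0..t} (\<lambda>s. (N s z)\<^sup>2 * (h s)\<^sup>2)\<bar>) \<le> ennreal (((1 + 1 / \<theta>) * \<kappa> + \<theta> * (C\<^sup>2 * v t)) * v t)"
proof -
  have tH: "s \<in> horizon T" if "s \<in> {0..t}" for s using horizon_Icc[OF t(1)] that by blast
  let ?\<Phi> = "\<lambda>s z. \<bar>(\<rho> s z + C * N s z)\<^sup>2 - (C * N s z)\<^sup>2\<bar>"
  note hc = cont_Icc[OF h2_cont t(1)]
  have \<Phi>c: "continuous_on {0..t} (\<lambda>s. ?\<Phi> s z)" if "z \<in> space M" for z
    by (intro continuous_intros cont_Icc[OF \<rho>_cont[OF that] t(1)] cont_Icc[OF N_cont[OF that] t(1)])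
  have "nn_mean M (\<lambda>z. \<bar>obs t z - C\<^sup>2 * integral {0..t} (\<lambda>s. (N s z)\<^sup>2 * (h s)\<^sup>2)\<bar>) \<le> nn_mean M (\<lambda>z. integral {0..t} (\<lambda>s. (h s)\<^sup>2 * ?\<Phi> s z))"
  proof (rule nn_integral_mono, rule ennreal_leI)
    fix z assume z: "z \<in> space M"
    note Nc = cont_Icc[OF N_cont[OF z] t(1)] and \<rho>c = cont_Icc[OF \<rho>_cont[OF z] t(1)]
    have c1: "continuous_on {0..t} (\<lambda>s. (h s)\<^sup>2 * (\<rho> s z + C * N s z)\<^sup>2)" by (intro continuous_on_mult[OF hc] continuous_intros Nc \<rho>c)
    have c2: "continuous_on {0..t} (\<lambda>s. (h s)\<^sup>2 * (C * N s z)\<^sup>2)" by (intro continuous_on_mult[OF hc] continuous_intros Nc)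
    have "C\<^sup>2 * integral {0..t} (\<lambda>s. (N s z)\<^sup>2 * (h s)\<^sup>2) = integral {0..t} (\<lambda>s. C\<^sup>2 * ((N s z)\<^sup>2 * (h s)\<^sup>2))" by simp
    also have "... = integral {0..t} (\<lambda>s. (h s)\<^sup>2 * (C * N s z)\<^sup>2)" by (simp add: power_mult_distrib ac_simps)
    finally have diff: "obs t z - C\<^sup>2 * integral {0..t} (\<lambda>s. (N s z)\<^sup>2 * (h s)\<^sup>2) =
        integral {0..t} (\<lambda>s. (h s)\<^sup>2 * (\<rho> s z + C * N s z)\<^sup>2 - (h s)\<^sup>2 * (C * N s z)\<^sup>2)"
      unfolding obs_eq(1)[OF t(1) z]
      by (simp only:) (rule Henstock_Kurzweil_Integration.integral_diff[symmetric]; rule integrable_continuous_real; rule c1 c2)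
    have "norm (integral {0..t} (\<lambda>s. (h s)\<^sup>2 * (\<rho> s z + C * N s z)\<^sup>2 - (h s)\<^sup>2 * (C * N s z)\<^sup>2)) \<le> integral {0..t} (\<lambda>s. (h s)\<^sup>2 * ?\<Phi> s z)"
    proof (rule integral_norm_bound_integral)
      show "(\<lambda>s. (h s)\<^sup>2 * (\<rho> s z + C * N s z)\<^sup>2 - (h s)\<^sup>2 * (C * N s z)\<^sup>2) integrable_on {0..t}"
        by (rule integrable_continuous_real[OF continuous_on_diff[OF c1 c2]])
      show "(\<lambda>s. (h s)\<^sup>2 * ?\<Phi> s z) integrable_on {0..t}" by (rule integrable_continuous_real[OF continuous_on_mult[OF hc \<Phi>c[OF z]]])
    qed (simp add: right_diff_distrib[symmetric] abs_mult)
    then show "\<bar>obs t z - C\<^sup>2 * integral {0..t} (\<lambda>s. (N s z)\<^sup>2 * (h s)\<^sup>2)\<bar> \<le> integral {0..t} (\<lambda>s. (h s)\<^sup>2 * ?\<Phi> s z)"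
      unfolding diff by (simp only: real_norm_def)
  qed
  also have "... \<le> ennreal (((1 + 1 / \<theta>) * \<kappa> + \<theta> * (C\<^sup>2 * v t)) * integral {0..t} (\<lambda>s. (h s)\<^sup>2))"
  proof (rule expected_integral_le[OF _ _ \<Phi>c])
    fix s assume s: "s \<in> {0..t}"
    show "?\<Phi> s \<in> borel_measurable M" using \<rho>_measurable[OF tH[OF s]] N_measurable[OF tH[OF s]] by measurable
    show "nn_mean M (?\<Phi> s) \<le> ennreal ((1 + 1 / \<theta>) * \<kappa> + \<theta> * (C\<^sup>2 * v t))"
      by (rule square_difference_bound[OF tH[OF s] v_le[OF t(1) s] k(1) k(2)[OF s] \<theta>])
  qed (use t k \<theta> v_nonneg[OF t(1)] hc in \<open>auto intro!: add_nonneg_nonneg mult_nonneg_nonneg\<close>)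
  finally show ?thesis by (simp only: v_def[of t, symmetric])
qed

lemma integral_v_h2:
  assumes t: "t \<in> horizon T" shows "integral {0..t} (\<lambda>s. v s * (h s)\<^sup>2) = (v t)\<^sup>2 / 2"
proof (rule integral_unique)
  have "((\<lambda>s. v s * (h s)\<^sup>2) has_integral (v t)\<^sup>2 / 2 - (v 0)\<^sup>2 / 2) {0..t}"
  proof (rule fundamental_theorem_of_calculus)
    show "0 \<le> t" using t by (simp add: horizon_def)
    fix x assume x: "x \<in> {0..t}"
    have "((\<lambda>s. (v s)\<^sup>2 / 2) has_real_derivative v x * (h x)\<^sup>2) (at x within {0..t})"
    proof -
      have "((\<lambda>s. v s * v s) has_real_derivative 2 * (v x * (h x)\<^sup>2)) (at x within {0..t})"
        using DERIV_mult[OF v_deriv[OF t x] v_deriv[OF t x]] by (simp add: mult.commute)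
      from DERIV_cdivide[OF this, of 2] show ?thesis by (simp add: power2_eq_square)
    qed
    then show "((\<lambda>s. (v s)\<^sup>2 / 2) has_vector_derivative v x * (h x)\<^sup>2) (at x within {0..t})"
      by (simp add: has_real_derivative_iff_has_vector_derivative)
  qed
  then show "((\<lambda>s. v s * (h s)\<^sup>2) has_integral (v t)\<^sup>2 / 2) {0..t}" by simp
qed

text \<open>This is the expectation of \<open>denominator_bound\<close>: since \<open>E N\<^sup>2 = v\<close>, the leading term is
  \<open>C\<^sup>2 \<integral> v dv\<close>.\<close>

lemma fisher_info_Y_bound:
  assumes t: "t \<in> horizon T" "0 < t" and k: "0 \<le> \<kappa>" "\<And>s. s \<in> {0..t} \<Longrightarrow> mean_square M (\<rho> s) \<le> ennreal \<kappa>" and \<theta>: "0 < \<theta>"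
  shows "\<bar>fisher_info M b \<sigma> a Y t - C\<^sup>2 * (v t)\<^sup>2 / 2\<bar> \<le> ((1 + 1 / \<theta>) * \<kappa> + \<theta> * (C\<^sup>2 * v t)) * v t"
proof -
  have tH: "s \<in> horizon T" if "s \<in> {0..t}" for s using horizon_Icc[OF t(1)] that by blast
  define c where "c = (1 + 1 / \<theta>) * \<kappa> + \<theta> * (C\<^sup>2 * v t)"
  have c0: "0 \<le> c" using k \<theta> v_nonneg[OF t(1)] by (auto simp: c_def intro!: add_nonneg_nonneg mult_nonneg_nonneg)
  define f where "f s = expectation (\<lambda>z. (\<rho> s z + C * N s z)\<^sup>2)" for s
  have near: "\<bar>f s - C\<^sup>2 * v s\<bar> \<le> c" if s: "s \<in> {0..t}" for s
  proof -
    let ?X = "\<lambda>z. (\<rho> s z + C * N s z)\<^sup>2" and ?Y = "\<lambda>z. (C * N s z)\<^sup>2"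
    have m: "?X \<in> borel_measurable M" "?Y \<in> borel_measurable M"
      using \<rho>_measurable[OF tH[OF s]] N_measurable[OF tH[OF s]] by auto
    have iY: "integrable M ?Y" using N_square_integrable(1)[OF tH[OF s]] by (simp add: power_mult_distrib)
    have b: "nn_mean M (\<lambda>z. \<bar>?X z - ?Y z\<bar>) \<le> ennreal c"
      unfolding c_def by (rule square_difference_bound[OF tH[OF s] v_le[OF t(1) s] k(1) k(2)[OF s] \<theta>])
    have i: "integrable M (\<lambda>z. ?X z - ?Y z)"
      by (rule integrableI_bounded) (use m b in \<open>auto intro: order_le_less_trans\<close>)
    have iX: "integrable M ?X" using Bochner_Integration.integrable_add[OF i iY] by simp
    have diff: "f s - C\<^sup>2 * v s = expectation (\<lambda>z. ?X z - ?Y z)"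
      unfolding f_def using Bochner_Integration.integral_diff[OF iX iY] N_square_integrable(2)[OF tH[OF s]] by (simp add: power_mult_distrib)
    have "\<bar>f s - C\<^sup>2 * v s\<bar> \<le> expectation (\<lambda>z. \<bar>?X z - ?Y z\<bar>)" unfolding diff by (rule integral_abs_bound)
    also have "... \<le> c"
      using b nn_integral_eq_integral[OF integrable_abs[OF i]] c0 by (simp add: ennreal_le_iff)
    finally show ?thesis .
  qed
  have fm: "(\<lambda>s. f (project 0 t s)) \<in> borel_measurable lborel"
  proof -
    let ?\<Phi> = "\<lambda>s z. (\<rho> s z + C * N s z)\<^sup>2"
    have "(\<lambda>(s, z). ?\<Phi> (project 0 t s) z) \<in> borel_measurable (lborel \<Otimes>\<^sub>M M)"
    proof (rule continuous_process_measurable)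
      fix s assume s: "s \<in> {0..t}"
      show "?\<Phi> s \<in> borel_measurable M" using \<rho>_measurable[OF tH[OF s]] N_measurable[OF tH[OF s]] by auto
    qed (use t in \<open>auto intro!: continuous_intros cont_Icc[OF \<rho>_cont] cont_Icc[OF N_cont]\<close>)
    then show ?thesis unfolding f_def by (rule borel_measurable_lebesgue_integral)
  qed
  have hc: "continuous_on {0..t} (\<lambda>s. (h s)\<^sup>2)" by (rule cont_Icc[OF h2_cont t(1)])
  have vh: "continuous_on {0..t} (\<lambda>s. C\<^sup>2 * (v s * (h s)\<^sup>2))" by (intro continuous_intros hc cont_Icc[OF v_cont t(1)])
  have ih: "set_integrable lborel {0..t} (\<lambda>s. c * (h s)\<^sup>2)" by (rule borel_integrable_atLeastAtMost') (intro continuous_intros hc)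
  have iv: "set_integrable lborel {0..t} (\<lambda>s. C\<^sup>2 * (v s * (h s)\<^sup>2))" by (rule borel_integrable_atLeastAtMost'[OF vh])
  let ?g = "\<lambda>s. (h s)\<^sup>2 * f (project 0 t s) - C\<^sup>2 * (v s * (h s)\<^sup>2)"
  have gle: "\<bar>?g s\<bar> \<le> c * (h s)\<^sup>2" if s: "s \<in> {0..t}" for s
  proof -
    have "\<bar>(h s)\<^sup>2 * (f s - C\<^sup>2 * v s)\<bar> \<le> (h s)\<^sup>2 * c" unfolding abs_mult using near[OF s] by (intro mult_mono) auto
    then show ?thesis using s by (simp add: project_id algebra_simps)
  qed
  have hm: "(\<lambda>s. indicator {0..t} s *\<^sub>R (h s)\<^sup>2) \<in> borel_measurable lborel"
    using borel_integrable_atLeastAtMost'[OF hc] unfolding set_integrable_def by (rule borel_measurable_integrable)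
  have ig: "set_integrable lborel {0..t} ?g"
    unfolding set_integrable_def
  proof (rule Bochner_Integration.integrable_bound)
    show "integrable lborel (\<lambda>s. indicator {0..t} s *\<^sub>R (c * (h s)\<^sup>2))" using ih by (simp add: set_integrable_def)
    have "(\<lambda>s. (indicator {0..t} s *\<^sub>R (h s)\<^sup>2) * f (project 0 t s) - indicator {0..t} s *\<^sub>R (C\<^sup>2 * (v s * (h s)\<^sup>2))) \<in> borel_measurable lborel"
      by (intro borel_measurable_diff borel_measurable_times hm fm borel_measurable_integrable[OF iv[unfolded set_integrable_def]])
    moreover have "(indicator {0..t} s *\<^sub>R (h s)\<^sup>2) * f (project 0 t s) - indicator {0..t} s *\<^sub>R (C\<^sup>2 * (v s * (h s)\<^sup>2)) = indicator {0..t} s *\<^sub>R ?g s" for s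
      by (simp add: algebra_simps)
    ultimately show "(\<lambda>s. indicator {0..t} s *\<^sub>R ?g s) \<in> borel_measurable lborel" by (simp only:)
    show "AE s in lborel. norm (indicator {0..t} s *\<^sub>R ?g s) \<le> norm (indicator {0..t} s *\<^sub>R (c * (h s)\<^sup>2))"
      using gle c0 by (intro AE_I2) (auto simp: indicator_def)
  qed
  have "fisher_info M b \<sigma> a Y t = (LBINT s:{0..t}. ?g s + C\<^sup>2 * (v s * (h s)\<^sup>2))"
    unfolding fisher_info_def
  proof (rule set_lebesgue_integral_cong)
    show "\<forall>s. s \<in> {0..t} \<longrightarrow> (b s)\<^sup>2 / (\<sigma> s)\<^sup>2 * expectation (\<lambda>z. (a (Y s z))\<^sup>2) = ?g s + C\<^sup>2 * (v s * (h s)\<^sup>2)"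
    proof (intro allI impI)
      fix s assume s: "s \<in> {0..t}"
      have "(b s)\<^sup>2 / (\<sigma> s)\<^sup>2 * (a (Y s z))\<^sup>2 = (h s)\<^sup>2 * (\<rho> s z + C * N s z)\<^sup>2" for z
      proof -
        have "(b s)\<^sup>2 / (\<sigma> s)\<^sup>2 * (a (Y s z))\<^sup>2 = (\<sigma> s)\<^sup>2 * (integrand s z)\<^sup>2"
          using \<sigma>_pos[OF tH[OF s]] by (simp add: power_mult_distrib power_divide power2_eq_square)
        then show ?thesis unfolding integrand_eq[OF tH[OF s]] h_def by (simp add: power_mult_distrib)
      qed
      then have "expectation (\<lambda>z. (b s)\<^sup>2 / (\<sigma> s)\<^sup>2 * (a (Y s z))\<^sup>2) = expectation (\<lambda>z. (h s)\<^sup>2 * (\<rho> s z + C * N s z)\<^sup>2)" by (simp only:)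
      then show "(b s)\<^sup>2 / (\<sigma> s)\<^sup>2 * expectation (\<lambda>z. (a (Y s z))\<^sup>2) = ?g s + C\<^sup>2 * (v s * (h s)\<^sup>2)"
        by (simp only: integral_mult_right_zero project_id[OF s] f_def)
    qed
  qed simp
  also have "... = (LBINT s:{0..t}. ?g s) + (LBINT s:{0..t}. C\<^sup>2 * (v s * (h s)\<^sup>2))" by (rule set_integral_add(2)[OF ig iv])
  also have "(LBINT s:{0..t}. C\<^sup>2 * (v s * (h s)\<^sup>2)) = C\<^sup>2 * (v t)\<^sup>2 / 2"
    unfolding LBINT_eq_integral[OF vh] using integral_v_h2[OF t(1)] by simp
  finally have "\<bar>fisher_info M b \<sigma> a Y t - C\<^sup>2 * (v t)\<^sup>2 / 2\<bar> = \<bar>LBINT s:{0..t}. ?g s\<bar>" by simp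
  also have "... \<le> (LBINT s:{0..t}. \<bar>?g s\<bar>)" using set_integral_norm_bound[OF ig] by simp
  also have "... \<le> (LBINT s:{0..t}. c * (h s)\<^sup>2)"
    by (rule set_integral_mono[OF set_integrable_abs[OF ig] ih]) (use gle in auto)
  also have "... = c * v t"
    using LBINT_eq_integral[of 0 t "\<lambda>s. c * (h s)\<^sup>2"] hc by (simp add: continuous_on_mult v_def[of t])
  finally show ?thesis by (simp add: c_def)
qed

end

section \<open>The limit law\<close>

lemma ennreal_affine: "0 \<le> c \<Longrightarrow> 0 \<le> y \<Longrightarrow> 0 \<le> d \<Longrightarrow> ennreal (c * y + d) = ennreal c * ennreal y + ennreal d"
  by (simp only: ennreal_plus ennreal_mult mult_nonneg_nonneg)

context prob_space
begin

lemma L1_le_L2: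
  assumes [measurable]: "X \<in> borel_measurable M" and d: "0 < d"
    and b: "mean_square M X \<le> ennreal (d\<^sup>2)"
  shows "nn_mean M (\<lambda>z. \<bar>X z\<bar>) \<le> ennreal d"
proof -
  have pt: "\<bar>x\<bar> \<le> 1 / (2 * d) * x\<^sup>2 + d / 2" for x :: real
  proof -
    have "0 \<le> (\<bar>x\<bar> - d)\<^sup>2 / (2 * d)" using d by simp
    also have "... = 1 / (2 * d) * x\<^sup>2 + d / 2 - \<bar>x\<bar>" using d by (simp add: power2_eq_square field_simps)
    finally show ?thesis by simp
  qed
  have "nn_mean M (\<lambda>z. \<bar>X z\<bar>) \<le> (\<integral>\<^sup>+z. ennreal (1 / (2 * d)) * ennreal ((X z)\<^sup>2) + ennreal (d / 2) \<partial>M)"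
  proof (rule nn_integral_mono)
    fix z
    have "ennreal \<bar>X z\<bar> \<le> ennreal (1 / (2 * d) * (X z)\<^sup>2 + d / 2)" by (rule ennreal_leI[OF pt])
    also have "... = ennreal (1 / (2 * d)) * ennreal ((X z)\<^sup>2) + ennreal (d / 2)"
      by (rule ennreal_affine) (use d in auto)
    finally show "ennreal \<bar>X z\<bar> \<le> ennreal (1 / (2 * d)) * ennreal ((X z)\<^sup>2) + ennreal (d / 2)" .
  qed
  also have "... = ennreal (1 / (2 * d)) * mean_square M X + ennreal (d / 2)"
    by (simp add: nn_integral_add nn_integral_cmult emeasure_space_1)
  also have "... \<le> ennreal (1 / (2 * d)) * ennreal (d\<^sup>2) + ennreal (d / 2)" by (intro add_mono mult_left_mono b) auto
  also have "... = ennreal (1 / (2 * d) * d\<^sup>2 + d / 2)" by (rule ennreal_affine[symmetric]) (use d in auto)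
  also have "1 / (2 * d) * d\<^sup>2 + d / 2 = d" using d by (simp add: power2_eq_square)
  finally show ?thesis .
qed

lemma nn_integral_abs_scale:
  assumes [measurable]: "X \<in> borel_measurable M" and b: "nn_mean M (\<lambda>z. \<bar>X z\<bar>) \<le> ennreal k" and k: "0 \<le> k"
  shows "nn_mean M (\<lambda>z. \<bar>c * X z\<bar>) \<le> ennreal (\<bar>c\<bar> * k)"
proof -
  have "nn_mean M (\<lambda>z. \<bar>c * X z\<bar>) = ennreal \<bar>c\<bar> * nn_mean M (\<lambda>z. \<bar>X z\<bar>)"
    by (subst nn_integral_cmult[symmetric]) (auto simp: abs_mult ennreal_mult)
  also have "... \<le> ennreal \<bar>c\<bar> * ennreal k" by (intro mult_left_mono b) auto
  finally show ?thesis using k by (simp add: ennreal_mult)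
qed

end

context wiener_on
begin

text \<open>Taking the integrand to be one brings the functionals of the limit law under the same scaling
  law as those of \<open>N\<close>.\<close>

lemma unit_martingale: "wiener_martingale M B t (\<lambda>_. 1) B"
proof unfold_locales
  show "wiener_integral (\<lambda>_. 1) B" by (rule wiener_integral_B)
qed (use wiener in \<open>auto simp: wiener_process_def intro: B_measurable_F\<close>)

lemma unit_V: "wiener_martingale.V t (\<lambda>_. 1) = t"
  using t_pos by (simp add: wiener_martingale.V_def[OF unit_martingale] wiener_martingale.v_def[OF unit_martingale])

lemma AE_endpoint_nonzero: "AE z in M. B t z \<noteq> 0"
proof -
  have D: "distributed M lborel (\<lambda>z. B t z - B 0 z) (normal_density 0 (sqrt (t - 0)))"
    by (rule increment_normal) (use t_pos in auto)
  have [measurable]: "B t \<in> borel_measurable M" "B 0 \<in> borel_measurable M" using t_pos by auto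
  have "emeasure M ((\<lambda>z. B t z - B 0 z) -` {0} \<inter> space M) = (\<integral>\<^sup>+x. ennreal (normal_density 0 (sqrt (t - 0)) x) * indicator {0} x \<partial>lborel)"
    by (rule distributed_emeasure[OF D]) simp
  also have "... = 0"
    by (rule nn_integral_null_set) (simp add: null_sets_def)
  finally have "AE z in M. z \<notin> (\<lambda>z. B t z - B 0 z) -` {0} \<inter> space M"
    by (intro AE_not_in) (auto simp: null_sets_def)
  then show ?thesis using B_zero AE_space by eventually_elim auto
qed

text \<open>A continuous path that does not end at zero has positive energy.\<close>

lemma unit_energy_pos: "AE z in M. 0 < wiener_martingale.energy t (\<lambda>_. 1) B z"
  using AE_endpoint_nonzero AE_space
proof eventually_elim
  case (elim z)
  interpret W: wiener_martingale M B t "\<lambda>_. 1" B by (rule unit_martingale)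
  let ?f = "\<lambda>s. (B s z)\<^sup>2 * 1\<^sup>2"
  have c: "continuous_on {0..t} ?f" by (intro continuous_intros W.N_cont elim)
  have nn: "0 \<le> integral {0..t} ?f" by (rule integral_nonneg[OF integrable_continuous_real[OF c]]) auto
  moreover have "integral {0..t} ?f \<noteq> 0"
  proof
    assume "integral {0..t} ?f = 0"
    then have "\<forall>s\<in>{0..t}. ?f s = 0"
      using integral_eq_0_iff[OF c t_pos] by auto
    then show False using elim(1) t_pos by auto
  qed
  ultimately have "0 < integral {0..t} ?f" by linarith
  then show ?case unfolding W.energy_def using W.V_pos by simp
qed

text \<open>Ito's formula identifies the stochastic integral of the Wiener process against itself.\<close>

lemma integral_B_dB:
  assumes J: "has_stochastic_integral M F B B t J"
  shows "AE z in M. J z = ((B t z)\<^sup>2 - t) / 2"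
proof -
  interpret W: wiener_martingale M B t "\<lambda>_. 1" B by (rule unit_martingale)
  let ?V = "\<lambda>m z. \<Sum>k<Suc m. B (W.vgrid m k) z * (B (W.vgrid m (Suc k)) z - B (W.vgrid m k) z)"
  have 1: "converges_in_prob M ?V J"
    by (rule W.stochastic_integral_vgrid[OF l2_integrator_B _ J]) simp
  have 2: "converges_in_prob M ?V (\<lambda>z. ((B t z)\<^sup>2 - W.V) / 2)"
    using W.ito_square_sum[OF continuous_on_const continuous_on_const _ wiener_integral_B, of 1] by (simp del: sum.lessThan_Suc)
  have "AE z in M. J z = ((B t z)\<^sup>2 - W.V) / 2"
  proof (rule converges_in_prob_unique[OF _ _ _ 1 2])
    show "?V m \<in> borel_measurable M" for m
      using W.vgrid(1)[of _ m] by (intro borel_measurable_sum borel_measurable_times borel_measurable_diff B_measurable) auto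
    show "J \<in> borel_measurable M" using J by (simp add: has_stochastic_integral_def)
    have "B t \<in> borel_measurable M" using t_pos by simp
    then show "(\<lambda>z. ((B t z)\<^sup>2 - W.V) / 2) \<in> borel_measurable M" by simp
  qed
  then show ?thesis unfolding unit_V .
qed

end

context perturbed_diffusion
begin

abbreviation "P t \<equiv> wiener_martingale.endpoint t h N"
abbreviation "U t \<equiv> wiener_martingale.energy t h N"
abbreviation "IY t \<equiv> fisher_info M b \<sigma> a Y t"

lemma endpoint_energy_eq:
  assumes t: "t \<in> horizon T" "0 < t"
  shows "P t z = ((N t z)\<^sup>2 / v t - 1) / 2" "U t z = integral {0..t} (\<lambda>s. (N s z)\<^sup>2 * (h s)\<^sup>2) / (v t)\<^sup>2"
    "0 < v t" "P t \<in> borel_measurable M" "U t \<in> borel_measurable M"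
proof -
  interpret W: wiener_martingale M B t h N by (rule martingale[OF t])
  have V: "W.V = v t" using martingale_v[OF t] by (simp add: W.V_def)
  show "P t z = ((N t z)\<^sup>2 / v t - 1) / 2" "U t z = integral {0..t} (\<lambda>s. (N s z)\<^sup>2 * (h s)\<^sup>2) / (v t)\<^sup>2"
    unfolding W.endpoint_def W.energy_def V by simp_all
  show "0 < v t" using W.V_pos V by simp
  show "P t \<in> borel_measurable M" "U t \<in> borel_measurable M" by (rule W.endpoint_measurable W.energy_measurable)+
qed

lemma endpoint_L1:
  assumes t: "t \<in> horizon T" "0 < t"
  shows "nn_mean M (\<lambda>z. \<bar>P t z\<bar>) \<le> ennreal 1"
proof -
  note e = endpoint_energy_eq[OF t]
  have "nn_mean M (\<lambda>z. \<bar>P t z\<bar>) \<le> (\<integral>\<^sup>+z. ennreal (1 / (2 * v t)) * ennreal ((N t z)\<^sup>2) + ennreal (1/2) \<partial>M)"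
  proof (rule nn_integral_mono)
    fix z
    have "0 \<le> (N t z)\<^sup>2 / v t" using e(3) by simp
    then have "\<bar>P t z\<bar> \<le> ((N t z)\<^sup>2 / v t + 1) / 2" unfolding e(1) by (auto simp: abs_le_iff)
    also have "... = 1 / (2 * v t) * (N t z)\<^sup>2 + 1/2" by (simp add: add_divide_distrib)
    finally have "ennreal \<bar>P t z\<bar> \<le> ennreal (1 / (2 * v t) * (N t z)\<^sup>2 + 1/2)" by (rule ennreal_leI)
    also have "... = ennreal (1 / (2 * v t)) * ennreal ((N t z)\<^sup>2) + ennreal (1/2)"
      by (rule ennreal_affine) (use e(3) in auto)
    finally show "ennreal \<bar>P t z\<bar> \<le> ennreal (1 / (2 * v t)) * ennreal ((N t z)\<^sup>2) + ennreal (1/2)" .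
  qed
  also have "... = ennreal (1 / (2 * v t)) * ennreal (v t) + ennreal (1/2)"
    using N_measurable[OF t(1)] by (simp add: nn_integral_add nn_integral_cmult emeasure_space_1 N_second_moment[OF t(1)])
  also have "... = ennreal (1 / (2 * v t) * v t + 1/2)" by (rule ennreal_affine[symmetric]) (use e(3) in auto)
  also have "1 / (2 * v t) * v t + 1/2 = (1::real)" using e(3) by simp
  finally show ?thesis .
qed

text \<open>Once \<open>\<rho>\<close> is negligible against \<open>v\<close>, the bounds of the previous part, divided by the proper powers of
  \<open>v\<close>, become small; the parameter \<open>\<theta>\<close> of Young's inequality is fixed before \<open>t\<close> is chosen.\<close>

lemma asymptotic_expansion:
  assumes tau: "0 < \<tau>"
  obtains t1 where "t1 \<in> horizon T" "0 < t1"
    "\<And>t. t \<in> horizon T \<Longrightarrow> t1 \<le> t \<Longrightarrow> nn_mean M (\<lambda>z. \<bar>Q t z / v t - C * P t z\<bar>) \<le> ennreal \<tau>"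
    "\<And>t. t \<in> horizon T \<Longrightarrow> t1 \<le> t \<Longrightarrow> nn_mean M (\<lambda>z. \<bar>obs t z / (v t)\<^sup>2 - C\<^sup>2 * U t z\<bar>) \<le> ennreal \<tau>"
    "\<And>t. t \<in> horizon T \<Longrightarrow> t1 \<le> t \<Longrightarrow> \<bar>IY t / (v t)\<^sup>2 - C\<^sup>2 / 2\<bar> \<le> \<tau>"
proof -
  obtain \<theta> a0 where \<theta>: "0 < \<theta>" "0 < a0" "(1 + 1 / \<theta>) * a0 + \<theta> * C\<^sup>2 \<le> \<tau>"
    using small_theta_choice[OF tau zero_le_power2] by blast
  define \<eta> where "\<eta> = min a0 (\<tau>\<^sup>2 / 4)"
  have \<eta>: "0 < \<eta>" "\<eta> \<le> a0" "4 * \<eta> \<le> \<tau>\<^sup>2" using \<theta> tau by (auto simp: \<eta>_def)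
  obtain t1 where t1: "t1 \<in> horizon T" "0 < t1"
    "\<And>t s. t \<in> horizon T \<Longrightarrow> t1 \<le> t \<Longrightarrow> s \<in> {0..t} \<Longrightarrow> mean_square M (\<rho> s) \<le> ennreal (\<eta> * v t)"
    by (rule \<rho>_negligible[OF \<eta>(1)]) blast
  have \<theta>\<eta>: "(1 + 1 / \<theta>) * \<eta> + \<theta> * C\<^sup>2 \<le> \<tau>"
  proof -
    have "(1 + 1 / \<theta>) * \<eta> \<le> (1 + 1 / \<theta>) * a0" using \<theta> \<eta> by (intro mult_left_mono) auto
    then show ?thesis using \<theta>(3) by linarith
  qed
  show ?thesis
  proof (rule that[OF t1(1,2)])
    fix t assume t: "t \<in> horizon T" "t1 \<le> t"
    have t0: "0 < t" using t t1 by linarith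
    note e = endpoint_energy_eq[OF t(1) t0]
    have k0: "0 \<le> \<eta> * v t" using \<eta> e(3) by simp
    have scale: "((1 + 1 / \<theta>) * (\<eta> * v t) + \<theta> * (C\<^sup>2 * v t)) * v t \<le> \<tau> * (v t)\<^sup>2"
    proof -
      have "((1 + 1 / \<theta>) * (\<eta> * v t) + \<theta> * (C\<^sup>2 * v t)) * v t = ((1 + 1 / \<theta>) * \<eta> + \<theta> * C\<^sup>2) * (v t)\<^sup>2"
        by (simp add: power2_eq_square algebra_simps)
      also have "... \<le> \<tau> * (v t)\<^sup>2" by (rule mult_right_mono[OF \<theta>\<eta>]) simp
      finally show ?thesis .
    qed
    show "nn_mean M (\<lambda>z. \<bar>Q t z / v t - C * P t z\<bar>) \<le> ennreal \<tau>"
    proof (rule L1_le_L2)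
      let ?Z = "\<lambda>z. Q t z - C * (((N t z)\<^sup>2 - v t) / 2)"
      have Zm: "?Z \<in> borel_measurable M"
        using Q_measurable[OF t(1)] N_measurable[OF t(1)] by measurable
      show "(\<lambda>z. Q t z / v t - C * P t z) \<in> borel_measurable M" using Q_measurable[OF t(1)] e(4) by simp
      have eq: "Q t z / v t - C * P t z = 1 / v t * ?Z z" for z
        unfolding e(1) using e(3) by (simp add: field_simps)
      have "mean_square M (\<lambda>z. Q t z / v t - C * P t z) = ennreal ((1 / v t)\<^sup>2) * mean_square M ?Z"
        unfolding eq power_mult_distrib using Zm
        by (subst nn_integral_cmult[symmetric]) (auto simp only: ennreal_mult zero_le_power2 intro!: measurable_compose[OF _ measurable_ennreal] borel_measurable_power)
      also have "... \<le> ennreal ((1 / v t)\<^sup>2) * ennreal (4 * (\<eta> * v t) * v t)"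
        by (intro mult_left_mono numerator_bound[OF t(1) t0 k0 t1(3)[OF t]]) auto
      also have "... = ennreal ((1 / v t)\<^sup>2 * (4 * (\<eta> * v t) * v t))"
        by (intro ennreal_mult[symmetric]) (use k0 e(3) in auto)
      also have "(1 / v t)\<^sup>2 * (4 * (\<eta> * v t) * v t) = 4 * \<eta>" using e(3) by (simp add: power2_eq_square)
      also have "ennreal (4 * \<eta>) \<le> ennreal (\<tau>\<^sup>2)" by (rule ennreal_leI[OF \<eta>(3)])
      finally show "mean_square M (\<lambda>z. Q t z / v t - C * P t z) \<le> ennreal (\<tau>\<^sup>2)" .
    qed (use tau in auto)
    show "nn_mean M (\<lambda>z. \<bar>obs t z / (v t)\<^sup>2 - C\<^sup>2 * U t z\<bar>) \<le> ennreal \<tau>"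
    proof -
      let ?Z = "\<lambda>z. obs t z - C\<^sup>2 * integral {0..t} (\<lambda>s. (N s z)\<^sup>2 * (h s)\<^sup>2)"
      have Z_eq: "?Z z = obs t z - C\<^sup>2 * (v t)\<^sup>2 * U t z" for z unfolding e(2) using e(3) by simp
      have Zm: "?Z \<in> borel_measurable M" unfolding Z_eq using obs_measurable[OF t(1)] e(5) by simp
      have eq: "obs t z / (v t)\<^sup>2 - C\<^sup>2 * U t z = 1 / (v t)\<^sup>2 * ?Z z" for z
        unfolding e(2) using e(3) by (simp add: right_diff_distrib)
      have "nn_mean M (\<lambda>z. \<bar>?Z z\<bar>) \<le> ennreal (\<tau> * (v t)\<^sup>2)"
        by (rule order_trans[OF denominator_bound[OF t(1) t0 k0 t1(3)[OF t] \<theta>(1)] ennreal_leI[OF scale]]) auto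
      from nn_integral_abs_scale[OF Zm this, of "1 / (v t)\<^sup>2"] tau
      have "nn_mean M (\<lambda>z. \<bar>1 / (v t)\<^sup>2 * ?Z z\<bar>) \<le> ennreal (\<bar>1 / (v t)\<^sup>2\<bar> * (\<tau> * (v t)\<^sup>2))" by simp
      also have "\<bar>1 / (v t)\<^sup>2\<bar> * (\<tau> * (v t)\<^sup>2) = \<tau>" using e(3) by simp
      finally show ?thesis unfolding eq .
    qed
    have "\<bar>IY t - C\<^sup>2 * (v t)\<^sup>2 / 2\<bar> \<le> \<tau> * (v t)\<^sup>2"
      by (rule order_trans[OF fisher_info_Y_bound[OF t(1) t0 k0 t1(3)[OF t] \<theta>(1)] scale])
    then have "\<bar>IY t - C\<^sup>2 * (v t)\<^sup>2 / 2\<bar> / (v t)\<^sup>2 \<le> \<tau>" using e(3) by (simp add: field_simps)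
    moreover have "\<bar>IY t - C\<^sup>2 * (v t)\<^sup>2 / 2\<bar> / (v t)\<^sup>2 = \<bar>IY t / (v t)\<^sup>2 - C\<^sup>2 / 2\<bar>"
    proof -
      have "IY t / (v t)\<^sup>2 - C\<^sup>2 / 2 = (IY t - C\<^sup>2 * (v t)\<^sup>2 / 2) / (v t)\<^sup>2" using e(3) by (simp add: diff_divide_distrib)
      then show ?thesis by simp
    qed
    ultimately show "\<bar>IY t / (v t)\<^sup>2 - C\<^sup>2 / 2\<bar> \<le> \<tau>" by linarith
  qed
qed

text \<open>For \<open>x\<close> fixed, the event that the normalized error is at most \<open>x\<close> is, once the
  observed information is positive, the event that this variable is nonpositive.\<close>

definition discrepancy :: "real \<Rightarrow> real \<Rightarrow> 'a \<Rightarrow> real" where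
  "discrepancy x t z = sqrt (IY t) / v t * (Q t z / v t) - x * (obs t z / (v t)\<^sup>2)"

lemma discrepancy_measurable: "t \<in> horizon T \<Longrightarrow> discrepancy x t \<in> borel_measurable M"
  unfolding discrepancy_def[abs_def]
  by (intro borel_measurable_diff borel_measurable_times borel_measurable_divide borel_measurable_const Q_measurable obs_measurable)

text \<open>The normalizing factor \<open>sqrt (IY t) / v t\<close> tends to \<open>|C| / sqrt 2\<close>, and \<open>P t\<close> is bounded in mean, so the
  factor may be replaced by its limit.\<close>

lemma discrepancy_expansion:
  assumes eps: "0 < \<epsilon>"
  obtains t1 where "t1 \<in> horizon T" "0 < t1"
    "\<And>t. t \<in> horizon T \<Longrightarrow> t1 \<le> t \<Longrightarrow>
      nn_mean M (\<lambda>z. \<bar>discrepancy x t z - (\<bar>C\<bar> / sqrt 2 * C * P t z + (- x * C\<^sup>2) * U t z)\<bar>) \<le> ennreal \<epsilon>"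
proof -
  let ?lim = "\<bar>C\<bar> / sqrt 2"
  \<comment> \<open>The errors of \<open>Q\<close>, of the normalizing factor and of the observed information, if each expansion holds up to \<open>\<tau>\<close>.\<close>
  have "((\<lambda>\<tau>. (?lim + sqrt \<tau>) * \<tau> + sqrt \<tau> * \<bar>C\<bar> + \<bar>x\<bar> * \<tau>) \<longlongrightarrow> (?lim + sqrt 0) * 0 + sqrt 0 * \<bar>C\<bar> + \<bar>x\<bar> * 0) (at_right 0)"
    by (intro tendsto_intros)
  from order_tendstoD(2)[OF this, of \<epsilon>] eps
  have "eventually (\<lambda>\<tau>. (?lim + sqrt \<tau>) * \<tau> + sqrt \<tau> * \<bar>C\<bar> + \<bar>x\<bar> * \<tau> < \<epsilon>) (at_right 0)" by simp
  then have "eventually (\<lambda>\<tau>. 0 < \<tau> \<and> (?lim + sqrt \<tau>) * \<tau> + sqrt \<tau> * \<bar>C\<bar> + \<bar>x\<bar> * \<tau> < \<epsilon>) (at_right 0)"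
    using eventually_at_right_less[of "0::real"] by eventually_elim auto
  then obtain \<tau> where \<tau>: "0 < \<tau>" "(?lim + sqrt \<tau>) * \<tau> + sqrt \<tau> * \<bar>C\<bar> + \<bar>x\<bar> * \<tau> < \<epsilon>"
    using eventually_happens'[OF trivial_limit_at_right_real] by blast
  obtain t1 where t1: "t1 \<in> horizon T" "0 < t1"
    and Qb: "\<And>t. t \<in> horizon T \<Longrightarrow> t1 \<le> t \<Longrightarrow> nn_mean M (\<lambda>z. \<bar>Q t z / v t - C * P t z\<bar>) \<le> ennreal \<tau>"
    and Ob: "\<And>t. t \<in> horizon T \<Longrightarrow> t1 \<le> t \<Longrightarrow> nn_mean M (\<lambda>z. \<bar>obs t z / (v t)\<^sup>2 - C\<^sup>2 * U t z\<bar>) \<le> ennreal \<tau>"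
    and Ib: "\<And>t. t \<in> horizon T \<Longrightarrow> t1 \<le> t \<Longrightarrow> \<bar>IY t / (v t)\<^sup>2 - C\<^sup>2 / 2\<bar> \<le> \<tau>"
    by (rule asymptotic_expansion[OF \<tau>(1)]) blast
  show ?thesis
  proof (rule that[OF t1])
    fix t assume t: "t \<in> horizon T" "t1 \<le> t"
    have t0: "0 < t" using t t1 by linarith
    note e = endpoint_energy_eq[OF t(1) t0]
    let ?s = "sqrt (IY t) / v t"
    have three: "\<bar>p + q + \<nu>\<bar> \<le> \<bar>p\<bar> + \<bar>q\<bar> + \<bar>\<nu>\<bar>" for p q \<nu> :: real by linarith
    have s_eq: "?s = sqrt (IY t / (v t)\<^sup>2)" using e(3) by (simp add: real_sqrt_divide)
    have s0_eq: "?lim = sqrt (C\<^sup>2 / 2)" by (simp add: real_sqrt_divide)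
    have root: "\<bar>sqrt y - sqrt \<nu>\<bar> \<le> sqrt \<bar>y - \<nu>\<bar>" if \<nu>: "0 \<le> \<nu>" "0 \<le> y" for y \<nu> :: real
    proof -
      have half: "sqrt p - sqrt q \<le> sqrt \<bar>p - q\<bar>" if "0 \<le> q" "0 \<le> p" for p q :: real
      proof -
        have "sqrt p \<le> sqrt (q + \<bar>p - q\<bar>)" by (rule real_sqrt_le_mono) linarith
        also have "... \<le> sqrt q + sqrt \<bar>p - q\<bar>" by (rule sqrt_add_le_add_sqrt) (use that in auto)
        finally show ?thesis by simp
      qed
      show ?thesis using half[OF \<nu>] half[OF \<nu>(2,1)] by (simp add: abs_le_iff abs_minus_commute)
    qed
    have I0: "0 \<le> IY t"
      unfolding fisher_info_def set_lebesgue_integral_def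
      by (rule integral_nonneg_AE, rule AE_I2) (auto simp: indicator_def intro!: divide_nonneg_nonneg mult_nonneg_nonneg Bochner_Integration.integral_nonneg)
    have s: "\<bar>?s - ?lim\<bar> \<le> sqrt \<tau>"
      unfolding s_eq s0_eq using root[of "C\<^sup>2 / 2" "IY t / (v t)\<^sup>2"] Ib[OF t] I0
      by (meson order_trans real_sqrt_le_mono zero_le_divide_iff zero_le_power2 zero_le_numeral)
    let ?q = "\<lambda>z. Q t z / v t - C * P t z" and ?o = "\<lambda>z. obs t z / (v t)\<^sup>2 - C\<^sup>2 * U t z"
    have m: "?q \<in> borel_measurable M" "?o \<in> borel_measurable M"
      using Q_measurable[OF t(1)] obs_measurable[OF t(1)] e(4,5) by measurable
    have 1: "nn_mean M (\<lambda>z. \<bar>?s * ?q z\<bar>) \<le> ennreal (\<bar>?s\<bar> * \<tau>)"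
      by (rule nn_integral_abs_scale[OF m(1) Qb[OF t]]) (use \<tau> in auto)
    have 2: "nn_mean M (\<lambda>z. \<bar>((?s - ?lim) * C) * P t z\<bar>) \<le> ennreal (\<bar>(?s - ?lim) * C\<bar> * 1)"
      by (rule nn_integral_abs_scale[OF e(4) endpoint_L1[OF t(1) t0]]) auto
    have 3: "nn_mean M (\<lambda>z. \<bar>(- x) * ?o z\<bar>) \<le> ennreal (\<bar>- x\<bar> * \<tau>)"
      by (rule nn_integral_abs_scale[OF m(2) Ob[OF t]]) (use \<tau> in auto)
    have "nn_mean M (\<lambda>z. \<bar>discrepancy x t z - (?lim * C * P t z + (- x * C\<^sup>2) * U t z)\<bar>) \<le>
      (\<integral>\<^sup>+z. ennreal \<bar>?s * ?q z\<bar> + ennreal \<bar>((?s - ?lim) * C) * P t z\<bar> + ennreal \<bar>(- x) * ?o z\<bar> \<partial>M)"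
    proof (rule nn_integral_mono)
      fix z
      have "discrepancy x t z - (?lim * C * P t z + (- x * C\<^sup>2) * U t z) = ?s * ?q z + ((?s - ?lim) * C) * P t z + (- x) * ?o z"
        unfolding discrepancy_def by (simp only: right_diff_distrib left_diff_distrib)
      then have "\<bar>discrepancy x t z - (?lim * C * P t z + (- x * C\<^sup>2) * U t z)\<bar> \<le> \<bar>?s * ?q z\<bar> + \<bar>((?s - ?lim) * C) * P t z\<bar> + \<bar>(- x) * ?o z\<bar>"
        by (simp only: three)
      then have "ennreal \<bar>discrepancy x t z - (?lim * C * P t z + (- x * C\<^sup>2) * U t z)\<bar> \<le> ennreal (\<bar>?s * ?q z\<bar> + \<bar>((?s - ?lim) * C) * P t z\<bar> + \<bar>(- x) * ?o z\<bar>)"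
        by (rule ennreal_leI)
      also have "... = ennreal \<bar>?s * ?q z\<bar> + ennreal \<bar>((?s - ?lim) * C) * P t z\<bar> + ennreal \<bar>(- x) * ?o z\<bar>"
        by (simp only: ennreal_plus abs_ge_zero add_nonneg_nonneg)
      finally show "ennreal \<bar>discrepancy x t z - (?lim * C * P t z + (- x * C\<^sup>2) * U t z)\<bar> \<le>
        ennreal \<bar>?s * ?q z\<bar> + ennreal \<bar>((?s - ?lim) * C) * P t z\<bar> + ennreal \<bar>(- x) * ?o z\<bar>" .
    qed
    also have "... = nn_mean M (\<lambda>z. \<bar>?s * ?q z\<bar>) + nn_mean M (\<lambda>z. \<bar>((?s - ?lim) * C) * P t z\<bar>) + nn_mean M (\<lambda>z. \<bar>(- x) * ?o z\<bar>)"
    proof -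
      have n: "(\<lambda>z. ennreal \<bar>?s * ?q z\<bar>) \<in> borel_measurable M" "(\<lambda>z. ennreal \<bar>((?s - ?lim) * C) * P t z\<bar>) \<in> borel_measurable M"
        "(\<lambda>z. ennreal \<bar>(- x) * ?o z\<bar>) \<in> borel_measurable M"
        by (intro measurable_compose[OF _ measurable_ennreal] borel_measurable_abs borel_measurable_times borel_measurable_const m e)+
      show ?thesis by (simp only: nn_integral_add[OF borel_measurable_add[OF n(1,2)] n(3)] nn_integral_add[OF n(1,2)])
    qed
    also have "... \<le> ennreal (\<bar>?s\<bar> * \<tau>) + ennreal (\<bar>(?s - ?lim) * C\<bar> * 1) + ennreal (\<bar>- x\<bar> * \<tau>)" by (intro add_mono 1 2 3)
    also have "... = ennreal (\<bar>?s\<bar> * \<tau> + \<bar>(?s - ?lim) * C\<bar> * 1 + \<bar>- x\<bar> * \<tau>)"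
      using \<tau>(1) by (simp only: ennreal_plus abs_ge_zero add_nonneg_nonneg mult_nonneg_nonneg less_imp_le zero_le_one)
    also have "... \<le> ennreal \<epsilon>"
    proof (rule ennreal_leI)
      have "0 \<le> ?lim" by simp
      then have "\<bar>?s\<bar> \<le> ?lim + sqrt \<tau>" using s by linarith
      then have "\<bar>?s\<bar> * \<tau> \<le> (?lim + sqrt \<tau>) * \<tau>" using \<tau> by (intro mult_right_mono) auto
      moreover have "\<bar>(?s - ?lim) * C\<bar> * 1 \<le> sqrt \<tau> * \<bar>C\<bar>" unfolding abs_mult using s by (simp add: mult_right_mono)
      ultimately show "\<bar>?s\<bar> * \<tau> + \<bar>(?s - ?lim) * C\<bar> * 1 + \<bar>- x\<bar> * \<tau> \<le> \<epsilon>" using \<tau>(2) by simp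
    qed
    finally show "nn_mean M (\<lambda>z. \<bar>discrepancy x t z - (?lim * C * P t z + (- x * C\<^sup>2) * U t z)\<bar>) \<le> ennreal \<epsilon>" .
  qed
qed

lemma obs_mono:
  assumes "t \<in> horizon T" "0 \<le> s" "s \<le> t" "z \<in> space M" shows "obs s z \<le> obs t z"
proof -
  have sH: "s \<in> horizon T" by (rule horizon_le[OF assms(1-3)])
  have c: "continuous_on (horizon T) (\<lambda>s. (h s)\<^sup>2 * (\<rho> s z + C * N s z)\<^sup>2)"
    by (intro continuous_intros h_cont \<rho>_cont[OF assms(4)] N_cont[OF assms(4)])
  show ?thesis
    unfolding obs_eq(1)[OF sH assms(4)] obs_eq(1)[OF assms(1,4)]
    by (rule integral_subset_le) (use assms in \<open>auto intro!: integrable_continuous_real cont_Icc[OF c] sH\<close>)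
qed

end

locale perturbed_diffusion_limit = perturbed_diffusion +
  fixes M' :: "'b measure" and W :: "real \<Rightarrow> 'b \<Rightarrow> real"
  assumes W: "wiener_process M' {0..1} W"
begin

sublocale L: wiener_on M' W 1 by (rule wiener_on.intro[OF W]) simp

abbreviation "PW \<equiv> wiener_martingale.endpoint 1 (\<lambda>_. 1) W"
abbreviation "UW \<equiv> wiener_martingale.energy 1 (\<lambda>_. 1) W"

lemma same_law:
  assumes t: "t \<in> horizon T" "0 < t"
  shows "prob {z\<in>space M. c * P t z + d * U t z \<le> \<nu>} = L.prob {z\<in>space M'. c * PW z + d * UW z \<le> \<nu>}"
  by (rule endpoint_energy_law[OF martingale[OF t] L.unit_martingale])

lemma PW_measurable: "PW \<in> borel_measurable M'" and UW_measurable: "UW \<in> borel_measurable M'"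
proof -
  interpret W: wiener_martingale M' W 1 "\<lambda>_. 1" W by (rule L.unit_martingale)
  show "PW \<in> borel_measurable M'" "UW \<in> borel_measurable M'" by (rule W.endpoint_measurable W.energy_measurable)+
qed

lemma PW_eq: "PW z = ((W 1 z)\<^sup>2 - 1) / 2"
  unfolding wiener_martingale.endpoint_def[OF L.unit_martingale] L.unit_V by simp

lemma UW_eq: "z \<in> space M' \<Longrightarrow> UW z = (LBINT s:{0..1}. (W s z)\<^sup>2)"
proof -
  assume w: "z \<in> space M'"
  have "continuous_on {0..1} (\<lambda>s. (W s z)\<^sup>2)"
    using W w by (intro continuous_intros) (auto simp: wiener_process_def)
  from LBINT_eq_integral[OF this] show ?thesis
    unfolding wiener_martingale.energy_def[OF L.unit_martingale] L.unit_V by simp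
qed

text \<open>The observed information is positive with probability tending to one, because its normalized
  limit is positive almost surely.\<close>

lemma obs_nonpos_prob:
  assumes \<delta>: "0 < \<delta>"
  obtains t1 where "t1 \<in> horizon T" "0 < t1" "\<And>t. t \<in> horizon T \<Longrightarrow> t1 \<le> t \<Longrightarrow> prob {z\<in>space M. obs t z \<le> 0} < \<delta>"
proof -
  have C2: "0 < C\<^sup>2" using C_nz by simp
  have [measurable]: "UW \<in> borel_measurable M'" "PW \<in> borel_measurable M'" by (rule UW_measurable PW_measurable)+
  have "AE z in M'. z \<notin> {z\<in>space M'. 0 * PW z + C\<^sup>2 * UW z \<le> 0}"
    using L.unit_energy_pos by eventually_elim (use C2 in \<open>auto simp: not_le\<close>)
  moreover have "{z\<in>space M'. 0 * PW z + C\<^sup>2 * UW z \<le> 0} \<in> L.events" by measurable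
  ultimately have "L.prob {z\<in>space M'. 0 * PW z + C\<^sup>2 * UW z \<le> 0} = 0" using L.prob_eq_0 by blast
  moreover have "(\<lambda>n. L.prob {z\<in>space M'. 0 * PW z + C\<^sup>2 * UW z \<le> 0 + 1 / real (Suc n)}) \<longlonglongrightarrow> L.prob {z\<in>space M'. 0 * PW z + C\<^sup>2 * UW z \<le> 0}"
    by (rule L.prob_le_shift_right) measurable
  ultimately have "eventually (\<lambda>n. L.prob {z\<in>space M'. 0 * PW z + C\<^sup>2 * UW z \<le> 0 + 1 / real (Suc n)} < \<delta>/2) sequentially"
    using order_tendstoD(2)[of _ 0 sequentially "\<delta>/2"] \<delta> by simp
  then obtain n where n: "L.prob {z\<in>space M'. 0 * PW z + C\<^sup>2 * UW z \<le> 0 + 1 / real (Suc n)} < \<delta>/2"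
    by (auto simp: eventually_sequentially)
  define \<epsilon> where "\<epsilon> = 1 / real (Suc n) / 2"
  have e: "0 < \<epsilon>" by (simp add: \<epsilon>_def)
  have "1 / real (Suc n) = 2 * \<epsilon>" by (simp add: \<epsilon>_def del: of_nat_Suc)
  then have en: "\<epsilon> < 1 / real (Suc n)" using e by linarith
  have tau: "0 < \<epsilon> * (\<delta>/4)" using e \<delta> by simp
  obtain t1 where t1: "t1 \<in> horizon T" "0 < t1"
    and Ob: "\<And>t. t \<in> horizon T \<Longrightarrow> t1 \<le> t \<Longrightarrow> nn_mean M (\<lambda>z. \<bar>obs t z / (v t)\<^sup>2 - C\<^sup>2 * U t z\<bar>) \<le> ennreal (\<epsilon> * (\<delta>/4))"
    by (rule asymptotic_expansion[OF tau]) blast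
  show ?thesis
  proof (rule that[OF t1])
    fix t assume t: "t \<in> horizon T" "t1 \<le> t"
    have t0: "0 < t" using t t1 by linarith
    note pu = endpoint_energy_eq[OF t(1) t0]
    have [measurable]: "obs t \<in> borel_measurable M" "U t \<in> borel_measurable M" "P t \<in> borel_measurable M"
      using obs_measurable[OF t(1)] pu(4,5) by auto
    have "prob {z\<in>space M. obs t z \<le> 0} \<le> prob {z\<in>space M. 0 * P t z + C\<^sup>2 * U t z \<le> 0 + 1 / real (Suc n)} +
      prob {z\<in>space M. \<epsilon> < \<bar>obs t z / (v t)\<^sup>2 - C\<^sup>2 * U t z\<bar>}"
    proof (rule prob_le_add)
      show "{z\<in>space M. obs t z \<le> 0} \<subseteq> {z\<in>space M. 0 * P t z + C\<^sup>2 * U t z \<le> 0 + 1 / real (Suc n)} \<union>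
        {z\<in>space M. \<epsilon> < \<bar>obs t z / (v t)\<^sup>2 - C\<^sup>2 * U t z\<bar>}"
      proof
        fix z assume w: "z \<in> {z\<in>space M. obs t z \<le> 0}"
        then have "obs t z / (v t)\<^sup>2 \<le> 0" by (simp add: divide_nonpos_nonneg)
        then have "C\<^sup>2 * U t z \<le> 1 / real (Suc n) \<or> \<epsilon> < \<bar>obs t z / (v t)\<^sup>2 - C\<^sup>2 * U t z\<bar>" using e en by linarith
        then show "z \<in> {z\<in>space M. 0 * P t z + C\<^sup>2 * U t z \<le> 0 + 1 / real (Suc n)} \<union>
          {z\<in>space M. \<epsilon> < \<bar>obs t z / (v t)\<^sup>2 - C\<^sup>2 * U t z\<bar>}" using w by simp
      qed
    qed measurable
    also have "prob {z\<in>space M. 0 * P t z + C\<^sup>2 * U t z \<le> 0 + 1 / real (Suc n)} < \<delta>/2"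
      unfolding same_law[OF t(1) t0] by (rule n)
    also have "prob {z\<in>space M. \<epsilon> < \<bar>obs t z / (v t)\<^sup>2 - C\<^sup>2 * U t z\<bar>} \<le> \<epsilon> * (\<delta>/4) / \<epsilon>"
      by (rule prob_tail_L1[OF _ _ _ Ob[OF t]]) (use e \<delta> in auto)
    also have "\<epsilon> * (\<delta>/4) / \<epsilon> = \<delta>/4" using e by simp
    finally show "prob {z\<in>space M. obs t z \<le> 0} < \<delta>" using \<delta> by simp
  qed
qed

text \<open>The observed information is nondecreasing in time, so it suffices that it is positive at some
  time of a sequence along which it fails to be positive with vanishing probability.\<close>

lemma obs_eventually_pos: "AE z in M. \<exists>t1\<in>horizon T. \<forall>t\<in>horizon T. t1 \<le> t \<longrightarrow> 0 < obs t z"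
proof -
  have "\<exists>t\<in>horizon T. prob {z\<in>space M. obs t z \<le> 0} < 1 / real (Suc n)" for n
  proof -
    have "0 < 1 / real (Suc n)" by simp
    from obs_nonpos_prob[OF this] show ?thesis by (metis order_refl)
  qed
  then obtain \<tau> where \<tau>: "\<And>n. \<tau> n \<in> horizon T" "\<And>n. prob {z\<in>space M. obs (\<tau> n) z \<le> 0} < 1 / real (Suc n)"
    unfolding Bex_def by moura
  have [measurable]: "obs (\<tau> n) \<in> borel_measurable M" for n by (rule obs_measurable[OF \<tau>(1)])
  let ?Z = "{z\<in>space M. \<forall>n. obs (\<tau> n) z \<le> 0}"
  have Zm: "?Z \<in> events" by measurable
  have "prob ?Z \<le> 1 / real (Suc n)" for n
  proof -
    have "prob ?Z \<le> prob {z\<in>space M. obs (\<tau> n) z \<le> 0}" by (rule prob_mono_ev) auto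
    then show ?thesis using \<tau>(2)[of n] by linarith
  qed
  then have "prob ?Z \<le> 0"
    using LIMSEQ_le_const[OF LIMSEQ_inverse_real_of_nat, of "prob ?Z"] by (auto simp: field_simps)
  then have "prob ?Z = 0" using measure_nonneg[of M ?Z] by linarith
  then have "AE z in M. z \<notin> ?Z" using prob_eq_0[OF Zm] by simp
  then show ?thesis
    using AE_space
  proof eventually_elim
    case (elim z)
    then obtain n where n: "0 < obs (\<tau> n) z" by (auto simp: not_le)
    have "0 < obs t z" if "t \<in> horizon T" "\<tau> n \<le> t" for t
    proof -
      have "0 \<le> \<tau> n" using \<tau>(1)[of n] by (simp add: horizon_def)
      from obs_mono[OF that(1) this that(2) elim(2)] n show ?thesis by linarith
    qed
    then show ?case using \<tau>(1) by blast
  qed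
qed

text \<open>Convergence of the probabilities follows by squeezing the event between two events for the
  linear limit functional, which puts no mass at zero.\<close>

lemma discrepancy_limit:
  assumes x0: "L.prob {z\<in>space M'. \<bar>C\<bar> / sqrt 2 * C * PW z + (- x * C\<^sup>2) * UW z = 0} = 0" and \<delta>: "0 < \<delta>"
  obtains t1 where "t1 \<in> horizon T" "0 < t1" "\<And>t. t \<in> horizon T \<Longrightarrow> t1 \<le> t \<Longrightarrow>
    \<bar>prob {z\<in>space M. discrepancy x t z \<le> 0} - L.prob {z\<in>space M'. \<bar>C\<bar> / sqrt 2 * C * PW z + (- x * C\<^sup>2) * UW z \<le> 0}\<bar> < \<delta>"
proof -
  have [measurable]: "UW \<in> borel_measurable M'" "PW \<in> borel_measurable M'" by (rule UW_measurable PW_measurable)+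
  let ?c = "\<bar>C\<bar> / sqrt 2 * C" and ?d = "- x * C\<^sup>2"
  let ?Z = "\<lambda>z. ?c * PW z + ?d * UW z"
  let ?p = "L.prob {z\<in>space M'. ?Z z \<le> 0}"
  have "L.prob {z\<in>space M'. ?Z z \<le> 0} \<le> L.prob {z\<in>space M'. ?Z z < 0} + L.prob {z\<in>space M'. ?Z z = 0}"
    by (rule L.prob_le_add) auto
  moreover have "L.prob {z\<in>space M'. ?Z z < 0} \<le> ?p" by (rule L.prob_mono_ev) auto
  ultimately have lt: "L.prob {z\<in>space M'. ?Z z < 0} = ?p" using x0 by linarith
  have r2: "?p < ?p + \<delta>/2" "?p - \<delta>/2 < ?p" using \<delta> by auto
  have "(\<lambda>n. L.prob {z\<in>space M'. ?Z z \<le> 0 + 1 / real (Suc n)}) \<longlonglongrightarrow> ?p" by (rule L.prob_le_shift_right) measurable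
  from order_tendstoD(2)[OF this r2(1)]
  have up: "eventually (\<lambda>n. L.prob {z\<in>space M'. ?Z z \<le> 0 + 1 / real (Suc n)} < ?p + \<delta>/2) sequentially" .
  have "(\<lambda>n. L.prob {z\<in>space M'. ?Z z \<le> 0 - 1 / real (Suc n)}) \<longlonglongrightarrow> ?p"
    unfolding lt[symmetric] by (rule L.prob_le_shift_left) measurable
  from order_tendstoD(1)[OF this r2(2)]
  have lo: "eventually (\<lambda>n. ?p - \<delta>/2 < L.prob {z\<in>space M'. ?Z z \<le> 0 - 1 / real (Suc n)}) sequentially" .
  from eventually_happens'[OF sequentially_bot eventually_conj[OF up lo]]
  obtain n where n: "L.prob {z\<in>space M'. ?Z z \<le> 0 + 1 / real (Suc n)} < ?p + \<delta>/2"
    "?p - \<delta>/2 < L.prob {z\<in>space M'. ?Z z \<le> 0 - 1 / real (Suc n)}" by blast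
  define \<epsilon> where "\<epsilon> = 1 / real (Suc n) / 2"
  have e: "0 < \<epsilon>" by (simp add: \<epsilon>_def)
  have "1 / real (Suc n) = 2 * \<epsilon>" by (simp add: \<epsilon>_def del: of_nat_Suc)
  then have en: "\<epsilon> < 1 / real (Suc n)" using e by linarith
  have tau: "0 < \<epsilon> * (\<delta>/4)" using e \<delta> by simp
  obtain t1 where t1: "t1 \<in> horizon T" "0 < t1" and Db: "\<And>t. t \<in> horizon T \<Longrightarrow> t1 \<le> t \<Longrightarrow>
      nn_mean M (\<lambda>z. \<bar>discrepancy x t z - (?c * P t z + ?d * U t z)\<bar>) \<le> ennreal (\<epsilon> * (\<delta>/4))"
    by (rule discrepancy_expansion[OF tau, of x]) blast
  show ?thesis
  proof (rule that[OF t1])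
    fix t assume t: "t \<in> horizon T" "t1 \<le> t"
    have t0: "0 < t" using t t1 by linarith
    note pu = endpoint_energy_eq[OF t(1) t0]
    have [measurable]: "discrepancy x t \<in> borel_measurable M" "U t \<in> borel_measurable M" "P t \<in> borel_measurable M"
      using discrepancy_measurable[OF t(1)] pu(4,5) by auto
    let ?V = "\<lambda>z. ?c * P t z + ?d * U t z"
    let ?far = "{z\<in>space M. \<epsilon> < \<bar>discrepancy x t z - ?V z\<bar>}"
    have "prob ?far \<le> \<epsilon> * (\<delta>/4) / \<epsilon>" by (rule prob_tail_L1[OF _ _ _ Db[OF t]]) (use e \<delta> in auto)
    then have far: "prob ?far \<le> \<delta>/4" using e by simp
    have "prob {z\<in>space M. discrepancy x t z \<le> 0} \<le> prob {z\<in>space M. ?V z \<le> 0 + 1 / real (Suc n)} + prob ?far"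
    proof (rule prob_le_add)
      show "{z\<in>space M. discrepancy x t z \<le> 0} \<subseteq> {z\<in>space M. ?V z \<le> 0 + 1 / real (Suc n)} \<union> ?far"
      proof
        fix z assume w: "z \<in> {z\<in>space M. discrepancy x t z \<le> 0}"
        then have "?V z \<le> 0 + 1 / real (Suc n) \<or> \<epsilon> < \<bar>discrepancy x t z - ?V z\<bar>" using e en by (simp only: mem_Collect_eq) linarith
        then show "z \<in> {z\<in>space M. ?V z \<le> 0 + 1 / real (Suc n)} \<union> ?far" using w by blast
      qed
    qed measurable
    also have "prob {z\<in>space M. ?V z \<le> 0 + 1 / real (Suc n)} < ?p + \<delta>/2"
      unfolding same_law[OF t(1) t0] by (rule n)
    finally have 1: "prob {z\<in>space M. discrepancy x t z \<le> 0} < ?p + \<delta>" using far \<delta> by linarith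
    have "prob {z\<in>space M. ?V z \<le> 0 - 1 / real (Suc n)} \<le> prob {z\<in>space M. discrepancy x t z \<le> 0} + prob ?far"
    proof (rule prob_le_add)
      show "{z\<in>space M. ?V z \<le> 0 - 1 / real (Suc n)} \<subseteq> {z\<in>space M. discrepancy x t z \<le> 0} \<union> ?far"
      proof
        fix z assume w: "z \<in> {z\<in>space M. ?V z \<le> 0 - 1 / real (Suc n)}"
        then have "discrepancy x t z \<le> 0 \<or> \<epsilon> < \<bar>discrepancy x t z - ?V z\<bar>" using e en by (simp only: mem_Collect_eq) linarith
        then show "z \<in> {z\<in>space M. discrepancy x t z \<le> 0} \<union> ?far" using w by blast
      qed
    qed measurable
    moreover have "?p - \<delta>/2 < prob {z\<in>space M. ?V z \<le> 0 - 1 / real (Suc n)}"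
      unfolding same_law[OF t(1) t0] by (rule n)
    ultimately have "?p - \<delta> < prob {z\<in>space M. discrepancy x t z \<le> 0}" using far \<delta> by linarith
    with 1 show "\<bar>prob {z\<in>space M. discrepancy x t z \<le> 0} - ?p\<bar> < \<delta>" by linarith
  qed
qed

end

text \<open>With \<open>q = s / k\<close>, the value at \<open>q\<close> exceeds the value at \<open>m\<close> by \<open>k (m - q)\<^sup>2 / 2\<close>.\<close>

lemma quadratic_arg_max:
  fixes s k m :: real
  assumes k: "0 < k" and m: "is_arg_max (\<lambda>x. x * s - x\<^sup>2 / 2 * k) (\<lambda>_. True) m"
  shows "m = s / k"
proof -
  define q where "q = s / k"
  have s: "s = q * k" using k by (simp add: q_def)
  have "q * s - q\<^sup>2 / 2 * k \<le> m * s - m\<^sup>2 / 2 * k" using m by (auto simp: is_arg_max_def not_less)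
  then have "k * (m - q)\<^sup>2 \<le> 0" unfolding s by (simp add: power2_eq_square algebra_simps)
  then have "(m - q)\<^sup>2 \<le> 0" using k by (simp add: mult_le_0_iff)
  then show ?thesis by (simp add: q_def)
qed

lemma (in prob_space) cdf_distr:
  assumes [measurable]: "f \<in> borel_measurable M"
  shows "cdf (distr M borel f) x = prob {z\<in>space M. f z \<le> x}"
  unfolding cdf_def by (subst measure_distr) (auto intro!: arg_cong[where f=prob])

lemma pos_mult_le_0: "0 < k \<Longrightarrow> k * (y - x) \<le> 0 \<longleftrightarrow> y \<le> x" for k x y :: real
  by (auto simp: mult_le_0_iff)

context perturbed_diffusion_limit
begin

lemma estimator_eq:
  assumes est: "max_likelihood_estimator M T b \<sigma> a Y S est"
  shows "AE z in M. \<forall>t\<in>horizon T. 0 < obs t z \<longrightarrow> est t z = S t z / obs t z"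
proof -
  have "AE z in M. \<forall>t\<in>horizon T. 0 < obs t z \<longrightarrow>
        is_arg_max (log_likelihood b \<sigma> a Y S t z) (\<lambda>_. True) (est t z)"
    using est by (simp add: max_likelihood_estimator_def)
  then show ?thesis
  proof eventually_elim
    case (elim z)
    show ?case
    proof (intro ballI impI)
      fix t assume t: "t \<in> horizon T" and o: "0 < obs t z"
      from elim t o have "is_arg_max (log_likelihood b \<sigma> a Y S t z) (\<lambda>_. True) (est t z)" by blast
      from quadratic_arg_max[OF o this[unfolded log_likelihood_def[abs_def]]]
      show "est t z = S t z / obs t z" .
    qed
  qed
qed

lemma estimator_exists:
  assumes est: "max_likelihood_estimator M T b \<sigma> a Y S est"
  shows "AE z in M. \<exists>t1\<in>horizon T. \<forall>t\<in>horizon T. t1 \<le> t \<longrightarrow> 0 < obs t z \<and> est t z = S t z / obs t z"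
  using estimator_eq[OF est] obs_eventually_pos by eventually_elim blast

lemma error_le_iff_discrepancy:
  assumes "0 < v t" "0 < obs t z" "\<nu> = S t z / obs t z"
  shows "sqrt (IY t) * (\<nu> - \<alpha>) \<le> x \<longleftrightarrow> discrepancy x t z \<le> 0"
proof -
  have "\<nu> - \<alpha> = Q t z / obs t z" using assms(2) by (simp add: assms(3) Q_def diff_divide_distrib)
  then have "discrepancy x t z = obs t z / (v t)\<^sup>2 * (sqrt (IY t) * (\<nu> - \<alpha>) - x)"
    using assms(1,2) by (simp add: discrepancy_def power2_eq_square right_diff_distrib)
  moreover have "0 < obs t z / (v t)\<^sup>2" using assms by simp
  ultimately show ?thesis by (simp only: pos_mult_le_0)
qed

text \<open>Since \<open>|C| C = C\<^sup>2 sgn C\<close>, the linear expression is \<open>C\<^sup>2 u\<close> times the difference of the two sides.\<close>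

lemma limit_le_iff:
  assumes "0 < u"
  shows "sgn C / sqrt 2 * (p / u) \<le> x \<longleftrightarrow> \<bar>C\<bar> / sqrt 2 * C * p + (- x * C\<^sup>2) * u \<le> 0"
    "sgn C / sqrt 2 * (p / u) = x \<longleftrightarrow> \<bar>C\<bar> / sqrt 2 * C * p + (- x * C\<^sup>2) * u = 0"
proof -
  have "\<bar>C\<bar> * C = C\<^sup>2 * sgn C" by (simp add: abs_sgn power2_eq_square)
  then have "\<bar>C\<bar> / sqrt 2 * C * p = C\<^sup>2 * sgn C / sqrt 2 * p" by (simp only: times_divide_eq_left times_divide_eq_right)
  then have eq: "\<bar>C\<bar> / sqrt 2 * C * p + (- x * C\<^sup>2) * u = C\<^sup>2 * u * (sgn C / sqrt 2 * (p / u) - x)"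
    using assms by (simp add: right_diff_distrib)
  have pos: "0 < C\<^sup>2 * u" using assms C_nz by simp
  show "sgn C / sqrt 2 * (p / u) \<le> x \<longleftrightarrow> \<bar>C\<bar> / sqrt 2 * C * p + (- x * C\<^sup>2) * u \<le> 0"
    "sgn C / sqrt 2 * (p / u) = x \<longleftrightarrow> \<bar>C\<bar> / sqrt 2 * C * p + (- x * C\<^sup>2) * u = 0"
    unfolding eq by (simp only: pos_mult_le_0[OF pos]) (use pos in auto)
qed

text \<open>At a continuity point, the limit law has no atom, which is the hypothesis of
  \<open>discrepancy_limit\<close>. The events in terms of the estimator and in terms of the discrepancy
  differ only where the observed information is not positive.\<close>

lemma error_weak_limit:
  assumes est: "max_likelihood_estimator M T b \<sigma> a Y S est"
    and J: "has_stochastic_integral M' (aug_filtration M' W) W W 1 J"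
  shows "weak_conv_filter
           (\<lambda>t. distr M borel (\<lambda>z. sqrt (IY t) * (est t z - \<alpha>)))
           (distr M' borel (\<lambda>z. sgn C / sqrt 2 * (J z / (LBINT s:{0..1}. (W s z)\<^sup>2))))
           (at_horizon T)"
  unfolding weak_conv_filter_def
proof (intro allI impI)
  fix x
  let ?Z = "\<lambda>z. sgn C / sqrt 2 * (J z / (LBINT s:{0..1}. (W s z)\<^sup>2))"
  let ?E = "\<lambda>t z. sqrt (IY t) * (est t z - \<alpha>)"
  let ?lin = "\<lambda>z. \<bar>C\<bar> / sqrt 2 * C * PW z + (- x * C\<^sup>2) * UW z"
  assume x: "isCont (cdf (distr M' borel ?Z)) x"
  have [measurable]: "UW \<in> borel_measurable M'" "PW \<in> borel_measurable M'" by (rule UW_measurable PW_measurable)+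
  have [measurable]: "J \<in> borel_measurable M'" using J by (simp add: has_stochastic_integral_def)
  have [measurable]: "(\<lambda>z. LBINT s:{0..1}. (W s z)\<^sup>2) \<in> borel_measurable M'"
    using UW_measurable by (subst measurable_cong[OF UW_eq[symmetric]]) auto
  have Zm[measurable]: "?Z \<in> borel_measurable M'" by measurable
  interpret R: real_distribution "distr M' borel ?Z" by (rule L.real_distribution_distr[OF Zm])
  have ae: "AE z in M'. (?Z z \<le> x \<longleftrightarrow> ?lin z \<le> 0) \<and> (?Z z = x \<longleftrightarrow> ?lin z = 0)"
    using L.integral_B_dB[OF J] L.unit_energy_pos AE_space
  proof eventually_elim
    case (elim z)
    have J_eq: "J z = PW z" unfolding PW_eq by (rule elim(1))
    show ?case unfolding J_eq UW_eq[OF elim(3), symmetric] using limit_le_iff[OF elim(2)] by blast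
  qed
  have "measure (distr M' borel ?Z) {x} = 0" using x by (simp only: R.isCont_cdf)
  moreover have "measure (distr M' borel ?Z) {x} = L.prob {z\<in>space M'. ?Z z = x}"
    by (subst measure_distr) (auto intro!: arg_cong[where f=L.prob])
  moreover have "L.prob {z\<in>space M'. ?Z z = x} = L.prob {z\<in>space M'. ?lin z = 0}"
    by (rule L.finite_measure_eq_AE) (use ae in \<open>auto\<close>)
  ultimately have x0: "L.prob {z\<in>space M'. ?lin z = 0} = 0" by simp
  have "L.prob {z\<in>space M'. ?Z z \<le> x} = L.prob {z\<in>space M'. ?lin z \<le> 0}"
    by (rule L.finite_measure_eq_AE) (use ae in \<open>auto\<close>)
  then have target: "cdf (distr M' borel ?Z) x = L.prob {z\<in>space M'. ?lin z \<le> 0}"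
    by (simp only: L.cdf_distr[OF Zm])
  show "((\<lambda>t. cdf (distr M borel (?E t)) x) \<longlongrightarrow> cdf (distr M' borel ?Z) x) (at_horizon T)"
  proof (rule tendstoI)
    fix \<delta> :: real assume "0 < \<delta>"
    then have d2: "0 < \<delta> / 2" by simp
    obtain t1 where t1: "t1 \<in> horizon T" "0 < t1" and D: "\<And>t. t \<in> horizon T \<Longrightarrow> t1 \<le> t \<Longrightarrow>
        \<bar>prob {z\<in>space M. discrepancy x t z \<le> 0} - L.prob {z\<in>space M'. ?lin z \<le> 0}\<bar> < \<delta> / 2"
      by (rule discrepancy_limit[OF x0 d2]) blast
    obtain t2 where t2: "t2 \<in> horizon T" and O: "\<And>t. t \<in> horizon T \<Longrightarrow> t2 \<le> t \<Longrightarrow> prob {z\<in>space M. obs t z \<le> 0} < \<delta> / 2"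
      by (rule obs_nonpos_prob[OF d2]) blast
    show "eventually (\<lambda>t. dist (cdf (distr M borel (?E t)) x) (cdf (distr M' borel ?Z) x) < \<delta>) (at_horizon T)"
      unfolding eventually_at_horizon[OF T_pos]
    proof (intro bexI[of _ "max t1 t2"] ballI impI)
      show "max t1 t2 \<in> horizon T" using t1 t2 by (auto simp: max_def)
      fix t assume t: "t \<in> horizon T" "max t1 t2 \<le> t"
      have t0: "0 < t" using t t1 by simp
      have vt: "0 < v t" by (rule endpoint_energy_eq(3)[OF t(1) t0])
      have [measurable]: "discrepancy x t \<in> borel_measurable M" "obs t \<in> borel_measurable M"
        by (rule discrepancy_measurable[OF t(1)] obs_measurable[OF t(1)])+
      have [measurable]: "est t \<in> borel_measurable M" using est t(1) by (simp add: max_likelihood_estimator_def)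
      let ?A = "{z\<in>space M. ?E t z \<le> x}" and ?D = "{z\<in>space M. discrepancy x t z \<le> 0}" and ?O = "{z\<in>space M. obs t z \<le> 0}"
      have iff: "AE z in M. 0 < obs t z \<longrightarrow> (?E t z \<le> x \<longleftrightarrow> discrepancy x t z \<le> 0)"
        using estimator_eq[OF est] by eventually_elim (use t(1) error_le_iff_discrepancy[OF vt] in blast)
      have "prob ?A \<le> prob (?D \<union> ?O)"
        by (rule finite_measure_mono_AE) (use iff in \<open>auto simp: not_le\<close>)
      also have "... \<le> prob ?D + prob ?O" by (rule measure_Un_le) auto
      finally have up: "prob ?A \<le> prob ?D + prob ?O" .
      have "prob ?D \<le> prob (?A \<union> ?O)"
        by (rule finite_measure_mono_AE) (use iff in \<open>auto simp: not_le\<close>)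
      also have "... \<le> prob ?A + prob ?O" by (rule measure_Un_le) auto
      finally have lo: "prob ?D \<le> prob ?A + prob ?O" .
      have "cdf (distr M borel (?E t)) x = prob ?A" by (rule cdf_distr) measurable
      moreover have "\<bar>prob ?D - L.prob {z\<in>space M'. ?lin z \<le> 0}\<bar> < \<delta> / 2" "prob ?O < \<delta> / 2"
        using D[OF t(1)] O[OF t(1)] t(2) by auto
      ultimately show "dist (cdf (distr M borel (?E t)) x) (cdf (distr M' borel ?Z) x) < \<delta>"
        using up lo unfolding target dist_real_def by linarith
    qed
  qed
qed

end

theorem theorem4p3:
  fixes T :: ereal
    and b \<sigma> a r :: "real \<Rightarrow> real"
    and L \<gamma> K t0 \<alpha> C :: real
    and M :: "'a measure" and B X Y S est :: "real \<Rightarrow> 'a \<Rightarrow> real"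
    and M' :: "'b measure" and W :: "real \<Rightarrow> 'b \<Rightarrow> real" and J :: "'b \<Rightarrow> real"
  assumes T_pos: "0 < T"
    and b_cont: "continuous_on (horizon T) b"
    and \<sigma>_cont: "continuous_on (horizon T) \<sigma>"
    and \<sigma>_pos: "\<And>t. t \<in> horizon T \<Longrightarrow> 0 < \<sigma> t"
    and t0: "0 < t0" "t0 \<in> horizon T"
    and b_nz: "\<And>t. t \<in> horizon T \<Longrightarrow> t0 \<le> t \<Longrightarrow> b t \<noteq> 0"
    and a_eq: "\<And>x. a x = x + r x"
    and L: "0 \<le> L" and \<gamma>: "0 \<le> \<gamma>" "\<gamma> < 1"
    and r_growth: "\<And>x. \<bar>r x\<bar> \<le> L * (1 + abs_pow x \<gamma>)"
    and K: "0 \<le> K"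
    and r_lipschitz: "\<And>x y. \<bar>r x - r y\<bar> \<le> K * \<bar>x - y\<bar>"
    and B: "wiener_process M (horizon T) B"
    and X: "strong_solution M B T \<alpha> b \<sigma> (\<lambda>x. x) X"
    and Y: "strong_solution M B T \<alpha> b \<sigma> a Y"
    and S: "stochastic_integral_process M (aug_filtration M B) T Y
              (\<lambda>s \<omega>. b s * a (Y s \<omega>) / (\<sigma> s)\<^sup>2) S"
    and est: "max_likelihood_estimator M T b \<sigma> a Y S est"
    and info_X: "filterlim (fisher_info M b \<sigma> (\<lambda>x. x) X) at_top (at_horizon T)"
    and C: "((\<lambda>t. b t / (\<sigma> t)\<^sup>2 * exp (2 * \<alpha> * (LBINT w:{0..t}. b w))) \<longlongrightarrow> C) (at_horizon T)"
           "C \<noteq> 0"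
    and sign: "sgn \<alpha> = sgn C \<or> \<alpha> = 0"
    and W: "wiener_process M' {0..1} W"
    and J: "has_stochastic_integral M' (aug_filtration M' W) W W 1 J"
  shows "(AE \<omega> in M. \<exists>t1\<in>horizon T. \<forall>t\<in>horizon T. t1 \<le> t \<longrightarrow>
            0 < observed_info b \<sigma> a Y t \<omega> \<and> est t \<omega> = S t \<omega> / observed_info b \<sigma> a Y t \<omega>) \<and>
         weak_conv_filter
           (\<lambda>t. distr M borel (\<lambda>\<omega>. sqrt (fisher_info M b \<sigma> a Y t) * (est t \<omega> - \<alpha>)))
           (distr M' borel (\<lambda>\<omega>. sgn C / sqrt 2 * (J \<omega> / (LBINT s:{0..1}. (W s \<omega>)\<^sup>2))))
           (at_horizon T)"
proof -
  have r_cont: "continuous_on UNIV r"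
    by (rule lipschitz_on_continuous_on[of K]) (use K r_lipschitz in \<open>auto intro!: lipschitz_onI simp: dist_real_def\<close>)
  interpret perturbed_diffusion_limit T b \<sigma> a r L \<gamma> \<alpha> C M B X Y S M' W
    by unfold_locales (fact T_pos b_cont \<sigma>_cont \<sigma>_pos a_eq L \<gamma> r_growth r_cont B X Y S info_X C sign W)+
  show ?thesis using estimator_exists[OF est] error_weak_limit[OF est J] by blast
qed

end
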